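(* Let $k\ge0$ and $\sigma\in[-1,1]$. There exists $\epsilon>0$ such that the following holds. Let $u_0\in\mathcal{X}^{k-1}\cap\mathcal{X}^{-1}\cap\mathcal{Y}^\sigma$ and $B_0\in\mathcal{X}^{k-1}\cap\mathcal{X}^{-1}\cap\mathcal{X}^0\cap\mathcal{Y}^\sigma$ with $\operatorname{div}u_0=\operatorname{div}B_0=0$. If $\|u_0\|_{\mathcal{X}^{-1}}+\|B_0\|_{\mathcal{X}^{-1}}+\|B_0\|_{\mathcal{X}^0}\le\epsilon$, then the Hall-MHD equations on $\mathbb{R}^3$ $$u_t+u\cdot\nabla u+\nabla p-\Delta u=(\nabla\times B)\times B,$$ $$B_t-\nabla\times(u\times B)-\Delta B+\nabla\times((\nabla\times B)\times B)=0,\qquad \operatorname{div}u=0,\quad\operatorname{div}B=0,$$ with initial data $(u_0,B_0)$ admit a unique solution $$u\in L^\infty([0,\infty);\mathcal{X}^{k-1}\cap\mathcal{X}^{-1}\cap\mathcal{Y}^\sigma)\cap L^1((0,\infty);\mathcal{X}^{k+1}\cap\mathcal{X}^1),$$ $$B\in L^\infty([0,\infty);\mathcal{X}^{k-1}\cap\mathcal{X}^{-1}\cap\mathcal{X}^0\cap\mathcal{Y}^\sigma)\cap L^1((0,\infty);\mathcal{X}^{k+1}\cap\mathcal{X}^1\cap\mathcal{X}^2).$$ Furthermore, there is a constant $C_k$ independent of time such that $$\|u(t)\|_{\mathcal{X}^{k-1}}+\|B(t)\|_{\mathcal{X}^{k-1}}\le C_k(1+t)^{-1+\frac\sigma2-\frac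 k2}\qquad\text{for all }t>0.$$
   Context: $u(t,x)\in\mathbb{R}^3$ is the velocity, $p$ the pressure, $B(t,x)\in\mathbb{R}^3$ the magnetic field (viscosity and resistivity are set to $1$). $\widehat f$ is the Fourier transform in $x\in\mathbb{R}^3$. For $s\in\mathbb{R}$, the Lei-Lin space $\mathcal{X}^s$ and the space of pseudo-measures $\mathcal{Y}^s$ are $$\mathcal{X}^s=\Big\{f\in\mathcal{S}'(\mathbb{R}^3):\ \|f\|_{\mathcal{X}^s}:=\int_{\mathbb{R}^3}|\xi|^s|\widehat f(\xi)|\,d\xi<\infty\Big\},\qquad \mathcal{Y}^s=\Big\{f\in\mathcal{S}'(\mathbb{R}^3):\ \|f\|_{\mathcal{Y}^s}:=\sup_{\xi\in\mathbb{R}^3}|\xi|^s|\widehat f(\xi)|<\infty\Big\}.$$ For a Banach space $X$, $f\in L^\infty([0,\infty);X)$ means that $\sup_{0\le t<\infty}\|f(t)\|_X$ is finite. The constant $C_k$ may depend on norms of the initial data and on $k,\sigma$, but not on time. A solution is understood through the integral form of the system $$u(t)=e^{t\Delta}u_0-\int_0^te^{(t-\tau)\Delta}\mathbb{P}\big(\operatorname{div}(u\otimes u)-\operatorname{div}(B\otimes B)\big)(\tau)\,d\tau,$$ $$B(t)=e^{t\Delta}B_0+\int_0^te^{(t-\tau)\Delta}\big(\nabla\times(u\times B)-\nabla\times\operatorname{div}(B\otimes B)\big)(\tau)\,d\tau,$$ where $\mathbb{P}$ is the Leray projection, with Fourier multiplier $\delta_{ij}-\xi_i\xi_j/|\xi|^2$.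 *)

theory Defs
  imports "HOL-Analysis.Analysis" "HOL-Probability.Essential_Supremum"
begin

subsection \<open>Schwartz functions and tempered distributions on three-dimensional space\<close>

definition pderiv_fun :: "3 \<Rightarrow> (real^3 \<Rightarrow> complex) \<Rightarrow> real^3 \<Rightarrow> complex" where
  "pderiv_fun i f = (\<lambda>x. frechet_derivative f (at x) (axis i 1))"

definition schwartz :: "(real^3 \<Rightarrow> complex) \<Rightarrow> bool" where
  "schwartz \<phi> \<longleftrightarrow>
     (\<forall>is. (\<forall>x. foldr pderiv_fun is \<phi> differentiable (at x)) \<and>
           (\<forall>m::nat. bounded (range (\<lambda>x. norm x ^ m *\<^sub>R foldr pderiv_fun is \<phi> x))))"

text \<open>
  The last clause of \<open>is_tempered\<close> is continuity for the Schwartz seminorms: \<open>M\<close> ranges over the common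
  upper bounds of the seminorms of order at most \<open>N\<close>. Functionals are set to \<open>0\<close> outside the
  Schwartz space, so that equality in the type \<open>tempered\<close> is equality of distributions.
\<close>

definition is_tempered :: "((real^3 \<Rightarrow> complex) \<Rightarrow> complex) \<Rightarrow> bool" where
  "is_tempered T \<longleftrightarrow>
     (\<forall>\<phi>. \<not> schwartz \<phi> \<longrightarrow> T \<phi> = 0) \<and>
     (\<forall>\<phi> \<psi>. schwartz \<phi> \<longrightarrow> schwartz \<psi> \<longrightarrow> T (\<lambda>x. \<phi> x + \<psi> x) = T \<phi> + T \<psi>) \<and>
     (\<forall>c \<phi>. schwartz \<phi> \<longrightarrow> T (\<lambda>x. c * \<phi> x) = c * T \<phi>) \<and>
     (\<exists>(N::nat) C. \<forall>\<phi> M. schwartz \<phi> \<longrightarrow>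
        (\<forall>is m x. length is \<le> N \<longrightarrow> m \<le> N \<longrightarrow> norm x ^ m * cmod (foldr pderiv_fun is \<phi> x) \<le> M) \<longrightarrow>
        cmod (T \<phi>) \<le> C * M)"

lemma is_tempered_zero: "is_tempered (\<lambda>_. 0)"
  unfolding is_tempered_def by (auto intro!: exI[of _ 0])

lemma is_tempered_add:
  assumes S: "is_tempered S" and T: "is_tempered T"
  shows "is_tempered (\<lambda>\<phi>. S \<phi> + T \<phi>)"
proof -
  obtain N1 C1 where 1: "\<And>\<phi> M. schwartz \<phi> \<Longrightarrow>
      (\<forall>is m x. length is \<le> (N1::nat) \<longrightarrow> m \<le> N1 \<longrightarrow> norm x ^ m * cmod (foldr pderiv_fun is \<phi> x) \<le> M) \<Longrightarrow>
      cmod (S \<phi>) \<le> C1 * M"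
    using S unfolding is_tempered_def by blast
  obtain N2 C2 where 2: "\<And>\<phi> M. schwartz \<phi> \<Longrightarrow>
      (\<forall>is m x. length is \<le> (N2::nat) \<longrightarrow> m \<le> N2 \<longrightarrow> norm x ^ m * cmod (foldr pderiv_fun is \<phi> x) \<le> M) \<Longrightarrow>
      cmod (T \<phi>) \<le> C2 * M"
    using T unfolding is_tempered_def by blast
  have "cmod (S \<phi> + T \<phi>) \<le> (C1 + C2) * M"
    if \<phi>: "schwartz \<phi>" and M: "\<forall>is m x. length is \<le> max N1 N2 \<longrightarrow> m \<le> max N1 N2 \<longrightarrow>
        norm x ^ m * cmod (foldr pderiv_fun is \<phi> x) \<le> M" for \<phi> M
  proof -
    have "cmod (S \<phi>) \<le> C1 * M" by (rule 1[OF \<phi>]) (use M in auto)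
    moreover have "cmod (T \<phi>) \<le> C2 * M" by (rule 2[OF \<phi>]) (use M in auto)
    ultimately show ?thesis
      using norm_triangle_ineq[of "S \<phi>" "T \<phi>"] by (simp add: distrib_right)
  qed
  then have "\<exists>(N::nat) C. \<forall>\<phi> M. schwartz \<phi> \<longrightarrow>
        (\<forall>is m x. length is \<le> N \<longrightarrow> m \<le> N \<longrightarrow> norm x ^ m * cmod (foldr pderiv_fun is \<phi> x) \<le> M) \<longrightarrow>
        cmod (S \<phi> + T \<phi>) \<le> C * M"
    by blast
  with S T show ?thesis
    unfolding is_tempered_def by (simp add: algebra_simps)
qed

lemma is_tempered_uminus: "is_tempered T \<Longrightarrow> is_tempered (\<lambda>\<phi>. - T \<phi>)"
  unfolding is_tempered_def by simp

typedef tempered = "{T. is_tempered T}"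
  morphisms pairing Abs_tempered
  using is_tempered_zero by blast

setup_lifting type_definition_tempered

instantiation tempered :: ab_group_add
begin

lift_definition zero_tempered :: tempered is "\<lambda>_. 0"
  by (rule is_tempered_zero)

lift_definition plus_tempered :: "tempered \<Rightarrow> tempered \<Rightarrow> tempered" is "\<lambda>S T \<phi>. S \<phi> + T \<phi>"
  by (rule is_tempered_add)

lift_definition uminus_tempered :: "tempered \<Rightarrow> tempered" is "\<lambda>T \<phi>. - T \<phi>"
  by (rule is_tempered_uminus)

definition minus_tempered :: "tempered \<Rightarrow> tempered \<Rightarrow> tempered" where
  "minus_tempered S T = S + - T"

instance
  by standard (simp_all add: minus_tempered_def, (transfer; simp add: fun_eq_iff)+)

end

text \<open>
  \<open>represents h T\<close>: \<open>T\<close> is given by the function \<open>h\<close>. Such an \<open>h\<close> is Borel measurable, locally integrable and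
  determined almost everywhere; \<open>fun_of T\<close> picks one.
\<close>

definition represents :: "(real^3 \<Rightarrow> complex) \<Rightarrow> tempered \<Rightarrow> bool" where
  "represents h T \<longleftrightarrow>
     (\<forall>\<phi>. schwartz \<phi> \<longrightarrow> integrable lborel (\<lambda>x. h x * \<phi> x) \<and>
                      pairing T \<phi> = (LINT x|lborel. h x * \<phi> x))"

definition fun_of :: "tempered \<Rightarrow> real^3 \<Rightarrow> complex" where
  "fun_of T = (SOME h. represents h T)"

definition dist_of :: "(real^3 \<Rightarrow> complex) \<Rightarrow> tempered" where
  "dist_of h = Abs_tempered (\<lambda>\<phi>. if schwartz \<phi> then LINT x|lborel. h x * \<phi> x else 0)"

definition real_dist :: "tempered \<Rightarrow> bool" where
  "real_dist T \<longleftrightarrow> (\<forall>\<phi>. schwartz \<phi> \<longrightarrow> pairing T (\<lambda>x. cnj (\<phi> x)) = cnj (pairing T \<phi>))"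

subsection \<open>Derivatives, Fourier transform and Fourier multipliers\<close>

definition tderiv :: "3 \<Rightarrow> tempered \<Rightarrow> tempered" where
  "tderiv i T = Abs_tempered (\<lambda>\<phi>. if schwartz \<phi> then - pairing T (pderiv_fun i \<phi>) else 0)"

definition fourier_fun :: "(real^3 \<Rightarrow> complex) \<Rightarrow> real^3 \<Rightarrow> complex" where
  "fourier_fun \<phi> \<xi> = (LINT x|lborel. cis (- (x \<bullet> \<xi>)) * \<phi> x)"

definition inv_fourier_fun :: "(real^3 \<Rightarrow> complex) \<Rightarrow> real^3 \<Rightarrow> complex" where
  "inv_fourier_fun \<phi> x = (LINT \<xi>|lborel. cis (x \<bullet> \<xi>) * \<phi> \<xi>) / complex_of_real ((2 * pi) ^ 3)"

definition fourier :: "tempered \<Rightarrow> tempered" where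
  "fourier T = Abs_tempered (\<lambda>\<phi>. if schwartz \<phi> then pairing T (fourier_fun \<phi>) else 0)"

definition inv_fourier :: "tempered \<Rightarrow> tempered" where
  "inv_fourier T = Abs_tempered (\<lambda>\<phi>. if schwartz \<phi> then pairing T (inv_fourier_fun \<phi>) else 0)"

text \<open>
  \<open>multiplier\<close> and \<open>tmult\<close> are meaningful only when \<open>fourier T\<close>, respectively \<open>S\<close> and \<open>T\<close>, are functions
  and the resulting product is a function representing a tempered distribution. This is so for
  elements of the spaces \<open>\<X>\<^sup>s\<close> used below: an element of \<open>\<X>\<^sup>0\<close> is a bounded continuous function.
\<close>

definition multiplier :: "(real^3 \<Rightarrow> complex) \<Rightarrow> tempered \<Rightarrow> tempered" where
  "multiplier m T = inv_fourier (dist_of (\<lambda>\<xi>. m \<xi> * fun_of (fourier T) \<xi>))"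

definition tmult :: "tempered \<Rightarrow> tempered \<Rightarrow> tempered" where
  "tmult S T = dist_of (\<lambda>x. fun_of S x * fun_of T x)"

subsection \<open>Vector fields\<close>

definition real_field :: "tempered^3 \<Rightarrow> bool" where
  "real_field f \<longleftrightarrow> (\<forall>i. real_dist (f $ i))"

definition tdiv :: "tempered^3 \<Rightarrow> tempered" where
  "tdiv f = (\<Sum>i\<in>UNIV. tderiv i (f $ i))"

definition tcurl :: "tempered^3 \<Rightarrow> tempered^3" where
  "tcurl f = vector [tderiv 2 (f $ 3) - tderiv 3 (f $ 2),
                     tderiv 3 (f $ 1) - tderiv 1 (f $ 3),
                     tderiv 1 (f $ 2) - tderiv 2 (f $ 1)]"

definition tcross :: "tempered^3 \<Rightarrow> tempered^3 \<Rightarrow> tempered^3" where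
  "tcross f g = vector [tmult (f $ 2) (g $ 3) - tmult (f $ 3) (g $ 2),
                        tmult (f $ 3) (g $ 1) - tmult (f $ 1) (g $ 3),
                        tmult (f $ 1) (g $ 2) - tmult (f $ 2) (g $ 1)]"

definition ttensor :: "tempered^3 \<Rightarrow> tempered^3 \<Rightarrow> tempered^3^3" where
  "ttensor f g = (\<chi> i j. tmult (f $ i) (g $ j))"

definition tdiv_mat :: "tempered^3^3 \<Rightarrow> tempered^3" where
  "tdiv_mat F = (\<chi> i. tdiv (F $ i))"

definition heat :: "real \<Rightarrow> tempered^3 \<Rightarrow> tempered^3" where
  "heat t f = (\<chi> i. multiplier (\<lambda>\<xi>. complex_of_real (exp (- t * (norm \<xi>)\<^sup>2))) (f $ i))"

definition leray :: "tempered^3 \<Rightarrow> tempered^3" where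
  "leray f = (\<chi> i. \<Sum>j\<in>UNIV.
     multiplier (\<lambda>\<xi>. complex_of_real ((if i = j then 1 else 0) - \<xi> $ i * \<xi> $ j / (norm \<xi>)\<^sup>2)) (f $ j))"

subsection \<open>Lei--Lin spaces and pseudo-measures\<close>

definition fhat :: "tempered^3 \<Rightarrow> real^3 \<Rightarrow> complex^3" where
  "fhat f \<xi> = (\<chi> i. fun_of (fourier (f $ i)) \<xi>)"

definition fhat_is_function :: "tempered^3 \<Rightarrow> bool" where
  "fhat_is_function f \<longleftrightarrow> (\<forall>i. \<exists>h. represents h (fourier (f $ i)))"

text \<open>
  A field belongs to \<open>\<X>\<^sup>s\<close> or \<open>\<Y>\<^sup>s\<close> iff the respective norm is finite; to an intersection of
  such spaces iff the sum of the norms is finite.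
\<close>

definition Xnorm :: "real \<Rightarrow> tempered^3 \<Rightarrow> ennreal" where
  "Xnorm s f = (if fhat_is_function f
     then \<integral>\<^sup>+\<xi>. ennreal (norm \<xi> powr s * norm (fhat f \<xi>)) \<partial>lborel else \<infinity>)"

definition Ynorm :: "real \<Rightarrow> tempered^3 \<Rightarrow> ennreal" where
  "Ynorm s f = (if fhat_is_function f
     then esssup lborel (\<lambda>\<xi>. ennreal (norm \<xi> powr s * norm (fhat f \<xi>))) else \<infinity>)"

subsection \<open>Functions of time\<close>

text \<open>
  In the following two definitions \<open>N\<close> is the norm of the space \<open>X\<close> of the fields \<open>f\<close> with \<open>N f < \<infinity>\<close>.
  \<open>in_L1\<close> is membership in the Bochner space \<open>L\<^sup>1((0,\<infinity>);X)\<close>, with strong measurability spelled out.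
\<close>

definition in_Linfty :: "(tempered^3 \<Rightarrow> ennreal) \<Rightarrow> (real \<Rightarrow> tempered^3) \<Rightarrow> bool" where
  "in_Linfty N f \<longleftrightarrow> (SUP t\<in>{0..}. N (f t)) < \<infinity>"

definition in_L1 :: "(tempered^3 \<Rightarrow> ennreal) \<Rightarrow> (real \<Rightarrow> tempered^3) \<Rightarrow> bool" where
  "in_L1 N f \<longleftrightarrow>
     (\<exists>s :: nat \<Rightarrow> real \<Rightarrow> tempered^3.
        (\<forall>n. simple_function (lebesgue_on {0<..}) (s n)) \<and>
        (\<forall>n. \<forall>t>0. N (s n t) < \<infinity>) \<and>
        (AE t in lebesgue_on {0<..}. (\<lambda>n. N (s n t - f t)) \<longlonglongrightarrow> 0)) \<and>
     (\<integral>\<^sup>+t. N (f t) \<partial>lebesgue_on {0<..}) < \<infinity>"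

text \<open>\<open>I\<close> is the integral of \<open>f\<close> over \<open>[0,t]\<close> in the space of tempered distributions.\<close>

definition has_time_integral :: "(real \<Rightarrow> tempered^3) \<Rightarrow> tempered^3 \<Rightarrow> real \<Rightarrow> bool" where
  "has_time_integral f I t \<longleftrightarrow>
     (\<forall>i \<phi>. schwartz \<phi> \<longrightarrow>
        set_integrable lebesgue {0..t} (\<lambda>\<tau>. pairing (f \<tau> $ i) \<phi>) \<and>
        pairing (I $ i) \<phi> = (LINT \<tau>:{0..t}|lebesgue. pairing (f \<tau> $ i) \<phi>))"

subsection \<open>The Hall-MHD equations\<close>

definition u_integrand ::
  "(real \<Rightarrow> tempered^3) \<Rightarrow> (real \<Rightarrow> tempered^3) \<Rightarrow> real \<Rightarrow> real \<Rightarrow> tempered^3" where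
  "u_integrand u B t \<tau> = heat (t - \<tau>)
     (leray (tdiv_mat (ttensor (u \<tau>) (u \<tau>)) - tdiv_mat (ttensor (B \<tau>) (B \<tau>))))"

definition B_integrand ::
  "(real \<Rightarrow> tempered^3) \<Rightarrow> (real \<Rightarrow> tempered^3) \<Rightarrow> real \<Rightarrow> real \<Rightarrow> tempered^3" where
  "B_integrand u B t \<tau> = heat (t - \<tau>)
     (tcurl (tcross (u \<tau>) (B \<tau>)) - tcurl (tdiv_mat (ttensor (B \<tau>) (B \<tau>))))"

definition hall_mhd_solution ::
  "tempered^3 \<Rightarrow> tempered^3 \<Rightarrow> (real \<Rightarrow> tempered^3) \<Rightarrow> (real \<Rightarrow> tempered^3) \<Rightarrow> bool" where
  "hall_mhd_solution u0 B0 u B \<longleftrightarrow>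
     (\<forall>t\<ge>0. real_field (u t) \<and> real_field (B t) \<and> tdiv (u t) = 0 \<and> tdiv (B t) = 0 \<and>
        (\<exists>Iu IB. has_time_integral (u_integrand u B t) Iu t \<and>
                 has_time_integral (B_integrand u B t) IB t \<and>
                 u t = heat t u0 - Iu \<and> B t = heat t B0 + IB))"

definition u_norm :: "real \<Rightarrow> real \<Rightarrow> tempered^3 \<Rightarrow> ennreal" where
  "u_norm k \<sigma> f = Xnorm (k - 1) f + Xnorm (- 1) f + Ynorm \<sigma> f"

definition B_norm :: "real \<Rightarrow> real \<Rightarrow> tempered^3 \<Rightarrow> ennreal" where
  "B_norm k \<sigma> f = Xnorm (k - 1) f + Xnorm (- 1) f + Xnorm 0 f + Ynorm \<sigma> f"

definition in_solution_class ::
  "real \<Rightarrow> real \<Rightarrow> (real \<Rightarrow> tempered^3) \<Rightarrow> (real \<Rightarrow> tempered^3) \<Rightarrow> bool" where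
  "in_solution_class k \<sigma> u B \<longleftrightarrow>
     in_Linfty (u_norm k \<sigma>) u \<and> in_L1 (\<lambda>f. Xnorm (k + 1) f + Xnorm 1 f) u \<and>
     in_Linfty (B_norm k \<sigma>) B \<and> in_L1 (\<lambda>f. Xnorm (k + 1) f + Xnorm 1 f + Xnorm 2 f) B"

end

theory Submission
 imports Defs "HOL-Probability.Probability"
begin

text \<open>
 On the Fourier side the system becomes a quadratic fixed-point problem for the Duhamel formula. A function p majorizes z
 if the supremum of |z| in time is at most |xi| p and the time integral of |xi| |z| is at most p. Two majorized functions
 satisfy: the time integral of |z(ze)| |w(et)| is at most min(|ze|,|et|)/max(|ze|,|et|) times p(ze) q(et). Hence Duhamel's
 formula is controlled by convolutions of the majorants alone, which are contractive in the smallness norm and propagate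
 the higher and the pseudo-measure norms linearly. Picard iteration gives existence. A solution of the class has majorants
 whose norm depends continuously on the length of the time interval, so it stays small, and iterating the difference
 estimate gives uniqueness. For the decay let F and G be the norms of order k - 1 and k + 1. Then F(t) is at most 2 F(s),
 the integral of G over (s,t) is at most 2 F(s), and splitting frequencies at R bounds F by G/R^2 plus a power of R;
 taking s = t/2 and R^2 proportional to 1/t and iterating gives the rate.
\<close>

text \<open>The obstacle is the Hall term, which costs |xi|^2 where the other quadratic terms cost
  |xi|. Supremum and time integral are taken at a fixed frequency, inside the frequency integral, so
  the gain min/max of a product is available pointwise. Since |xi| <= 2 max(|ze|,|et|), it turns the
  surplus factor |xi| into 2 min(|ze|,|et|), a single derivative on the lower frequency. This closes
  in the smallness norm because that norm contains the order-zero norm of B0. For uniqueness, a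
  solution of the class is only a curve of distributions whose norms stand outside the frequency
  integral. It first receives jointly measurable representatives; the right-hand side of Duhamel's
  formula then represents it at every time and provides majorants. The range of \<sigma>: \<sigma>
  >= -1 makes the exponent \<sigma> + 1 of the majorant weight nonnegative, so the weight of a sum
  of frequencies is controlled by the weights of the summands; \<sigma> <= 1 keeps
  |xi|^(k-1-\<sigma>) integrable at the origin.\<close>

abbreviation nn_lborel (binder "NN " 10) where "nn_lborel \<equiv> nn_integral lborel"
abbreviation ae_lborel (binder "AL " 10) where "ae_lborel P \<equiv> eventually P (ae_filter lborel)"
abbreviation BM where "BM \<equiv> borel_measurable borel"
abbreviation en where "en x \<equiv> ennreal (norm x)"
abbreviation er where "er \<equiv> ennreal"
abbreviation ic where "ic \<equiv> \<infinity>"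
abbreviation cor where "cor \<equiv> complex_of_real"
abbreviation ind where "ind \<equiv> indicator"
abbreviation pf where "pf \<equiv> pderiv_fun"
abbreviation ff where "ff \<equiv> fourier_fun"
abbreviation seq_lim (infix "-+>" 60) where "X -+> L \<equiv> filterlim X (nhds L) sequentially"
notation scaleR (infixr "*R" 75)

section \<open>Schwartz functions\<close>

text \<open>Iterated derivatives of one function rarely keep its form, but they stay in a suitable
  class. Closure of the class under \<open>pf\<close> then reduces the conditions on all derivatives
  to its members themselves.\<close>

lemma schwartzI_class:
 assumes f: "f \<in> G"
 and d: "!!f x. f \<in> G ==> f differentiable (at x)"
 and b: "!!f m. f \<in> G ==> \<exists>C. \<forall>x. norm x ^ m * cmod (f x) <= C"
 and p: "!!f i. f \<in> G ==> pf i f \<in> G"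
 shows "schwartz f"
proof -
 have "foldr pf is f \<in> G" for "is"
 by (induction "is") (use f p in auto)
 then show ?thesis
 unfolding schwartz_def bounded_iff using d b by (auto 4 4)
qed

lemma schwartz_differentiable: "schwartz fy ==> fy differentiable (at x)"
 unfolding schwartz_def by (metis foldr.simps(1) id_apply)

lemma schwartz_foldr: "schwartz fy ==> schwartz (foldr pf is fy)"
 unfolding schwartz_def by (metis foldr_append comp_apply)

lemma schwartz_pderiv: "schwartz fy ==> schwartz (pf i fy)"
 using schwartz_foldr[of fy "[i]"] by simp

lemma schwartz_bound: "schwartz fy ==> \<exists>C. \<forall>x. norm x ^ m * cmod (fy x) <= C"
proof -
 assume "schwartz fy"
 then have "bounded (range (%x. norm x ^ m *R foldr pf [] fy x))"
 unfolding schwartz_def by blast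
 then show ?thesis by (auto simp: bounded_iff)
qed

lemma schwartz_continuous: "schwartz fy ==> continuous_on UNIV fy"
 by (meson continuous_at_imp_continuous_on differentiable_imp_continuous_within schwartz_differentiable)

lemma schwartz_measurable: "schwartz fy ==> fy \<in> BM"
 by (rule borel_measurable_continuous_onI[OF schwartz_continuous])

lemma pderiv_fun_eq: "(f has_derivative f') (at x) ==> pf i f x = f' (axis i 1)"
 by (simp add: pderiv_fun_def frechet_derivative_at[symmetric])

lemma differentiable_has_derivative:
 "f differentiable (at x) ==> (f has_derivative frechet_derivative f (at x)) (at x)"
 by (simp add: frechet_derivative_works)

section \<open>Closure of the Schwartz space under sums, multiples, coordinates, affine maps and
  conjugation\<close>

lemma pderiv_fun_add:
 assumes "!!x. f differentiable (at x)" "!!x. g differentiable (at x)"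
 shows "pf i (%x. f x + g x) = (%x. pf i f x + pf i g x)"
proof
 fix x
 show "pf i (%x. f x + g x) x = pf i f x + pf i g x"
 using pderiv_fun_eq[OF has_derivative_add[OF differentiable_has_derivative differentiable_has_derivative, OF assms]]
 by (simp add: pderiv_fun_def)
qed

lemma pderiv_fun_cmult:
 assumes "!!x. f differentiable (at x)"
 shows "pf i (%x. c * f x) = (%x. c * pf i f x)"
proof
 fix x
 show "pf i (%x. c * f x) x = c * pf i f x"
 using pderiv_fun_eq[OF has_derivative_mult_right[OF differentiable_has_derivative, OF assms]]
 by (simp add: pderiv_fun_def)
qed

lemma schwartz_add:
 assumes "schwartz fy" "schwartz \<psi>"
 shows "schwartz (%x. fy x + \<psi> x)"
proof (rule schwartzI_class[where G="{%x. fy x + \<psi> x | fy \<psi>. schwartz fy & schwartz \<psi>}"])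
 fix f and m :: nat
 assume "f \<in> {%x. fy x + \<psi> x | fy \<psi>. schwartz fy & schwartz \<psi>}"
 then obtain fy \<psi> where f: "f = (%x. fy x + \<psi> x)" and s: "schwartz fy" "schwartz \<psi>" by auto
 obtain C D where "\<forall>x. norm x ^ m * cmod (fy x) <= C" "\<forall>x. norm x ^ m * cmod (\<psi> x) <= D"
 using s schwartz_bound by meson
 then have le: "norm x ^ m * (cmod (fy x) + cmod (\<psi> x)) <= C + D" for x
 by (simp add: distrib_left add_mono)
 have "norm x ^ m * cmod (f x) <= C + D" for x
 unfolding f using le[of x] by (rule order_trans[rotated]) (intro mult_left_mono norm_triangle_ineq; simp)
 then show "\<exists>C. \<forall>x. norm x ^ m * cmod (f x) <= C" by blast
next
 fix f x assume "f \<in> {%x. fy x + \<psi> x | fy \<psi>. schwartz fy & schwartz \<psi>}"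
 then show "f differentiable (at x)" using schwartz_differentiable by auto
next
 fix f i assume "f \<in> {%x. fy x + \<psi> x | fy \<psi>. schwartz fy & schwartz \<psi>}"
 then obtain fy \<psi> where f: "f = (%x. fy x + \<psi> x)" and s: "schwartz fy" "schwartz \<psi>" by auto
 have "pf i f = (%x. pf i fy x + pf i \<psi> x)"
 unfolding f by (rule pderiv_fun_add) (use s schwartz_differentiable in auto)
 then show "pf i f \<in> {%x. fy x + \<psi> x | fy \<psi>. schwartz fy & schwartz \<psi>}"
 using s schwartz_pderiv by blast
qed (use assms in auto)

lemma schwartz_cmult:
 assumes "schwartz fy"
 shows "schwartz (%x. c * fy x)"
proof (rule schwartzI_class[where G="{%x. c * fy x | fy. schwartz fy}"])
 fix f and m :: nat
 assume "f \<in> {%x. c * fy x | fy. schwartz fy}"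
 then obtain fy where f: "f = (%x. c * fy x)" and s: "schwartz fy" by auto
 obtain C where "\<forall>x. norm x ^ m * cmod (fy x) <= C" using s schwartz_bound by meson
 then have "norm x ^ m * cmod (f x) <= cmod c * C" for x
 unfolding f norm_mult using mult_left_mono[of "norm x ^ m * cmod (fy x)" C "cmod c"] by (simp add: mult_ac)
 then show "\<exists>C. \<forall>x. norm x ^ m * cmod (f x) <= C" by blast
next
 fix f x assume "f \<in> {%x. c * fy x | fy. schwartz fy}"
 then show "f differentiable (at x)" using schwartz_differentiable by auto
next
 fix f i assume "f \<in> {%x. c * fy x | fy. schwartz fy}"
 then show "pf i f \<in> {%x. c * fy x | fy. schwartz fy}"
 using pderiv_fun_cmult schwartz_pderiv schwartz_differentiable by fastforce
qed (use assms in auto)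

lemma schwartz_zero: "schwartz (%x. 0)"
 by (rule schwartzI_class[where G="{%x. 0}"]) (auto simp: pderiv_fun_def frechet_derivative_const)

definition xmul :: "3 => (real^3 => complex) => real^3 => complex" where
 "xmul j f = (%x. cor (x $ j) * f x)"

lemma has_derivative_coord:
 "((%x::real^3. cor (x $ j)) has_derivative (%h. cor (h $ j))) (at x)"
 by (intro bounded_linear.has_derivative[OF bounded_linear_of_real] bounded_linear_imp_has_derivative
 bounded_linear_vec_nth)

lemma xmul_differentiable: "f differentiable (at x) ==> xmul j f differentiable (at x)"
 unfolding xmul_def using has_derivative_coord by (intro differentiable_mult) (auto simp: differentiable_def)

lemma pderiv_fun_xmul:
 assumes "!!x. f differentiable (at x)"
 shows "pf i (xmul j f) = (%x. xmul j (pf i f) x + (if i = j then 1 else 0) * f x)"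
proof
 fix x
 show "pf i (xmul j f) x = xmul j (pf i f) x + (if i = j then 1 else 0) * f x"
 using pderiv_fun_eq[OF has_derivative_mult[OF has_derivative_coord[of j] differentiable_has_derivative, OF assms]]
 by (auto simp: pderiv_fun_def xmul_def axis_def)
qed

lemma xmul_norm_le: "cmod (xmul j f x) <= norm x * cmod (f x)"
 by (simp add: xmul_def norm_mult component_le_norm_cart mult_right_mono)

text \<open>The class has a free Schwartz summand because the product rule leaves an
  undifferentiated term when the derivative falls on the coordinate.\<close>

lemma schwartz_xmul:
 assumes "schwartz fy"
 shows "schwartz (xmul j fy)"
proof (rule schwartzI_class[where G="{%x. xmul j fy x + \<psi> x | fy \<psi>. schwartz fy & schwartz \<psi>}"])
 show "xmul j fy \<in> {%x. xmul j fy x + \<psi> x | fy \<psi>. schwartz fy & schwartz \<psi>}"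
 using assms schwartz_zero by (intro CollectI exI[of _ fy] exI[of _ "%x. 0"]) simp
next
 fix f and m :: nat
 assume "f \<in> {%x. xmul j fy x + \<psi> x | fy \<psi>. schwartz fy & schwartz \<psi>}"
 then obtain fy \<psi> where f: "f = (%x. xmul j fy x + \<psi> x)" and s: "schwartz fy" "schwartz \<psi>" by auto
 obtain C D where CD: "\<forall>x. norm x ^ (Suc m) * cmod (fy x) <= C" "\<forall>x. norm x ^ m * cmod (\<psi> x) <= D"
 using s schwartz_bound by meson
 have "norm x ^ m * cmod (f x) <= C + D" for x
 proof -
 have "norm x ^ m * cmod (f x) <= norm x ^ m * (norm x * cmod (fy x) + cmod (\<psi> x))"
 unfolding f by (intro mult_left_mono order_trans[OF norm_triangle_ineq] add_right_mono xmul_norm_le) auto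
 also have "... <= C + D" using CD[THEN spec, of x] by (simp add: algebra_simps)
 finally show ?thesis .
 qed
 then show "\<exists>C. \<forall>x. norm x ^ m * cmod (f x) <= C" by blast
next
 fix f x assume "f \<in> {%x. xmul j fy x + \<psi> x | fy \<psi>. schwartz fy & schwartz \<psi>}"
 then show "f differentiable (at x)" using schwartz_differentiable xmul_differentiable by auto
next
 fix f i assume "f \<in> {%x. xmul j fy x + \<psi> x | fy \<psi>. schwartz fy & schwartz \<psi>}"
 then obtain fy \<psi> where f: "f = (%x. xmul j fy x + \<psi> x)" and s: "schwartz fy" "schwartz \<psi>" by auto
 have "pf i f = (%x. xmul j (pf i fy) x + ((if i = j then 1 else 0) * fy x + pf i \<psi> x))"
 unfolding f using s schwartz_differentiable xmul_differentiable
 by (subst pderiv_fun_add) (auto simp: pderiv_fun_xmul algebra_simps)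
 moreover have "schwartz (%x. (if i = j then 1 else 0) * fy x + pf i \<psi> x)"
 using s by (intro schwartz_add schwartz_cmult schwartz_pderiv)
 ultimately show "pf i f \<in> {%x. xmul j fy x + \<psi> x | fy \<psi>. schwartz fy & schwartz \<psi>}"
 using s schwartz_pderiv
 by (intro CollectI exI[of _ "pf i fy"] exI[of _ "%x. (if i = j then 1 else 0) * fy x + pf i \<psi> x"]) simp
qed

lemma pderiv_fun_affine:
 assumes "!!x. f differentiable (at x)"
 shows "pf i (%x. f (c + s *R x)) = (%x. cor s * pf i f (c + s *R x))"
proof
 fix x
 have a: "((%x::real^3. c + s *R x) has_derivative (%h. s *R h)) (at x)"
 by (auto intro!: derivative_eq_intros)
 have "bounded_linear (frechet_derivative f (at (c + s *R x)))"
 using assms differentiable_has_derivative has_derivative_bounded_linear by blast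
 from pderiv_fun_eq[OF has_derivative_compose[OF a differentiable_has_derivative[OF assms]], of i]
 linear_scale[OF bounded_linear.linear[OF this], of s "axis i 1"]
 show "pf i (%x. f (c + s *R x)) x = cor s * pf i f (c + s *R x)"
 by (simp add: pderiv_fun_def scaleR_conv_of_real)
qed

lemma schwartz_affine:
 assumes "schwartz fy" "s ~= 0"
 shows "schwartz (%x. fy (c + s *R x))"
proof (rule schwartzI_class[where G="{%x. fy (c + s *R x) | fy. schwartz fy}"])
 fix f and m :: nat
 assume "f \<in> {%x. fy (c + s *R x) | fy. schwartz fy}"
 then obtain fy where f: "f = (%x. fy (c + s *R x))" and ph: "schwartz fy" by auto
 obtain C D where CD: "\<forall>x. norm x ^ m * cmod (fy x) <= C" "\<forall>x. norm x ^ 0 * cmod (fy x) <= D"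
 using ph schwartz_bound by meson
 have "norm x ^ m * cmod (f x) <= (2 ^ m * C + 2 ^ m * norm c ^ m * D) / \<bar>s\<bar> ^ m" for x
 proof -
 let ?y = "c + s *R x"
 have "\<bar>s\<bar> * norm x = norm (?y - c)" by simp
 also have "... <= norm ?y + norm c" by (rule norm_triangle_ineq4)
 also have "... <= 2 * max (norm ?y) (norm c)" by auto
 finally have "(\<bar>s\<bar> * norm x) ^ m <= (2 * max (norm ?y) (norm c)) ^ m" by (intro power_mono) auto
 also have "... <= 2 ^ m * (norm ?y ^ m + norm c ^ m)"
 unfolding power_mult_distrib by (intro mult_left_mono) (auto simp: max_def)
 finally have "(\<bar>s\<bar> * norm x) ^ m * cmod (f x) <= 2 ^ m * (norm ?y ^ m + norm c ^ m) * cmod (f x)"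
 by (intro mult_right_mono) auto
 also have "... = 2 ^ m * (norm ?y ^ m * cmod (fy ?y)) + 2 ^ m * norm c ^ m * cmod (fy ?y)"
 by (simp add: f algebra_simps)
 also have "... <= 2 ^ m * C + 2 ^ m * norm c ^ m * D"
 using CD[THEN spec, of ?y] by (intro add_mono mult_left_mono) auto
 finally show ?thesis using \<open>s ~= 0\<close> by (simp add: power_mult_distrib field_simps)
 qed
 then show "\<exists>C. \<forall>x. norm x ^ m * cmod (f x) <= C" by blast
next
 fix f x assume "f \<in> {%x. fy (c + s *R x) | fy. schwartz fy}"
 then obtain fy where f: "f = (%x. fy (c + s *R x))" and ph: "schwartz fy" by auto
 have "(%x::real^3. c + s *R x) differentiable (at x)"
 by (auto intro!: derivative_intros)
 then show "f differentiable (at x)"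
 unfolding f using differentiable_chain_at[of "%x. c + s *R x" x fy] schwartz_differentiable[OF ph]
 by (simp add: o_def)
next
 fix f i assume "f \<in> {%x. fy (c + s *R x) | fy. schwartz fy}"
 then obtain fy where f: "f = (%x. fy (c + s *R x))" and ph: "schwartz fy" by auto
 have "pf i f = (%x. (%y. cor s * pf i fy y) (c + s *R x))"
 unfolding f using pderiv_fun_affine schwartz_differentiable[OF ph] by auto
 moreover have "schwartz (%y. cor s * pf i fy y)"
 using ph by (intro schwartz_cmult schwartz_pderiv)
 ultimately show "pf i f \<in> {%x. fy (c + s *R x) | fy. schwartz fy}"
 by (intro CollectI exI[of _ "%y. cor s * pf i fy y"]) simp
qed (use assms in auto)

lemma schwartz_reflect: "schwartz fy ==> schwartz (%x. fy (- x))"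
 using schwartz_affine[of fy "-1" 0] by simp

lemma schwartz_translate: "schwartz fy ==> schwartz (%x. fy (c + x))"
 using schwartz_affine[of fy 1 c] by simp

lemma pderiv_fun_cnj:
 assumes "!!x. f differentiable (at x)"
 shows "pf i (%x. cnj (f x)) = (%x. cnj (pf i f x))"
proof
 fix x
 show "pf i (%x. cnj (f x)) x = cnj (pf i f x)"
 using pderiv_fun_eq[OF bounded_linear.has_derivative[OF bounded_linear_cnj differentiable_has_derivative, OF assms]]
 by (simp add: pderiv_fun_def)
qed

lemma schwartz_cnj:
 assumes "schwartz fy"
 shows "schwartz (%x. cnj (fy x))"
proof (rule schwartzI_class[where G="{%x. cnj (fy x) | fy. schwartz fy}"])
 fix f and m :: nat
 assume "f \<in> {%x. cnj (fy x) | fy. schwartz fy}"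
 then show "\<exists>C. \<forall>x. norm x ^ m * cmod (f x) <= C" using schwartz_bound by auto
next
 fix f x assume "f \<in> {%x. cnj (fy x) | fy. schwartz fy}"
 then show "f differentiable (at x)"
 using bounded_linear.has_derivative[OF bounded_linear_cnj] schwartz_differentiable
 unfolding differentiable_def by blast
next
 fix f i assume "f \<in> {%x. cnj (fy x) | fy. schwartz fy}"
 then show "pf i f \<in> {%x. cnj (fy x) | fy. schwartz fy}"
 using pderiv_fun_cnj schwartz_pderiv schwartz_differentiable by fastforce
qed (use assms in auto)

subsection \<open>Gaussians\<close>

definition gauss :: "real => real^3 => complex" where
 "gauss a x = cor (exp (- a * (norm x)\<^sup>2))"

text \<open>Polynomials times the Gaussian: the family in which the derivatives of the Gaussian
  stay.\<close>

inductive_set gauss_span :: "real => (real^3 => complex) set" for a where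
 "gauss a \<in> gauss_span a"
| "f \<in> gauss_span a ==> xmul j f \<in> gauss_span a"
| "f \<in> gauss_span a ==> (%x. c * f x) \<in> gauss_span a"
| "f \<in> gauss_span a ==> g \<in> gauss_span a ==> (%x. f x + g x) \<in> gauss_span a"

lemma gauss_has_derivative:
 "(gauss a has_derivative (%h. cor (- 2 * a * (x \<bullet> h)) * gauss a x)) (at x)"
proof -
 have *: "((%x::real^3. exp (- a * (x \<bullet> x))) has_derivative (%h. - 2 * a * (x \<bullet> h) * exp (- a * (x \<bullet> x)))) (at x)"
 by (auto intro!: derivative_eq_intros simp: inner_commute algebra_simps)
 show ?thesis
 using bounded_linear.has_derivative[OF bounded_linear_of_real *]
 unfolding gauss_def[abs_def] power2_norm_eq_inner by (simp add: fun_eq_iff)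
qed

text \<open>A single term of the exponential series gives
  \<open>(a * y^2)^m / m! <= exp (a * y^2)\<close>, which controls the power 2m; the power m is at
  most 1 plus the power 2m.\<close>

lemma gauss_bound:
 assumes "a > 0"
 shows "\<exists>C. \<forall>x. norm x ^ m * cmod (gauss a x) <= C"
proof -
 have "norm x ^ m * cmod (gauss a x) <= 1 + fact m / a ^ m" for x :: "real^3"
 proof -
 let ?y = "norm x"
 have e: "exp (- a * ?y\<^sup>2) <= 1" using assms by simp
 have "(a * ?y\<^sup>2) ^ m / fact m <= exp (a * ?y\<^sup>2)"
 using sum_le_suminf[OF summable_exp, of "{m}" "a * ?y\<^sup>2"] assms
 by (simp add: exp_def divide_inverse mult.commute scaleR_conv_of_real)
 then have "?y ^ (2 * m) * exp (- a * ?y\<^sup>2) <= fact m / a ^ m"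
 unfolding exp_minus power_mult_distrib mult_minus_left power_mult using assms by (simp add: field_simps)
 moreover have "?y ^ m <= 1 + ?y ^ (2 * m)"
 proof (cases "?y <= 1")
 case True then show ?thesis by (simp add: power_le_one add_increasing2)
 next
 case False
 then have "?y ^ m <= ?y ^ (2*m)" by (intro power_increasing) auto
 then show ?thesis by simp
 qed
 then have "?y ^ m * exp (- a * ?y\<^sup>2) <= (1 + ?y ^ (2 * m)) * exp (- a * ?y\<^sup>2)"
 by (intro mult_right_mono) auto
 ultimately have "?y ^ m * exp (- a * ?y\<^sup>2) <= 1 + fact m / a ^ m"
 using e unfolding distrib_right by linarith
 then show ?thesis by (simp add: gauss_def)
 qed
 then show ?thesis by blast
qed

lemma schwartz_gauss:
 assumes a: "a > 0"
 shows "schwartz (gauss a)"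
proof (rule schwartzI_class[where G="gauss_span a"])
 have diff: "f differentiable (at x)" if "f \<in> gauss_span a" for f x
 using that
 proof (induction arbitrary: x)
 case 1 then show ?case using gauss_has_derivative differentiable_def by blast
 qed (auto simp: xmul_differentiable)
 then show "!!f x. f \<in> gauss_span a ==> f differentiable (at x)" .
 show "\<exists>C. \<forall>x. norm x ^ m * cmod (f x) <= C" if "f \<in> gauss_span a" for f m
 using that
 proof (induction arbitrary: m)
 case 1 then show ?case by (rule gauss_bound[OF a])
 next
 case (2 f j)
 obtain C where C: "\<forall>x. norm x ^ (Suc m) * cmod (f x) <= C" using 2 by blast
 have "norm x ^ m * cmod (xmul j f x) <= C" for x
 using order_trans[OF mult_left_mono[OF xmul_norm_le[of j f x], of "norm x ^ m"]] C[THEN spec, of x]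
 by (simp add: algebra_simps)
 then show ?case by blast
 next
 case (3 f c)
 obtain C where C: "\<forall>x. norm x ^ m * cmod (f x) <= C" using 3 by blast
 have "norm x ^ m * cmod (c * f x) <= cmod c * C" for x
 using mult_left_mono[OF C[THEN spec, of x], of "cmod c"] by (simp add: norm_mult mult_ac)
 then show ?case by blast
 next
 case (4 f g)
 obtain C D where C: "\<forall>x. norm x ^ m * cmod (f x) <= C" "\<forall>x. norm x ^ m * cmod (g x) <= D" using 4 by meson
 have "norm x ^ m * cmod (f x + g x) <= C + D" for x
 using mult_left_mono[OF norm_triangle_ineq[of "f x" "g x"], of "norm x ^ m"] C[THEN spec, of x]
 by (simp add: distrib_left)
 then show ?case by blast
 qed
 show "pf i f \<in> gauss_span a" if "f \<in> gauss_span a" for f i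
 using that
 proof induction
 case 1
 have "pf i (gauss a) = (%x. cor (- 2 * a) * xmul i (gauss a) x)"
 using pderiv_fun_eq[OF gauss_has_derivative] by (auto simp: xmul_def inner_axis)
 then show ?case by (metis gauss_span.intros)
 next
 case (2 f j)
 then show ?case using diff by (subst pderiv_fun_xmul) (auto intro!: gauss_span.intros)
 next
 case (3 f c)
 then show ?case using diff by (subst pderiv_fun_cmult) (auto intro!: gauss_span.intros)
 next
 case (4 f g)
 then show ?case using diff by (subst pderiv_fun_add) (auto intro!: gauss_span.intros)
 qed
qed (rule gauss_span.intros)

section \<open>Integrals over three-dimensional space\<close>

lemma cart_euclidean_representation: "(\<Sum>b\<in>Basis. f b *R b) $ i = f (axis i (1::real))"
 for f :: "real^'n => real"
proof -
 have "(\<Sum>b\<in>Basis. f b *R b) \<bullet> axis i 1 = f (axis i 1)"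
 by (subst inner_sum_left_Basis) (auto simp: axis_in_Basis_iff)
 then show ?thesis by (simp add: inner_axis)
qed

lemma prod_Basis_cart: "(\<Prod>b\<in>(Basis :: (real^'n) set). g b) = (\<Prod>i\<in>UNIV. g (axis i 1))"
proof -
 have *: "(Basis :: (real^'n) set) = range (%i. axis i 1)" by (auto simp: Basis_vec_def)
 show ?thesis unfolding * by (subst prod.reindex) (auto simp: inj_on_def axis_eq_axis)
qed

lemma
 fixes f :: "'n::finite => real => complex"
 assumes f: "!!i. integrable lborel (f i)"
 shows integrable_prod_coords: "integrable lborel (%x::real^'n. \<Prod>i\<in>UNIV. f i (x $ i))"
 and integral_prod_coords: "(LINT x|lborel. (\<Prod>i\<in>UNIV. f i ((x::real^'n) $ i))) = (\<Prod>i\<in>UNIV. LINT x|lborel. f i x)"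
proof -
 interpret product_sigma_finite "%_::real^'n. lborel :: real measure" by standard
 \<comment> \<open>The Lebesgue measure is the image of a product measure indexed by basis vectors;
   the choice inverts \<open>axis i 1\<close> to carry the factors over to that index set.\<close>
 define g where "g b = f (SOME i. b = axis i (1::real))" for b :: "real^'n"
 have g: "g (axis i 1) = f i" for i by (simp add: g_def axis_eq_axis)
 have gi: "integrable lborel (g b)" for b by (simp add: g_def f)
 have [measurable]: "f i \<in> BM" for i using borel_measurable_integrable[OF f] by simp
 have m: "(%x::real^'n. \<Prod>i\<in>UNIV. f i (x $ i)) \<in> BM" by measurable
 have m2: "(%f. \<Sum>b\<in>Basis. f b *R b) \<in> (\<Pi>\<^sub>M b\<in>(Basis::(real^'n) set). lborel) \<rightarrow>\<^sub>M borel" by measurable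
 have e: "(\<Prod>i\<in>UNIV. f i ((\<Sum>b\<in>Basis. h b *R b) $ i)) = (\<Prod>b\<in>Basis. g b (h b))" for h :: "real^'n => real"
 unfolding cart_euclidean_representation prod_Basis_cart g ..
 show "integrable lborel (%x::real^'n. \<Prod>i\<in>UNIV. f i (x $ i))"
 unfolding lborel_eq[where 'a="real^'n"]
 unfolding integrable_distr_eq[OF m2 m] e using product_integrable_prod[of Basis g] gi by simp
 show "(LINT x|lborel. (\<Prod>i\<in>UNIV. f i ((x::real^'n) $ i))) = (\<Prod>i\<in>UNIV. LINT x|lborel. f i x)"
 unfolding lborel_eq[where 'a="real^'n"]
 unfolding integral_distr[OF m2 m] e
 using product_integral_prod[of Basis g] gi by (simp add: prod_Basis_cart g)
qed

section \<open>Affine changes of variables\<close>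

lemma nn_integral_affine:
 fixes f :: "'a::euclidean_space => ennreal"
 assumes [measurable]: "f \<in> BM" and c: "c ~= 0"
 shows "(NN x. f x) = er (\<bar>c\<bar> ^ DIM('a)) * (NN x. f (t + c *R x))"
 by (subst lborel_affine[OF c, of t])
 (simp add: nn_integral_density nn_integral_distr nn_integral_cmult)

lemma nn_integral_translate:
 fixes f :: "'a::euclidean_space => ennreal"
 assumes "f \<in> BM"
 shows "(NN x. f (t + x)) = (NN x. f x)"
 using nn_integral_affine[OF assms, of 1 t] by simp

lemma nn_integral_reflect:
 fixes f :: "'a::euclidean_space => ennreal"
 assumes "f \<in> BM"
 shows "(NN x. f (t - x)) = (NN x. f x)"
 using nn_integral_affine[OF assms, of "-1" t] by simp

lemma integrable_affine_iff:
 fixes f :: "'a::euclidean_space => 'b::{banach, second_countable_topology}"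
 assumes c: "c ~= 0"
 shows "integrable lborel (%x. f (t + c *R x)) \<longleftrightarrow> integrable lborel f"
proof -
 have *: "integrable lborel (%x. f (t + c *R x))" if f: "integrable lborel f" and c: "c ~= 0"
 for f :: "'a => 'b" and c t
 using f f[THEN borel_measurable_integrable] nn_integral_affine[of "%x. en (f x)" c t] c
 unfolding integrable_iff_bounded by (auto simp: ennreal_mult_less_top ennreal_zero_less_mult_iff)
 show ?thesis
 using *[of f c t] *[of "%x. f (t + c *R x)" "1/c" "- (1/c) *R t"] c by (auto simp: algebra_simps)
qed

lemma integral_affine:
 fixes f :: "'a::euclidean_space => 'b::{banach, second_countable_topology}"
 assumes c: "c ~= 0"
 shows "(\<integral>x. f x \<partial>lborel) = (\<bar>c\<bar> ^ DIM('a)) *R (\<integral>x. f (t + c *R x) \<partial>lborel)"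
proof cases
 assume f[measurable]: "integrable lborel f"
 then have [measurable]: "f \<in> BM" using borel_measurable_integrable by force
 show ?thesis
 by (subst lborel_affine[OF c, of t]) (simp add: integral_density integral_distr)
next
 assume "\<not> integrable lborel f" with c show ?thesis
 by (simp add: integrable_affine_iff not_integrable_integral_eq)
qed

lemma integral_reflect:
 fixes f :: "'a::euclidean_space => 'b::{banach, second_countable_topology}"
 shows "(\<integral>x. f (t - x) \<partial>lborel) = (\<integral>x. f x \<partial>lborel)"
 using integral_affine[of "-1" f t] by simp

lemma integral_translate:
 fixes f :: "'a::euclidean_space => 'b::{banach, second_countable_topology}"
 shows "(\<integral>x. f (t + x) \<partial>lborel) = (\<integral>x. f x \<partial>lborel)"
 using integral_affine[of 1 f t] by simp

lemma integrable_reflect: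
 fixes f :: "'a::euclidean_space => 'b::{banach, second_countable_topology}"
 shows "integrable lborel (%x. f (t - x)) \<longleftrightarrow> integrable lborel f"
 using integrable_affine_iff[of "-1" f t] by simp

section \<open>An integrable weight with polynomial decay\<close>

lemma integrable_inverse_square: "integrable lborel (%x::real. 1 / (1 + x\<^sup>2))"
 using integrable_inverse_1_plus_square
 by (simp add: set_integrable_def einterval_def inverse_eq_divide)

text \<open>The product form makes integrability a matter of one variable, while
  \<open>poly_weight_lower\<close> still bounds the weight below by (1 + |x|^2)^(-3). Decay of order
  6 therefore implies integrability.\<close>

definition poly_weight :: "real^3 => real" where
 "poly_weight x = (\<Prod>i\<in>UNIV. 1 / (1 + (x $ i)\<^sup>2))"

lemma poly_weight_nonneg: "0 <= poly_weight x"
 by (simp add: poly_weight_def prod_nonneg)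

lemma poly_weight_measurable [measurable]: "poly_weight \<in> BM"
 unfolding poly_weight_def[abs_def] by measurable

lemma integrable_poly_weight: "integrable lborel poly_weight"
proof -
 have "integrable lborel (%x::real^3. \<Prod>i\<in>UNIV. cor (1 / (1 + (x $ i)\<^sup>2)))"
 by (rule integrable_prod_coords[where f="%_ x. cor (1 / (1 + x\<^sup>2))"])
 (intro integrable_of_real integrable_inverse_square)
 then have "integrable lborel (%x. cor (poly_weight x))"
 unfolding poly_weight_def of_real_prod .
 then show ?thesis by (simp add: complex_of_real_integrable_eq)
qed

lemma poly_weight_lower: "1 <= poly_weight x * (1 + (norm x)\<^sup>2) ^ 3"
proof -
 have "(\<Prod>i\<in>UNIV. 1 + (x $ i)\<^sup>2) <= (\<Prod>i\<in>(UNIV::3 set). 1 + (norm x)\<^sup>2)"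
 by (intro prod_mono) (auto intro!: power_mono simp: component_le_norm_cart abs_le_square_iff[symmetric] simp del: abs_le_square_iff)
 moreover have "(\<Prod>i\<in>UNIV. 1 + (x $ i)\<^sup>2) > 0" by (intro prod_pos) (auto intro: add_pos_nonneg)
 ultimately show ?thesis by (simp add: poly_weight_def prod_dividef divide_simps)
qed

text \<open>The factor 8 = 1 + 3 + 3 + 1 is the sum of the coefficients of (1 + |x|^2)^3.\<close>

definition poly_mass :: real where
 "poly_mass = 8 * (LINT x|lborel. poly_weight x)"

lemma poly_mass_nonneg: "0 <= poly_mass"
 by (simp add: poly_mass_def poly_weight_nonneg)

lemma
 assumes m[measurable]: "f \<in> BM"
 and b: "!!m x. m <= 6 ==> norm x ^ m * cmod (f x) <= M"
 shows integrable_poly_decay: "integrable lborel (f :: real^3 => complex)"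
 and integral_poly_decay: "(LINT x|lborel. cmod (f x)) <= poly_mass * M"
proof -
 have le: "cmod (f x) <= 8 * M * poly_weight x" for x
 proof -
 have "cmod (f x) <= cmod (f x) * (poly_weight x * (1 + (norm x)\<^sup>2) ^ 3)"
 using mult_left_mono[OF poly_weight_lower[of x], of "cmod (f x)"] by simp
 also have "... = poly_weight x * (norm x ^ 0 * cmod (f x) + 3 * (norm x ^ 2 * cmod (f x)) + 3 * (norm x ^ 4 * cmod (f x)) + norm x ^ 6 * cmod (f x))"
 by (simp add: power3_eq_cube algebra_simps power2_eq_square power4_eq_xxxx eval_nat_numeral)
 also have "... <= poly_weight x * (M + 3 * M + 3 * M + M)"
 using b[of 0 x] b[of 2 x] b[of 4 x] b[of 6 x] by (intro mult_left_mono) (auto simp: poly_weight_nonneg)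
 finally show ?thesis by (simp add: algebra_simps)
 qed
 show i: "integrable lborel f"
 by (rule Bochner_Integration.integrable_bound[OF integrable_mult_right[OF integrable_poly_weight, of "8 * M"]])
 (use le in \<open>auto intro: order_trans[OF _ abs_ge_self]\<close>)
 have "(LINT x|lborel. cmod (f x)) <= (LINT x|lborel. 8 * M * poly_weight x)"
 using i integrable_poly_weight le by (intro integral_mono) auto
 then show "(LINT x|lborel. cmod (f x)) <= poly_mass * M" by (simp add: poly_mass_def algebra_simps)
qed

section \<open>The Fourier transform of Schwartz functions\<close>

text \<open>This is the premise on seminorms in \<open>is_tempered\<close>, named so that continuity
  bounds of operations on test functions can be chained.\<close>

definition sbound :: "nat => (real^3 => complex) => real => bool" where
 "sbound N fy M \<longleftrightarrow> (\<forall>is m x. length is <= N --> m <= N --> norm x ^ m * cmod (foldr pf is fy x) <= M)"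

lemma sboundD: "sbound N fy M ==> length is <= N ==> m <= N ==> norm x ^ m * cmod (foldr pf is fy x) <= M"
 by (auto simp: sbound_def)

lemma sboundD0: "sbound N fy M ==> m <= N ==> norm x ^ m * cmod (fy x) <= M"
 using sboundD[of N fy M "[]"] by simp

lemma sbound_nonneg: "sbound N fy M ==> 0 <= M"
 using order_trans[OF _ sboundD0[of N fy M 0 0]] by simp

lemma sbound_mono: "sbound N fy M ==> K <= N ==> M <= M' ==> sbound K fy M'"
 unfolding sbound_def by (meson order_trans)

lemma sbound_pderiv: "sbound (Suc N) fy M ==> sbound N (pf i fy) M"
 unfolding sbound_def
proof safe
 fix "is" :: "3 list" and m and x :: "real^3"
 assume a: "\<forall>is m x. length is <= Suc N --> m <= Suc N --> norm x ^ m * cmod (foldr pf is fy x) <= M"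
 and "length is <= N" "m <= N"
 then show "norm x ^ m * cmod (foldr pf is (pf i fy) x) <= M"
 using a[rule_format, of "is @ [i]" m x] by simp
qed

lemma schwartz_sbound:
 assumes "schwartz fy"
 shows "\<exists>M. sbound N fy M"
proof -
 have "\<forall>is m. \<exists>C. \<forall>x. norm x ^ m * cmod (foldr pf is fy x) <= C"
 using schwartz_bound[OF schwartz_foldr[OF assms]] by blast
 then obtain C where C: "!!is m x. norm x ^ m * cmod (foldr pf is fy x) <= C is m" by metis
 have fin: "finite ({is :: 3 list. length is <= N} \<times> {..N})"
 using finite_lists_length_le[of "UNIV :: 3 set" N] by simp
 have "sbound N fy (Max ((%(is, m). C is m) ` ({is. length is <= N} \<times> {..N})))"
 unfolding sbound_def
 proof safe
 fix "is" :: "3 list" and m and x :: "real^3"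
 assume "length is <= N" "m <= N"
 then have "C is m <= Max ((%(is, m). C is m) ` ({is. length is <= N} \<times> {..N}))"
 using fin by (intro Max_ge) auto
 then show "norm x ^ m * cmod (foldr pf is fy x) <= Max ((%(is, m). C is m) ` ({is. length is <= N} \<times> {..N}))"
 using C order_trans by blast
 qed
 then show ?thesis ..
qed

lemma schwartz_integrable: "schwartz fy ==> integrable lborel fy"
 using schwartz_sbound[of fy 6] sboundD0 integrable_poly_decay schwartz_measurable by metis

lemma norm_sum_list_le: "norm (\<Sum>x\<leftarrow>xs. f x) <= (\<Sum>x\<leftarrow>xs. norm (f x :: 'a::real_normed_vector))"
 by (induction xs) (auto intro: order_trans[OF norm_triangle_ineq])

lemma pderiv_fun_sum_list:
 assumes "!!f. f \<in> set fs ==> schwartz f"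
 shows "pf i (%x. \<Sum>f\<leftarrow>fs. f x) = (%x. \<Sum>f\<leftarrow>fs. pf i f x) & schwartz (%x. \<Sum>f\<leftarrow>fs. f x)"
 using assms
proof (induction fs)
 case Nil then show ?case using schwartz_zero pderiv_fun_cmult[of "%x. 0" i 0] by simp
next
 case (Cons f fs)
 have "schwartz f" "schwartz (%x. \<Sum>f\<leftarrow>fs. f x)" using Cons by auto
 then show ?case using Cons by (auto simp: pderiv_fun_add schwartz_differentiable intro!: schwartz_add)
qed

text \<open>Leibniz rule: at most one derivative can fall on the coordinate, and each derivative in
  the list has one chance to do so. Only the number and the length of the stray terms are recorded,
  since a seminorm estimate asks for no more.\<close>

lemma foldr_pderiv_xmul:
 assumes "schwartz fy"
 shows "\<exists>L. length L <= length is & (\<forall>js\<in>set L. length js <= length is) &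
 foldr pf is (xmul j fy) = (%x. xmul j (foldr pf is fy) x + (\<Sum>js\<leftarrow>L. foldr pf js fy x))"
proof (induction "is")
 case Nil then show ?case by (intro exI[of _ "[]"]) simp
next
 case (Cons i "is")
 then obtain L where L: "length L <= length is" "\<forall>js\<in>set L. length js <= length is"
 "foldr pf is (xmul j fy) = (%x. xmul j (foldr pf is fy) x + (\<Sum>js\<leftarrow>L. foldr pf js fy x))" by auto
 let ?L = "(if i = j then [is] else []) @ map ((#) i) L"
 let ?fs = "map (%js. foldr pf js fy) L"
 have s: "schwartz (foldr pf js fy)" for js using schwartz_foldr[OF assms] .
 have S: "pf i (%x. \<Sum>f\<leftarrow>?fs. f x) = (%x. \<Sum>f\<leftarrow>?fs. pf i f x)" "schwartz (%x. \<Sum>f\<leftarrow>?fs. f x)"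
 using pderiv_fun_sum_list[of ?fs i] s by auto
 have eq: "(\<Sum>f\<leftarrow>?fs. f x) = (\<Sum>js\<leftarrow>L. foldr pf js fy x)" for x by (simp add: o_def)
 have "foldr pf (i # is) (xmul j fy) =
 pf i (%x. xmul j (foldr pf is fy) x + (\<Sum>f\<leftarrow>?fs. f x))"
 unfolding eq L(3)[symmetric] by simp
 also have "... = (%x. pf i (xmul j (foldr pf is fy)) x + (\<Sum>f\<leftarrow>?fs. pf i f x))"
 using s S schwartz_xmul by (subst pderiv_fun_add) (auto simp: schwartz_differentiable)
 also have "... = (%x. xmul j (foldr pf (i # is) fy) x + (\<Sum>js\<leftarrow>?L. foldr pf js fy x))"
 using s by (subst pderiv_fun_xmul) (auto simp: schwartz_differentiable o_def)
 finally show ?case using L by (intro exI[of _ ?L]) auto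
qed

text \<open>One unit of order is spent on the additional power of |x|; the factor N + 1 counts the
  main term and at most N stray terms of the Leibniz rule.\<close>

lemma sbound_xmul:
 assumes s: "schwartz fy" and b: "sbound (Suc N) fy M"
 shows "sbound N (xmul j fy) (real (Suc N) * M)"
 unfolding sbound_def
proof safe
 fix "is" :: "3 list" and m and x :: "real^3"
 assume l: "length is <= N" "m <= N"
 obtain L where L: "length L <= length is" "\<forall>js\<in>set L. length js <= length is"
 "foldr pf is (xmul j fy) = (%x. xmul j (foldr pf is fy) x + (\<Sum>js\<leftarrow>L. foldr pf js fy x))"
 using foldr_pderiv_xmul[OF s] by blast
 have "norm x ^ m * cmod (\<Sum>js\<leftarrow>L. foldr pf js fy x) <= norm x ^ m * (\<Sum>js\<leftarrow>L. cmod (foldr pf js fy x))"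
 by (intro mult_left_mono norm_sum_list_le) auto
 also have "... = (\<Sum>js\<leftarrow>L. norm x ^ m * cmod (foldr pf js fy x))" by (simp add: sum_list_const_mult)
 also have "... <= (\<Sum>js\<leftarrow>L. M)"
 using L l by (intro sum_list_mono sboundD[OF b]) auto
 also have "... = real (length L) * M" by (simp add: sum_list_triv)
 also have "... <= real N * M" using L(1) l sbound_nonneg[OF b] by (intro mult_right_mono) auto
 finally have 1: "norm x ^ m * cmod (\<Sum>js\<leftarrow>L. foldr pf js fy x) <= real N * M" .
 have "norm x ^ m * cmod (xmul j (foldr pf is fy) x) <= norm x ^ m * (norm x * cmod (foldr pf is fy x))"
 by (intro mult_left_mono xmul_norm_le) auto
 also have "... = norm x ^ Suc m * cmod (foldr pf is fy x)" by (simp add: mult_ac)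
 also have "... <= M" using l by (intro sboundD[OF b]) auto
 finally have 2: "norm x ^ m * cmod (xmul j (foldr pf is fy) x) <= M" .
 have "norm x ^ m * cmod (foldr pf is (xmul j fy) x)
 <= norm x ^ m * (cmod (xmul j (foldr pf is fy) x) + cmod (\<Sum>js\<leftarrow>L. foldr pf js fy x))"
 unfolding L(3) by (intro mult_left_mono norm_triangle_ineq) auto
 also have "... <= real (Suc N) * M" using 1 2 by (simp add: algebra_simps)
 finally show "norm x ^ m * cmod (foldr pf is (xmul j fy) x) <= real (Suc N) * M" .
qed

lemma cis_measurable [measurable]: "cis \<in> BM"
 by (intro borel_measurable_continuous_onI continuous_on_cis continuous_on_id)

lemma fourier_fun_integrable: "integrable lborel fy ==> integrable lborel (%x. cis (- (x \<bullet> xi)) * fy x)"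
proof -
 assume i: "integrable lborel fy"
 then have [measurable]: "fy \<in> BM" by (auto dest: borel_measurable_integrable)
 show ?thesis
 by (rule Bochner_Integration.integrable_bound[OF i]) (auto simp: norm_mult)
qed

lemma fourier_fun_norm_le: "integrable lborel fy ==> cmod (ff fy xi) <= (LINT x|lborel. cmod (fy x))"
 unfolding fourier_fun_def by (rule order_trans[OF integral_norm_bound]) (simp add: norm_mult)

lemma cis_approx1: "cmod (cis t - 1 - \<i> * t) <= t\<^sup>2 / 2"
 using iexp_approx1[of t 1] by (simp add: cis_conv_exp eval_nat_numeral algebra_simps)

text \<open>The operation that becomes a partial derivative after the Fourier transform; iterating
  it describes all derivatives of a transform.\<close>

definition fmul :: "3 => (real^3 => complex) => real^3 => complex" where
 "fmul j f = (%x. - \<i> * xmul j f x)"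

lemma schwartz_fmul: "schwartz fy ==> schwartz (fmul j fy)"
 unfolding fmul_def by (intro schwartz_cmult schwartz_xmul)

text \<open>The remainder of the linear approximation of \<open>cis\<close> is quadratic, so the
  error is at most |h|^2/2 times the second absolute moment of \<open>fy\<close>. That moment is
  finite because |x|^2 \<open>fy\<close> is a sum of twice coordinate-multiplied Schwartz
  functions.\<close>

lemma fourier_has_derivative:
 assumes s: "schwartz fy"
 shows "(ff fy has_derivative (%h. \<Sum>j\<in>UNIV. cor (h $ j) * ff (fmul j fy) xi)) (at xi)"
proof -
 note i = schwartz_integrable
 define K where "K = (LINT x|lborel. (norm x)\<^sup>2 * cmod (fy x))"
 have i2: "integrable lborel (%x. (norm x)\<^sup>2 * cmod (fy x))"
 proof -
 have "integrable lborel (%x. \<Sum>j\<in>UNIV. xmul j (xmul j fy) x)"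
 using s by (intro Bochner_Integration.integrable_sum i schwartz_xmul)
 also have "(%x. \<Sum>j\<in>UNIV. xmul j (xmul j fy) x) = (%x. cor ((norm x)\<^sup>2) * fy x)"
 by (simp add: xmul_def power2_norm_eq_inner inner_vec_def mult.assoc[symmetric] sum_distrib_right[symmetric])
 finally have "integrable lborel (%x. norm (cor ((norm x)\<^sup>2) * fy x))"
 by (rule integrable_norm)
 then show ?thesis by (simp add: norm_mult norm_power)
 qed
 have K0: "0 <= K" by (simp add: K_def)
 let ?D = "%h. \<Sum>j\<in>UNIV. cor (h $ j) * ff (fmul j fy) xi"
 have ij: "integrable lborel (%x. cis (- (x \<bullet> xi)) * fmul j fy x)" for j
 using s by (intro fourier_fun_integrable i schwartz_fmul)
 have le: "cmod (ff fy y - ff fy xi - ?D (y - xi)) <= (norm (y - xi))\<^sup>2 / 2 * K" for y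
 proof -
 let ?h = "y - xi"
 have D: "?D ?h = (LINT x|lborel. (\<Sum>j\<in>UNIV. cor (?h $ j) * (cis (- (x \<bullet> xi)) * fmul j fy x)))"
 using ij by (simp add: fourier_fun_def)
 have "ff fy y - ff fy xi - ?D ?h =
 (LINT x|lborel. cis (- (x \<bullet> y)) * fy x - cis (- (x \<bullet> xi)) * fy x - (\<Sum>j\<in>UNIV. cor (?h $ j) * (cis (- (x \<bullet> xi)) * fmul j fy x)))"
 unfolding D unfolding fourier_fun_def using ij s by (simp add: fourier_fun_integrable i)
 also have "cmod ... <= (LINT x|lborel. (norm ?h)\<^sup>2 / 2 * ((norm x)\<^sup>2 * cmod (fy x)))"
 proof (rule Bochner_Integration.integral_norm_bound_integral)
 fix x
 let ?t = "- (x \<bullet> ?h)"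
 have e0: "(\<Sum>j\<in>UNIV. cor (h $ j) * (c * fmul j fy x)) = c * fy x * (\<i> * (- (x \<bullet> h)))" for h c
 by (simp add: fmul_def xmul_def inner_vec_def sum_distrib_left sum_negf mult_ac)
 have e: "(\<Sum>j\<in>UNIV. cor (?h $ j) * (cis (- (x \<bullet> xi)) * fmul j fy x)) = cis (- (x \<bullet> xi)) * fy x * (\<i> * ?t)"
 by (rule e0)
 have e2: "cis (- (x \<bullet> y)) = cis (- (x \<bullet> xi)) * cis ?t"
 by (simp add: cis_mult inner_diff_right)
 have "cis (- (x \<bullet> y)) * fy x - cis (- (x \<bullet> xi)) * fy x - (\<Sum>j\<in>UNIV. cor (?h $ j) * (cis (- (x \<bullet> xi)) * fmul j fy x))
 = cis (- (x \<bullet> xi)) * fy x * (cis ?t - 1 - \<i> * ?t)"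
 unfolding e e2 by (simp add: algebra_simps)
 then have "cmod (cis (- (x \<bullet> y)) * fy x - cis (- (x \<bullet> xi)) * fy x - (\<Sum>j\<in>UNIV. cor (?h $ j) * (cis (- (x \<bullet> xi)) * fmul j fy x)))
 = cmod (fy x) * cmod (cis ?t - 1 - \<i> * ?t)"
 by (simp only: norm_mult norm_cis mult_1)
 also have "... <= cmod (fy x) * (?t\<^sup>2 / 2)" by (intro mult_left_mono cis_approx1) simp
 also have "... <= cmod (fy x) * ((norm x * norm ?h)\<^sup>2 / 2)"
 using Cauchy_Schwarz_ineq2[of x ?h]
 by (intro mult_left_mono divide_right_mono) (auto simp: abs_le_square_iff[symmetric] abs_mult)
 finally show "cmod (cis (- (x \<bullet> y)) * fy x - cis (- (x \<bullet> xi)) * fy x - (\<Sum>j\<in>UNIV. cor (?h $ j) * (cis (- (x \<bullet> xi)) * fmul j fy x)))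
 <= (norm ?h)\<^sup>2 / 2 * ((norm x)\<^sup>2 * cmod (fy x))"
 by (simp add: power_mult_distrib mult_ac)
 next
 show "integrable lborel (%x. cis (- (x \<bullet> y)) * fy x - cis (- (x \<bullet> xi)) * fy x - (\<Sum>j\<in>UNIV. cor (?h $ j) * (cis (- (x \<bullet> xi)) * fmul j fy x)))"
 by (intro Bochner_Integration.integrable_diff fourier_fun_integrable[OF i[OF s]] Bochner_Integration.integrable_sum integrable_mult_right ij)
 qed (use i2 in auto)
 finally show ?thesis by (simp add: K_def)
 qed
 show ?thesis
 proof (rule has_derivativeI_sandwich[where e=1 and H="%y. norm (y - xi) / 2 * K"])
 show "bounded_linear ?D"
 by (intro bounded_linear_sum bounded_linear_mult_const bounded_linear_compose[OF bounded_linear_of_real] bounded_linear_vec_nth)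
 show "norm ((ff fy y - ff fy xi) - ?D (y - xi)) / norm (y - xi) <= norm (y - xi) / 2 * K"
 if "y ~= xi" for y
 using le[of y] that by (simp add: divide_simps power2_eq_square mult_ac)
 have "((%y. norm (y - xi) / 2 * K) \<longlongrightarrow> norm (xi - xi) / 2 * K) (at xi)" by (intro tendsto_intros) simp
 then show "((%y. norm (y - xi) / 2 * K) \<longlongrightarrow> 0) (at xi)" by simp
 qed auto
qed

lemma pderiv_fourier:
 assumes s: "schwartz fy"
 shows "pf j (ff fy) = ff (fmul j fy)"
proof
 fix xi
 have "pf j (ff fy) xi = (\<Sum>i\<in>UNIV. cor ((axis j 1 :: real^3) $ i) * ff (fmul i fy) xi)"
 by (rule pderiv_fun_eq[OF fourier_has_derivative[OF s]])
 also have "... = (\<Sum>i\<in>UNIV. if i = j then ff (fmul i fy) xi else 0)"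
 by (intro sum.cong) (auto simp: axis_def)
 finally show "pf j (ff fy) xi = ff (fmul j fy) xi" by simp
qed

lemma fourier_fun_translate:
 "ff (%x. fy (c + x)) xi = cis (c \<bullet> xi) * ff fy xi"
proof -
 have "ff (%x. fy (c + x)) xi = (LINT x|lborel. cis (- ((-c + (c + x)) \<bullet> xi)) * fy (c + x))"
 by (simp add: fourier_fun_def)
 also have "... = (LINT x|lborel. cis (- ((-c + x) \<bullet> xi)) * fy x)"
 by (rule integral_translate)
 also have "... = (LINT x|lborel. cis (c \<bullet> xi) * (cis (- (x \<bullet> xi)) * fy x))"
 proof -
 have "cis (- ((-c + x) \<bullet> xi)) = cis (c \<bullet> xi) * cis (- (x \<bullet> xi))" for x
 by (simp add: cis_mult inner_diff_left)
 then show ?thesis by (simp only: mult.assoc)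
 qed
 finally show ?thesis by (simp add: fourier_fun_def)
qed

lemma schwartz_decay:
 assumes "schwartz fy"
 shows "\<exists>C\<ge>0. \<forall>x. (1 + (norm x)\<^sup>2) ^ 3 * cmod (fy x) <= C"
proof -
 obtain M where M: "sbound 6 fy M" using schwartz_sbound[OF assms] by blast
 have "(1 + (norm x)\<^sup>2) ^ 3 * cmod (fy x) <= 8 * M" for x
 proof -
 have "(1 + (norm x)\<^sup>2) ^ 3 * cmod (fy x) = norm x ^ 0 * cmod (fy x) + 3 * (norm x ^ 2 * cmod (fy x)) + 3 * (norm x ^ 4 * cmod (fy x)) + norm x ^ 6 * cmod (fy x)"
 by (simp add: power3_eq_cube algebra_simps power2_eq_square power4_eq_xxxx eval_nat_numeral)
 then show ?thesis using sboundD0[OF M, of 0 x] sboundD0[OF M, of 2 x] sboundD0[OF M, of 4 x] sboundD0[OF M, of 6 x] by simp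
 qed
 then show ?thesis using sbound_nonneg[OF M] by (intro exI[of _ "8 * M"]) auto
qed

text \<open>Difference quotients take the place of integration by parts: a translation multiplies
  the transform by a character, and the quotients converge under a common multiple of
  \<open>poly_weight\<close>.\<close>

lemma fourier_of_pderiv:
 assumes s: "schwartz fy"
 shows "ff (pf j fy) xi = \<i> * xi $ j * ff fy xi"
proof -
 have aux: "1 + a <= 3 * (1 + b)" if "a <= 2 * b + 2" "0 <= b" for a b :: real using that by simp
 let ?e = "axis j 1 :: real^3"
 define t where "t n = 1 / real (Suc n)" for n
 have t: "0 < t n" "t n <= 1" for n by (auto simp: t_def)
 have t0: "t -+> 0" unfolding t_def[abs_def] by (rule LIMSEQ_inverse_real_of_nat[unfolded inverse_eq_divide])
 obtain C where C: "C >= 0" "!!x. (1 + (norm x)\<^sup>2) ^ 3 * cmod (pf j fy x) <= C"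
 using schwartz_decay[OF schwartz_pderiv[OF s]] by blast
 have vd: "((%r. fy (x + r *R ?e)) has_vector_derivative pf j fy (x + r *R ?e)) (at r)" for x r
 proof -
 have a: "((%r. x + r *R ?e) has_derivative (%h. h *R ?e)) (at r)" by (auto intro!: derivative_eq_intros)
 have b: "(fy has_derivative frechet_derivative fy (at (x + r *R ?e))) (at (x + r *R ?e))"
 using s by (intro differentiable_has_derivative schwartz_differentiable)
 show ?thesis
 using has_derivative_compose[OF a b] linear_scale[OF bounded_linear.linear[OF has_derivative_bounded_linear[OF b]]]
 by (simp add: has_vector_derivative_def pderiv_fun_def)
 qed
 have q: "(%n. (fy (t n *R ?e + x) - fy x) / t n) -+> pf j fy x" for x
 proof -
 let ?v = "pf j fy x"
 have "((%h. norm (fy (x + h *R ?e) - fy x - h *R ?v) / norm h) \<longlongrightarrow> 0) (at 0)"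
 using vd[of x 0] by (simp add: has_vector_derivative_def has_derivative_at)
 moreover have "filterlim t (at 0) sequentially"
 using t0 t by (auto simp: filterlim_at less_imp_neq[THEN not_sym])
 ultimately have "(%n. norm (fy (x + t n *R ?e) - fy x - t n *R ?v) / norm (t n)) -+> 0"
 by (rule filterlim_compose)
 also have "(%n. norm (fy (x + t n *R ?e) - fy x - t n *R ?v) / norm (t n)) = (%n. norm ((fy (t n *R ?e + x) - fy x) / t n - ?v))"
 proof
 fix n
 have "(fy (t n *R ?e + x) - fy x) / t n - ?v = (fy (x + t n *R ?e) - fy x - t n *R ?v) / t n"
 using t(1)[of n] by (simp add: field_simps scaleR_conv_of_real)
 then show "norm (fy (x + t n *R ?e) - fy x - t n *R ?v) / norm (t n) = norm ((fy (t n *R ?e + x) - fy x) / t n - ?v)"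
 by (simp only: norm_divide norm_of_real real_norm_def)
 qed
 finally show ?thesis using LIM_zero_cancel tendsto_norm_zero_iff by blast
 qed
 have bd: "cmod ((fy (t n *R ?e + x) - fy x) / t n) <= 27 * C * poly_weight x" for n x
 proof -
 \<comment> \<open>A shift by at most 1 changes 1 + |x|^2 by a factor of at most 3, and 27 is its
   cube.\<close>
 have bb: "cmod (pf j fy (x + r *R ?e)) <= 27 * C * poly_weight x" if "0 <= r" "r <= 1" for r
 proof -
 let ?y = "x + r *R ?e"
 have "norm x <= norm ?y + 1" using norm_triangle_ineq4[of ?y "r *R ?e"] that by simp
 then have "(norm x)\<^sup>2 <= (norm ?y + 1)\<^sup>2" by (intro power_mono) auto
 also have "... <= 2 * (norm ?y)\<^sup>2 + 2" using sum_squares_bound[of "norm ?y" 1] by (simp add: power2_sum)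
 finally have "1 + (norm x)\<^sup>2 <= 3 * (1 + (norm ?y)\<^sup>2)"
 using zero_le_power2 by (rule aux)
 then have "(1 + (norm x)\<^sup>2) ^ 3 <= (3 * (1 + (norm ?y)\<^sup>2)) ^ 3" by (intro power_mono) auto
 also have "... = 27 * (1 + (norm ?y)\<^sup>2) ^ 3" by (simp only: power_mult_distrib) simp
 finally have le: "(1 + (norm x)\<^sup>2) ^ 3 <= 27 * (1 + (norm ?y)\<^sup>2) ^ 3" .
 have "cmod (pf j fy ?y) <= cmod (pf j fy ?y) * (poly_weight x * (1 + (norm x)\<^sup>2) ^ 3)"
 using mult_left_mono[OF poly_weight_lower[of x], of "cmod (pf j fy ?y)"] by simp
 also have "... <= cmod (pf j fy ?y) * (poly_weight x * (27 * (1 + (norm ?y)\<^sup>2) ^ 3))"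
 using le by (intro mult_left_mono) (auto simp: poly_weight_nonneg)
 also have "... = 27 * poly_weight x * ((1 + (norm ?y)\<^sup>2) ^ 3 * cmod (pf j fy ?y))" by (simp add: mult_ac)
 also have "... <= 27 * poly_weight x * C" by (intro mult_left_mono C) (simp add: poly_weight_nonneg)
 finally show ?thesis by (simp add: mult_ac)
 qed
 have "norm (fy (x + t n *R ?e) - fy (x + 0 *R ?e)) <= 27 * C * poly_weight x * norm (t n - 0)"
 proof (rule differentiable_bound[where S="{0..1}" and f'="%r h. h *R pf j fy (x + r *R ?e)"])
 show "((%r. fy (x + r *R ?e)) has_derivative (%h. h *R pf j fy (x + r *R ?e))) (at r within {0..1})" for r
 using vd[of x r] unfolding has_vector_derivative_def by (rule has_derivative_at_withinI)
 show "onorm (%h. h *R pf j fy (x + r *R ?e)) <= 27 * C * poly_weight x" if "r \<in> {0..1}" for r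
 proof (rule onorm_bound)
 show "norm (h *R pf j fy (x + r *R ?e)) <= 27 * C * poly_weight x * norm h" for h
 using mult_right_mono[OF bb[of r], of "norm h"] that by (simp add: mult_ac)
 qed (use C(1) in \<open>auto simp: poly_weight_nonneg\<close>)
 qed (use t[of n] in auto)
 then show ?thesis using t[of n] by (simp add: norm_divide field_simps add.commute)
 qed
 have m[measurable]: "fy \<in> BM" "pf j fy \<in> BM"
 using s schwartz_pderiv schwartz_measurable by auto
 have "(%n. LINT x|lborel. cis (- (x \<bullet> xi)) * ((fy (t n *R ?e + x) - fy x) / t n)) -+> (LINT x|lborel. cis (- (x \<bullet> xi)) * pf j fy x)"
 proof (rule integral_dominated_convergence[where w="%x. 27 * C * poly_weight x"])
 show "AL x. (%n. cis (- (x \<bullet> xi)) * ((fy (t n *R ?e + x) - fy x) / t n)) -+> cis (- (x \<bullet> xi)) * pf j fy x"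
 by (intro always_eventually allI tendsto_mult tendsto_const q)
 show "AL x. norm (cis (- (x \<bullet> xi)) * ((fy (t n *R ?e + x) - fy x) / t n)) <= 27 * C * poly_weight x" for n
 unfolding norm_mult norm_cis mult_1 by (intro always_eventually allI bd)
 qed (auto intro!: integrable_mult_right integrable_poly_weight)
 moreover have "(LINT x|lborel. cis (- (x \<bullet> xi)) * ((fy (t n *R ?e + x) - fy x) / t n)) = (cis (t n * xi $ j) - 1) / t n * ff fy xi" for n
 proof -
 have "(LINT x|lborel. cis (- (x \<bullet> xi)) * ((fy (t n *R ?e + x) - fy x) / t n)) =
 (LINT x|lborel. (cis (- (x \<bullet> xi)) * fy (t n *R ?e + x) - cis (- (x \<bullet> xi)) * fy x) / t n)"
 by (simp add: algebra_simps)
 also have "... = (ff (%x. fy (t n *R ?e + x)) xi - ff fy xi) / t n"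
 using s by (simp add: fourier_fun_def fourier_fun_integrable schwartz_integrable schwartz_translate)
 also have "... = (cis (t n * xi $ j) - 1) / t n * ff fy xi"
 unfolding fourier_fun_translate using t(1)[of n] by (simp add: inner_axis' field_simps)
 finally show ?thesis .
 qed
 moreover have "(%n. (cis (t n * xi $ j) - 1) / t n * ff fy xi) -+> \<i> * xi $ j * ff fy xi"
 proof (intro tendsto_mult_right)
 show "(%n. (cis (t n * xi $ j) - 1) / t n) -+> \<i> * xi $ j"
 proof (rule LIM_zero_cancel, rule Lim_null_comparison)
 show "\<forall>\<^sub>F n in sequentially. norm ((cis (t n * xi $ j) - 1) / t n - \<i> * xi $ j) <= t n * ((xi $ j)\<^sup>2 / 2)"
 proof (intro always_eventually allI)
 fix n
 have "(cis (t n * xi $ j) - 1) / t n - \<i> * xi $ j = (cis (t n * xi $ j) - 1 - \<i> * (t n * xi $ j)) / t n"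
 using t(1)[of n] by (simp add: field_simps)
 then have "norm ((cis (t n * xi $ j) - 1) / t n - \<i> * xi $ j) = cmod (cis (t n * xi $ j) - 1 - \<i> * (t n * xi $ j)) / t n"
 using t(1)[of n] by (simp add: norm_divide)
 also have "... <= ((t n * xi $ j)\<^sup>2 / 2) / t n"
 using cis_approx1[of "t n * xi $ j"] t(1)[of n] by (intro divide_right_mono) auto
 also have "... = t n * ((xi $ j)\<^sup>2 / 2)" using t(1)[of n] by (simp add: power2_eq_square field_simps)
 finally show "norm ((cis (t n * xi $ j) - 1) / t n - \<i> * xi $ j) <= t n * ((xi $ j)\<^sup>2 / 2)" .
 qed
 show "(%n. t n * ((xi $ j)\<^sup>2 / 2)) -+> 0" using tendsto_mult_right[OF t0] by simp
 qed
 qed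
 ultimately show ?thesis using LIMSEQ_unique unfolding fourier_fun_def[symmetric] by force
qed

lemma schwartz_foldr_fmul: "schwartz fy ==> schwartz (foldr fmul is fy)"
 by (induction "is") (auto intro: schwartz_fmul)

lemma foldr_pderiv_fourier:
 "schwartz fy ==> foldr pf is (ff fy) = ff (foldr fmul is fy)"
 by (induction "is") (auto simp: pderiv_fourier schwartz_foldr_fmul)

text \<open>Each power of |xi| is paid for by one derivative through |xi| <= |xi_1| + |xi_2| +
  |xi_3|, whence the factor 3 per power; the six additional orders make the last function
  integrable.\<close>

lemma fourier_decay:
 assumes "schwartz \<psi>" "sbound (6 + m) \<psi> M"
 shows "norm xi ^ m * cmod (ff \<psi> xi) <= 3 ^ m * poly_mass * M"
 using assms
proof (induction m arbitrary: \<psi>)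
 case 0
 have "cmod (ff \<psi> xi) <= (LINT x|lborel. cmod (\<psi> x))"
 using 0 by (intro fourier_fun_norm_le schwartz_integrable)
 also have "... <= poly_mass * M"
 using 0 sboundD0 by (intro integral_poly_decay schwartz_measurable) auto
 finally show ?case by simp
next
 case (Suc m)
 have "norm xi ^ Suc m * cmod (ff \<psi> xi) = norm xi * (norm xi ^ m * cmod (ff \<psi> xi))" by simp
 also have "... <= (\<Sum>j\<in>UNIV. \<bar>xi $ j\<bar>) * (norm xi ^ m * cmod (ff \<psi> xi))"
 by (intro mult_right_mono norm_le_l1_cart) auto
 also have "... = (\<Sum>j\<in>UNIV. norm xi ^ m * cmod (ff (pf j \<psi>) xi))"
 using Suc.prems by (simp add: fourier_of_pderiv norm_mult sum_distrib_right)
 (simp add: mult_ac)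
 also have "... <= (\<Sum>j\<in>(UNIV :: 3 set). 3 ^ m * poly_mass * M)"
 using Suc.prems by (intro sum_mono Suc.IH schwartz_pderiv sbound_pderiv) auto
 finally show ?case by simp
qed

lemma foldr_pderiv_cmult:
 "schwartz fy ==> foldr pf is (%x. c * fy x) = (%x. c * foldr pf is fy x)"
 by (induction "is") (auto simp: pderiv_fun_cmult schwartz_foldr schwartz_differentiable)

lemma sbound_cmult: "schwartz fy ==> sbound N fy M ==> sbound N (%x. c * fy x) (cmod c * M)"
 unfolding sbound_def
proof safe
 fix "is" :: "3 list" and m and x :: "real^3"
 assume s: "schwartz fy"
 and a: "\<forall>is m x. length is <= N --> m <= N --> norm x ^ m * cmod (foldr pf is fy x) <= M"
 and l: "length is <= N" "m <= N"
 then show "norm x ^ m * cmod (foldr pf is (%x. c * fy x) x) <= cmod c * M"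
 using mult_left_mono[OF a[rule_format, of "is" m x], of "cmod c"]
 by (simp add: foldr_pderiv_cmult norm_mult mult_ac)
qed

lemma sbound_foldr_fmul:
 assumes "schwartz fy" "sbound (K + length is) fy M"
 shows "sbound K (foldr fmul is fy) (real (K + length is) ^ length is * M)"
 using assms
proof (induction "is" arbitrary: K)
 case Nil then show ?case by simp
next
 case (Cons i "is")
 note M = sbound_nonneg[OF Cons.prems(2)]
 have "sbound (Suc K) (foldr fmul is fy) (real (Suc K + length is) ^ length is * M)"
 by (rule Cons.IH) (use Cons.prems in auto)
 then have "sbound K (xmul i (foldr fmul is fy)) (real (Suc K) * (real (Suc K + length is) ^ length is * M))"
 using Cons.prems by (intro sbound_xmul schwartz_foldr_fmul)
 then have "sbound K (%x. - \<i> * xmul i (foldr fmul is fy) x) (cmod (- \<i>) * (real (Suc K) * (real (Suc K + length is) ^ length is * M)))"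
 using Cons.prems by (intro sbound_cmult schwartz_xmul schwartz_foldr_fmul)
 then have "sbound K (foldr fmul (i # is) fy) (real (Suc K) * (real (Suc K + length is) ^ length is * M))"
 by (simp add: fmul_def)
 moreover have "real (Suc K) * (real (Suc K + length is) ^ length is * M) <= real (Suc K + length is) * (real (Suc K + length is) ^ length is * M)"
 using M by (intro mult_right_mono) auto
 ultimately show ?case by (elim sbound_mono) (auto simp: mult_ac)
qed

lemma schwartz_fourier: "schwartz fy ==> schwartz (ff fy)"
proof (rule schwartzI_class[where G="{f. \<exists>fy. schwartz fy & f = ff fy}"])
 fix f x assume "f \<in> {f. \<exists>fy. schwartz fy & f = ff fy}"
 then show "f differentiable (at x)"
 using fourier_has_derivative unfolding differentiable_def by blast
next
 fix f and m :: nat assume "f \<in> {f. \<exists>fy. schwartz fy & f = ff fy}"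
 then obtain fy where "schwartz fy" "f = ff fy" by auto
 then show "\<exists>C. \<forall>x. norm x ^ m * cmod (f x) <= C"
 using schwartz_sbound[of fy "6 + m"] fourier_decay by metis
next
 fix f i assume "f \<in> {f. \<exists>fy. schwartz fy & f = ff fy}"
 then show "pf i f \<in> {f. \<exists>fy. schwartz fy & f = ff fy}"
 using pderiv_fourier schwartz_fmul by blast
qed auto

text \<open>The factors are N powers of |xi| from \<open>fourier_decay\<close>, the integrability
  constant, and N coordinate multiplications. The order 6 + 2N in \<open>sbound_fourier\<close>
  arises likewise as 6 for integrability, N for decay and N for multiplications.\<close>

definition fourier_const :: "nat => real" where
 "fourier_const N = 3 ^ N * poly_mass * real (6 + 2 * N) ^ N"

lemma sbound_fourier:
 assumes s: "schwartz fy" and b: "sbound (6 + 2 * N) fy M"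
 shows "sbound N (ff fy) (fourier_const N * M)"
 unfolding sbound_def
proof safe
 fix "is" :: "3 list" and m and x :: "real^3"
 assume l: "length is <= N" "m <= N"
 note M = sbound_nonneg[OF b]
 have "sbound (6 + m + length is) fy M" using b by (rule sbound_mono) (use l in auto)
 then have "norm x ^ m * cmod (ff (foldr fmul is fy) x) <= 3 ^ m * poly_mass * (real (6 + m + length is) ^ length is * M)"
 using s by (intro fourier_decay schwartz_foldr_fmul sbound_foldr_fmul)
 also have "... <= 3 ^ N * poly_mass * (real (6 + 2 * N) ^ N * M)"
 proof (intro mult_mono)
 have "real (6 + m + length is) ^ length is <= real (6 + 2 * N) ^ length is" using l by (intro power_mono) auto
 also have "... <= real (6 + 2 * N) ^ N" using l by (intro power_increasing) auto
 finally show "real (6 + m + length is) ^ length is <= real (6 + 2 * N) ^ N" .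
 qed (use l M poly_mass_nonneg in \<open>auto intro!: power_increasing\<close>)
 finally show "norm x ^ m * cmod (foldr pf is (ff fy) x) <= fourier_const N * M"
 using s by (simp add: foldr_pderiv_fourier fourier_const_def mult_ac)
qed

lemma foldr_pderiv_reflect:
 "schwartz fy ==> foldr pf is (%x. fy (- x)) = (%x. (-1) ^ length is * foldr pf is fy (- x))"
proof (induction "is")
 case (Cons i "is")
 have s: "schwartz (%x. foldr pf is fy (- x))" using Cons.prems by (intro schwartz_reflect schwartz_foldr)
 have "pf i (%x. foldr pf is fy (- x)) = (%x. - pf i (foldr pf is fy) (- x))"
 using pderiv_fun_affine[of "foldr pf is fy" i 0 "-1"] Cons.prems
 by (simp add: schwartz_differentiable schwartz_foldr)
 then show ?case using Cons s by (simp add: pderiv_fun_cmult schwartz_differentiable)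
qed simp

lemma sbound_reflect: "schwartz fy ==> sbound N fy M ==> sbound N (%x. fy (- x)) M"
 unfolding sbound_def by (auto simp: foldr_pderiv_reflect norm_mult norm_power) (metis norm_minus_cancel)

lemma inv_fourier_fun_eq: "inv_fourier_fun fy = (%x. (1 / cor ((2 * pi) ^ 3)) * ff fy (- x))"
 by (simp add: inv_fourier_fun_def fourier_fun_def fun_eq_iff inner_commute)

lemma schwartz_inv_fourier: "schwartz fy ==> schwartz (inv_fourier_fun fy)"
 unfolding inv_fourier_fun_eq by (intro schwartz_cmult schwartz_reflect schwartz_fourier)

lemma sbound_inv_fourier:
 assumes s: "schwartz fy" and b: "sbound (6 + 2 * N) fy M"
 shows "sbound N (inv_fourier_fun fy) (cmod (1 / cor ((2 * pi) ^ 3)) * (fourier_const N * M))"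
 unfolding inv_fourier_fun_eq using assms
 by (intro sbound_cmult sbound_reflect sbound_fourier schwartz_reflect schwartz_fourier)

subsection \<open>Fourier inversion\<close>

text \<open>Up to normalization this is the characteristic function of the standard normal
  distribution.\<close>

lemma gauss_1d: "(LINT x|lborel. cis (- (x * t)) * cor (exp (- x\<^sup>2 / 2))) = cor (sqrt (2 * pi) * exp (- t\<^sup>2 / 2))"
 and gauss_1d_integrable: "integrable lborel (%x. cis (- (x * t)) * cor (exp (- x\<^sup>2 / 2)))"
proof -
 have i: "integrable lborel (%x. exp (- x\<^sup>2 / 2) :: real)"
 using integrable_mult_right[OF integrable_std_normal_moment[of 0], of "sqrt (2 * pi)"] by (simp add: std_normal_density_def)
 show "integrable lborel (%x. cis (- (x * t)) * cor (exp (- x\<^sup>2 / 2)))"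
 by (rule Bochner_Integration.integrable_bound[OF i]) (auto simp: norm_mult)
 have "cor (exp (- t\<^sup>2 / 2)) = char std_normal_distribution (- t)"
 by (simp add: char_std_normal_distribution)
 also have "... = (LINT x|lborel. std_normal_density x *R iexp (- t * x))"
 unfolding char_def by (subst integral_density) (auto simp: normal_density_nonneg)
 also have "... = (LINT x|lborel. (1 / sqrt (2 * pi)) *R (cis (- (x * t)) * cor (exp (- x\<^sup>2 / 2))))"
 by (intro Bochner_Integration.integral_cong)
 (auto simp: std_normal_density_def cis_conv_exp scaleR_conv_of_real mult_ac)
 also have "... = (1 / sqrt (2 * pi)) *R (LINT x|lborel. cis (- (x * t)) * cor (exp (- x\<^sup>2 / 2)))"
 by (rule integral_scaleR_right)
 finally show "(LINT x|lborel. cis (- (x * t)) * cor (exp (- x\<^sup>2 / 2))) = cor (sqrt (2 * pi) * exp (- t\<^sup>2 / 2))"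
 by (simp add: scaleR_conv_of_real field_simps)
qed

lemma cis_sum: "finite A ==> cis (\<Sum>i\<in>A. f i) = (\<Prod>i\<in>A. cis (f i))"
 by (induction A rule: finite_induct) (auto simp: cis_mult[symmetric])

lemma gauss_prod: "gauss (1/2) x = (\<Prod>i\<in>UNIV. cor (exp (- (x $ i)\<^sup>2 / 2)))"
 unfolding gauss_def power2_norm_eq_inner inner_vec_def of_real_prod[symmetric] exp_sum[OF finite, symmetric]
 by (simp add: sum_distrib_left sum_negf power2_eq_square sum_divide_distrib)

lemma fourier_gauss: "ff (gauss (1/2)) xi = cor (sqrt (2 * pi) ^ 3) * gauss (1/2) xi"
proof -
 have "ff (gauss (1/2)) xi = (LINT x|lborel. (\<Prod>i\<in>UNIV. cis (- (x $ i * xi $ i)) * cor (exp (- (x $ i)\<^sup>2 / 2))))"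
 unfolding fourier_fun_def gauss_prod prod.distrib cis_sum[OF finite, symmetric] inner_vec_def
 by (simp add: sum_negf)
 also have "... = (\<Prod>i\<in>UNIV. cor (sqrt (2 * pi) * exp (- (xi $ i)\<^sup>2 / 2)))"
 by (subst integral_prod_coords[where f="%i x. cis (- (x * xi $ i)) * cor (exp (- x\<^sup>2 / 2))"])
 (rule gauss_1d_integrable, simp only: gauss_1d)
 finally show ?thesis by (simp add: gauss_prod prod.distrib)
qed

lemma integrable_pair_dominated:
 fixes h :: "'a::euclidean_space \<times> 'b::euclidean_space => 'c::{banach, second_countable_topology}"
 assumes f: "integrable lborel f" and g: "integrable lborel g"
 and [measurable]: "h \<in> borel_measurable (lborel \<Otimes>\<^sub>M lborel)"
 and le: "!!x y. norm (h (x, y)) <= norm (f x :: 'd::{banach, second_countable_topology}) * norm (g y :: 'e::{banach, second_countable_topology})"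
 shows "integrable (lborel \<Otimes>\<^sub>M lborel) h"
 unfolding integrable_iff_bounded
proof
 have [measurable]: "f \<in> borel_measurable lborel" "g \<in> borel_measurable lborel" using f g by auto
 have "(\<integral>\<^sup>+ p. en (h p) \<partial>(lborel \<Otimes>\<^sub>M lborel)) <= (\<integral>\<^sup>+ p. en (f (fst p)) * en (g (snd p)) \<partial>(lborel \<Otimes>\<^sub>M lborel))"
 using le by (intro nn_integral_mono) (auto simp: ennreal_mult'[symmetric])
 also have "... = (\<integral>\<^sup>+ x. en (f x) \<partial>lborel) * (\<integral>\<^sup>+ y. en (g y) \<partial>lborel)"
 by (subst lborel.nn_integral_fst[symmetric]) (auto simp: nn_integral_cmult nn_integral_multc)
 also have "... < ic" using f g by (auto simp: integrable_iff_bounded ennreal_mult_less_top)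
 finally show "(\<integral>\<^sup>+ p. en (h p) \<partial>(lborel \<Otimes>\<^sub>M lborel)) < ic" .
qed fact

lemma fourier_gauss_scaled:
 assumes n: "n > 0"
 shows "(LINT xi|lborel. cis (- (z \<bullet> xi)) * gauss (1/2) ((1 / n) *R xi)) = cor (n ^ 3 * sqrt (2 * pi) ^ 3) * gauss (1/2) (n *R z)"
proof -
 have "(LINT xi|lborel. cis (- (z \<bullet> xi)) * gauss (1/2) ((1 / n) *R xi)) =
 (\<bar>n\<bar> ^ DIM(real^3)) *R (LINT xi|lborel. cis (- (z \<bullet> (0 + n *R xi))) * gauss (1/2) ((1 / n) *R (0 + n *R xi)))"
 using n by (intro integral_affine) simp
 also have "... = n ^ 3 *R ff (gauss (1/2)) (n *R z)"
 using n by (simp add: fourier_fun_def inner_commute)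
 finally show ?thesis by (simp add: fourier_gauss scaleR_conv_of_real)
qed

lemma gauss_continuous: "continuous_on UNIV (gauss a)"
 unfolding gauss_def[abs_def] by (intro continuous_intros)

lemma gauss_measurable [measurable]: "gauss a \<in> BM"
 by (rule borel_measurable_continuous_onI[OF gauss_continuous])

lemma gauss_norm_le_1: "a >= 0 ==> cmod (gauss a x) <= 1"
 by (simp add: gauss_def)

lemma gauss_tendsto_scaled: "(%n. gauss a ((1 / real (Suc n)) *R x)) -+> 1"
proof -
 have "(%n. (1 / real (Suc n)) *R x) -+> 0 *R x"
 by (intro tendsto_intros LIMSEQ_inverse_real_of_nat[unfolded inverse_eq_divide])
 then have "(%n. gauss a ((1 / real (Suc n)) *R x)) -+> gauss a 0"
 using gauss_continuous[of a] by (intro isCont_tendsto_compose[of _ "gauss a"]) (auto simp: continuous_on_eq_continuous_at)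
 then show ?thesis by (simp add: gauss_def)
qed

text \<open>A wide Gaussian is inserted into the inversion integral, and the result
  \<open>A n\<close> is computed twice. Dominated convergence gives the inversion integral; Fubini
  and the transform of the Gaussian give a Gaussian average of \<open>fy\<close> over distance
  1/(n+1) around \<open>x\<close>. The constants agree because (2 pi)^(3/2) occurs twice.\<close>

theorem fourier_inversion:
 assumes s: "schwartz fy"
 shows "inv_fourier_fun (ff fy) = fy"
proof
 fix x
 define A where "A n = (LINT xi|lborel. cis (x \<bullet> xi) * ff fy xi * gauss (1/2) ((1 / real (Suc n)) *R xi))" for n
 have m[measurable]: "fy \<in> BM" "ff fy \<in> BM"
 using s schwartz_fourier schwartz_measurable by auto
 have gi: "integrable lborel (gauss (1/2))" by (intro schwartz_integrable schwartz_gauss) simp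
 have "A -+> (LINT xi|lborel. cis (x \<bullet> xi) * ff fy xi * 1)"
 unfolding A_def[abs_def]
 proof (rule integral_dominated_convergence[where w="%xi. cmod (ff fy xi)"])
 show "AL xi. (%n. cis (x \<bullet> xi) * ff fy xi * gauss (1/2) ((1 / real (Suc n)) *R xi)) -+> cis (x \<bullet> xi) * ff fy xi * 1"
 by (intro always_eventually allI tendsto_intros gauss_tendsto_scaled)
 show "AL xi. norm (cis (x \<bullet> xi) * ff fy xi * gauss (1/2) ((1 / real (Suc n)) *R xi)) <= cmod (ff fy xi)" for n
 using gauss_norm_le_1[of "1/2"] by (auto simp: norm_mult intro!: mult_left_le)
 show "integrable lborel (%xi. cmod (ff fy xi))"
 using s by (intro integrable_norm schwartz_integrable schwartz_fourier)
 qed auto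
 then have lim1: "A -+> cor ((2 * pi) ^ 3) * inv_fourier_fun (ff fy) x"
 by (simp add: inv_fourier_fun_def)
 have A2: "A n = cor (sqrt (2 * pi) ^ 3) * (LINT z|lborel. fy (x + (1 / real (Suc n)) *R z) * gauss (1/2) z)" for n
 proof -
 let ?n = "real (Suc n)"
 let ?h = "%(xi, y). cis (- ((y - x) \<bullet> xi)) * fy y * gauss (1/2) ((1 / ?n) *R xi)"
 have gs: "integrable lborel (%xi. gauss (1/2) ((1 / ?n) *R xi))"
 using integrable_affine_iff[of "1 / ?n" "gauss (1/2)" 0] gi by simp
 have int: "integrable (lborel \<Otimes>\<^sub>M lborel) ?h"
 by (rule integrable_pair_dominated[OF gs schwartz_integrable[OF s]]) (auto simp: norm_mult)
 have "A n = (LINT xi|lborel. LINT y|lborel. ?h (xi, y))"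
 unfolding A_def
 proof (rule Bochner_Integration.integral_cong[OF refl])
 fix xi
 have "cis (x \<bullet> xi) * ff fy xi * gauss (1/2) ((1 / ?n) *R xi) = (LINT y|lborel. cis (x \<bullet> xi) * (cis (- (y \<bullet> xi)) * fy y) * gauss (1/2) ((1 / ?n) *R xi))"
 unfolding fourier_fun_def by (simp only: integral_mult_right_zero integral_mult_left_zero)
 also have "... = (LINT y|lborel. ?h (xi, y))"
 by (simp add: mult.assoc[symmetric] cis_mult inner_diff_left)
 finally show "cis (x \<bullet> xi) * ff fy xi * gauss (1/2) ((1 / ?n) *R xi) = (LINT y|lborel. ?h (xi, y))" .
 qed
 also have "... = (LINT y|lborel. LINT xi|lborel. ?h (xi, y))"
 using lborel_pair.Fubini_integral[of "%xi y. ?h (xi, y)"] int by simp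
 also have "... = (LINT y|lborel. fy y * (LINT xi|lborel. cis (- ((y - x) \<bullet> xi)) * gauss (1/2) ((1 / ?n) *R xi)))"
 by (simp add: mult_ac flip: integral_mult_right_zero)
 also have "... = (LINT y|lborel. fy y * (cor (?n ^ 3 * sqrt (2 * pi) ^ 3) * gauss (1/2) (?n *R (y - x))))"
 by (subst fourier_gauss_scaled) auto
 also have "... = (\<bar>1 / ?n\<bar> ^ DIM(real^3)) *R (LINT z|lborel. fy (x + (1 / ?n) *R z) * (cor (?n ^ 3 * sqrt (2 * pi) ^ 3) * gauss (1/2) (?n *R ((x + (1 / ?n) *R z) - x))))"
 by (rule integral_affine) simp
 also have "... = (\<bar>1 / ?n\<bar> ^ DIM(real^3)) *R (LINT z|lborel. cor (?n ^ 3 * sqrt (2 * pi) ^ 3) * (fy (x + (1 / ?n) *R z) * gauss (1/2) z))"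
 by (simp add: mult_ac del: of_nat_Suc)
 also have "... = cor ((1 / ?n) ^ 3 * (?n ^ 3 * sqrt (2 * pi) ^ 3)) * (LINT z|lborel. fy (x + (1 / ?n) *R z) * gauss (1/2) z)"
 unfolding integral_mult_right_zero by (simp add: scaleR_conv_of_real mult_ac del: of_nat_Suc)
 also have "(1 / ?n) ^ 3 * (?n ^ 3 * sqrt (2 * pi) ^ 3) = sqrt (2 * pi) ^ 3"
 by (simp add: power_one_over del: of_nat_Suc)
 finally show ?thesis .
 qed
 obtain D where D: "!!y. cmod (fy y) <= D" using schwartz_bound[OF s, of 0] by auto
 have "(%n. LINT z|lborel. fy (x + (1 / real (Suc n)) *R z) * gauss (1/2) z) -+> (LINT z|lborel. fy x * gauss (1/2) z)"
 proof (rule integral_dominated_convergence[where w="%z. D * cmod (gauss (1/2) z)"])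
 show "AL z. (%n. fy (x + (1 / real (Suc n)) *R z) * gauss (1/2) z) -+> fy x * gauss (1/2) z"
 proof (intro always_eventually allI tendsto_mult tendsto_const)
 fix z
 have "(%n. x + (1 / real (Suc n)) *R z) -+> x + 0 *R z"
 by (intro tendsto_intros LIMSEQ_inverse_real_of_nat[unfolded inverse_eq_divide])
 then show "(%n. fy (x + (1 / real (Suc n)) *R z)) -+> fy x"
 using schwartz_continuous[OF s]
 by (intro isCont_tendsto_compose[of _ fy]) (auto simp: continuous_on_eq_continuous_at)
 qed
 show "AL z. norm (fy (x + (1 / real (Suc n)) *R z) * gauss (1/2) z) <= D * cmod (gauss (1/2) z)" for n
 using D by (auto simp: norm_mult intro!: mult_right_mono)
 show "integrable lborel (%z. D * cmod (gauss (1/2) z))" using gi by auto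
 qed auto
 then have "A -+> cor (sqrt (2 * pi) ^ 3) * (LINT z|lborel. fy x * gauss (1/2) z)"
 unfolding A2[abs_def] by (intro tendsto_mult_left)
 moreover have "cor (sqrt (2 * pi) ^ 3) * (LINT z|lborel. fy x * gauss (1/2) z) = cor ((2 * pi) ^ 3) * fy x"
 proof -
 have g0: "gauss (1/2) 0 = 1" by (simp add: gauss_def)
 have "(LINT z|lborel. fy x * gauss (1/2) z) = fy x * ff (gauss (1/2)) 0"
 by (simp add: fourier_fun_def)
 also have "... = fy x * cor (sqrt (2 * pi) ^ 3)"
 unfolding fourier_gauss g0 by simp
 finally have "cor (sqrt (2 * pi) ^ 3) * (LINT z|lborel. fy x * gauss (1/2) z) = cor (sqrt (2 * pi) ^ 3 * sqrt (2 * pi) ^ 3) * fy x"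
 by (simp only: of_real_mult mult_ac)
 also have "sqrt (2 * pi) ^ 3 * sqrt (2 * pi) ^ 3 = (2 * pi) ^ 3"
 unfolding power_mult_distrib[symmetric] by simp
 finally show ?thesis .
 qed
 ultimately have "A -+> cor ((2 * pi) ^ 3) * fy x" by (simp only:)
 with lim1 have "cor ((2 * pi) ^ 3) * inv_fourier_fun (ff fy) x = cor ((2 * pi) ^ 3) * fy x"
 by (rule LIMSEQ_unique)
 then show "inv_fourier_fun (ff fy) x = fy x" by simp
qed

lemma fourier_fun_reflect: "ff (%x. fy (- x)) xi = ff fy (- xi)"
 using integral_reflect[of "%x. cis (x \<bullet> xi) * fy x" 0]
 unfolding fourier_fun_def by simp

lemma fourier_fun_cmult: "ff (%x. c * fy x) xi = c * ff fy xi"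
 unfolding fourier_fun_def by (simp add: mult_ac flip: integral_mult_right_zero)

text \<open>The inverse transform is a multiple of the reflected transform, so the other order of
  composition is inversion for the reflected function.\<close>

theorem fourier_inversion':
 assumes s: "schwartz fy"
 shows "ff (inv_fourier_fun fy) = fy"
proof
 fix x
 have "ff (inv_fourier_fun fy) x = (1 / cor ((2 * pi) ^ 3)) * ff (%y. ff (%z. fy (- z)) y) x"
 unfolding inv_fourier_fun_eq fourier_fun_cmult by (simp add: fourier_fun_reflect)
 also have "... = inv_fourier_fun (ff (%z. fy (- z))) (- x)"
 by (simp add: inv_fourier_fun_eq)
 also have "... = fy x"
 by (subst fourier_inversion[OF schwartz_reflect[OF s]]) simp
 finally show "ff (inv_fourier_fun fy) x = fy x" .
qed

lemma fourier_fun_add: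
 "integrable lborel fy ==> integrable lborel \<psi> ==> ff (%x. fy x + \<psi> x) = (%xi. ff fy xi + ff \<psi> xi)"
 unfolding fourier_fun_def by (simp add: distrib_left fourier_fun_integrable)

section \<open>Tempered distributions given by functions\<close>

lemma pairing_nonschwartz: "\<not> schwartz fy ==> pairing T fy = 0"
 using pairing[of T] by (auto simp: is_tempered_def)

lemma pairing_add: "schwartz fy ==> schwartz \<psi> ==> pairing T (%x. fy x + \<psi> x) = pairing T fy + pairing T \<psi>"
 using pairing[of T] by (auto simp: is_tempered_def)

lemma pairing_cmult: "schwartz fy ==> pairing T (%x. c * fy x) = c * pairing T fy"
 using pairing[of T] by (auto simp: is_tempered_def)

lemma pairing_bound: "\<exists>N C. \<forall>fy M. schwartz fy --> sbound N fy M --> cmod (pairing T fy) <= C * M"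
 using pairing[of T] unfolding is_tempered_def sbound_def by blast

lemma is_temperedI:
 assumes "!!fy. \<not> schwartz fy ==> T fy = 0"
 and "!!fy \<psi>. schwartz fy ==> schwartz \<psi> ==> T (%x. fy x + \<psi> x) = T fy + T \<psi>"
 and "!!c fy. schwartz fy ==> T (%x. c * fy x) = c * T fy"
 and "!!fy M. schwartz fy ==> sbound N fy M ==> cmod (T fy) <= C * M"
 shows "is_tempered T"
 unfolding is_tempered_def using assms(1-3) assms(4)[unfolded sbound_def]
 by (intro conjI exI[of _ N] exI[of _ C]) auto

lemma tempered_eqI: "(!!fy. schwartz fy ==> pairing S fy = pairing T fy) ==> S = T"
proof (rule pairing_inject[THEN iffD1], rule ext)
 fix fy assume "!!fy. schwartz fy ==> pairing S fy = pairing T fy"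
 then show "pairing S fy = pairing T fy" by (cases "schwartz fy") (auto simp: pairing_nonschwartz)
qed

lemma pairing_zero [simp]: "pairing 0 fy = 0"
 by (simp add: zero_tempered.rep_eq)

lemma pairing_plus [simp]: "pairing (S + T) fy = pairing S fy + pairing T fy"
 by (simp add: plus_tempered.rep_eq)

lemma pairing_uminus [simp]: "pairing (- T) fy = - pairing T fy"
 by (simp add: uminus_tempered.rep_eq)

lemma pairing_minus [simp]: "pairing (S - T) fy = pairing S fy - pairing T fy"
 unfolding minus_tempered_def pairing_plus pairing_uminus by simp

text \<open>The transpose of a continuous linear map of the Schwartz space acts on tempered
  distributions. Derivative, Fourier transform and its inverse are instances.\<close>

lemma is_tempered_precompose:
 assumes s: "!!fy. schwartz fy ==> schwartz (L fy)"
 and a: "!!fy \<psi>. schwartz fy ==> schwartz \<psi> ==> L (%x. fy x + \<psi> x) = (%x. L fy x + L \<psi> x)"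
 and c: "!!c fy. schwartz fy ==> L (%x. c * fy x) = (%x. c * L fy x)"
 and b: "!!N fy M. schwartz fy ==> sbound (N' N) fy M ==> sbound N (L fy) (A N * M)"
 shows "is_tempered (%fy. if schwartz fy then pairing T (L fy) else 0)"
proof -
 obtain N C where NC: "!!fy M. schwartz fy ==> sbound N fy M ==> cmod (pairing T fy) <= C * M"
 using pairing_bound[of T] by blast
 show ?thesis
 proof (rule is_temperedI)
 fix fy M assume "schwartz fy" "sbound (N' N) fy M"
 then show "cmod (if schwartz fy then pairing T (L fy) else 0) <= C * A N * M"
 using NC[of "L fy" "A N * M"] s b by (simp add: mult.assoc)
 qed (auto simp: s a c pairing_add pairing_cmult schwartz_add schwartz_cmult)
qed

lemma pairing_tderiv:
 assumes "schwartz fy"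
 shows "pairing (tderiv i T) fy = - pairing T (pf i fy)"
proof -
 have "is_tempered (%fy. if schwartz fy then pairing T (pf i fy) else 0)"
 by (rule is_tempered_precompose[where N'=Suc and A="%_. 1"])
 (auto simp: schwartz_pderiv pderiv_fun_add pderiv_fun_cmult schwartz_differentiable sbound_pderiv)
 then have "is_tempered (%fy. - (if schwartz fy then pairing T (pf i fy) else 0))"
 by (rule is_tempered_uminus)
 moreover have "(%fy. - (if schwartz fy then pairing T (pf i fy) else 0)) = (%fy. if schwartz fy then - pairing T (pf i fy) else 0)"
 by auto
 ultimately show ?thesis
 using assms unfolding tderiv_def by (simp add: Abs_tempered_inverse)
qed

lemma pairing_fourier:
 assumes "schwartz fy"
 shows "pairing (fourier T) fy = pairing T (ff fy)"
proof -
 have "is_tempered (%fy. if schwartz fy then pairing T (ff fy) else 0)"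
 by (rule is_tempered_precompose[where N'="%N. 6 + 2 * N" and A=fourier_const])
 (auto simp: schwartz_fourier fourier_fun_add fourier_fun_cmult schwartz_integrable sbound_fourier)
 then show ?thesis
 using assms unfolding fourier_def by (simp add: Abs_tempered_inverse)
qed

lemma inv_fourier_fun_add:
 "integrable lborel fy ==> integrable lborel \<psi> ==> inv_fourier_fun (%x. fy x + \<psi> x) = (%x. inv_fourier_fun fy x + inv_fourier_fun \<psi> x)"
 unfolding inv_fourier_fun_eq by (simp add: fourier_fun_add add_divide_distrib)

lemma inv_fourier_fun_cmult: "inv_fourier_fun (%x. c * fy x) = (%x. c * inv_fourier_fun fy x)"
 unfolding inv_fourier_fun_eq by (simp add: fourier_fun_cmult)

lemma pairing_inv_fourier:
 assumes "schwartz fy"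
 shows "pairing (inv_fourier T) fy = pairing T (inv_fourier_fun fy)"
proof -
 have "is_tempered (%fy. if schwartz fy then pairing T (inv_fourier_fun fy) else 0)"
 proof (rule is_tempered_precompose[where N'="%N. 6 + 2 * N" and A="%N. cmod (1 / cor ((2 * pi) ^ 3)) * fourier_const N"])
 fix N fy M assume "schwartz fy" "sbound (6 + 2 * N) fy M"
 from sbound_inv_fourier[OF this] show "sbound N (inv_fourier_fun fy) (cmod (1 / cor ((2 * pi) ^ 3)) * fourier_const N * M)"
 by (simp only: mult.assoc)
 qed (auto simp: schwartz_inv_fourier inv_fourier_fun_add inv_fourier_fun_cmult schwartz_integrable)
 then show ?thesis
 using assms unfolding inv_fourier_def by (simp add: Abs_tempered_inverse)
qed

lemma fourier_inv_fourier [simp]: "fourier (inv_fourier T) = T"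
 by (rule tempered_eqI) (simp add: pairing_fourier pairing_inv_fourier schwartz_fourier fourier_inversion)

lemma inv_fourier_fourier [simp]: "inv_fourier (fourier T) = T"
 by (rule tempered_eqI) (simp add: pairing_fourier pairing_inv_fourier schwartz_inv_fourier fourier_inversion')

lemma pairing_via_fourier: "schwartz fy ==> pairing T fy = pairing (fourier T) (inv_fourier_fun fy)"
 by (simp add: pairing_fourier schwartz_inv_fourier fourier_inversion')

lemma fourier_plus: "fourier (S + T) = fourier S + fourier T"
 by (rule tempered_eqI) (simp add: pairing_fourier)

lemma fourier_minus: "fourier (S - T) = fourier S - fourier T"
 by (rule tempered_eqI) (simp add: pairing_fourier)

lemma fourier_zero: "fourier 0 = 0"
 by (rule tempered_eqI) (simp add: pairing_fourier)

text \<open>Integrability against some inverse polynomial weight: a criterion under which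
  \<open>dist_of h\<close> is tempered, stable under sums and under factors of polynomial
  growth.\<close>

definition tfun :: "(real^3 => complex) => bool" where
 "tfun h \<longleftrightarrow> h \<in> BM & (\<exists>N. (NN x. er (cmod (h x) / (1 + norm x) ^ N)) < ic)"

lemma sbound_poly:
 assumes "sbound N fy M"
 shows "(1 + norm x) ^ N * cmod (fy x) <= 2 ^ N * 2 * M"
proof -
 have "(1 + norm x) ^ N <= (2 * max 1 (norm x)) ^ N" by (intro power_mono) auto
 also have "... <= 2 ^ N * (1 + norm x ^ N)" unfolding power_mult_distrib
 by (intro mult_left_mono) (auto simp: max_def)
 finally have "(1 + norm x) ^ N * cmod (fy x) <= 2 ^ N * (1 + norm x ^ N) * cmod (fy x)" by (rule mult_right_mono) simp
 also have "... = 2 ^ N * (norm x ^ 0 * cmod (fy x) + norm x ^ N * cmod (fy x))" by (simp add: algebra_simps)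
 also have "... <= 2 ^ N * (M + M)" by (intro mult_left_mono add_mono sboundD0[OF assms]) auto
 finally show ?thesis by simp
qed

lemma tfun_pairing_bound:
 assumes h: "h \<in> BM" and N: "(NN x. er (cmod (h x) / (1 + norm x) ^ N)) < ic"
 and s: "schwartz fy" and b: "sbound N fy M"
 shows "integrable lborel (%x. h x * fy x)"
 and "cmod (LINT x|lborel. h x * fy x) <= 2 ^ N * 2 * enn2real (NN x. er (cmod (h x) / (1 + norm x) ^ N)) * M"
proof -
 note [measurable] = h schwartz_measurable[OF s]
 have M: "0 <= M" by (rule sbound_nonneg[OF b])
 have le: "cmod (h x * fy x) <= (2 ^ N * 2 * M) * (cmod (h x) / (1 + norm x) ^ N)" for x
 proof -
 have p: "0 < (1 + norm x) ^ N" by (intro zero_less_power) (auto intro: add_pos_nonneg)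
 have "cmod (h x * fy x) = (cmod (h x) / (1 + norm x) ^ N) * ((1 + norm x) ^ N * cmod (fy x))"
 using less_imp_neq[OF p] by (simp add: norm_mult del: power_eq_0_iff)
 also have "... <= (cmod (h x) / (1 + norm x) ^ N) * (2 ^ N * 2 * M)"
 using p by (intro mult_left_mono sbound_poly[OF b]) auto
 also have "... = (2 ^ N * 2 * M) * (cmod (h x) / (1 + norm x) ^ N)" by (rule mult.commute)
 finally show ?thesis .
 qed
 have "(NN x. er (cmod (h x * fy x))) <= (NN x. er (2 ^ N * 2 * M) * er (cmod (h x) / (1 + norm x) ^ N))"
 proof (rule nn_integral_mono)
 fix x
 show "er (cmod (h x * fy x)) <= er (2 ^ N * 2 * M) * er (cmod (h x) / (1 + norm x) ^ N)"
 using M le[of x] by (subst ennreal_mult'[symmetric]) (auto intro!: ennreal_leI simp del: times_divide_eq_right)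
 qed
 also have "... = er (2 ^ N * 2 * M) * (NN x. er (cmod (h x) / (1 + norm x) ^ N))"
 by (rule nn_integral_cmult) measurable
 finally have 1: "(NN x. er (cmod (h x * fy x))) <= er (2 ^ N * 2 * M) * (NN x. er (cmod (h x) / (1 + norm x) ^ N))" .
 also have 2: "... < ic" using N by (simp add: ennreal_mult_less_top)
 finally show i: "integrable lborel (%x. h x * fy x)" by (simp add: integrable_iff_bounded)
 have "er (cmod (LINT x|lborel. h x * fy x)) <= (NN x. er (cmod (h x * fy x)))"
 by (rule integral_norm_bound_ennreal[OF i])
 also note 1
 finally have "er (cmod (LINT x|lborel. h x * fy x)) <= er (2 ^ N * 2 * M) * (NN x. er (cmod (h x) / (1 + norm x) ^ N))" .
 from enn2real_mono[OF this] 2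
 show "cmod (LINT x|lborel. h x * fy x) <= 2 ^ N * 2 * enn2real (NN x. er (cmod (h x) / (1 + norm x) ^ N)) * M"
 using M by (simp add: enn2real_mult mult_ac)
qed

lemma tfun_integrable: "tfun h ==> schwartz fy ==> integrable lborel (%x. h x * fy x)"
proof -
 assume h: "tfun h" and s: "schwartz fy"
 obtain N where "(NN x. er (cmod (h x) / (1 + norm x) ^ N)) < ic"
 using h by (auto simp: tfun_def)
 moreover obtain M where "sbound N fy M" using schwartz_sbound[OF s] by blast
 ultimately show ?thesis using h s by (intro tfun_pairing_bound(1)) (auto simp: tfun_def)
qed

lemma tfun_measurable: "tfun h ==> h \<in> BM"
 by (simp add: tfun_def)

lemma pairing_dist_of:
 assumes h: "tfun h" and s: "schwartz fy"
 shows "pairing (dist_of h) fy = (LINT x|lborel. h x * fy x)"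
proof -
 obtain N where N: "(NN x. er (cmod (h x) / (1 + norm x) ^ N)) < ic"
 using h by (auto simp: tfun_def)
 have "is_tempered (%fy. if schwartz fy then LINT x|lborel. h x * fy x else 0)"
 proof (rule is_temperedI)
 fix fy M assume "schwartz fy" "sbound N fy M"
 then show "cmod (if schwartz fy then LINT x|lborel. h x * fy x else 0) <= 2 ^ N * 2 * enn2real (NN x. er (cmod (h x) / (1 + norm x) ^ N)) * M"
 using tfun_pairing_bound(2)[OF tfun_measurable[OF h] N] by simp
 next
 fix fy c assume "schwartz fy"
 then show "(if schwartz (%x. c * fy x) then LINT x|lborel. h x * (c * fy x) else 0) = c * (if schwartz fy then LINT x|lborel. h x * fy x else 0)"
 by (simp add: schwartz_cmult mult.left_commute[of _ c])
 qed (auto simp: distrib_left tfun_integrable[OF h] schwartz_add)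
 then show ?thesis using s by (simp add: dist_of_def Abs_tempered_inverse)
qed

lemma represents_dist_of: "tfun h ==> represents h (dist_of h)"
 by (simp add: represents_def tfun_integrable pairing_dist_of)

text \<open>Measurability is hidden in the integrability of \<open>h\<close> times the Gaussian,
  which vanishes nowhere and can be divided out.\<close>

lemma represents_measurable:
 assumes "represents h T"
 shows "h \<in> BM"
proof -
 have "integrable lborel (%x. h x * gauss 1 x)" using assms schwartz_gauss[of 1] by (simp add: represents_def)
 then have [measurable]: "(%x. h x * gauss 1 x) \<in> BM" by (auto dest: borel_measurable_integrable)
 have "(%x. h x * gauss 1 x / gauss 1 x) \<in> BM" by measurable
 then show ?thesis by (simp add: gauss_def)
qed

lemma represents_inj: "represents h S ==> represents h T ==> S = T"
 by (rule tempered_eqI) (simp add: represents_def)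

lemma represents_cong_AE:
 assumes r: "represents h T" and m: "h' \<in> BM" and ae: "AL x. h x = h' x"
 shows "represents h' T"
 unfolding represents_def
proof (intro allI impI)
 fix fy assume s: "schwartz fy"
 note [measurable] = m represents_measurable[OF r] schwartz_measurable[OF s]
 have i: "integrable lborel (%x. h x * fy x)" and p: "pairing T fy = (LINT x|lborel. h x * fy x)"
 using r s by (auto simp: represents_def)
 have ae': "AL x. h x * fy x = h' x * fy x" using ae by eventually_elim simp
 have "integrable lborel (%x. h' x * fy x)"
 using i by (rule Bochner_Integration.integrable_cong_AE_imp) (use ae' in \<open>auto elim: eventually_mono\<close>)
 moreover have "(LINT x|lborel. h x * fy x) = (LINT x|lborel. h' x * fy x)"
 by (rule integral_cong_AE) (use ae' in auto)
 ultimately show "integrable lborel (%x. h' x * fy x) & pairing T fy = (LINT x|lborel. h' x * fy x)"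
 using p by simp
qed

lemma represents_zero: "represents (%_. 0) 0"
 by (simp add: represents_def)

lemma represents_add: "represents h S ==> represents k T ==> represents (%x. h x + k x) (S + T)"
 by (simp add: represents_def distrib_right)

lemma represents_diff: "represents h S ==> represents k T ==> represents (%x. h x - k x) (S - T)"
 by (simp add: represents_def left_diff_distrib)

subsection \<open>A distribution determines its function almost everywhere\<close>

text \<open>The positive and the negative part are densities of two measures that agree on boxes, an
  intersection-stable generator, so the densities coincide almost everywhere.\<close>

lemma integral_boxes_zero_imp_AE_zero:
 fixes f :: "'a::euclidean_space => real"
 assumes f: "integrable lborel f"
 and z: "!!l u. (LINT x|lborel. ind (box l u) x * f x) = 0"
 shows "AL x. f x = 0"
proof -
 have [measurable]: "f \<in> BM" using f by (auto dest: borel_measurable_integrable)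
 let ?p = "%x. er (f x)" and ?n = "%x. er (- f x)"
 have box: "(NN x. ?p x * ind (box l u) x) = (NN x. ?n x * ind (box l u) x) &
 (NN x. ?p x * ind (box l u) x) < ic" for l u
 proof -
 let ?g = "%x. ind (box l u) x * f x"
 have gi: "integrable lborel ?g" using integrable_mult_indicator[OF _ f, of "box l u"] by simp
 have e: "(NN x. ?p x * ind (box l u) x) = (NN x. er (?g x))"
 "(NN x. ?n x * ind (box l u) x) = (NN x. er (- ?g x))"
 by (auto intro!: nn_integral_cong simp: indicator_def)
 have f1: "(NN x. er (?g x)) < ic" "(NN x. er (- ?g x)) < ic"
 using gi by (auto simp: real_integrable_def less_top)
 have "enn2real (NN x. er (?g x)) = enn2real (NN x. er (- ?g x))"
 using real_lebesgue_integral_def[OF gi] z[of l u] by simp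
 then show ?thesis unfolding e using f1 by (metis ennreal_enn2real infinity_ennreal_def)
 qed
 have "density lborel ?p = density lborel ?n"
 proof (rule measure_eqI_generator_eq[where \<Omega>=UNIV and E="range (%(l, u). box l u)" and A="%n. box (- (real n *R One)) (real n *R One)"])
 show "Int_stable (range (%(l, u). box l (u::'a)))"
 by (auto simp: Int_stable_def box_Int_box)
 show "sets (density lborel ?p) = sigma_sets UNIV (range (%(l, u). box l u))"
 "sets (density lborel ?n) = sigma_sets UNIV (range (%(l, u). box l u))"
 by (simp_all add: borel_eq_box)
 show "(\<Union>i. box (- (real i *R One)) (real i *R (One::'a))) = UNIV"
 unfolding UN_box_eq_UNIV ..
 show "emeasure (density lborel ?p) X = emeasure (density lborel ?n) X" if "X \<in> range (%(l, u). box l u)" for X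
 using that box by (auto simp: emeasure_density)
 show "emeasure (density lborel ?p) (box (- (real i *R One)) (real i *R One)) ~= ic" for i
 using box[of "- (real i *R One)" "real i *R One"] by (auto simp: emeasure_density)
 qed auto
 then have "AL x. ?p x = ?n x"
 by (intro sigma_finite_measure.density_unique[OF lborel.sigma_finite_measure_axioms]) auto
 then show ?thesis
 proof eventually_elim
 case (elim x)
 then show ?case by (cases "f x" "0::real" rule: linorder_cases) (auto simp: ennreal_neg ennreal_eq_0_iff)
 qed
qed

text \<open>Completing the square. A fixed Gaussian times a translated one is thereby a multiple of
  a translated Gaussian, hence an admissible test function.\<close>

lemma gauss_prod_translate:
 assumes a: "a > 0"
 shows "gauss 1 y * gauss a (y - c) = gauss (1 + a) (y - (a / (1 + a)) *R c) * cor (exp (- (a / (1 + a)) * (norm c)\<^sup>2))"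
proof -
 have e: "1 * (norm y)\<^sup>2 + a * (norm (y - c))\<^sup>2 = (1 + a) * (norm (y - (a / (1 + a)) *R c))\<^sup>2 + (a / (1 + a)) * (norm c)\<^sup>2"
 using a unfolding power2_norm_eq_inner
 by (simp add: inner_diff_left inner_diff_right inner_commute divide_simps) (simp add: algebra_simps)
 show ?thesis
 unfolding gauss_def of_real_mult[symmetric] exp_add[symmetric] using e by (simp add: algebra_simps)
qed

text \<open>As \<open>h\<close> need not be integrable, it is replaced by the integrable
  \<open>f\<close>, its product with a Gaussian. Testing with narrow Gaussians at all centres
  \<open>c\<close> and averaging \<open>c\<close> over a box shows that \<open>f\<close> is
  orthogonal to mollified indicators of boxes, and in the limit to the indicators.\<close>

lemma integral_schwartz_zero_imp_AE_zero:
 assumes i: "!!fy. schwartz fy ==> integrable lborel (%x. h x * fy x)"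
 and z: "!!fy. schwartz fy ==> (LINT x|lborel. h x * fy x) = 0"
 shows "AL x. h x = 0"
proof -
 define f where "f x = h x * gauss 1 x" for x
 have fi: "integrable lborel f" unfolding f_def[abs_def] by (intro i schwartz_gauss) simp
 have [measurable]: "f \<in> BM" using fi by (auto dest: borel_measurable_integrable)
 let ?g = "gauss (1/2)"
 have gi: "integrable lborel ?g" by (intro schwartz_integrable schwartz_gauss) simp
 have fz: "(LINT y|lborel. f y * ?g (real (Suc n) *R (y - c))) = 0" for n c
 proof -
 let ?a = "(real (Suc n))\<^sup>2 / 2"
 have a: "?a > 0" by simp
 have "(LINT y|lborel. f y * ?g (real (Suc n) *R (y - c))) = (LINT y|lborel. h y * (gauss 1 y * gauss ?a (y - c)))"
 by (rule Bochner_Integration.integral_cong) (auto simp: f_def gauss_def power_mult_distrib simp del: of_nat_Suc)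
 also have "... = 0"
 proof (rule z)
 have "schwartz (%y. cor (exp (- (?a / (1 + ?a)) * (norm c)\<^sup>2)) * gauss (1 + ?a) (- ((?a / (1 + ?a)) *R c) + y))"
 using a by (intro schwartz_cmult schwartz_translate schwartz_gauss) (auto intro: add_pos_pos)
 then show "schwartz (%y. gauss 1 y * gauss ?a (y - c))"
 unfolding gauss_prod_translate[OF a] by (simp add: mult.commute)
 qed
 finally show ?thesis .
 qed
 have boxc: "(LINT y|lborel. ind (box l u) y *R f y) = 0" for l u :: "real^3"
 proof -
 let ?I = "%x. ind (box l u) x :: real"
 have Ii: "integrable lborel ?I" by (intro integrable_real_indicator) (auto simp: emeasure_lborel_box_eq)
 \<comment> \<open>The substitution c = y - z/(n+1) turns the average over centres into the
   mollified indicator of the box.\<close>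
 have w0: "(LINT y|lborel. f y * (LINT z|lborel. ?I (y - (1 / real (Suc n)) *R z) *R ?g z)) = 0" for n
 proof -
 let ?n = "real (Suc n)"
 have sc: "(LINT z|lborel. ?I (y - (1 / ?n) *R z) *R ?g z) = ?n ^ 3 *R (LINT c|lborel. ?I c *R ?g (?n *R (y - c)))" for y
 proof -
 have "(LINT z|lborel. ?I (y - (1 / ?n) *R z) *R ?g z) =
 (\<bar>- ?n\<bar> ^ DIM(real^3)) *R (LINT c|lborel. ?I (y - (1 / ?n) *R (?n *R y + (- ?n) *R c)) *R ?g (?n *R y + (- ?n) *R c))"
 by (rule integral_affine) simp
 then show ?thesis by (simp add: scaleR_right_diff_distrib del: of_nat_Suc)
 qed
 have int: "integrable (lborel \<Otimes>\<^sub>M lborel) (%(y, c). f y * (?I c *R ?g (?n *R (y - c))))"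
 by (rule integrable_pair_dominated[OF fi Ii])
 (use gauss_norm_le_1[of "1/2"] in \<open>auto simp: norm_mult indicator_def mult_left_le\<close>)
 have "(LINT y|lborel. f y * (LINT c|lborel. ?I c *R ?g (?n *R (y - c)))) = (LINT y|lborel. LINT c|lborel. f y * (?I c *R ?g (?n *R (y - c))))"
 by (simp only: integral_mult_right_zero)
 also have "... = (LINT c|lborel. LINT y|lborel. f y * (?I c *R ?g (?n *R (y - c))))"
 using lborel_pair.Fubini_integral[of "%y c. f y * (?I c *R ?g (?n *R (y - c)))"] int by simp
 also have "... = (LINT c|lborel. ?I c *R (LINT y|lborel. f y * ?g (?n *R (y - c))))"
 by (simp flip: integral_scaleR_right)
 also have "... = 0" by (simp only: fz) simp
 finally show ?thesis unfolding sc by simp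
 qed
 have "(%n. LINT y|lborel. f y * (LINT z|lborel. ?I (y - (1 / real (Suc n)) *R z) *R ?g z)) -+> (LINT y|lborel. f y * (LINT z|lborel. ?I y *R ?g z))"
 proof (rule integral_dominated_convergence[where w="%y. cmod (f y) * (LINT z|lborel. cmod (?g z))"])
 \<comment> \<open>The mollified indicators converge off the boundary of the box, which is a null
   set.\<close>
 have null: "AL y. y \<notin> cbox l u - box l u"
 proof (rule AE_not_in)
 have "emeasure lborel (cbox l u - box l u) = emeasure lborel (cbox l u) - emeasure lborel (box l u)"
 by (rule emeasure_Diff) (auto simp: box_subset_cbox emeasure_lborel_box_eq)
 then show "cbox l u - box l u \<in> null_sets lborel"
 by (auto simp: null_sets_def emeasure_lborel_cbox_eq emeasure_lborel_box_eq)
 qed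
 show "AL y. (%n. f y * (LINT z|lborel. ?I (y - (1 / real (Suc n)) *R z) *R ?g z)) -+> f y * (LINT z|lborel. ?I y *R ?g z)"
 using null
 proof eventually_elim
 case (elim y)
 have "(%n. LINT z|lborel. ?I (y - (1 / real (Suc n)) *R z) *R ?g z) -+> (LINT z|lborel. ?I y *R ?g z)"
 proof (rule integral_dominated_convergence[where w="%z. cmod (?g z)"])
 show "AL z. (%n. ?I (y - (1 / real (Suc n)) *R z) *R ?g z) -+> ?I y *R ?g z"
 proof (intro always_eventually allI tendsto_intros)
 fix z
 have lim: "(%n. y - (1 / real (Suc n)) *R z) -+> y - 0 *R z"
 by (intro tendsto_intros LIMSEQ_inverse_real_of_nat[unfolded inverse_eq_divide])
 have "y \<in> box l u \<or> y \<in> - cbox l u" using elim by auto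
 then have "\<forall>\<^sub>F n in sequentially. ?I (y - (1 / real (Suc n)) *R z) = ?I y"
 proof
 assume y: "y \<in> box l u"
 have "\<forall>\<^sub>F n in sequentially. y - (1 / real (Suc n)) *R z \<in> box l u"
 using topological_tendstoD[OF lim open_box] y by simp
 then show ?thesis by eventually_elim (simp add: y)
 next
 assume y: "y \<in> - cbox l u"
 have "\<forall>\<^sub>F n in sequentially. y - (1 / real (Suc n)) *R z \<in> - cbox l u"
 using topological_tendstoD[OF lim open_Compl[OF closed_cbox]] y by simp
 moreover have "y \<notin> box l u" using y box_subset_cbox by auto
 ultimately show ?thesis using box_subset_cbox[of l u] by (auto elim!: eventually_mono simp: indicator_def)
 qed
 then show "(%n. ?I (y - (1 / real (Suc n)) *R z)) -+> ?I y" by (rule tendsto_eventually)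
 qed
 show "AL z. norm (?I (y - (1 / real (Suc n)) *R z) *R ?g z) <= cmod (?g z)" for n
 by (auto simp: indicator_def)
 show "(%z. ?I (y - (1 / real (Suc n)) *R z) *R ?g z) \<in> borel_measurable lborel" for n by measurable
 qed (use gi in auto)
 then show ?case by (intro tendsto_mult tendsto_const)
 qed
 show "AL y. norm (f y * (LINT z|lborel. ?I (y - (1 / real (Suc n)) *R z) *R ?g z)) <= cmod (f y) * (LINT z|lborel. cmod (?g z))" for n
 proof (intro always_eventually allI)
 fix y
 have "cmod (LINT z|lborel. ?I (y - (1 / real (Suc n)) *R z) *R ?g z) <= (LINT z|lborel. cmod (?g z))"
 proof (rule Bochner_Integration.integral_norm_bound_integral)
 show "integrable lborel (%z. ?I (y - (1 / real (Suc n)) *R z) *R ?g z)"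
 by (rule Bochner_Integration.integrable_bound[OF gi]) (auto simp: indicator_def)
 qed (use gi in \<open>auto simp: indicator_def\<close>)
 then show "norm (f y * (LINT z|lborel. ?I (y - (1 / real (Suc n)) *R z) *R ?g z)) <= cmod (f y) * (LINT z|lborel. cmod (?g z))"
 by (simp add: norm_mult mult_left_mono)
 qed
 show "integrable lborel (%y. cmod (f y) * (LINT z|lborel. cmod (?g z)))" using fi by auto
 qed measurable
 then have "(LINT y|lborel. f y * (LINT z|lborel. ?I y *R ?g z)) = 0"
 unfolding w0 by (simp add: LIMSEQ_const_iff)
 also have "(LINT y|lborel. f y * (LINT z|lborel. ?I y *R ?g z)) = (LINT y|lborel. (?I y *R f y) * ff ?g 0)"
 by (simp add: fourier_fun_def mult_ac)
 also have "... = (LINT y|lborel. ?I y *R f y) * ff ?g 0"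
 by (rule integral_mult_left_zero)
 finally show ?thesis by (simp add: fourier_gauss gauss_def)
 qed
 have Ib: "integrable lborel (%y. ind (box l u) y *R f y)" for l u
 using fi by (intro integrable_mult_indicator) auto
 have "AL x. Re (f x) = 0"
 proof (rule integral_boxes_zero_imp_AE_zero)
 show "(LINT x|lborel. ind (box l u) x * Re (f x)) = 0" for l u
 using arg_cong[OF boxc[of l u], of Re] integral_Re[OF Ib[of l u]] by simp
 qed (use fi in auto)
 moreover have "AL x. Im (f x) = 0"
 proof (rule integral_boxes_zero_imp_AE_zero)
 show "(LINT x|lborel. ind (box l u) x * Im (f x)) = 0" for l u
 using arg_cong[OF boxc[of l u], of Im] integral_Im[OF Ib[of l u]] by simp
 qed (use fi in auto)
 ultimately show ?thesis
 proof eventually_elim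
 case (elim x)
 then have "f x = 0" by (simp add: complex_eq_iff)
 then show ?case by (simp add: f_def gauss_def)
 qed
qed

lemma represents_unique:
 assumes "represents h T" "represents k T"
 shows "AL x. h x = k x"
proof -
 have "AL x. h x - k x = 0"
 by (rule integral_schwartz_zero_imp_AE_zero)
 (use represents_diff[OF assms] in \<open>auto simp: represents_def\<close>)
 then show ?thesis by simp
qed

lemma represents_fun_of: "represents h T ==> represents (fun_of T) T"
 using someI[of "%h. represents h T" h] by (simp add: fun_of_def)

lemma fun_of_AE: "represents h T ==> AL x. fun_of T x = h x"
 using represents_unique represents_fun_of by blast

subsection \<open>Fourier transforms that are functions\<close>

lemma tfun_cong_AE:
 assumes "tfun h" "h' \<in> BM" "AL x. h x = h' x"
 shows "tfun h'"
proof -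
 obtain N where N: "(NN x. er (cmod (h x) / (1 + norm x) ^ N)) < ic" using assms by (auto simp: tfun_def)
 have "(NN x. er (cmod (h' x) / (1 + norm x) ^ N)) = (NN x. er (cmod (h x) / (1 + norm x) ^ N))"
 by (rule nn_integral_cong_AE) (use assms(3) in eventually_elim, simp)
 then show ?thesis using N assms(2) unfolding tfun_def by (intro conjI exI[of _ N]) auto
qed

lemma tfun_mult:
 assumes h: "tfun h" and m[measurable]: "m \<in> BM" and b: "!!x. cmod (m x) <= C * (1 + norm x) ^ K"
 shows "tfun (%x. m x * h x)"
proof -
 note [measurable] = tfun_measurable[OF h]
 obtain N where N: "(NN x. er (cmod (h x) / (1 + norm x) ^ N)) < ic" using h by (auto simp: tfun_def)
 have C: "0 <= C" using order_trans[OF norm_ge_zero b[of 0]] by simp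
 have "(NN x. er (cmod (m x * h x) / (1 + norm x) ^ (N + K))) <= (NN x. ennreal C * er (cmod (h x) / (1 + norm x) ^ N))"
 proof (rule nn_integral_mono)
 fix x :: "real^3"
 have p: "0 < (1 + norm x) ^ K" "0 < (1 + norm x) ^ N" by (auto intro!: zero_less_power add_pos_nonneg)
 have "cmod (m x * h x) / (1 + norm x) ^ (N + K) = (cmod (m x) / (1 + norm x) ^ K) * (cmod (h x) / (1 + norm x) ^ N)"
 by (simp add: norm_mult power_add mult_ac)
 also have "... <= C * (cmod (h x) / (1 + norm x) ^ N)"
 using b[of x] p by (intro mult_right_mono) (auto simp: divide_le_eq)
 finally show "er (cmod (m x * h x) / (1 + norm x) ^ (N + K)) <= ennreal C * er (cmod (h x) / (1 + norm x) ^ N)"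
 using C by (subst ennreal_mult'[symmetric]) (auto intro!: ennreal_leI)
 qed
 also have "... = ennreal C * (NN x. er (cmod (h x) / (1 + norm x) ^ N))"
 by (rule nn_integral_cmult) measurable
 also have "... < ic" using N by (simp add: ennreal_mult_less_top)
 finally show ?thesis unfolding tfun_def by (intro conjI exI[of _ "N + K"]) auto
qed

lemma tfun_add:
 assumes h: "tfun h" and k: "tfun k"
 shows "tfun (%x. h x + k x)"
proof -
 note [measurable] = tfun_measurable[OF h] tfun_measurable[OF k]
 obtain N K where N: "(NN x. er (cmod (h x) / (1 + norm x) ^ N)) < ic"
 and K: "(NN x. er (cmod (k x) / (1 + norm x) ^ K)) < ic" using h k by (auto simp: tfun_def)
 have "(NN x. er (cmod (h x + k x) / (1 + norm x) ^ (N + K))) <=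
 (NN x. er (cmod (h x) / (1 + norm x) ^ N) + er (cmod (k x) / (1 + norm x) ^ K))"
 proof (rule nn_integral_mono)
 fix x :: "real^3"
 have p: "0 < (1 + norm x) ^ K" "0 < (1 + norm x) ^ N" by (auto intro!: zero_less_power add_pos_nonneg)
 have q: "(1 + norm x) ^ N <= (1 + norm x) ^ (N + K)" "(1 + norm x) ^ K <= (1 + norm x) ^ (N + K)"
 by (auto intro!: power_increasing)
 have "cmod (h x + k x) / (1 + norm x) ^ (N + K) <= cmod (h x) / (1 + norm x) ^ (N + K) + cmod (k x) / (1 + norm x) ^ (N + K)"
 unfolding add_divide_distrib[symmetric] using p by (intro divide_right_mono norm_triangle_ineq) auto
 also have "... <= cmod (h x) / (1 + norm x) ^ N + cmod (k x) / (1 + norm x) ^ K"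
 using p q by (intro add_mono divide_left_mono mult_pos_pos) (auto simp: power_add)
 finally show "er (cmod (h x + k x) / (1 + norm x) ^ (N + K)) <= er (cmod (h x) / (1 + norm x) ^ N) + er (cmod (k x) / (1 + norm x) ^ K)"
 by (subst ennreal_plus[symmetric]) (auto intro!: ennreal_leI simp del: ennreal_plus)
 qed
 also have "... < ic" using N K by (simp add: nn_integral_add)
 finally show ?thesis unfolding tfun_def by (intro conjI exI[of _ "N + K"]) auto
qed

lemma tfun_uminus: "tfun h ==> tfun (%x. - h x)"
 using tfun_mult[of h "%_. -1" 1 0] by simp

lemma tfun_diff: "tfun h ==> tfun k ==> tfun (%x. h x - k x)"
 using tfun_add[OF _ tfun_uminus, of h k] by simp

lemma tfun_zero: "tfun (%x. 0)"
 by (auto simp: tfun_def)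

lemma tfun_L1: "integrable lborel h ==> tfun h"
 unfolding tfun_def by (auto intro!: exI[of _ 0] simp: integrable_iff_bounded)

lemma AE_nonzero: "AL x. x ~= (0 :: 'a::euclidean_space)"
 using AE_lborel_singleton[of 0] by simp

lemma tfun_weighted:
 assumes [measurable]: "h \<in> BM"
 and i: "(NN x. er (norm x powr - 1 * cmod (h x))) < ic"
 shows "tfun h"
proof -
 have "(NN x. er (cmod (h x) / (1 + norm x) ^ 1)) <= (NN x. er (norm x powr - 1 * cmod (h x)))"
 proof (rule nn_integral_mono_AE)
 show "AL x. er (cmod (h x) / (1 + norm x) ^ 1) <= er (norm x powr - 1 * cmod (h x))"
 using AE_nonzero
 proof eventually_elim
 case (elim x)
 have "cmod (h x) / (1 + norm x) <= cmod (h x) / norm x" using elim by (intro divide_left_mono mult_pos_pos) (auto intro: add_pos_nonneg)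
 then show ?case using elim by (intro ennreal_leI) (simp add: powr_minus_divide)
 qed
 qed
 then have "(NN x. er (cmod (h x) / (1 + norm x) ^ 1)) < ic" using i by (rule le_less_trans)
 then show ?thesis unfolding tfun_def using assms(1) by blast
qed

definition ft :: "(real^3 => complex) => tempered => bool" where
 "ft h T \<longleftrightarrow> represents h (fourier T) & tfun h"

lemma ft_measurable: "ft h T ==> h \<in> BM"
 by (simp add: ft_def tfun_def)

lemma ft_inj: "ft h S ==> ft h T ==> S = T"
 unfolding ft_def by (metis represents_inj inv_fourier_fourier)

lemma ft_unique: "ft h T ==> ft k T ==> AL x. h x = k x"
 unfolding ft_def using represents_unique by blast

lemma ft_cong_AE: "ft h T ==> h' \<in> BM ==> AL x. h x = h' x ==> ft h' T"
 unfolding ft_def using represents_cong_AE tfun_cong_AE by blast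

lemma ft_inv_fourier: "tfun h ==> ft h (inv_fourier (dist_of h))"
 by (simp add: ft_def represents_dist_of)

lemma ft_zero: "ft (%_. 0) 0"
 by (simp add: ft_def fourier_zero represents_zero tfun_zero)

lemma ft_add: "ft h S ==> ft k T ==> ft (%x. h x + k x) (S + T)"
 by (simp add: ft_def fourier_plus represents_add tfun_add)

lemma ft_diff: "ft h S ==> ft k T ==> ft (%x. h x - k x) (S - T)"
 by (simp add: ft_def fourier_minus represents_diff tfun_diff)

lemma ft_sum: "(!!i. i \<in> A ==> ft (h i) (T i)) ==> ft (%x. \<Sum>i\<in>A. h i x) (\<Sum>i\<in>A. T i)"
 by (induction A rule: infinite_finite_induct) (auto intro: ft_zero ft_add)

lemma ft_pairing: "ft h T ==> schwartz fy ==> pairing T fy = (LINT x|lborel. h x * inv_fourier_fun fy x)"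
 by (simp add: pairing_via_fourier[of fy T] ft_def represents_def schwartz_inv_fourier)

lemma coord_measurable [measurable]: "(%x::real^'n. x $ i) \<in> BM"
 by (intro borel_measurable_continuous_onI continuous_intros)

lemma norm_coord_le: "cmod (cor (x $ i)) <= 1 * (1 + norm x) ^ 1"
 using component_le_norm_cart[of x i] by simp

lemma ft_tderiv:
 assumes f: "ft h T"
 shows "ft (%xi. \<i> * cor (xi $ j) * h xi) (tderiv j T)"
proof -
 note [measurable] = ft_measurable[OF f]
 have t: "tfun (%xi. \<i> * cor (xi $ j) * h xi)"
 by (rule tfun_mult[where C=1 and K=1])
 (use f norm_coord_le in \<open>auto simp: ft_def norm_mult\<close>)
 have "represents (%xi. \<i> * cor (xi $ j) * h xi) (fourier (tderiv j T))"
 unfolding represents_def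
 proof (intro allI impI conjI)
 fix fy assume s: "schwartz fy"
 show "integrable lborel (%xi. \<i> * cor (xi $ j) * h xi * fy xi)" using tfun_integrable[OF t s] .
 have "pairing (fourier (tderiv j T)) fy = - pairing T (ff (fmul j fy))"
 using s by (simp add: pairing_fourier pairing_tderiv schwartz_fourier pderiv_fourier)
 also have "... = - pairing (fourier T) (fmul j fy)" using s by (simp add: pairing_fourier schwartz_fmul)
 also have "... = - (LINT xi|lborel. h xi * fmul j fy xi)" using f s by (simp add: ft_def represents_def schwartz_fmul)
 also have "... = (LINT xi|lborel. - (h xi * fmul j fy xi))" by simp
 also have "... = (LINT xi|lborel. \<i> * cor (xi $ j) * h xi * fy xi)"
 by (rule Bochner_Integration.integral_cong) (auto simp: fmul_def xmul_def)
 finally show "pairing (fourier (tderiv j T)) fy = (LINT xi|lborel. \<i> * cor (xi $ j) * h xi * fy xi)" .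
 qed
 with t show ?thesis by (simp add: ft_def)
qed

lemma ft_multiplier:
 assumes f: "ft h T" and m[measurable]: "m \<in> BM" and b: "!!x. cmod (m x) <= C"
 shows "ft (%xi. m xi * h xi) (multiplier m T)"
proof -
 note [measurable] = ft_measurable[OF f]
 have r: "represents (fun_of (fourier T)) (fourier T)" using f represents_fun_of by (auto simp: ft_def)
 note [measurable] = represents_measurable[OF r]
 have ae: "AL x. fun_of (fourier T) x = h x" using f by (auto simp: ft_def intro: fun_of_AE)
 have t: "tfun (%xi. m xi * fun_of (fourier T) xi)"
 proof (rule tfun_mult[where C=C and K=0])
 show "tfun (fun_of (fourier T))"
 by (rule tfun_cong_AE[of h]) (use f ae in \<open>auto simp: ft_def elim: eventually_mono\<close>)
 qed (use b in auto)
 have "ft (%xi. m xi * fun_of (fourier T) xi) (multiplier m T)"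
 unfolding multiplier_def by (rule ft_inv_fourier[OF t])
 then show ?thesis
 by (rule ft_cong_AE) (use ae in \<open>auto elim: eventually_mono\<close>)
qed

subsection \<open>Products and convolutions\<close>

lemma fourier_fun_measurable [measurable]:
 assumes [measurable]: "f \<in> BM"
 shows "ff f \<in> BM"
proof -
 have "(%xi. LINT x|lborel. cis (- (x \<bullet> xi)) * f x) \<in> BM"
 by (rule lborel.borel_measurable_lebesgue_integral) measurable
 then show ?thesis by (simp add: fourier_fun_def[abs_def])
qed

lemma uminus_borel_measurable [measurable]: "(uminus :: real^3 => real^3) \<in> BM"
proof -
 have "(%x::real^3. - x) \<in> BM" by measurable
 then show ?thesis by simp
qed

lemma inv_fourier_fun_measurable [measurable]:
 "f \<in> BM ==> inv_fourier_fun f \<in> BM"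
 unfolding inv_fourier_fun_eq by (intro borel_measurable_times borel_measurable_const measurable_compose[OF uminus_borel_measurable fourier_fun_measurable])

lemma inv_fourier_fun_norm_le:
 "integrable lborel f ==> cmod (inv_fourier_fun f x) <= (LINT x|lborel. cmod (f x))"
proof -
 assume f: "integrable lborel f"
 have pi: "(1::real) <= (2 * pi) ^ 3" using pi_ge_two by (intro one_le_power) simp
 have "cmod (inv_fourier_fun f x) = cmod (ff f (- x)) / (2 * pi) ^ 3"
 by (simp add: inv_fourier_fun_eq norm_divide norm_mult norm_power)
 also have "... <= cmod (ff f (- x)) / 1" using pi by (intro divide_left_mono) auto
 also have "... <= (LINT x|lborel. cmod (f x))" using fourier_fun_norm_le[OF f] by simp
 finally show ?thesis .
qed

lemma fourier_exchange:
 assumes f: "integrable lborel f" and g: "integrable lborel g"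
 shows "(LINT x|lborel. f x * ff g x) = (LINT x|lborel. ff f x * g x)"
proof -
 have [measurable]: "f \<in> BM" "g \<in> BM" using f g by (auto dest: borel_measurable_integrable)
 have int: "integrable (lborel \<Otimes>\<^sub>M lborel) (%(x, y). f x * (cis (- (y \<bullet> x)) * g y))"
 by (rule integrable_pair_dominated[OF f g]) (auto simp: norm_mult)
 have "(LINT x|lborel. f x * ff g x) = (LINT x|lborel. LINT y|lborel. f x * (cis (- (y \<bullet> x)) * g y))"
 unfolding fourier_fun_def by (simp only: integral_mult_right_zero)
 also have "... = (LINT y|lborel. LINT x|lborel. f x * (cis (- (y \<bullet> x)) * g y))"
 using lborel_pair.Fubini_integral[of "%x y. f x * (cis (- (y \<bullet> x)) * g y)"] int by simp
 also have "... = (LINT y|lborel. ff f y * g y)"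
 unfolding fourier_fun_def integral_mult_left_zero[symmetric] by (simp only: mult_ac inner_commute)
 finally show ?thesis .
qed

lemma inv_fourier_exchange:
 assumes f: "integrable lborel f" and g: "integrable lborel g"
 shows "(LINT x|lborel. f x * inv_fourier_fun g x) = (LINT x|lborel. inv_fourier_fun f x * g x)"
proof -
 let ?c = "1 / cor ((2 * pi) ^ 3)"
 have g': "integrable lborel (%x. g (- x))" using integrable_reflect[of g 0] g by simp
 have "(LINT x|lborel. f x * inv_fourier_fun g x) = (LINT x|lborel. ?c * (f x * ff (%x. g (- x)) x))"
 unfolding inv_fourier_fun_eq fourier_fun_reflect by (simp only: mult_ac)
 also have "... = ?c * (LINT x|lborel. ff f x * g (- x))"
 unfolding integral_mult_right_zero fourier_exchange[OF f g'] ..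
 also have "(LINT x|lborel. ff f x * g (- x)) = (LINT x|lborel. ff f (- x) * g x)"
 using integral_reflect[of "%x. ff f (- x) * g x" 0] by simp
 also have "?c * ... = (LINT x|lborel. inv_fourier_fun f x * g x)"
 unfolding inv_fourier_fun_eq integral_mult_right_zero[symmetric] by (simp only: mult_ac)
 finally show ?thesis .
qed

lemma tfun_bounded:
 assumes [measurable]: "h \<in> BM" and b: "!!x. cmod (h x) <= C"
 shows "tfun h"
proof -
 have C: "0 <= C" using order_trans[OF norm_ge_zero b[of 0]] .
 have "(NN x. er (cmod (h x) / (1 + norm x) ^ 6)) <= (NN x. er (C * poly_weight x))"
 proof (intro nn_integral_mono ennreal_leI)
 fix x :: "real^3"
 have p: "0 < (1 + norm x) ^ 6" by (intro zero_less_power) (auto intro: add_pos_nonneg)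
 have "(1 + (norm x)\<^sup>2) <= (1 + norm x)\<^sup>2" by (simp add: power2_sum)
 then have "(1 + (norm x)\<^sup>2) ^ 3 <= ((1 + norm x)\<^sup>2) ^ 3" by (intro power_mono) auto
 then have "1 <= poly_weight x * (1 + norm x) ^ 6"
 using order_trans[OF poly_weight_lower mult_left_mono[OF _ poly_weight_nonneg]] by (simp flip: power_mult)
 then have "1 / (1 + norm x) ^ 6 <= poly_weight x" using p by (simp add: divide_le_eq)
 then have "cmod (h x) * (1 / (1 + norm x) ^ 6) <= C * poly_weight x" using b[of x] C p by (intro mult_mono) auto
 then show "cmod (h x) / (1 + norm x) ^ 6 <= C * poly_weight x" by simp
 qed
 also have "... < ic"
 using nn_integral_eq_integral[OF integrable_mult_right[OF integrable_poly_weight, of C]] C poly_weight_nonneg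
 by (simp del: integral_mult_right_zero)
 finally show ?thesis using assms(1) unfolding tfun_def by blast
qed

lemma represents_inv_fourier_fun:
 assumes f: "ft f T" and i: "integrable lborel f"
 shows "represents (inv_fourier_fun f) T" "tfun (inv_fourier_fun f)"
proof -
 note [measurable] = ft_measurable[OF f]
 show t: "tfun (inv_fourier_fun f)" by (rule tfun_bounded[OF _ inv_fourier_fun_norm_le[OF i]]) measurable
 show "represents (inv_fourier_fun f) T"
 unfolding represents_def
 using tfun_integrable[OF t] ft_pairing[OF f] inv_fourier_exchange[OF i schwartz_integrable] by simp
qed

text \<open>With the normalization of \<open>fourier\<close>, the transform of a product is the
  convolution of the transforms divided by (2 pi)^3.\<close>

definition cconv :: "(real^3 => complex) => (real^3 => complex) => real^3 => complex" where
 "cconv f g ze = (1 / cor ((2 * pi) ^ 3)) * (LINT et|lborel. f (ze - et) * g et)"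

lemma conv_pair_integrable:
 fixes f g :: "'a::euclidean_space => complex"
 assumes f: "integrable lborel f" and g: "integrable lborel g"
 shows "integrable (lborel \<Otimes>\<^sub>M lborel) (%(et, ze). f (ze - et) * g et)"
 unfolding integrable_iff_bounded
proof
 have [measurable]: "f \<in> BM" "g \<in> BM" using f g by (auto dest: borel_measurable_integrable)
 show "(%(et, ze). f (ze - et) * g et) \<in> borel_measurable (lborel \<Otimes>\<^sub>M lborel)" by measurable
 have "(\<integral>\<^sup>+ p. er (norm ((%(et, ze). f (ze - et) * g et) p)) \<partial>(lborel \<Otimes>\<^sub>M lborel)) =
 (\<integral>\<^sup>+ et. \<integral>\<^sup>+ ze. er (cmod (f (- et + ze))) * er (cmod (g et)) \<partial>lborel \<partial>lborel)"
 by (subst lborel.nn_integral_fst[symmetric]) (auto simp: norm_mult ennreal_mult')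
 also have "... = (\<integral>\<^sup>+ et. (\<integral>\<^sup>+ ze. er (cmod (f ze)) \<partial>lborel) * er (cmod (g et)) \<partial>lborel)"
 proof (rule nn_integral_cong)
 fix et
 have "(\<integral>\<^sup>+ ze. er (cmod (f (- et + ze))) * er (cmod (g et)) \<partial>lborel) = (\<integral>\<^sup>+ ze. er (cmod (f (- et + ze))) \<partial>lborel) * er (cmod (g et))"
 by (rule nn_integral_multc) measurable
 also have "(\<integral>\<^sup>+ ze. er (cmod (f (- et + ze))) \<partial>lborel) = (\<integral>\<^sup>+ ze. er (cmod (f ze)) \<partial>lborel)"
 by (rule nn_integral_translate[of "%ze. er (cmod (f ze))"]) measurable
 finally show "(\<integral>\<^sup>+ ze. er (cmod (f (- et + ze))) * er (cmod (g et)) \<partial>lborel) = (\<integral>\<^sup>+ ze. er (cmod (f ze)) \<partial>lborel) * er (cmod (g et))" .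
 qed
 also have "... < ic" using f g by (auto simp: nn_integral_cmult integrable_iff_bounded ennreal_mult_less_top)
 finally show "(\<integral>\<^sup>+ p. er (norm ((%(et, ze). f (ze - et) * g et) p)) \<partial>(lborel \<Otimes>\<^sub>M lborel)) < ic" .
qed

lemma
 assumes f: "integrable lborel f" and g: "integrable lborel g"
 shows conv_integrable_AE: "AL ze. integrable lborel (%et. f (ze - et) * g et)"
 and cconv_integrable: "integrable lborel (cconv f g)"
proof -
 have i: "integrable (lborel \<Otimes>\<^sub>M lborel) (%(ze, et). f (ze - et) * g et)"
 using lborel_pair.integrable_product_swap[OF conv_pair_integrable[OF f g]] by (simp add: case_prod_beta')
 show "AL ze. integrable lborel (%et. f (ze - et) * g et)"
 using lborel_pair.AE_integrable_fst'[OF i] by simp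
 show "integrable lborel (cconv f g)"
 unfolding cconv_def[abs_def] using lborel_pair.integrable_fst'[OF i] by (intro integrable_mult_right) simp
qed

text \<open>Both factors are inverse transforms of integrable functions, hence bounded, and agree
  almost everywhere with the functions picked by \<open>tmult\<close>. Writing one factor as an
  integral over \<open>et\<close> and exchanging integrals twice moves the product to the
  convolution side.\<close>

lemma ft_tmult:
 assumes f: "ft f S" and fi: "integrable lborel f" and g: "ft g T" and gi: "integrable lborel g"
 shows "ft (cconv f g) (tmult S T)"
proof -
 note [measurable] = ft_measurable[OF f] ft_measurable[OF g]
 let ?F = "inv_fourier_fun f" and ?G = "inv_fourier_fun g"
 let ?c = "1 / cor ((2 * pi) ^ 3)"
 note F = represents_inv_fourier_fun[OF f fi] and G = represents_inv_fourier_fun[OF g gi]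
 have m[measurable]: "fun_of S \<in> BM" "fun_of T \<in> BM"
 using represents_measurable[OF represents_fun_of] F(1) G(1) by auto
 have tFG: "tfun (%x. ?F x * ?G x)"
 by (rule tfun_bounded[where C="(LINT x|lborel. cmod (f x)) * (LINT x|lborel. cmod (g x))"])
 (auto simp: norm_mult intro!: mult_mono inv_fourier_fun_norm_le fi gi)
 have ae: "AL x. ?F x * ?G x = fun_of S x * fun_of T x"
 using fun_of_AE[OF F(1)] fun_of_AE[OF G(1)] by eventually_elim simp
 have "tfun (%x. fun_of S x * fun_of T x)" by (rule tfun_cong_AE[OF tFG _ ae]) measurable
 then have "represents (%x. fun_of S x * fun_of T x) (tmult S T)" unfolding tmult_def by (rule represents_dist_of)
 then have rep: "represents (%x. ?F x * ?G x) (tmult S T)"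
 by (rule represents_cong_AE) (use ae in \<open>auto elim: eventually_mono\<close>)
 have t: "tfun (cconv f g)" by (intro tfun_L1 cconv_integrable fi gi)
 have "represents (cconv f g) (fourier (tmult S T))"
 unfolding represents_def
 proof (intro allI impI conjI)
 fix fy assume s: "schwartz fy"
 show "integrable lborel (%x. cconv f g x * fy x)" using tfun_integrable[OF t s] .
 have sF: "schwartz (ff fy)" by (rule schwartz_fourier[OF s])
 note [measurable] = schwartz_measurable[OF s] schwartz_measurable[OF sF]
 have iF: "integrable lborel (%x. ?F x * ff fy x)" using tfun_integrable[OF F(2) sF] .
 obtain D where D: "!!x. cmod (fy x) <= D" using schwartz_bound[OF s, of 0] by auto
 \<comment> \<open>The character translates the test function; the inverse transform is then shifted
   onto the transform of the translate, where inversion removes both.\<close>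
 have inner: "(LINT x|lborel. ?F x * ff fy x * cis (x \<bullet> et)) = (LINT ze|lborel. f (ze - et) * fy ze)" for et
 proof -
 let ?\<psi> = "%x. fy (et + x)"
 have sp: "schwartz ?\<psi>" by (rule schwartz_translate[OF s])
 have "(LINT x|lborel. ?F x * ff fy x * cis (x \<bullet> et)) = (LINT x|lborel. ?F x * ff ?\<psi> x)"
 proof -
 have "?F x * ff fy x * cis (x \<bullet> et) = ?F x * ff ?\<psi> x" for x
 using fourier_fun_translate[of fy et x] by (simp only: mult.assoc mult.commute[of "ff fy x"] inner_commute[of x et])
 then show ?thesis by (simp only:)
 qed
 also have "... = (LINT x|lborel. f x * inv_fourier_fun (ff ?\<psi>) x)"
 by (rule inv_fourier_exchange[symmetric, OF fi schwartz_integrable[OF schwartz_fourier[OF sp]]])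
 also have "... = (LINT x|lborel. f ((et + x) - et) * fy (et + x))" by (simp add: fourier_inversion[OF sp])
 also have "... = (LINT ze|lborel. f (ze - et) * fy ze)" by (rule integral_translate)
 finally show ?thesis .
 qed
 have int1: "integrable (lborel \<Otimes>\<^sub>M lborel) (%(x, et). ?F x * ff fy x * (cis (x \<bullet> et) * g et))"
 by (rule integrable_pair_dominated[OF iF gi]) (auto simp: norm_mult)
 have int2: "integrable (lborel \<Otimes>\<^sub>M lborel) (%(et, ze). f (ze - et) * g et * fy ze)"
 proof (rule Bochner_Integration.integrable_bound[OF integrable_mult_right[OF integrable_norm[OF conv_pair_integrable[OF fi gi]], of D]])
 show "AE p in lborel \<Otimes>\<^sub>M lborel. norm ((%(et, ze). f (ze - et) * g et * fy ze) p) <= norm (D * norm ((%(et, ze). f (ze - et) * g et) p))"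
 proof (intro AE_I2)
 fix p :: "(real^3) \<times> (real^3)"
 obtain et ze where p: "p = (et, ze)" by fastforce
 have "cmod (f (ze - et) * g et) * cmod (fy ze) <= cmod (f (ze - et) * g et) * D" by (intro mult_left_mono D) simp
 then show "norm ((%(et, ze). f (ze - et) * g et * fy ze) p) <= norm (D * norm ((%(et, ze). f (ze - et) * g et) p))"
 unfolding p prod.case norm_mult[of "f (ze - et) * g et"]
 using abs_ge_self[of "D * cmod (f (ze - et) * g et)"] by (simp only: real_norm_def mult.commute[of D])
 qed
 qed measurable
 let ?K = "%x et. ?F x * ff fy x * (cis (x \<bullet> et) * g et)"
 have J: "(LINT x|lborel. LINT et|lborel. ?K x et) = (LINT ze|lborel. (LINT et|lborel. f (ze - et) * g et) * fy ze)"
 proof -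
 have "(LINT x|lborel. LINT et|lborel. ?K x et) = (LINT et|lborel. LINT x|lborel. ?K x et)"
 by (rule lborel_pair.Fubini_integral[symmetric]) (rule int1)
 also have "... = (LINT et|lborel. LINT ze|lborel. f (ze - et) * g et * fy ze)"
 proof (rule Bochner_Integration.integral_cong[OF refl])
 fix et
 have "(LINT x|lborel. ?K x et) = (LINT x|lborel. ?F x * ff fy x * cis (x \<bullet> et)) * g et"
 unfolding mult.assoc[symmetric] by (rule integral_mult_left_zero)
 also have "... = (LINT ze|lborel. f (ze - et) * fy ze) * g et" unfolding inner ..
 also have "... = (LINT ze|lborel. f (ze - et) * fy ze * g et)"
 by (rule integral_mult_left_zero[symmetric])
 also have "... = (LINT ze|lborel. f (ze - et) * g et * fy ze)"
 by (simp only: mult_ac)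
 finally show "(LINT x|lborel. ?K x et) = (LINT ze|lborel. f (ze - et) * g et * fy ze)" .
 qed
 also have "... = (LINT ze|lborel. LINT et|lborel. f (ze - et) * g et * fy ze)"
 by (rule lborel_pair.Fubini_integral[symmetric]) (rule int2)
 also have "... = (LINT ze|lborel. (LINT et|lborel. f (ze - et) * g et) * fy ze)"
 by (intro Bochner_Integration.integral_cong[OF refl] integral_mult_left_zero)
 finally show ?thesis .
 qed
 have K: "?F x * ?G x * ff fy x = ?c * (LINT et|lborel. ?K x et)" for x
 proof -
 have "(LINT et|lborel. ?K x et) = ?F x * ff fy x * (LINT et|lborel. cis (x \<bullet> et) * g et)"
 by (rule integral_mult_right_zero)
 moreover have "?G x = ?c * (LINT et|lborel. cis (x \<bullet> et) * g et)"
 unfolding inv_fourier_fun_def by simp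
 ultimately show ?thesis by (simp only: mult_ac)
 qed
 have "pairing (fourier (tmult S T)) fy = (LINT x|lborel. ?F x * ?G x * ff fy x)"
 using rep sF unfolding pairing_fourier[OF s] represents_def by blast
 also have "... = ?c * (LINT x|lborel. LINT et|lborel. ?K x et)"
 unfolding K by (rule integral_mult_right_zero)
 also have "... = ?c * (LINT ze|lborel. (LINT et|lborel. f (ze - et) * g et) * fy ze)"
 unfolding J ..
 also have "... = (LINT ze|lborel. cconv f g ze * fy ze)"
 unfolding cconv_def mult.assoc[of ?c] by (rule integral_mult_right_zero[symmetric])
 finally show "pairing (fourier (tmult S T)) fy = (LINT ze|lborel. cconv f g ze * fy ze)" .
 qed
 with t show ?thesis by (simp add: ft_def)
qed

subsection \<open>Reality\<close>

lemma cnj_measurable [measurable]: "cnj \<in> BM"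
 by (intro borel_measurable_continuous_onI continuous_intros)

lemma inv_fourier_fun_cnj: "inv_fourier_fun (%x. cnj (fy x)) xi = cnj (inv_fourier_fun fy (- xi))"
proof -
 have "(LINT x|lborel. cis (xi \<bullet> x) * cnj (fy x)) = cnj (LINT x|lborel. cis (- (xi \<bullet> x)) * fy x)"
 unfolding Bochner_Integration.integral_cnj[symmetric] complex_cnj_mult cis_cnj by simp
 then show ?thesis by (simp add: inv_fourier_fun_def)
qed

lemma pairing_cnj_ft:
 assumes f: "ft h T" and s: "schwartz fy"
 shows "pairing T (%x. cnj (fy x)) = cnj (LINT x|lborel. cnj (h (- x)) * inv_fourier_fun fy x)"
proof -
 have "pairing T (%x. cnj (fy x)) = (LINT x|lborel. h x * cnj (inv_fourier_fun fy (- x)))"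
 using ft_pairing[OF f schwartz_cnj[OF s]] by (simp add: inv_fourier_fun_cnj)
 also have "... = (LINT x|lborel. h (- x) * cnj (inv_fourier_fun fy x))"
 using integral_reflect[of "%x. h (- x) * cnj (inv_fourier_fun fy x)" 0] by simp
 finally show ?thesis unfolding Bochner_Integration.integral_cnj[symmetric] complex_cnj_mult complex_cnj_cnj .
qed

lemma real_dist_ftI:
 assumes f: "ft h T" and h: "!!x. h (- x) = cnj (h x)"
 shows "real_dist T"
 unfolding real_dist_def using pairing_cnj_ft[OF f] ft_pairing[OF f] by (simp add: h)

lemma tfun_reflect_cnj: "tfun h ==> tfun (%x. cnj (h (- x)))"
proof -
 assume h: "tfun h"
 note [measurable] = tfun_measurable[OF h]
 obtain N where N: "(NN x. er (cmod (h x) / (1 + norm x) ^ N)) < ic" using h by (auto simp: tfun_def)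
 have "(NN x. er (cmod (cnj (h (- x))) / (1 + norm x) ^ N)) = (NN x. er (cmod (h (0 - x)) / (1 + norm (0 - x)) ^ N))" by simp
 also have "... = (NN x. er (cmod (h x) / (1 + norm x) ^ N))"
 by (rule nn_integral_reflect[of "%x. er (cmod (h x) / (1 + norm x) ^ N)" 0]) measurable
 finally show ?thesis using N unfolding tfun_def by (intro conjI exI[of _ N]) auto
qed

lemma real_dist_ftD:
 assumes f: "ft h T" and r: "real_dist T"
 shows "AL x. h x = cnj (h (- x))"
proof -
 have t: "tfun (%x. cnj (h (- x)))" "tfun h" using f tfun_reflect_cnj by (auto simp: ft_def)
 have "AL x. h x - cnj (h (- x)) = 0"
 proof (rule integral_schwartz_zero_imp_AE_zero)
 fix fy assume s: "schwartz fy"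
 then show "integrable lborel (%x. (h x - cnj (h (- x))) * fy x)" using t tfun_diff tfun_integrable by blast
 \<comment> \<open>Testing on \<open>ff fy\<close> makes the inverse transforms in both pairings
   collapse to \<open>fy\<close>.\<close>
 have sF: "schwartz (ff fy)" by (rule schwartz_fourier[OF s])
 have "(LINT x|lborel. cnj (h (- x)) * fy x) = (LINT x|lborel. h x * fy x)"
 proof -
 have "pairing T (%x. cnj (ff fy x)) = cnj (pairing T (ff fy))"
 using r sF unfolding real_dist_def by blast
 then show ?thesis
 unfolding pairing_cnj_ft[OF f sF] ft_pairing[OF f sF] fourier_inversion[OF s] complex_cnj_cancel_iff .
 qed
 then show "(LINT x|lborel. (h x - cnj (h (- x))) * fy x) = 0"
 using tfun_integrable[OF _ s] t by (simp add: left_diff_distrib)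
 qed
 then show ?thesis by simp
qed

section \<open>Vector fields on the Fourier side\<close>

lemma vec_measurableI:
 fixes f :: "'a => complex^'n"
 assumes "!!i. (%x. f x $ i) \<in> borel_measurable M"
 shows "f \<in> borel_measurable M"
proof -
 have "(%x. f x \<bullet> b) \<in> borel_measurable M" if b: "b \<in> Basis" for b
 proof -
 obtain i c where b: "b = axis i c" using b by (auto simp: Basis_vec_def)
 show ?thesis unfolding b inner_axis using assms[of i] by measurable
 qed
 then show ?thesis by (subst borel_measurable_euclidean_space) blast
qed

lemma vec_nth_measurable [measurable]: "(%x::complex^'n. x $ i) \<in> BM"
 by (intro borel_measurable_continuous_onI continuous_intros)

lemma vec_lambda_measurable [measurable (raw)]:
 fixes f :: "'a => 'n::finite => complex"
 assumes "!!i. (%x. f x i) \<in> borel_measurable M"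
 shows "(%x. \<chi> i. f x i) \<in> borel_measurable M"
 by (rule vec_measurableI) (simp add: assms)

lemma norm_vec_nth_le: "norm ((x :: complex^'n) $ i) <= norm x"
 by (rule Finite_Cartesian_Product.norm_nth_le)

lemma norm_vec_le_sum: "norm (x :: complex^'n) <= (\<Sum>i\<in>UNIV. norm (x $ i))"
 by (simp add: norm_vec_def L2_set_le_sum)

lemma integrable_vec_nth:
 fixes f :: "'a => complex^'n"
 shows "integrable M f ==> integrable M (%x. f x $ i)"
 by (rule integrable_bounded_linear[OF bounded_linear_vec_nth])

lemma integrable_vecI:
 fixes f :: "'a => complex^'n"
 assumes i: "!!i. integrable M (%x. f x $ i)"
 shows "integrable M f"
proof (rule Bochner_Integration.integrable_bound)
 show "integrable M (%x. \<Sum>i\<in>UNIV. norm (f x $ i))" using i by (intro Bochner_Integration.integrable_sum integrable_norm)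
 show "f \<in> borel_measurable M" using i by (intro vec_measurableI) auto
 show "AE x in M. norm (f x) <= norm (\<Sum>i\<in>UNIV. norm (f x $ i))"
 using norm_vec_le_sum by (auto intro!: AE_I2 order_trans[OF norm_vec_le_sum])
qed

lemma integral_vec_nth:
 fixes f :: "'a => complex^'n"
 assumes "integrable M f"
 shows "(LINT x|M. f x) $ i = (LINT x|M. f x $ i)"
 by (rule integral_bounded_linear[symmetric, OF bounded_linear_vec_nth assms])

section \<open>Fourier representatives of fields and their norms\<close>

definition ftv :: "(real^3 => complex^3) => tempered^3 => bool" where
 "ftv h f \<longleftrightarrow> (\<forall>i. ft (%xi. h xi $ i) (f $ i))"

lemma ftv_measurable: "ftv h f ==> h \<in> BM"
 by (intro vec_measurableI) (auto simp: ftv_def dest: ft_measurable)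

lemma ftv_inj: "ftv h f ==> ftv h g ==> f = g"
 unfolding ftv_def by (auto simp: vec_eq_iff intro: ft_inj)

lemma ftv_unique:
 assumes "ftv h f" "ftv k f"
 shows "AL xi. h xi = k xi"
proof -
 have "AL xi. \<forall>i. h xi $ i = k xi $ i"
 using assms by (intro AE_all_countable[THEN iffD2]) (auto simp: ftv_def intro: ft_unique)
 then show ?thesis by (simp add: vec_eq_iff)
qed

lemma ftv_cong_AE:
 assumes "ftv h f" "k \<in> BM" "AL xi. h xi = k xi"
 shows "ftv k f"
 unfolding ftv_def
proof
 fix i
 note [measurable] = assms(2)
 show "ft (%xi. k xi $ i) (f $ i)"
 by (rule ft_cong_AE[of "%xi. h xi $ i"]) (use assms in \<open>auto simp: ftv_def elim: eventually_mono\<close>)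
qed

lemma ftv_diff: "ftv h f ==> ftv k g ==> ftv (%xi. h xi - k xi) (f - g)"
 by (simp add: ftv_def ft_diff)

lemma ftv_add: "ftv h f ==> ftv k g ==> ftv (%xi. h xi + k xi) (f + g)"
 by (simp add: ftv_def ft_add)

lemma ftv_fhat: "ftv h f ==> AL xi. fhat f xi = h xi"
proof -
 assume h: "ftv h f"
 have "AL xi. \<forall>i. fun_of (fourier (f $ i)) xi = h xi $ i"
 using h by (intro AE_all_countable[THEN iffD2]) (auto simp: ftv_def ft_def intro: fun_of_AE)
 then show ?thesis by (simp add: fhat_def vec_eq_iff)
qed

lemma ftv_fhat_is_function: "ftv h f ==> fhat_is_function f"
 by (auto simp: ftv_def ft_def fhat_is_function_def)

lemma fhat_measurable: "fhat_is_function f ==> fhat f \<in> BM"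
 unfolding fhat_def[abs_def] fhat_is_function_def
 by (intro vec_lambda_measurable) (auto dest: represents_fun_of intro: represents_measurable)

lemma Xnorm_ftv:
 assumes h: "ftv h f"
 shows "Xnorm s f = (NN xi. er (norm xi powr s * norm (h xi)))"
 unfolding Xnorm_def using ftv_fhat_is_function[OF h] ftv_fhat[OF h]
 by (auto intro!: nn_integral_cong_AE elim: eventually_mono)

lemma Ynorm_ftv:
 assumes h: "ftv h f"
 shows "Ynorm s f = esssup lborel (%xi. er (norm xi powr s * norm (h xi)))"
proof -
 note [measurable] = ftv_measurable[OF h] fhat_measurable[OF ftv_fhat_is_function[OF h]]
 show ?thesis
 unfolding Ynorm_def using ftv_fhat_is_function[OF h] ftv_fhat[OF h]
 by (auto intro!: esssup_AE_cong elim: eventually_mono)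
qed

lemma tfun_weighted_nth:
 assumes [measurable]: "h \<in> BM"
 and i: "(NN xi. er (norm xi powr - 1 * norm (h xi :: complex^3))) < ic"
 shows "tfun (%xi. h xi $ j)"
proof (rule tfun_weighted)
 have "(NN xi. er (norm xi powr - 1 * norm (h xi $ j))) <= (NN xi. er (norm xi powr - 1 * norm (h xi)))"
 by (intro nn_integral_mono ennreal_leI mult_left_mono norm_vec_nth_le) auto
 then show "(NN xi. er (norm xi powr - 1 * norm (h xi $ j))) < ic" using i by (rule le_less_trans)
qed measurable

lemma ftv_of_Xnorm:
 assumes "Xnorm (- 1) f < ic"
 shows "ftv (fhat f) f"
proof -
 have f: "fhat_is_function f" using assms by (auto simp: Xnorm_def split: if_splits)
 have t: "tfun (%xi. fhat f xi $ i)" for i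
 using assms f by (intro tfun_weighted_nth fhat_measurable) (auto simp: Xnorm_def)
 have "represents (%xi. fhat f xi $ i) (fourier (f $ i))" for i
 using f by (auto simp: fhat_def fhat_is_function_def intro: represents_fun_of)
 with t show ?thesis by (simp add: ftv_def ft_def)
qed

definition field_of :: "(real^3 => complex^3) => tempered^3" where
 "field_of h = (\<chi> i. inv_fourier (dist_of (%xi. h xi $ i)))"

lemma ftv_field_of:
 assumes "h \<in> BM" "(NN xi. er (norm xi powr - 1 * norm (h xi))) < ic"
 shows "ftv h (field_of h)"
 unfolding ftv_def field_of_def using tfun_weighted_nth[OF assms] by (auto intro: ft_inv_fourier)

section \<open>Symbols of the heat flow, the Leray projection, divergence and curl\<close>

lemma ftv_heat:
 assumes h: "ftv h f" and t: "t >= 0"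
 shows "ftv (%xi. exp (- t * (norm xi)\<^sup>2) *R h xi) (heat t f)"
 unfolding ftv_def
proof
 fix i
 have "ft (%xi. cor (exp (- t * (norm xi)\<^sup>2)) * h xi $ i) (heat t f $ i)"
 unfolding heat_def vec_lambda_beta
 by (rule ft_multiplier[where C=1]) (use h t in \<open>auto simp: ftv_def\<close>)
 then show "ft (%xi. (exp (- t * (norm xi)\<^sup>2) *R h xi) $ i) (heat t f $ i)"
 by (simp add: scaleR_conv_of_real[symmetric])
qed

lemma leray_coeff_bound: "\<bar>(if i = j then 1 else 0) - xi $ i * xi $ j / (norm (xi::real^3))\<^sup>2\<bar> <= 2"
proof -
 have "\<bar>xi $ i * xi $ j\<bar> <= (norm xi)\<^sup>2"
 unfolding abs_mult power2_eq_square by (intro mult_mono component_le_norm_cart) auto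
 then have "\<bar>xi $ i * xi $ j / (norm xi)\<^sup>2\<bar> <= 1" by (simp add: abs_divide divide_le_eq_1)
 moreover have "\<bar>(if i = j then 1 else 0) - c\<bar> <= 2" if "\<bar>c\<bar> <= 1" for c :: real using that by auto
 ultimately show ?thesis by blast
qed

definition lproj :: "real^3 => complex^3 => complex^3" where
 "lproj xi v = (\<chi> i. \<Sum>j\<in>UNIV. cor ((if i = j then 1 else 0) - xi $ i * xi $ j / (norm xi)\<^sup>2) * v $ j)"

lemma ftv_leray:
 assumes h: "ftv h f"
 shows "ftv (%xi. lproj xi (h xi)) (leray f)"
 unfolding ftv_def
proof
 fix i
 show "ft (%xi. lproj xi (h xi) $ i) (leray f $ i)"
 unfolding leray_def lproj_def vec_lambda_beta
 by (intro ft_sum ft_multiplier[where C=2]) (use h leray_coeff_bound in \<open>auto simp: ftv_def simp del: of_real_diff\<close>)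
qed

definition dsym :: "real^3 => (3 => 3 => complex) => complex^3" where
 "dsym xi T = (\<chi> i. \<Sum>l\<in>UNIV. \<i> * cor (xi $ l) * T i l)"

lemma ftv_tdiv_mat:
 assumes "!!i j. ft (%xi. T xi i j) (F $ i $ j)"
 shows "ftv (%xi. dsym xi (T xi)) (tdiv_mat F)"
 unfolding ftv_def dsym_def tdiv_mat_def tdiv_def using assms by (auto intro!: ft_sum ft_tderiv)

definition csym :: "real^3 => complex^3 => complex^3" where
 "csym xi v = vector [\<i> * cor (xi $ 2) * v $ 3 - \<i> * cor (xi $ 3) * v $ 2,
 \<i> * cor (xi $ 3) * v $ 1 - \<i> * cor (xi $ 1) * v $ 3,
 \<i> * cor (xi $ 1) * v $ 2 - \<i> * cor (xi $ 2) * v $ 1]"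

lemma ftv_tcurl:
 assumes "ftv h f"
 shows "ftv (%xi. csym xi (h xi)) (tcurl f)"
 using assms unfolding ftv_def csym_def tcurl_def by (auto simp: forall_3 intro!: ft_diff ft_tderiv)

text \<open>For a matrix of products \<open>f_i g_j\<close> this is the cross product, so all
  nonlinear terms are linear in such matrices and convolution enters only through their
  entries.\<close>

definition crossT :: "(3 => 3 => complex) => complex^3" where
 "crossT T = vector [T 2 3 - T 3 2, T 3 1 - T 1 3, T 1 2 - T 2 1]"

lemma ftv_tcross:
 assumes "!!i j. ft (%xi. T xi i j) (tmult (f $ i) (g $ j))"
 shows "ftv (%xi. crossT (T xi)) (tcross f g)"
 using assms unfolding ftv_def crossT_def tcross_def by (auto simp: forall_3 intro!: ft_diff)

abbreviation \<kappa> :: complex where "\<kappa> \<equiv> 1 / cor ((2 * pi) ^ 3)"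

text \<open>The nonlinear term at one pair of frequencies: \<open>a\<close>, \<open>b\<close> are
  velocity and magnetic field at xi - et, the primed arguments those at et. The minus sign of the
  velocity equation is included, so that both equations read heat flow plus Duhamel term.\<close>

definition Nu :: "real^3 => complex^3 => complex^3 => complex^3 => complex^3 => complex^3" where
 "Nu xi a b a' b' = - lproj xi (dsym xi (%j l. \<kappa> * (a $ j * a' $ l)) - dsym xi (%j l. \<kappa> * (b $ j * b' $ l)))"

definition Nb :: "real^3 => complex^3 => complex^3 => complex^3 => complex^3 => complex^3" where
 "Nb xi a b a' b' = csym xi (crossT (%j l. \<kappa> * (a $ j * b' $ l))) - csym xi (dsym xi (%j l. \<kappa> * (b $ j * b' $ l)))"

lemma
 assumes i: "!!j l. integrable M (%et. T et j l)"
 shows integral_dsym: "integrable M (%et. dsym xi (T et))" "(LINT et|M. dsym xi (T et)) = dsym xi (%j l. LINT et|M. T et j l)"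
 and integral_crossT: "integrable M (%et. crossT (T et))" "(LINT et|M. crossT (T et)) = crossT (%j l. LINT et|M. T et j l)"
proof -
 show 1: "integrable M (%et. dsym xi (T et))"
 using i by (intro integrable_vecI) (simp add: dsym_def)
 show "(LINT et|M. dsym xi (T et)) = dsym xi (%j l. LINT et|M. T et j l)"
 using i by (simp add: vec_eq_iff integral_vec_nth[OF 1]) (simp add: dsym_def)
 show 2: "integrable M (%et. crossT (T et))"
 proof (rule integrable_vecI)
 show "integrable M (%et. crossT (T et) $ k)" for k using exhaust_3[of k] i by (auto simp: crossT_def)
 qed
 show "(LINT et|M. crossT (T et)) = crossT (%j l. LINT et|M. T et j l)"
 using i by (simp add: vec_eq_iff integral_vec_nth[OF 2] forall_3) (simp add: crossT_def)
qed

lemma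
 fixes v :: "'a => complex^3"
 assumes i: "integrable M v"
 shows integral_csym: "integrable M (%et. csym xi (v et))" "(LINT et|M. csym xi (v et)) = csym xi (LINT et|M. v et)"
 and integral_lproj: "integrable M (%et. lproj xi (v et))" "(LINT et|M. lproj xi (v et)) = lproj xi (LINT et|M. v et)"
proof -
 note j = integrable_vec_nth[OF i]
 show 1: "integrable M (%et. csym xi (v et))"
 proof (rule integrable_vecI)
 show "integrable M (%et. csym xi (v et) $ k)" for k using exhaust_3[of k] j by (auto simp: csym_def)
 qed
 show "(LINT et|M. csym xi (v et)) = csym xi (LINT et|M. v et)"
 using j by (simp add: vec_eq_iff integral_vec_nth[OF 1] forall_3) (simp add: csym_def integral_vec_nth[OF i])
 show 2: "integrable M (%et. lproj xi (v et))"
 using j by (intro integrable_vecI) (simp add: lproj_def)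
 show "(LINT et|M. lproj xi (v et)) = lproj xi (LINT et|M. v et)"
 using j by (simp add: vec_eq_iff integral_vec_nth[OF 2]) (simp add: lproj_def integral_vec_nth[OF i])
qed

lemma
 assumes aa: "!!j l. integrable M (%et. a et $ j * a' et $ l)"
 and bb: "!!j l. integrable M (%et. b et $ j * b' et $ l)"
 and ab: "!!j l. integrable M (%et. a et $ j * b' et $ l)"
 shows integral_Nu: "(LINT et|M. Nu xi (a et) (b et) (a' et) (b' et)) =
 - lproj xi (dsym xi (%j l. \<kappa> * (LINT et|M. a et $ j * a' et $ l)) - dsym xi (%j l. \<kappa> * (LINT et|M. b et $ j * b' et $ l)))"
 and integrable_Nu: "integrable M (%et. Nu xi (a et) (b et) (a' et) (b' et))"
 and integral_Nb: "(LINT et|M. Nb xi (a et) (b et) (a' et) (b' et)) =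
 csym xi (crossT (%j l. \<kappa> * (LINT et|M. a et $ j * b' et $ l))) - csym xi (dsym xi (%j l. \<kappa> * (LINT et|M. b et $ j * b' et $ l)))"
 and integrable_Nb: "integrable M (%et. Nb xi (a et) (b et) (a' et) (b' et))"
proof -
 note k = integrable_mult_right[of \<kappa>, OF aa] integrable_mult_right[of \<kappa>, OF bb] integrable_mult_right[of \<kappa>, OF ab]
 have e: "(LINT et|M. \<kappa> * (x et)) = \<kappa> * (LINT et|M. x et)" for x by (rule integral_mult_right_zero)
 have d: "integrable M (%et. dsym xi (%j l. \<kappa> * (a et $ j * a' et $ l)) - dsym xi (%j l. \<kappa> * (b et $ j * b' et $ l)))"
 by (intro Bochner_Integration.integrable_diff integral_dsym k)
 show "(LINT et|M. Nu xi (a et) (b et) (a' et) (b' et)) =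
 - lproj xi (dsym xi (%j l. \<kappa> * (LINT et|M. a et $ j * a' et $ l)) - dsym xi (%j l. \<kappa> * (LINT et|M. b et $ j * b' et $ l)))"
 unfolding Nu_def Bochner_Integration.integral_minus integral_lproj(2)[OF d]
 Bochner_Integration.integral_diff[OF integral_dsym(1)[OF k(1)] integral_dsym(1)[OF k(2)]]
 integral_dsym(2)[OF k(1)] integral_dsym(2)[OF k(2)] e ..
 show "integrable M (%et. Nu xi (a et) (b et) (a' et) (b' et))"
 unfolding Nu_def by (intro Bochner_Integration.integrable_minus integral_lproj(1)[OF d])
 show "(LINT et|M. Nb xi (a et) (b et) (a' et) (b' et)) =
 csym xi (crossT (%j l. \<kappa> * (LINT et|M. a et $ j * b' et $ l))) - csym xi (dsym xi (%j l. \<kappa> * (LINT et|M. b et $ j * b' et $ l)))"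
 unfolding Nb_def
 Bochner_Integration.integral_diff[OF integral_csym(1)[OF integral_crossT(1)[OF k(3)]] integral_csym(1)[OF integral_dsym(1)[OF k(2)]]]
 integral_csym(2)[OF integral_crossT(1)[OF k(3)]] integral_csym(2)[OF integral_dsym(1)[OF k(2)]]
 integral_dsym(2)[OF k(2)] integral_crossT(2)[OF k(3)] e ..
 show "integrable M (%et. Nb xi (a et) (b et) (a' et) (b' et))"
 unfolding Nb_def by (intro Bochner_Integration.integrable_diff integral_csym(1) integral_crossT(1) integral_dsym(1) k)
qed

section \<open>Convolution form of the nonlinear terms\<close>

lemma conv_products_AE:
 assumes a: "integrable lborel a" and b: "integrable lborel b"
 shows "AL xi. \<forall>j l. integrable lborel (%et. (a :: real^3 => complex^3) (xi - et) $ j * (b :: real^3 => complex^3) et $ l)"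
 using conv_integrable_AE[OF integrable_vec_nth[OF a] integrable_vec_nth[OF b]]
 by (intro AE_all_countable[THEN iffD2] allI)

lemma lproj_measurable [measurable (raw)]:
 assumes [measurable]: "x \<in> borel_measurable M" "v \<in> borel_measurable M"
 shows "(%w. lproj (x w) (v w)) \<in> borel_measurable M"
 unfolding lproj_def by measurable

lemma csym_measurable [measurable (raw)]:
 assumes [measurable]: "x \<in> borel_measurable M" "v \<in> borel_measurable M"
 shows "(%w. csym (x w) (v w)) \<in> borel_measurable M"
 by (rule vec_measurableI, rule forall_3[THEN iffD2, THEN spec]) (simp add: csym_def)

lemma dsym_measurable [measurable (raw)]:
 assumes [measurable]: "x \<in> borel_measurable M" "!!i j. (%w. T w i j) \<in> borel_measurable M"
 shows "(%w. dsym (x w) (T w)) \<in> borel_measurable M"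
 unfolding dsym_def by measurable

lemma crossT_measurable [measurable (raw)]:
 assumes [measurable]: "!!i j. (%w. T w i j) \<in> borel_measurable M"
 shows "(%w. crossT (T w)) \<in> borel_measurable M"
 by (rule vec_measurableI, rule forall_3[THEN iffD2, THEN spec]) (simp add: crossT_def)

lemma Nu_measurable [measurable (raw)]:
 assumes [measurable]: "x \<in> borel_measurable M" "a \<in> borel_measurable M" "b \<in> borel_measurable M"
 "a' \<in> borel_measurable M" "b' \<in> borel_measurable M"
 shows "(%w. Nu (x w) (a w) (b w) (a' w) (b' w)) \<in> borel_measurable M"
 unfolding Nu_def by measurable

lemma Nb_measurable [measurable (raw)]:
 assumes [measurable]: "x \<in> borel_measurable M" "a \<in> borel_measurable M" "b \<in> borel_measurable M"
 "a' \<in> borel_measurable M" "b' \<in> borel_measurable M"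
 shows "(%w. Nb (x w) (a w) (b w) (a' w) (b' w)) \<in> borel_measurable M"
 unfolding Nb_def by measurable

definition conv_Nu :: "(real^3 => complex^3) => (real^3 => complex^3) => real^3 => complex^3" where
 "conv_Nu a b xi = (LINT et|lborel. Nu xi (a (xi - et)) (b (xi - et)) (a et) (b et))"

definition conv_Nb :: "(real^3 => complex^3) => (real^3 => complex^3) => real^3 => complex^3" where
 "conv_Nb a b xi = (LINT et|lborel. Nb xi (a (xi - et)) (b (xi - et)) (a et) (b et))"

lemma conv_Nu_measurable [measurable]:
 assumes [measurable]: "a \<in> BM" "b \<in> BM"
 shows "conv_Nu a b \<in> BM"
 unfolding conv_Nu_def[abs_def] by (rule lborel.borel_measurable_lebesgue_integral) measurable

lemma conv_Nb_measurable [measurable]: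
 assumes [measurable]: "a \<in> BM" "b \<in> BM"
 shows "conv_Nb a b \<in> BM"
 unfolding conv_Nb_def[abs_def] by (rule lborel.borel_measurable_lebesgue_integral) measurable

text \<open>The symbols depend only on xi, so they move under the convolution integral, and the
  whole nonlinearity becomes one integral of \<open>Nu\<close> or \<open>Nb\<close>. The identity
  holds at almost every xi, where all the convolutions converge absolutely.\<close>

lemma ftv_integrands:
 assumes f: "ftv a (u ta)" "integrable lborel a" and g: "ftv b (B ta)" "integrable lborel b" and t: "ta <= t"
 shows "ftv (%xi. - (exp (- (t - ta) * (norm xi)\<^sup>2) *R conv_Nu a b xi)) (u_integrand u B t ta)"
 and "ftv (%xi. exp (- (t - ta) * (norm xi)\<^sup>2) *R conv_Nb a b xi) (B_integrand u B t ta)"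
proof -
 note [measurable] = ftv_measurable[OF f(1)] ftv_measurable[OF g(1)]
 have ia: "integrable lborel (%xi. a xi $ i)" and ib: "integrable lborel (%xi. b xi $ i)" for i
 using f(2) g(2) integrable_vec_nth by auto
 have fa: "ft (%xi. a xi $ i) (u ta $ i)" and fb: "ft (%xi. b xi $ i) (B ta $ i)" for i
 using f(1) g(1) by (auto simp: ftv_def)
 let ?aa = "%xi j l. cconv (%xi. a xi $ j) (%xi. a xi $ l) xi"
 let ?bb = "%xi j l. cconv (%xi. b xi $ j) (%xi. b xi $ l) xi"
 let ?ab = "%xi j l. cconv (%xi. a xi $ j) (%xi. b xi $ l) xi"
 have 1: "ft (%xi. ?aa xi j l) (tmult (u ta $ j) (u ta $ l))"
 and 2: "ft (%xi. ?bb xi j l) (tmult (B ta $ j) (B ta $ l))"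
 and 3: "ft (%xi. ?ab xi j l) (tmult (u ta $ j) (B ta $ l))" for j l
 using ft_tmult[OF fa ia fa ia] ft_tmult[OF fb ib fb ib] ft_tmult[OF fa ia fb ib] by simp_all
 have du: "ftv (%xi. dsym xi (?aa xi)) (tdiv_mat (ttensor (u ta) (u ta)))"
 and db: "ftv (%xi. dsym xi (?bb xi)) (tdiv_mat (ttensor (B ta) (B ta)))"
 by (rule ftv_tdiv_mat, simp add: ttensor_def 1 2)+
 have cr: "ftv (%xi. crossT (?ab xi)) (tcross (u ta) (B ta))" by (rule ftv_tcross[OF 3])
 have hu: "ftv (%xi. exp (- (t - ta) * (norm xi)\<^sup>2) *R lproj xi (dsym xi (?aa xi) - dsym xi (?bb xi))) (u_integrand u B t ta)"
 unfolding u_integrand_def using t by (intro ftv_heat ftv_leray ftv_diff du db) simp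
 have hb: "ftv (%xi. exp (- (t - ta) * (norm xi)\<^sup>2) *R (csym xi (crossT (?ab xi)) - csym xi (dsym xi (?bb xi)))) (B_integrand u B t ta)"
 unfolding B_integrand_def using t by (intro ftv_heat ftv_diff ftv_tcurl du db cr) simp
 have ae: "AL xi. conv_Nu a b xi = - lproj xi (dsym xi (?aa xi) - dsym xi (?bb xi)) &
 conv_Nb a b xi = csym xi (crossT (?ab xi)) - csym xi (dsym xi (?bb xi))"
 using conv_products_AE[OF f(2) f(2)] conv_products_AE[OF g(2) g(2)] conv_products_AE[OF f(2) g(2)]
 proof eventually_elim
 case (elim xi)
 then show ?case unfolding conv_Nu_def conv_Nb_def cconv_def
 by (intro conjI integral_Nu integral_Nb) auto
 qed
 show "ftv (%xi. - (exp (- (t - ta) * (norm xi)\<^sup>2) *R conv_Nu a b xi)) (u_integrand u B t ta)"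
 by (rule ftv_cong_AE[OF hu]) (measurable, use ae in \<open>auto elim: eventually_mono\<close>)
 show "ftv (%xi. exp (- (t - ta) * (norm xi)\<^sup>2) *R conv_Nb a b xi) (B_integrand u B t ta)"
 by (rule ftv_cong_AE[OF hb]) (measurable, use ae in \<open>auto elim: eventually_mono\<close>)
qed

subsection \<open>The bilinear symbols\<close>

lemma lproj_add: "lproj xi (v + w) = lproj xi v + lproj xi w"
 by (simp add: lproj_def vec_eq_iff distrib_left sum.distrib)

lemma Nu_diff: "Nu xi a b c d - Nu xi a' b' c' d' = Nu xi (a - a') (b - b') c d + Nu xi a' b' (c - c') (d - d')"
proof -
 have "dsym xi (%j l. \<kappa> * (a $ j * c $ l)) - dsym xi (%j l. \<kappa> * (a' $ j * c' $ l)) =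
 dsym xi (%j l. \<kappa> * ((a - a') $ j * c $ l)) + dsym xi (%j l. \<kappa> * (a' $ j * (c - c') $ l))" for a a' c c' :: "complex^3"
 proof -
 obtain k where k: "\<kappa> = k" by blast
 show ?thesis unfolding k by (simp add: dsym_def vec_eq_iff sum_subtractf[symmetric] sum.distrib[symmetric]) (simp add: algebra_simps)
 qed
 note * = this[of a c a' c'] this[of b d b' d']
 have l: "- lproj xi v - - lproj xi v' = - lproj xi w + - lproj xi w'" if "v - v' = w + w'" for v v' w w'
 proof -
 have "v + (- v') = w + w'" using that by simp
 then have "lproj xi v + lproj xi (- v') = lproj xi w + lproj xi w'" by (metis lproj_add)
 moreover have "lproj xi (- v') = - lproj xi v'" by (simp add: lproj_def vec_eq_iff sum_negf)
 ultimately show ?thesis by (simp add: algebra_simps)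
 qed
 show ?thesis unfolding Nu_def
 by (rule l) (use * in \<open>simp add: algebra_simps\<close>)
qed

lemma Nb_diff: "Nb xi a b c d - Nb xi a' b' c' d' = Nb xi (a - a') (b - b') c d + Nb xi a' b' (c - c') (d - d')"
proof -
 obtain k where k: "\<kappa> = k" by blast
 show ?thesis unfolding vec_eq_iff forall_3 Nb_def k
 by (simp add: csym_def crossT_def dsym_def sum_3) (simp add: algebra_simps)
qed

text \<open>The number 54 = 3 * 6 * 3 is the loss in \<open>norm_Nu_le\<close>: three terms of the
  divergence, 6 for the Leray projection, three components. The factor \<kappa> of the convolution
  absorbs it, so both symbols are bounded with constant 1.\<close>

lemma two_pi_cube: "54 <= (2 * pi) ^ 3"
proof -
 have "(6::real) ^ 3 <= (2 * pi) ^ 3" using pi_gt3 by (intro power_mono) auto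
 then show ?thesis by simp
qed

lemma kappa_bound: "54 * (cmod \<kappa> * x) <= x" if "x >= 0"
proof -
 have "cmod \<kappa> * 54 <= 1" using two_pi_cube by (simp add: norm_divide norm_power norm_mult divide_le_eq)
 then show ?thesis using mult_right_mono[of "cmod \<kappa> * 54" 1 x] that by (simp add: mult_ac)
qed

lemma norm_dsym_le: "norm (dsym xi (%j l. \<kappa> * (a $ j * b $ l)) $ i) <= 3 * (cmod \<kappa> * (norm xi * norm a * norm b))"
proof -
 have "norm (dsym xi (%j l. \<kappa> * (a $ j * b $ l)) $ i) <= (\<Sum>l\<in>UNIV. norm (\<i> * cor (xi $ l) * (\<kappa> * (a $ i * b $ l))))"
 unfolding dsym_def vec_lambda_beta by (rule norm_sum)
 also have "... <= (\<Sum>l\<in>(UNIV::3 set). cmod \<kappa> * (norm xi * norm a * norm b))"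
 proof (rule sum_mono)
 fix l :: 3
 have "\<bar>xi $ l\<bar> * (norm (a $ i) * norm (b $ l)) <= norm xi * (norm a * norm b)"
 by (intro mult_mono component_le_norm_cart norm_vec_nth_le) auto
 then have "cmod \<kappa> * (\<bar>xi $ l\<bar> * (norm (a $ i) * norm (b $ l))) <= cmod \<kappa> * (norm xi * (norm a * norm b))"
 by (rule mult_left_mono) simp
 then show "norm (\<i> * cor (xi $ l) * (\<kappa> * (a $ i * b $ l))) <= cmod \<kappa> * (norm xi * norm a * norm b)"
 by (simp only: norm_mult norm_ii norm_of_real mult_1 mult_ac)
 qed
 finally show ?thesis by simp
qed

lemma norm_csym_le:
 assumes "!!i. norm (v $ i) <= C"
 shows "norm (csym xi v $ i) <= 2 * (norm xi * C)"
proof -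
 have m: "norm (\<i> * cor (xi $ l) * v $ j) <= norm xi * C" for l j
 unfolding norm_mult norm_ii norm_of_real mult_1 by (intro mult_mono component_le_norm_cart assms) auto
 have "norm (x - y) <= 2 * (norm xi * C)" if "norm x <= norm xi * C" "norm y <= norm xi * C" for x y :: complex
 using norm_triangle_ineq4[of x y] that by linarith
 then show ?thesis using exhaust_3[of i] m by (auto simp: csym_def)
qed

lemma norm_lproj_le:
 assumes "!!i. norm (v $ i) <= C"
 shows "norm (lproj xi v $ i) <= 6 * C"
proof -
 have "norm (lproj xi v $ i) <= (\<Sum>j\<in>UNIV. norm (cor ((if i = j then 1 else 0) - xi $ i * xi $ j / (norm xi)\<^sup>2) * v $ j))"
 unfolding lproj_def vec_lambda_beta by (rule norm_sum)
 also have "... <= (\<Sum>j\<in>(UNIV::3 set). 2 * C)"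
 unfolding norm_mult norm_of_real by (intro sum_mono mult_mono leray_coeff_bound assms) auto
 finally show ?thesis by simp
qed

lemma norm_Nu_le: "norm (Nu xi a b a' b') <= norm xi * (norm a * norm a' + norm b * norm b')"
proof -
 let ?A = "norm xi * norm a * norm a'" and ?B = "norm xi * norm b * norm b'"
 let ?d = "dsym xi (%j l. \<kappa> * (a $ j * a' $ l)) - dsym xi (%j l. \<kappa> * (b $ j * b' $ l))"
 have "norm (?d $ i) <= 3 * (cmod \<kappa> * (?A + ?B))" for i
 using norm_triangle_ineq4[of "dsym xi (%j l. \<kappa> * (a $ j * a' $ l)) $ i" "dsym xi (%j l. \<kappa> * (b $ j * b' $ l)) $ i"]
 norm_dsym_le[of xi a a' i] norm_dsym_le[of xi b b' i] by (simp add: distrib_left)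
 then have c: "norm (lproj xi ?d $ i) <= 6 * (3 * (cmod \<kappa> * (?A + ?B)))" for i by (rule norm_lproj_le)
 have "norm (Nu xi a b a' b') = norm (lproj xi ?d)" by (simp add: Nu_def)
 also have "... <= (\<Sum>i\<in>UNIV. norm (lproj xi ?d $ i))" by (rule norm_vec_le_sum)
 also have "... <= (\<Sum>i\<in>(UNIV::3 set). 6 * (3 * (cmod \<kappa> * (?A + ?B))))" by (intro sum_mono c)
 also have "... = 54 * (cmod \<kappa> * (?A + ?B))" by simp
 also have "... <= ?A + ?B" by (rule kappa_bound) simp
 finally show ?thesis by (simp add: algebra_simps)
qed

lemma norm_Nb_le: "norm (Nb xi a b a' b') <= norm xi * (norm a * norm b') + (norm xi)\<^sup>2 * (norm b * norm b')"
proof -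
 let ?A = "norm a * norm b'" and ?B = "norm xi * norm b * norm b'"
 let ?c = "csym xi (crossT (%j l. \<kappa> * (a $ j * b' $ l)))" and ?d = "csym xi (dsym xi (%j l. \<kappa> * (b $ j * b' $ l)))"
 have p: "norm (\<kappa> * (a $ j * b' $ l)) <= cmod \<kappa> * ?A" for j l
 unfolding norm_mult by (intro mult_left_mono mult_mono norm_vec_nth_le) auto
 have "norm (x - y) <= 2 * (cmod \<kappa> * ?A)" if "norm x <= cmod \<kappa> * ?A" "norm y <= cmod \<kappa> * ?A" for x y :: complex
 using norm_triangle_ineq4[of x y] that by linarith
 then have "norm (crossT (%j l. \<kappa> * (a $ j * b' $ l)) $ i) <= 2 * (cmod \<kappa> * ?A)" for i
 using exhaust_3[of i] p unfolding crossT_def by (elim disjE) (simp_all only: vector_3)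
 then have c: "norm (?c $ i) <= 2 * (norm xi * (2 * (cmod \<kappa> * ?A)))" for i by (rule norm_csym_le)
 have d: "norm (?d $ i) <= 2 * (norm xi * (3 * (cmod \<kappa> * ?B)))" for i by (rule norm_csym_le[OF norm_dsym_le])
 have "norm (Nb xi a b a' b') <= norm ?c + norm ?d" unfolding Nb_def by (rule norm_triangle_ineq4)
 also have "... <= (\<Sum>i\<in>UNIV. norm (?c $ i)) + (\<Sum>i\<in>UNIV. norm (?d $ i))" by (intro add_mono norm_vec_le_sum)
 also have "... <= (\<Sum>i\<in>(UNIV::3 set). 2 * (norm xi * (2 * (cmod \<kappa> * ?A)))) + (\<Sum>i\<in>(UNIV::3 set). 2 * (norm xi * (3 * (cmod \<kappa> * ?B))))"
 by (intro add_mono sum_mono c d)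
 also have "... = 12 * (cmod \<kappa> * (norm xi * ?A)) + 18 * (cmod \<kappa> * (norm xi * ?B))" by simp
 also have "... <= 54 * (cmod \<kappa> * (norm xi * ?A)) + 54 * (cmod \<kappa> * (norm xi * ?B))" by (intro add_mono mult_right_mono) auto
 also have "... <= norm xi * ?A + norm xi * ?B" by (intro add_mono kappa_bound) auto
 finally show ?thesis by (simp add: power2_eq_square mult_ac)
qed

section \<open>Divergence and conjugation symmetry of the symbols\<close>

lemma csym_div_free: "(\<Sum>i\<in>UNIV. cor (xi $ i) * csym xi v $ i) = 0"
 by (simp add: csym_def sum_3 algebra_simps)

lemma lproj_div_free:
 assumes "xi ~= 0"
 shows "(\<Sum>i\<in>UNIV. cor (xi $ i) * lproj xi v $ i) = 0"
proof -
 have n: "(norm xi)\<^sup>2 = xi $ 1 * xi $ 1 + xi $ 2 * xi $ 2 + xi $ 3 * xi $ 3"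
 by (simp add: power2_norm_eq_inner inner_vec_def sum_3)
 have col: "(\<Sum>i\<in>UNIV. xi $ i * ((if i = j then 1 else 0) - xi $ i * xi $ j / (norm xi)\<^sup>2)) = 0" for j
 proof -
 have "(\<Sum>i\<in>UNIV. xi $ i * ((if i = j then 1 else 0) - xi $ i * xi $ j / (norm xi)\<^sup>2)) = (\<Sum>i\<in>UNIV. (if i = j then xi $ i else 0) - xi $ i * xi $ i * (xi $ j / (norm xi)\<^sup>2))"
 by (intro sum.cong) (auto simp: right_diff_distrib)
 also have "... = xi $ j - (\<Sum>i\<in>UNIV. xi $ i * xi $ i) * (xi $ j / (norm xi)\<^sup>2)"
 unfolding sum_subtractf sum_distrib_right[symmetric] by simp
 also have "(\<Sum>i\<in>UNIV. xi $ i * xi $ i) = (norm xi)\<^sup>2" by (simp add: power2_norm_eq_inner inner_vec_def)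
 finally show ?thesis using assms by simp
 qed
 have "(\<Sum>i\<in>UNIV. cor (xi $ i) * lproj xi v $ i) =
 (\<Sum>j\<in>UNIV. cor (\<Sum>i\<in>UNIV. xi $ i * ((if i = j then 1 else 0) - xi $ i * xi $ j / (norm xi)\<^sup>2)) * v $ j)"
 unfolding lproj_def vec_lambda_beta sum_distrib_left of_real_sum sum_distrib_right
 by (subst sum.swap) (simp add: mult.assoc)
 then show ?thesis unfolding col by simp
qed

lemma Nu_div_free: "xi ~= 0 ==> (\<Sum>i\<in>UNIV. cor (xi $ i) * Nu xi a b a' b' $ i) = 0"
 unfolding Nu_def using lproj_div_free by (simp add: sum_negf)

lemma Nb_div_free: "(\<Sum>i\<in>UNIV. cor (xi $ i) * Nb xi a b a' b' $ i) = 0"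
 unfolding Nb_def using csym_div_free by (simp add: right_diff_distrib sum_subtractf)

definition vcnj :: "complex^3 => complex^3" where "vcnj v = (\<chi> i. cnj (v $ i))"

lemma vcnj_nth [simp]: "vcnj v $ i = cnj (v $ i)"
 by (simp add: vcnj_def)

lemma norm_vcnj [simp]: "norm (vcnj v) = norm v"
 by (simp add: norm_vec_def)

lemma bounded_linear_vcnj: "bounded_linear vcnj"
 by (rule bounded_linear_intro[where K=1]) (auto simp: vec_eq_iff)

lemma integral_vcnj: "(LINT x|M. vcnj (f x)) = vcnj (LINT x|M. f x)"
 by (rule integral_bounded_linear'[OF bounded_linear_vcnj bounded_linear_vcnj]) (simp add: vec_eq_iff)

lemma Nu_cnj: "Nu (- xi) (vcnj a) (vcnj b) (vcnj a') (vcnj b') = vcnj (Nu xi a b a' b')"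
 by (simp add: Nu_def lproj_def dsym_def vec_eq_iff sum_3)

lemma Nb_cnj: "Nb (- xi) (vcnj a) (vcnj b) (vcnj a') (vcnj b') = vcnj (Nb xi a b a' b')"
 unfolding vec_eq_iff forall_3 by (simp add: Nb_def csym_def crossT_def dsym_def sum_3)

lemma real_field_ftvI:
 assumes "ftv h f" "!!xi. h (- xi) = vcnj (h xi)"
 shows "real_field f"
 unfolding real_field_def
proof
 fix i
 show "real_dist (f $ i)" by (rule real_dist_ftI[of "%xi. h xi $ i"]) (use assms in \<open>auto simp: ftv_def\<close>)
qed

lemma real_field_ftvD:
 assumes "ftv h f" "real_field f"
 shows "AL xi. h (- xi) = vcnj (h xi)"
proof -
 have "AL xi. h xi $ i = cnj (h (- xi) $ i)" for i
 using assms by (intro real_dist_ftD[of "%xi. h xi $ i"]) (auto simp: ftv_def real_field_def)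
 then have "AL xi. \<forall>i. h xi $ i = cnj (h (- xi) $ i)" by (intro AE_all_countable[THEN iffD2] allI)
 then show ?thesis by eventually_elim (simp add: vec_eq_iff)
qed

lemma ft_tdiv: "ftv h f ==> ft (%xi. \<Sum>i\<in>UNIV. \<i> * cor (xi $ i) * h xi $ i) (tdiv f)"
 unfolding tdiv_def ftv_def by (intro ft_sum ft_tderiv) auto

lemma tdiv_zero_ftvI:
 assumes h: "ftv h f" and z: "AL xi. (\<Sum>i\<in>UNIV. cor (xi $ i) * h xi $ i) = 0"
 shows "tdiv f = 0"
proof (rule ft_inj[OF _ ft_zero])
 show "ft (%_. 0) (tdiv f)"
 by (rule ft_cong_AE[OF ft_tdiv[OF h]])
 (use z in \<open>auto elim!: eventually_mono simp: mult.assoc sum_distrib_left[symmetric]\<close>)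
qed

lemma tdiv_zero_ftvD:
 assumes h: "ftv h f" and z: "tdiv f = 0"
 shows "AL xi. (\<Sum>i\<in>UNIV. cor (xi $ i) * h xi $ i) = 0"
proof -
 have "AL xi. (\<Sum>i\<in>UNIV. \<i> * cor (xi $ i) * h xi $ i) = 0"
 using ft_unique[OF ft_tdiv[OF h]] ft_zero z by simp
 then show ?thesis by eventually_elim (simp add: mult.assoc sum_distrib_left[symmetric])
qed

section \<open>Majorants\<close>

text \<open>Joint Borel measurability of a function of two arguments, mostly time and frequency; it
  permits exchanging the integrals over the two.\<close>

definition jm :: "('a::topological_space => 'b::topological_space => 'c::topological_space) => bool" where
 "jm u \<longleftrightarrow> case_prod u \<in> borel_measurable (borel \<Otimes>\<^sub>M borel)"

lemma jm_compose: "jm u ==> f \<in> borel_measurable M ==> g \<in> borel_measurable M ==> (%w. u (f w) (g w)) \<in> borel_measurable M"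
 unfolding jm_def using measurable_compose[OF measurable_Pair[of f M borel g borel], of "case_prod u" borel] by simp

lemma jmI: "(%w. u (fst w) (snd w)) \<in> borel_measurable (borel \<Otimes>\<^sub>M borel) ==> jm u"
 by (simp add: jm_def case_prod_beta')

lemma jm_slice: "jm u ==> u t \<in> BM"
 using jm_compose[of u "%_. t" borel "%x. x"] by simp

lemma AE_reflect:
 fixes P :: "'a::euclidean_space => bool"
 assumes "AL x. P x"
 shows "AL x. P (t - x)"
proof -
 obtain N where N: "N \<in> null_sets lborel" "{x. \<not> P x} \<subseteq> N"
 using assms by (auto simp: eventually_ae_filter)
 have [measurable]: "N \<in> sets borel" using N by auto
 have "(NN x. ind N (t - x)) = (NN x. ind N x)"
 by (rule nn_integral_reflect) measurable
 also have "... = 0" using null_setsD1[OF N(1)] by simp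
 finally have "AL x. (ind N (t - x) :: ennreal) = 0"
 by (subst (asm) nn_integral_0_iff_AE) auto
 then show ?thesis by eventually_elim (use N in \<open>auto simp: indicator_def split: if_splits\<close>)
qed

text \<open>The gain when a product of two majorized functions is integrated in time, see
  \<open>time_product\<close>.\<close>

definition kap1 :: "real^3 => real^3 => ennreal" where
 "kap1 ze et = er (min (norm ze) (norm et) / max (norm ze) (norm et))"

text \<open>What remains of \<open>kap1\<close> after one more factor |ze + et| <= 2 max(|ze|,|et|);
  it serves the Hall term.\<close>

definition kap2 :: "real^3 => real^3 => ennreal" where
 "kap2 ze et = er (2 * min (norm ze) (norm et))"

lemma jm_kap1: "jm kap1" and jm_kap2: "jm kap2"
 unfolding kap1_def[abs_def] kap2_def[abs_def] by (rule jmI, measurable)+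

definition kconv :: "(real^3 => real^3 => ennreal) => (real^3 => ennreal) => (real^3 => ennreal) => real^3 => ennreal" where
 "kconv k f g xi = (NN et. k (xi - et) et * (f (xi - et) * g et))"

lemma kconv_measurable:
 assumes k: "jm k" and [measurable]: "f \<in> BM" "g \<in> BM"
 shows "kconv k f g \<in> BM"
proof -
 note [measurable (raw)] = jm_compose[OF k]
 show ?thesis unfolding kconv_def[abs_def] by measurable
qed

lemmas kconv1_measurable [measurable (raw)] = kconv_measurable[OF jm_kap1]

lemmas kconv2_measurable [measurable (raw)] = kconv_measurable[OF jm_kap2]

lemma kconv_mono:
 "AL x. f x <= f' x ==> AL x. g x <= g' x ==> kconv k f g xi <= kconv k f' g' xi"
 unfolding kconv_def
proof (rule nn_integral_mono_AE)
 assume "AL x. f x <= f' x" and g: "AL x. g x <= g' x"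
 then have "AL et. f (xi - et) <= f' (xi - et)" by (intro AE_reflect)
 then show "AL et. k (xi - et) et * (f (xi - et) * g et) <= k (xi - et) et * (f' (xi - et) * g' et)"
 using g by eventually_elim (intro mult_left_mono mult_mono, auto)
qed

lemma nn_integral_shear:
 fixes H :: "real^3 => real^3 => ennreal"
 assumes H: "jm H"
 shows "(NN xi. (NN et. H (xi - et) et)) = (NN et. (NN ze. H ze et))"
proof -
 note [measurable (raw)] = jm_compose[OF H]
 have "(NN xi. (NN et. H (xi - et) et)) = (NN et. (NN xi. H (xi - et) et))"
 by (rule lborel_pair.Fubini'[symmetric]) measurable
 also have "... = (NN et. (NN ze. H ze et))"
 proof (rule nn_integral_cong)
 fix et
 have "(NN xi. H (- et + xi) et) = (NN ze. H ze et)"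
 by (rule nn_integral_translate) measurable
 then show "(NN xi. H (xi - et) et) = (NN ze. H ze et)" by simp
 qed
 finally show ?thesis .
qed

lemma nn_integral_product_bound:
 fixes \<alpha> \<beta> \<gamma> \<delta> f g :: "real^3 => ennreal"
 assumes [measurable]: "f \<in> BM" "g \<in> BM"
 "\<alpha> \<in> BM" "\<beta> \<in> BM" "\<gamma> \<in> BM" "\<delta> \<in> BM"
 and le: "!!ze et. ze ~= 0 ==> et ~= 0 ==> H ze et <= \<alpha> ze * \<beta> et + \<gamma> ze * \<delta> et"
 shows "(NN et. (NN ze. H ze et * (f ze * g et))) <=
 (NN ze. \<alpha> ze * f ze) * (NN et. \<beta> et * g et) + (NN ze. \<gamma> ze * f ze) * (NN et. \<delta> et * g et)"
proof -
 have "(NN et. (NN ze. H ze et * (f ze * g et))) <=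
 (NN et. (NN ze. (\<alpha> ze * f ze) * (\<beta> et * g et) + (\<gamma> ze * f ze) * (\<delta> et * g et)))"
 proof (rule nn_integral_mono_AE)
 show "AL et. (NN ze. H ze et * (f ze * g et)) <= (NN ze. (\<alpha> ze * f ze) * (\<beta> et * g et) + (\<gamma> ze * f ze) * (\<delta> et * g et))"
 using AE_nonzero
 proof eventually_elim
 case (elim et)
 show ?case
 proof (rule nn_integral_mono_AE)
 show "AL ze. H ze et * (f ze * g et) <= (\<alpha> ze * f ze) * (\<beta> et * g et) + (\<gamma> ze * f ze) * (\<delta> et * g et)"
 using AE_nonzero
 proof eventually_elim
 fix ze :: "real^3" assume "ze ~= 0"
 then have "H ze et * (f ze * g et) <= (\<alpha> ze * \<beta> et + \<gamma> ze * \<delta> et) * (f ze * g et)"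
 using elim by (intro mult_right_mono le) auto
 then show "H ze et * (f ze * g et) <= (\<alpha> ze * f ze) * (\<beta> et * g et) + (\<gamma> ze * f ze) * (\<delta> et * g et)"
 by (simp only: distrib_left distrib_right mult_ac)
 qed
 qed
 qed
 qed
 also have "... = (NN et. (NN ze. \<alpha> ze * f ze) * (\<beta> et * g et) + (NN ze. \<gamma> ze * f ze) * (\<delta> et * g et))"
 by (simp add: nn_integral_add nn_integral_multc)
 also have "... = (NN ze. \<alpha> ze * f ze) * (NN et. \<beta> et * g et) + (NN ze. \<gamma> ze * f ze) * (NN et. \<delta> et * g et)"
 by (simp add: nn_integral_add nn_integral_cmult)
 finally show ?thesis .
qed

text \<open>The shear (xi, et) -> (xi - et, et) separates the two factors. Once weight times kernel
  is bounded by a sum of two products, the weighted integral of the convolution splits into products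
  of weighted integrals; only this pointwise bound differs between the estimates below.\<close>

lemma kconv_weighted:
 assumes k: "jm k" and w[measurable]: "w \<in> BM"
 and [measurable]: "f \<in> BM" "g \<in> BM"
 "\<alpha> \<in> BM" "\<beta> \<in> BM" "\<gamma> \<in> BM" "\<delta> \<in> BM"
 and le: "!!ze et. ze ~= 0 ==> et ~= 0 ==> w (ze + et) * k ze et <= \<alpha> ze * \<beta> et + \<gamma> ze * \<delta> et"
 shows "(NN xi. w xi * kconv k f g xi) <=
 (NN ze. \<alpha> ze * f ze) * (NN et. \<beta> et * g et) + (NN ze. \<gamma> ze * f ze) * (NN et. \<delta> et * g et)"
proof -
 note [measurable (raw)] = jm_compose[OF k]
 let ?H = "%ze et. w (ze + et) * k ze et * (f ze * g et)"
 have "(NN xi. w xi * kconv k f g xi) = (NN xi. (NN et. ?H (xi - et) et))"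
 unfolding kconv_def by (simp add: nn_integral_cmult mult.assoc)
 also have "... = (NN et. (NN ze. ?H ze et))"
 by (rule nn_integral_shear, rule jmI) measurable
 also have "... <= (NN ze. \<alpha> ze * f ze) * (NN et. \<beta> et * g et) + (NN ze. \<gamma> ze * f ze) * (NN et. \<delta> et * g et)"
 by (rule nn_integral_product_bound[where H="%ze et. w (ze + et) * k ze et"]) (use le in auto)
 finally show ?thesis .
qed

text \<open>A majorant has the size of |z|/|xi|, so \<open>wN s\<close> of it controls the Lei-Lin
  norm of order s - 1 uniformly in time and the norm of order s + 1 integrated in time
  (\<open>Maj_sup_wN\<close>, \<open>Maj_int_wN\<close>).\<close>

definition wN :: "real => (real^3 => ennreal) => ennreal" where
 "wN s f = (NN xi. er (norm xi powr s) * f xi)"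

lemma wN_add: "f \<in> BM ==> g \<in> BM ==> wN s (%x. f x + g x) = wN s f + wN s g"
 unfolding wN_def by (simp add: distrib_left nn_integral_add)

lemma wN_mono: "AL x. f x <= g x ==> wN s f <= wN s g"
 unfolding wN_def by (intro nn_integral_mono_AE) (auto elim!: eventually_mono intro: mult_left_mono)

lemma min_div_max:
 fixes x y :: real
 assumes "x > 0" "y > 0"
 shows "0 <= min x y / max x y" "min x y / max x y <= 1"
 using assms by (auto simp: min_def max_def)

lemma powr_sum_le:
 fixes x y z s :: real
 assumes "s >= 0" "x > 0" "y > 0" "0 <= z" "z <= x + y"
 shows "z powr s <= 2 powr s * max x y powr s"
proof -
 have "z powr s <= (2 * max x y) powr s" using assms by (intro powr_mono2) auto
 then show ?thesis using assms by (simp add: powr_mult)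
qed

text \<open>The weight of the sum is at most 2^s times the weight of the larger frequency, and the
  kernel is at most 1.\<close>

lemma wN_kconv1:
 assumes s: "s >= 0" and [measurable]: "f \<in> BM" "g \<in> BM"
 shows "wN s (kconv kap1 f g) <= er (2 powr s) * (wN s f * wN 0 g + wN 0 f * wN s g)"
proof -
 have "wN s (kconv kap1 f g) <=
 (NN ze. er (2 powr s * norm ze powr s) * f ze) * (NN et. er (norm et powr 0) * g et) +
 (NN ze. er (2 powr s * norm ze powr 0) * f ze) * (NN et. er (norm et powr s) * g et)"
 unfolding wN_def
 proof (rule kconv_weighted[OF jm_kap1])
 fix ze et :: "real^3" assume z: "ze ~= 0" "et ~= 0"
 let ?x = "norm ze" and ?y = "norm et"
 have p: "?x > 0" "?y > 0" using z by auto
 have "norm (ze + et) powr s * (min ?x ?y / max ?x ?y) <= 2 powr s * max ?x ?y powr s * 1"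
 using p by (intro mult_mono powr_sum_le[OF s] norm_triangle_ineq min_div_max) auto
 also have "... <= 2 powr s * ?x powr s * ?y powr 0 + 2 powr s * ?x powr 0 * ?y powr s"
 using p by (simp add: max_def)
 finally show "er (norm (ze + et) powr s) * kap1 ze et <= er (2 powr s * ?x powr s) * er (?y powr 0) + er (2 powr s * ?x powr 0) * er (?y powr s)"
 unfolding kap1_def by (subst (1 2 3) ennreal_mult'[symmetric], simp, simp, simp, subst ennreal_plus[symmetric]) (auto intro!: ennreal_leI simp del: ennreal_plus)
 qed auto
 also have "... = er (2 powr s) * (wN s f * wN 0 g + wN 0 f * wN s g)"
 unfolding wN_def by (simp add: ennreal_mult' nn_integral_cmult mult.assoc distrib_left)
 finally show ?thesis .
qed

text \<open>The larger frequency takes the weight s, the smaller one takes the factor min of the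
  kernel.\<close>

lemma wN_kconv2:
 assumes s: "s >= 0" and [measurable]: "f \<in> BM" "g \<in> BM"
 shows "wN s (kconv kap2 f g) <= er (2 * 2 powr s) * (wN s f * wN 1 g + wN 1 f * wN s g)"
proof -
 have "wN s (kconv kap2 f g) <=
 (NN ze. er (2 * 2 powr s * norm ze powr s) * f ze) * (NN et. er (norm et powr 1) * g et) +
 (NN ze. er (2 * 2 powr s * norm ze powr 1) * f ze) * (NN et. er (norm et powr s) * g et)"
 unfolding wN_def
 proof (rule kconv_weighted[OF jm_kap2])
 fix ze et :: "real^3" assume z: "ze ~= 0" "et ~= 0"
 let ?x = "norm ze" and ?y = "norm et"
 have p: "?x > 0" "?y > 0" using z by auto
 have "norm (ze + et) powr s * (2 * min ?x ?y) <= 2 powr s * max ?x ?y powr s * (2 * min ?x ?y)"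
 using p by (intro mult_mono powr_sum_le[OF s] norm_triangle_ineq) auto
 also have "... <= 2 * 2 powr s * ?x powr s * ?y powr 1 + 2 * 2 powr s * ?x powr 1 * ?y powr s"
 using p by (simp add: max_def min_def)
 finally show "er (norm (ze + et) powr s) * kap2 ze et <= er (2 * 2 powr s * ?x powr s) * er (?y powr 1) + er (2 * 2 powr s * ?x powr 1) * er (?y powr s)"
 unfolding kap2_def by (subst (1 2 3) ennreal_mult'[symmetric], simp, simp, simp, subst ennreal_plus[symmetric]) (auto intro!: ennreal_leI simp del: ennreal_plus)
 qed auto
 also have "... = er (2 * 2 powr s) * (wN s f * wN 1 g + wN 1 f * wN s g)"
 unfolding wN_def by (simp add: ennreal_mult' nn_integral_cmult mult.assoc distrib_left)
 finally show ?thesis .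
qed

text \<open>Here |xi| times the kernel is at most 2 min(|ze|,|et|) <= 2|et|, so the entire
  derivative may be put on the second factor. In the term u x B that factor is magnetic; velocity
  majorants are not controlled at order 1.\<close>

lemma wN_1_kconv1:
 assumes [measurable]: "f \<in> BM" "g \<in> BM"
 shows "wN 1 (kconv kap1 f g) <= 2 * (wN 0 f * wN 1 g)"
proof -
 have "wN 1 (kconv kap1 f g) <=
 (NN ze. er (2 * norm ze powr 0) * f ze) * (NN et. er (norm et powr 1) * g et) +
 (NN ze. 0 * f ze) * (NN et. 0 * g et)"
 unfolding wN_def
 proof (rule kconv_weighted[OF jm_kap1])
 fix ze et :: "real^3" assume z: "ze ~= 0" "et ~= 0"
 let ?x = "norm ze" and ?y = "norm et"
 have p: "?x > 0" "?y > 0" using z by auto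
 have "norm (ze + et) powr 1 * (min ?x ?y / max ?x ?y) <= (2 * max ?x ?y) * (min ?x ?y / max ?x ?y)"
 using p norm_triangle_ineq[of ze et] by (intro mult_right_mono min_div_max) auto
 also have "... = 2 * min ?x ?y" using p by (auto simp: max_def)
 also have "... <= 2 * ?x powr 0 * ?y powr 1" using p by simp
 finally show "er (norm (ze + et) powr 1) * kap1 ze et <= er (2 * ?x powr 0) * er (?y powr 1) + 0 * 0"
 unfolding kap1_def by (subst (1 2) ennreal_mult'[symmetric]) (auto intro!: ennreal_leI)
 qed auto
 also have "... = 2 * (wN 0 f * wN 1 g)"
 unfolding wN_def by (simp add: ennreal_mult' nn_integral_cmult mult.assoc)
 finally show ?thesis .
qed

text \<open>The factor at the larger frequency takes the weight s and is replaced by its essential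
  supremum; the other factor is integrated.\<close>

lemma kconv_sup:
 assumes s: "s >= 0" and [measurable]: "f \<in> BM" "g \<in> BM"
 and f: "AL x. er (norm x powr s) * f x <= A" and g: "AL x. er (norm x powr s) * g x <= A'"
 shows "er (norm xi powr s) * kconv kap1 f g xi <= er (2 powr s) * (A * wN 0 g + A' * wN 0 f)"
 and "er (norm xi powr s) * kconv kap2 f g xi <= er (2 * 2 powr s) * (A * wN 1 g + A' * wN 1 f)"
proof -
 have gen: "er (norm xi powr s) * kconv k f g xi <= ennreal c * (A * wN i g + A' * wN i f)"
 if k: "jm k" and c: "c >= 0" and le: "!!ze et. ze ~= 0 ==> et ~= 0 ==> er (norm (ze + et) powr s) * k ze et <= er (c * (norm ze powr s * norm et powr i)) + er (c * (norm ze powr i * norm et powr s))" for k c i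
 proof -
 note [measurable (raw)] = jm_compose[OF k]
 have "er (norm xi powr s) * kconv k f g xi = (NN et. er (norm ((xi - et) + et) powr s) * k (xi - et) et * (f (xi - et) * g et))"
 unfolding kconv_def by (simp add: nn_integral_cmult mult.assoc)
 also have "... <= (NN et. ennreal c * (A * (er (norm et powr i) * g et)) + ennreal c * (A' * (er (norm (xi - et) powr i) * f (xi - et))))"
 proof (rule nn_integral_mono_AE)
 show "AL et. er (norm ((xi - et) + et) powr s) * k (xi - et) et * (f (xi - et) * g et) <=
 ennreal c * (A * (er (norm et powr i) * g et)) + ennreal c * (A' * (er (norm (xi - et) powr i) * f (xi - et)))"
 using AE_nonzero AE_reflect[OF AE_nonzero, of xi] g AE_reflect[OF f, of xi]
 proof eventually_elim
 case (elim et)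
 let ?z = "xi - et"
 have "er (norm (?z + et) powr s) * k ?z et * (f ?z * g et) <=
 (er (c * (norm ?z powr s * norm et powr i)) + er (c * (norm ?z powr i * norm et powr s))) * (f ?z * g et)"
 using elim by (intro mult_right_mono le) auto
 also have "... = ennreal c * ((er (norm ?z powr s) * f ?z) * (er (norm et powr i) * g et)) +
 ennreal c * ((er (norm et powr s) * g et) * (er (norm ?z powr i) * f ?z))"
 using c by (simp only: ennreal_mult' powr_ge_zero distrib_left distrib_right mult_ac)
 also have "... <= ennreal c * (A * (er (norm et powr i) * g et)) + ennreal c * (A' * (er (norm ?z powr i) * f ?z))"
 using elim by (intro add_mono mult_left_mono mult_right_mono) auto
 finally show ?case .
 qed
 qed
 also have "... = ennreal c * (A * wN i g) + ennreal c * (A' * (NN et. er (norm (xi - et) powr i) * f (xi - et)))"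
 unfolding wN_def by (simp add: nn_integral_add nn_integral_cmult)
 also have "(NN et. er (norm (xi - et) powr i) * f (xi - et)) = wN i f"
 unfolding wN_def by (rule nn_integral_reflect) measurable
 finally show ?thesis by (simp only: distrib_left)
 qed
 show "er (norm xi powr s) * kconv kap1 f g xi <= er (2 powr s) * (A * wN 0 g + A' * wN 0 f)"
 proof (rule gen[OF jm_kap1])
 fix ze et :: "real^3" assume z: "ze ~= 0" "et ~= 0"
 let ?x = "norm ze" and ?y = "norm et"
 have p: "?x > 0" "?y > 0" using z by auto
 have "norm (ze + et) powr s * (min ?x ?y / max ?x ?y) <= 2 powr s * max ?x ?y powr s * 1"
 using p by (intro mult_mono powr_sum_le[OF s] norm_triangle_ineq min_div_max) auto
 also have "... <= 2 powr s * (?x powr s * ?y powr 0) + 2 powr s * (?x powr 0 * ?y powr s)"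
 using p by (simp add: max_def)
 finally show "er (norm (ze + et) powr s) * kap1 ze et <= er (2 powr s * (?x powr s * ?y powr 0)) + er (2 powr s * (?x powr 0 * ?y powr s))"
 unfolding kap1_def by (subst ennreal_mult'[symmetric], simp, subst ennreal_plus[symmetric]) (auto intro!: ennreal_leI simp del: ennreal_plus)
 qed auto
 show "er (norm xi powr s) * kconv kap2 f g xi <= er (2 * 2 powr s) * (A * wN 1 g + A' * wN 1 f)"
 proof (rule gen[OF jm_kap2])
 fix ze et :: "real^3" assume z: "ze ~= 0" "et ~= 0"
 let ?x = "norm ze" and ?y = "norm et"
 have p: "?x > 0" "?y > 0" using z by auto
 have "norm (ze + et) powr s * (2 * min ?x ?y) <= 2 powr s * max ?x ?y powr s * (2 * min ?x ?y)"
 using p by (intro mult_mono powr_sum_le[OF s] norm_triangle_ineq) auto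
 also have "... <= 2 * 2 powr s * (?x powr s * ?y powr 1) + 2 * 2 powr s * (?x powr 1 * ?y powr s)"
 using p by (simp add: max_def min_def)
 finally show "er (norm (ze + et) powr s) * kap2 ze et <= er (2 * 2 powr s * (?x powr s * ?y powr 1)) + er (2 * 2 powr s * (?x powr 1 * ?y powr s))"
 unfolding kap2_def by (subst ennreal_mult'[symmetric], simp, subst ennreal_plus[symmetric]) (auto intro!: ennreal_leI simp del: ennreal_plus)
 qed auto
qed

text \<open>With \<open>p\<close>, \<open>q\<close> majorants of velocity and magnetic field,
  \<open>FU\<close> and \<open>FB\<close> majorize the two Duhamel terms. The argument slots are
  those of \<open>Nu\<close>; the Hall term has the kernel \<open>kap2\<close>.\<close>

definition FU where "FU p q p' q' xi = kconv kap1 p p' xi + kconv kap1 q q' xi"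

definition FB where "FB p q p' q' xi = kconv kap1 p q' xi + kconv kap2 q q' xi"

lemma FU_measurable [measurable (raw)]:
 "p \<in> BM ==> q \<in> BM ==> p' \<in> BM ==> q' \<in> BM ==>
 FU p q p' q' \<in> BM"
 unfolding FU_def[abs_def] by (intro borel_measurable_add kconv1_measurable)

lemma FB_measurable [measurable (raw)]:
 "p \<in> BM ==> q \<in> BM ==> p' \<in> BM ==> q' \<in> BM ==>
 FB p q p' q' \<in> BM"
 unfolding FB_def[abs_def] by (intro borel_measurable_add kconv1_measurable kconv2_measurable)

text \<open>On the majorants of the initial heat flow this equals the sum of norms assumed small in
  the theorem. The order 1, asked of the magnetic majorant only, is what the Hall kernel
  consumes.\<close>

definition nrm :: "(real^3 => ennreal) => (real^3 => ennreal) => ennreal" where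
 "nrm p q = wN 0 p + wN 0 q + wN 1 q"

definition hN :: "real => (real^3 => ennreal) => (real^3 => ennreal) => ennreal" where
 "hN s p q = wN s p + wN s q"

lemma ennreal_numeral_sums:
 "(2::ennreal) = 1 + 1" "(3::ennreal) = 1 + 1 + 1" "(4::ennreal) = 1 + 1 + 1 + 1" "(6::ennreal) = 1 + 1 + 1 + 1 + 1 + 1"
 "(8::ennreal) = 1 + 1 + 1 + 1 + 1 + 1 + 1 + 1"
 by simp_all

lemmas ennreal_ring = ennreal_numeral_sums distrib_left distrib_right mult_1_left mult_1_right mult_ac add_ac

text \<open>Subtraction is awkward in the extended nonnegative reals; the inequality follows by
  exhibiting the remainder as a sum.\<close>

lemma nrm_F_algebra:
 fixes a b c a' b' c' :: ennreal
 shows "2 * (a * a') + 2 * (b * b') + (2 * (a * b') + 2 * (b * c' + c * b')) + (2 * (a * c') + 8 * (c * c'))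
 <= 8 * ((a + b + c) * (a' + b' + c'))"
proof -
 have "8 * ((a + b + c) * (a' + b' + c')) = (2 * (a * a') + 2 * (b * b') + (2 * (a * b') + 2 * (b * c' + c * b')) + (2 * (a * c') + 8 * (c * c')))
 + (6 * (a * a') + 6 * (b * b') + 6 * (a * b') + 6 * (b * c') + 6 * (c * b') + 6 * (a * c') + 8 * (b * a') + 8 * (c * a'))"
 by (simp only: ennreal_ring)
 then show ?thesis by (metis le_iff_add)
qed

text \<open>The 8 is the constant of \<open>wN_kconv2\<close> at weight 1, that is 2 * 2 for each of
  two equal products, the largest loss among the six terms.\<close>

lemma nrm_F:
 assumes [measurable]: "p \<in> BM" "q \<in> BM" "p' \<in> BM" "q' \<in> BM"
 shows "nrm (FU p q p' q') (FB p q p' q') <= 8 * (nrm p q * nrm p' q')"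
proof -
 have k1: "wN 0 (kconv kap1 f g) <= 2 * (wN 0 f * wN 0 g)" if [measurable]: "f \<in> BM" "g \<in> BM" for f g
 using wN_kconv1[of 0 f g] by (simp add: mult_2)
 have k2: "wN 0 (kconv kap2 f g) <= 2 * (wN 0 f * wN 1 g + wN 1 f * wN 0 g)" if [measurable]: "f \<in> BM" "g \<in> BM" for f g
 using wN_kconv2[of 0 f g] by simp
 have k3: "wN 1 (kconv kap2 f g) <= 8 * (wN 1 f * wN 1 g)" if [measurable]: "f \<in> BM" "g \<in> BM" for f g
 using wN_kconv2[of 1 f g] by (simp add: mult_2[symmetric] mult.assoc[symmetric])
 have "nrm (FU p q p' q') (FB p q p' q') = wN 0 (kconv kap1 p p') + wN 0 (kconv kap1 q q') + (wN 0 (kconv kap1 p q') + wN 0 (kconv kap2 q q'))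
 + (wN 1 (kconv kap1 p q') + wN 1 (kconv kap2 q q'))"
 unfolding nrm_def FU_def[abs_def] FB_def[abs_def] by (subst (1 2 3) wN_add) auto
 also have "... <= 2 * (wN 0 p * wN 0 p') + 2 * (wN 0 q * wN 0 q') + (2 * (wN 0 p * wN 0 q') + 2 * (wN 0 q * wN 1 q' + wN 1 q * wN 0 q'))
 + (2 * (wN 0 p * wN 1 q') + 8 * (wN 1 q * wN 1 q'))"
 by (intro add_mono k1 k2 k3 wN_1_kconv1) auto
 also have "... <= 8 * (nrm p q * nrm p' q')" unfolding nrm_def by (rule nrm_F_algebra)
 finally show ?thesis .
qed

lemma hN_F_algebra:
 fixes A B A' B' :: ennreal
 shows "c * (A * a' + a * A') + c * (B * b' + b * B') + (c * (A * b' + a * B') + 2 * c * (B * d' + d * B'))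
 <= 2 * c * ((A + B) * (a' + b' + d') + (a + b + d) * (A' + B'))"
proof -
 have "2 * c * ((A + B) * (a' + b' + d') + (a + b + d) * (A' + B')) =
 (c * (A * a' + a * A') + c * (B * b' + b * B') + (c * (A * b' + a * B') + 2 * c * (B * d' + d * B')))
 + c * (A * a' + a * A' + B * b' + b * B' + A * b' + a * B' + 2 * (A * d') + 2 * (B * a') + 2 * (b * A') + 2 * (d * A'))"
 by (simp only: ennreal_ring)
 then show ?thesis by (metis le_iff_add)
qed

text \<open>Tame estimate: in each product only one factor carries the order s, the other is
  measured in the smallness norm. Higher norms thus propagate linearly and need not be
  small.\<close>

lemma hN_F:
 assumes s: "s >= 0" and [measurable]: "p \<in> BM" "q \<in> BM" "p' \<in> BM" "q' \<in> BM"
 shows "hN s (FU p q p' q') (FB p q p' q') <= er (2 * 2 powr s) * (hN s p q * nrm p' q' + nrm p q * hN s p' q')"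
proof -
 let ?c = "er (2 powr s)"
 have c2: "er (2 * 2 powr s) = 2 * ?c" by (simp add: ennreal_mult')
 have "hN s (FU p q p' q') (FB p q p' q') = wN s (kconv kap1 p p') + wN s (kconv kap1 q q') + (wN s (kconv kap1 p q') + wN s (kconv kap2 q q'))"
 unfolding hN_def FU_def[abs_def] FB_def[abs_def] by (subst (1 2) wN_add) auto
 also have "... <= ?c * (wN s p * wN 0 p' + wN 0 p * wN s p') + ?c * (wN s q * wN 0 q' + wN 0 q * wN s q')
 + (?c * (wN s p * wN 0 q' + wN 0 p * wN s q') + 2 * ?c * (wN s q * wN 1 q' + wN 1 q * wN s q'))"
 unfolding c2[symmetric] by (intro add_mono wN_kconv1 wN_kconv2 s) auto
 also have "... <= 2 * ?c * (hN s p q * nrm p' q' + nrm p q * hN s p' q')"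
 unfolding hN_def nrm_def by (rule hN_F_algebra)
 finally show ?thesis unfolding c2 .
qed

lemma sup_F:
 assumes s: "s >= 0" and [measurable]: "p \<in> BM" "q \<in> BM"
 and p: "AL x. er (norm x powr s) * p x <= A" and q: "AL x. er (norm x powr s) * q x <= A"
 shows "er (norm xi powr s) * FU p q p q xi <= er (4 * 2 powr s) * (A * nrm p q)"
 and "er (norm xi powr s) * FB p q p q xi <= er (4 * 2 powr s) * (A * nrm p q)"
proof -
 let ?c = "er (2 powr s)"
 have c2: "er (2 * 2 powr s) = 2 * ?c" "er (4 * 2 powr s) = 4 * ?c" by (simp_all add: ennreal_mult')
 have "er (norm xi powr s) * FU p q p q xi <= ?c * (A * wN 0 p + A * wN 0 p) + ?c * (A * wN 0 q + A * wN 0 q)"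
 unfolding FU_def distrib_left[of "er (norm xi powr s)"] by (intro add_mono kconv_sup(1) s p q) auto
 also have "... <= 4 * ?c * (A * nrm p q)"
 proof -
 have "4 * ?c * (A * nrm p q) = (?c * (A * wN 0 p + A * wN 0 p) + ?c * (A * wN 0 q + A * wN 0 q)) + ?c * (2 * (A * wN 0 p) + 2 * (A * wN 0 q) + 4 * (A * wN 1 q))"
 unfolding nrm_def by (simp only: ennreal_ring)
 then show ?thesis by (metis le_iff_add)
 qed
 finally show "er (norm xi powr s) * FU p q p q xi <= er (4 * 2 powr s) * (A * nrm p q)" unfolding c2 .
 have "er (norm xi powr s) * FB p q p q xi <= ?c * (A * wN 0 q + A * wN 0 p) + 2 * ?c * (A * wN 1 q + A * wN 1 q)"
 unfolding FB_def distrib_left[of "er (norm xi powr s)"] c2(1)[symmetric] by (intro add_mono kconv_sup s p q) auto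
 also have "... <= 4 * ?c * (A * nrm p q)"
 proof -
 have "4 * ?c * (A * nrm p q) = (?c * (A * wN 0 q + A * wN 0 p) + 2 * ?c * (A * wN 1 q + A * wN 1 q)) + ?c * (3 * (A * wN 0 p) + 3 * (A * wN 0 q))"
 unfolding nrm_def by (simp only: ennreal_ring)
 then show ?thesis by (metis le_iff_add)
 qed
 finally show "er (norm xi powr s) * FB p q p q xi <= er (4 * 2 powr s) * (A * nrm p q)" unfolding c2 .
qed

section \<open>Duhamel integrals\<close>

text \<open>A norm of Chemin-Lerner type before integration in frequency. The exceptional null set
  of frequencies is common to all times.\<close>

definition Maj :: "real set => (real => real^3 => complex^3) => (real^3 => ennreal) => bool" where
 "Maj J z p \<longleftrightarrow> (AL xi. (\<forall>t\<in>J. en (z t xi) <= en xi * p xi) &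
 en xi * (\<integral>\<^sup>+t\<in>J. en (z t xi) \<partial>lborel) <= p xi)"

lemma Maj_mono:
 assumes "Maj J z p" "AL x. p x <= q x"
 shows "Maj J z q"
 using assms unfolding Maj_def
proof eventually_elim
 case (elim xi)
 then have "en xi * p xi <= en xi * q xi" by (intro mult_left_mono) auto
 then show ?case using elim by (meson order_trans)
qed

text \<open>The factor with the lower frequency is bounded by its supremum, the other by its time
  integral: |ze| P * Q/|et| for |ze| <= |et|.\<close>

lemma time_product:
 assumes z: "ze ~= 0" "et ~= (0::real^3)" and [measurable]: "x \<in> BM" "y \<in> BM" "J \<in> sets borel"
 and x: "!!t. t \<in> J ==> en (x t :: complex^3) <= er (norm ze) * P" "er (norm ze) * (\<integral>\<^sup>+t\<in>J. en (x t) \<partial>lborel) <= P"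
 and y: "!!t. t \<in> J ==> en (y t :: complex^3) <= er (norm et) * Q" "er (norm et) * (\<integral>\<^sup>+t\<in>J. en (y t) \<partial>lborel) <= Q"
 shows "(\<integral>\<^sup>+t\<in>J. er (norm (x t) * norm (y t)) \<partial>lborel) <= kap1 ze et * (P * Q)"
proof -
 have gen: "(\<integral>\<^sup>+t\<in>J. er (norm (x t) * norm (y t)) \<partial>lborel) <= kap1 ze et * (P * Q)"
 if z: "norm ze <= norm et" "et ~= 0"
 and [measurable]: "x \<in> BM" "y \<in> BM"
 and x: "!!t. t \<in> J ==> en (x t :: complex^3) <= er (norm ze) * P"
 and y: "er (norm et) * (\<integral>\<^sup>+t\<in>J. en (y t :: complex^3) \<partial>lborel) <= Q"
 for ze et :: "real^3" and x y P Q
 proof -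
 have "(\<integral>\<^sup>+t\<in>J. er (norm (x t) * norm (y t)) \<partial>lborel) <= (NN t. (er (norm ze) * P) * (en (y t) * ind J t))"
 using x by (intro nn_integral_mono) (auto simp: indicator_def ennreal_mult intro!: mult_right_mono)
 also have "... = (er (norm ze) * P) * (\<integral>\<^sup>+t\<in>J. en (y t) \<partial>lborel)"
 by (rule nn_integral_cmult) measurable
 also have "er (norm ze) = kap1 ze et * er (norm et)"
 using z unfolding kap1_def by (subst ennreal_mult'[symmetric]) (auto simp: min_def max_def)
 also have "kap1 ze et * er (norm et) * P * (\<integral>\<^sup>+t\<in>J. en (y t) \<partial>lborel) = kap1 ze et * (P * (er (norm et) * (\<integral>\<^sup>+t\<in>J. en (y t) \<partial>lborel)))"
 by (simp only: mult_ac)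
 also have "... <= kap1 ze et * (P * Q)" by (intro mult_left_mono y) auto
 finally show ?thesis .
 qed
 show ?thesis
 proof (cases "norm ze <= norm et")
 case True then show ?thesis using z x y by (intro gen) auto
 next
 case False
 have "(\<integral>\<^sup>+t\<in>J. er (norm (y t) * norm (x t)) \<partial>lborel) <= kap1 et ze * (Q * P)"
 using False z x y by (intro gen) auto
 moreover have "kap1 et ze = kap1 ze et" by (simp add: kap1_def min.commute max.commute)
 ultimately show ?thesis by (simp add: mult.commute)
 qed
qed

lemma time_conv:
 assumes u: "jm u" and w: "jm w" and J[measurable]: "J \<in> sets borel"
 and [measurable]: "p \<in> BM" "q \<in> BM"
 and p: "Maj J u p" and q: "Maj J w q"
 shows "(\<integral>\<^sup>+t\<in>J. (NN et. er (norm (u t (xi - et)) * norm (w t et))) \<partial>lborel) <= kconv kap1 p q xi"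
proof -
 note [measurable (raw)] = jm_compose[OF u] jm_compose[OF w]
 have "(\<integral>\<^sup>+t\<in>J. (NN et. er (norm (u t (xi - et)) * norm (w t et))) \<partial>lborel) =
 (NN t. (NN et. er (norm (u t (xi - et)) * norm (w t et)) * ind J t))"
 by (intro nn_integral_cong nn_integral_multc[symmetric]) measurable
 also have "... = (NN et. (\<integral>\<^sup>+t\<in>J. er (norm (u t (xi - et)) * norm (w t et)) \<partial>lborel))"
 by (rule lborel_pair.Fubini'[symmetric]) measurable
 also have "... <= kconv kap1 p q xi"
 unfolding kconv_def
 proof (rule nn_integral_mono_AE)
 show "AL et. (\<integral>\<^sup>+t\<in>J. er (norm (u t (xi - et)) * norm (w t et)) \<partial>lborel) <= kap1 (xi - et) et * (p (xi - et) * q et)"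
 using AE_nonzero AE_reflect[OF AE_nonzero, of xi] q[unfolded Maj_def] AE_reflect[OF p[unfolded Maj_def], of xi]
 proof eventually_elim
 case (elim et)
 then show ?case by (intro time_product) auto
 qed
 qed
 finally show ?thesis .
qed

text \<open>Here the surplus derivative of the Hall term is absorbed, by |xi| <= 2 max(|xi -
  et|,|et|).\<close>

lemma norm_kconv1_le: "en xi * kconv kap1 p q xi <= kconv kap2 p q xi"
 if [measurable]: "p \<in> BM" "q \<in> BM"
proof -
 note [measurable (raw)] = jm_compose[OF jm_kap1]
 have "en xi * kconv kap1 p q xi = (NN et. en xi * (kap1 (xi - et) et * (p (xi - et) * q et)))"
 unfolding kconv_def by (rule nn_integral_cmult[symmetric]) measurable
 also have "... <= kconv kap2 p q xi"
 unfolding kconv_def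
 proof (rule nn_integral_mono_AE)
 show "AL et. en xi * (kap1 (xi - et) et * (p (xi - et) * q et)) <= kap2 (xi - et) et * (p (xi - et) * q et)"
 using AE_nonzero AE_reflect[OF AE_nonzero, of xi]
 proof eventually_elim
 case (elim et)
 let ?x = "norm (xi - et)" and ?y = "norm et"
 have p: "?x > 0" "?y > 0" using elim by auto
 have "norm xi <= 2 * max ?x ?y" using norm_triangle_ineq[of "xi - et" et] by auto
 then have "norm xi * (min ?x ?y / max ?x ?y) <= (2 * max ?x ?y) * (min ?x ?y / max ?x ?y)"
 using p by (intro mult_right_mono min_div_max)
 also have "... = 2 * min ?x ?y" using p by (auto simp: max_def)
 finally have "en xi * kap1 (xi - et) et <= kap2 (xi - et) et"
 unfolding kap1_def kap2_def by (subst ennreal_mult'[symmetric]) (auto intro!: ennreal_leI)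
 then show ?case unfolding mult.assoc[symmetric, of "en xi"] by (rule mult_right_mono) simp
 qed
 qed
 finally show ?thesis .
qed

text \<open>Duhamel integrals look back to time 0. Both {0..} and {0..T} qualify, so the same
  estimates serve global existence and the continuation argument for uniqueness.\<close>

definition initial :: "real set => bool" where
 "initial J \<longleftrightarrow> J \<in> sets borel & (\<forall>t\<in>J. 0 <= t & {0..t} \<subseteq> J)"

lemma initialD: "initial J ==> t \<in> J ==> 0 <= ta ==> ta <= t ==> ta \<in> J"
 unfolding initial_def by (meson atLeastAtMost_iff subsetD)

lemma initial_atLeast: "initial {0..}" and initial_Icc: "initial {0..T}"
 by (auto simp: initial_def)

lemma nn_integral_exp_decay:
 assumes "lam >= 0"
 shows "(NN t. er (lam * exp (- (t - ta) * lam)) * ind {ta..} t) <= 1"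
proof (cases "lam = 0")
 case False
 then have lam: "lam > 0" using assms by simp
 have "(NN t. er (lam * exp (- (t - ta) * lam)) * ind {ta..} t) = er (0 - (- exp (- (ta - ta) * lam)))"
 proof (rule nn_integral_FTC_atLeast[where T=0 and F="%t. - exp (- (t - ta) * lam)"])
 show "((%t. - exp (- (t - ta) * lam)) has_real_derivative lam * exp (- (t - ta) * lam)) (at t)" for t
 by (auto intro!: derivative_eq_intros)
 show "((%t. - exp (- (t - ta) * lam)) \<longlongrightarrow> 0) at_top"
 using lam by real_asymp
 qed (use lam in auto)
 then show ?thesis by simp
qed simp

text \<open>The supremum uses exp <= 1. The integral is Young's inequality in time:
  \<open>lam\<close> times the integral of the decaying exponential is at most 1. It will be used
  with lam = |xi|^2.\<close>

lemma duh_bounds: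
 assumes J: "initial J" and lam: "lam >= 0" and h[measurable]: "h \<in> BM"
 and Y: "!!t. t \<in> J ==> Y t <= (\<integral>\<^sup>+ta\<in>{0..t}. er (exp (- (t - ta) * lam)) * h ta \<partial>lborel)"
 shows "t \<in> J ==> Y t <= (\<integral>\<^sup>+ta\<in>J. h ta \<partial>lborel)"
 and "ennreal lam * (\<integral>\<^sup>+t\<in>J. Y t \<partial>lborel) <= (\<integral>\<^sup>+ta\<in>J. h ta \<partial>lborel)"
proof -
 have Jm[measurable]: "J \<in> sets borel" using J by (simp add: initial_def)
 have Ji: "ta \<in> J" if "t \<in> J" "0 <= ta" "ta <= t" for t ta
 using J that unfolding initial_def by (meson atLeastAtMost_iff subsetD)
 show "Y t <= (\<integral>\<^sup>+ta\<in>J. h ta \<partial>lborel)" if t: "t \<in> J"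
 proof (rule order_trans[OF Y[OF t] nn_integral_mono])
 fix ta
 show "er (exp (- (t - ta) * lam)) * h ta * ind {0..t} ta <= h ta * ind J ta"
 proof (cases "ta \<in> {0..t}")
 case True
 have "er (exp (- (t - ta) * lam)) <= 1" using True lam by (auto intro: mult_nonpos_nonneg)
 then have "er (exp (- (t - ta) * lam)) * h ta <= 1 * h ta" by (rule mult_right_mono) simp
 then show ?thesis using True Ji[OF t] by simp
 qed simp
 qed
 have "ennreal lam * (\<integral>\<^sup>+t\<in>J. Y t \<partial>lborel) <= ennreal lam * (NN t. (NN ta. er (exp (- (t - ta) * lam)) * h ta * ind {0..t} ta) * ind J t)"
 using Y by (intro mult_left_mono nn_integral_mono) (auto simp: indicator_def)
 also have "... = (NN t. ennreal lam * ((NN ta. er (exp (- (t - ta) * lam)) * h ta * ind {ta. 0 <= ta & ta <= t} ta) * ind J t))"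
 unfolding atLeastAtMost_def atLeast_def atMost_def Collect_conj_eq[symmetric]
 by (rule nn_integral_cmult[symmetric]) measurable
 also have "... = (NN t. (NN ta. ennreal lam * (er (exp (- (t - ta) * lam)) * h ta * ind {ta. 0 <= ta & ta <= t} ta) * ind J t))"
 proof (rule nn_integral_cong)
 fix t
 have "(NN ta. ennreal lam * (er (exp (- (t - ta) * lam)) * h ta * ind {ta. 0 <= ta & ta <= t} ta) * ind J t) =
 (NN ta. ennreal lam * (er (exp (- (t - ta) * lam)) * h ta * ind {ta. 0 <= ta & ta <= t} ta)) * ind J t"
 by (rule nn_integral_multc) measurable
 also have "(NN ta. ennreal lam * (er (exp (- (t - ta) * lam)) * h ta * ind {ta. 0 <= ta & ta <= t} ta)) = ennreal lam * (NN ta. er (exp (- (t - ta) * lam)) * h ta * ind {ta. 0 <= ta & ta <= t} ta)"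
 by (rule nn_integral_cmult) measurable
 finally show "ennreal lam * ((NN ta. er (exp (- (t - ta) * lam)) * h ta * ind {ta. 0 <= ta & ta <= t} ta) * ind J t) =
 (NN ta. ennreal lam * (er (exp (- (t - ta) * lam)) * h ta * ind {ta. 0 <= ta & ta <= t} ta) * ind J t)"
 by (simp only: mult.assoc)
 qed
 also have "... = (NN ta. (NN t. ennreal lam * (er (exp (- (t - ta) * lam)) * h ta * ind {ta. 0 <= ta & ta <= t} ta) * ind J t))"
 by (rule lborel_pair.Fubini') measurable
 also have "... <= (NN ta. h ta * ind J ta)"
 proof (rule nn_integral_mono)
 fix ta
 have "(NN t. ennreal lam * (er (exp (- (t - ta) * lam)) * h ta * ind {ta. 0 <= ta & ta <= t} ta) * ind J t)
 <= (NN t. (h ta * ind J ta) * (er (lam * exp (- (t - ta) * lam)) * ind {ta..} t))"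
 proof (rule nn_integral_mono)
 fix t
 have "er (lam * exp (- (t - ta) * lam)) = ennreal lam * er (exp (- (t - ta) * lam))"
 using lam by (intro ennreal_mult) auto
 then show "ennreal lam * (er (exp (- (t - ta) * lam)) * h ta * ind {ta. 0 <= ta & ta <= t} ta) * ind J t <= (h ta * ind J ta) * (er (lam * exp (- (t - ta) * lam)) * ind {ta..} t)"
 using Ji[of t ta] by (auto simp: indicator_def mult_ac)
 qed
 also have "... = (h ta * ind J ta) * (NN t. er (lam * exp (- (t - ta) * lam)) * ind {ta..} t)"
 by (rule nn_integral_cmult) measurable
 also have "... <= (h ta * ind J ta) * 1"
 by (intro mult_left_mono nn_integral_exp_decay lam) auto
 finally show "(NN t. ennreal lam * (er (exp (- (t - ta) * lam)) * h ta * ind {ta. 0 <= ta & ta <= t} ta) * ind J t) <= h ta * ind J ta" by simp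
 qed
 finally show "ennreal lam * (\<integral>\<^sup>+t\<in>J. Y t \<partial>lborel) <= (\<integral>\<^sup>+ta\<in>J. h ta \<partial>lborel)" .
qed

lemma divide_norm_le:
 assumes x: "x > 0" and le: "er (x\<^sup>2) * I <= ennreal x * X"
 shows "ennreal x * I <= X"
proof -
 have "er (1 / x) * (er (x\<^sup>2) * I) <= er (1 / x) * (ennreal x * X)" using le by (rule mult_left_mono) simp
 moreover have "er (1 / x) * (er (x\<^sup>2) * I) = ennreal x * I"
 using x unfolding mult.assoc[symmetric] by (subst ennreal_mult'[symmetric]) (auto simp: power2_eq_square)
 moreover have "er (1 / x) * (ennreal x * X) = X"
 using x unfolding mult.assoc[symmetric] by (subst ennreal_mult'[symmetric]) auto
 ultimately show ?thesis by simp
qed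

text \<open>The two equations share the whole Duhamel analysis. They differ in the symbol
  \<open>N\<close>, its scalar bound \<open>m\<close> and the majorant map \<open>F\<close>, linked
  by \<open>int_m\<close>.\<close>

locale bilin =
 fixes N :: "real^3 => complex^3 => complex^3 => complex^3 => complex^3 => complex^3"
 and m :: "real^3 => complex^3 => complex^3 => complex^3 => complex^3 => real"
 and F :: "(real^3 => ennreal) => (real^3 => ennreal) => (real^3 => ennreal) => (real^3 => ennreal) => real^3 => ennreal"
 assumes N_borel: "(%(x, a, b, a', b'). N x a b a' b') \<in> BM"
 and m_borel: "(%(x, a, b, a', b'). m x a b a' b') \<in> BM"
 and N_norm: "norm (N x a b a' b') <= m x a b a' b'"
 and N_diff: "N x a b c d - N x a' b' c' d' = N x (a - a') (b - b') c d + N x a' b' (c - c') (d - d')"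
 and int_m: "jm u ==> jm w ==> jm u' ==> jm w' ==> J \<in> sets borel ==>
 p \<in> BM ==> q \<in> BM ==> p' \<in> BM ==> q' \<in> BM ==>
 Maj J u p ==> Maj J w q ==> Maj J u' p' ==> Maj J w' q' ==>
 (\<integral>\<^sup>+t\<in>J. (NN et. er (m xi (u t (xi - et)) (w t (xi - et)) (u' t et) (w' t et))) \<partial>lborel) <= en xi * F p q p' q' xi"
begin

lemma N_measurable [measurable (raw)]:
 assumes [measurable]: "x \<in> borel_measurable M" "a \<in> borel_measurable M" "b \<in> borel_measurable M" "a' \<in> borel_measurable M" "b' \<in> borel_measurable M"
 shows "(%w. N (x w) (a w) (b w) (a' w) (b' w)) \<in> borel_measurable M"
proof -
 have "(%w. (x w, a w, b w, a' w, b' w)) \<in> borel_measurable M" by (intro borel_measurable_Pair assms)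
 from measurable_compose[OF this N_borel] show ?thesis by simp
qed

lemma m_measurable [measurable (raw)]:
 assumes [measurable]: "x \<in> borel_measurable M" "a \<in> borel_measurable M" "b \<in> borel_measurable M" "a' \<in> borel_measurable M" "b' \<in> borel_measurable M"
 shows "(%w. m (x w) (a w) (b w) (a' w) (b' w)) \<in> borel_measurable M"
proof -
 have "(%w. (x w, a w, b w, a' w, b' w)) \<in> borel_measurable M" by (intro borel_measurable_Pair assms)
 from measurable_compose[OF this m_borel] show ?thesis by simp
qed

definition C :: "(real^3 => complex^3) => (real^3 => complex^3) => real^3 => complex^3" where
 "C a b xi = (LINT et|lborel. N xi (a (xi - et)) (b (xi - et)) (a et) (b et))"

definition mm :: "(real^3 => complex^3) => (real^3 => complex^3) => (real^3 => complex^3) => (real^3 => complex^3) => real^3 => ennreal" where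
 "mm a b a' b' xi = (NN et. er (m xi (a (xi - et)) (b (xi - et)) (a' et) (b' et)))"

definition D :: "(real => real^3 => complex^3) => (real => real^3 => complex^3) => real => real^3 => complex^3" where
 "D u b t xi = (LINT ta:{0..t}|lborel. exp (- (t - ta) * (norm xi)\<^sup>2) *R C (u ta) (b ta) xi)"

abbreviation mq where "mq u b t \<equiv> mm (u t) (b t) (u t) (b t)"

lemma int_mm:
 "jm u ==> jm w ==> jm u' ==> jm w' ==> J \<in> sets borel ==>
 p \<in> BM ==> q \<in> BM ==> p' \<in> BM ==> q' \<in> BM ==>
 Maj J u p ==> Maj J w q ==> Maj J u' p' ==> Maj J w' q' ==>
 (\<integral>\<^sup>+t\<in>J. mm (u t) (w t) (u' t) (w' t) xi \<partial>lborel) <= en xi * F p q p' q' xi"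
 unfolding mm_def by (rule int_m[of u w u' w' J p q p' q' xi])

lemma N_integrable:
 assumes [measurable]: "a \<in> BM" "b \<in> BM" "a' \<in> BM" "b' \<in> BM"
 and fin: "mm a b a' b' xi < ic"
 shows "integrable lborel (%et. N xi (a (xi - et)) (b (xi - et)) (a' et) (b' et))"
 unfolding integrable_iff_bounded
proof
 have "(NN et. er (norm (N xi (a (xi - et)) (b (xi - et)) (a' et) (b' et)))) <= mm a b a' b' xi"
 unfolding mm_def by (intro nn_integral_mono ennreal_leI N_norm)
 then show "(NN et. er (norm (N xi (a (xi - et)) (b (xi - et)) (a' et) (b' et)))) < ic"
 using fin by (rule le_less_trans)
qed measurable

text \<open>Where the convolution integral fails to converge its value is 0, and the bound remains
  true; differences, by contrast, need convergence of both integrals.\<close>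

lemma C_norm:
 assumes [measurable]: "a \<in> BM" "b \<in> BM"
 shows "en (C a b xi) <= mm a b a b xi"
proof (cases "integrable lborel (%et. N xi (a (xi - et)) (b (xi - et)) (a et) (b et))")
 case True
 have "en (C a b xi) <= (NN et. er (norm (N xi (a (xi - et)) (b (xi - et)) (a et) (b et))))"
 unfolding C_def by (rule integral_norm_bound_ennreal[OF True])
 also have "... <= mm a b a b xi" unfolding mm_def by (intro nn_integral_mono ennreal_leI N_norm)
 finally show ?thesis .
next
 case False then show ?thesis by (simp add: C_def not_integrable_integral_eq)
qed

lemma C_diff_norm:
 assumes [measurable]: "a \<in> BM" "b \<in> BM" "a' \<in> BM" "b' \<in> BM"
 and fin: "mm a b a b xi < ic" "mm a' b' a' b' xi < ic"
 shows "en (C a b xi - C a' b' xi) <= mm (%x. a x - a' x) (%x. b x - b' x) a b xi + mm a' b' (%x. a x - a' x) (%x. b x - b' x) xi"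
proof -
 let ?N = "%a b a' b' et. N xi (a (xi - et)) (b (xi - et)) (a' et) (b' et)"
 let ?da = "%x. a x - a' x" and ?db = "%x. b x - b' x"
 have i: "integrable lborel (?N a b a b)" "integrable lborel (?N a' b' a' b')" using fin by (auto intro!: N_integrable)
 have "C a b xi - C a' b' xi = (LINT et|lborel. ?N a b a b et - ?N a' b' a' b' et)"
 unfolding C_def using i by simp
 then have "en (C a b xi - C a' b' xi) <= (NN et. en (?N a b a b et - ?N a' b' a' b' et))"
 using integral_norm_bound_ennreal[OF Bochner_Integration.integrable_diff[OF i]] by simp
 also have "... <= (NN et. er (m xi (?da (xi - et)) (?db (xi - et)) (a et) (b et)) + er (m xi (a' (xi - et)) (b' (xi - et)) (?da et) (?db et)))"
 proof (rule nn_integral_mono)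
 fix et
 have e: "?N a b a b et - ?N a' b' a' b' et = ?N ?da ?db a b et + ?N a' b' ?da ?db et"
 by (rule N_diff)
 have p: "0 <= m x a b a' b'" for x a b a' b' using order_trans[OF norm_ge_zero N_norm] .
 have "norm (?N a b a b et - ?N a' b' a' b' et) <= m xi (?da (xi - et)) (?db (xi - et)) (a et) (b et) + m xi (a' (xi - et)) (b' (xi - et)) (?da et) (?db et)"
 unfolding e by (rule order_trans[OF norm_triangle_ineq add_mono[OF N_norm N_norm]])
 then show "en (?N a b a b et - ?N a' b' a' b' et) <= er (m xi (?da (xi - et)) (?db (xi - et)) (a et) (b et)) + er (m xi (a' (xi - et)) (b' (xi - et)) (?da et) (?db et))"
 using p by (subst ennreal_plus[symmetric]) (auto intro!: ennreal_leI simp del: ennreal_plus)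
 qed
 also have "... = mm ?da ?db a b xi + mm a' b' ?da ?db xi" unfolding mm_def by (rule nn_integral_add) measurable
 finally show ?thesis .
qed

lemma C_jm:
 assumes "jm u" "jm b"
 shows "jm (%ta. C (u ta) (b ta))"
proof -
 note [measurable (raw)] = jm_compose[OF assms(1)] jm_compose[OF assms(2)]
 show ?thesis unfolding C_def by (rule jmI, rule lborel.borel_measurable_lebesgue_integral) measurable
qed

lemma mm_measurable:
 assumes "jm u" "jm b" "jm u'" "jm b'"
 shows "(%ta. mm (u ta) (b ta) (u' ta) (b' ta) xi) \<in> BM"
proof -
 note [measurable (raw)] = jm_compose[OF assms(1)] jm_compose[OF assms(2)] jm_compose[OF assms(3)] jm_compose[OF assms(4)]
 show ?thesis unfolding mm_def by measurable
qed

text \<open>The explicit condition on \<open>ta\<close> and \<open>t\<close> exhibits the integrand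
  as jointly measurable in both times.\<close>

lemma D_eq: "D u b t xi = (LINT ta|lborel. (if 0 <= ta & ta <= t then exp (- (t - ta) * (norm xi)\<^sup>2) *R C (u ta) (b ta) xi else 0))"
 unfolding D_def set_lebesgue_integral_def by (intro Bochner_Integration.integral_cong) auto

lemma D_jm:
 assumes "jm u" "jm b"
 shows "jm (D u b)"
proof -
 note [measurable (raw)] = jm_compose[OF C_jm[OF assms]]
 show ?thesis unfolding D_eq[abs_def] by (rule jmI, rule lborel.borel_measurable_lebesgue_integral) measurable
qed

lemma D_integrable:
 assumes u: "jm u" and b: "jm b" and fin: "(\<integral>\<^sup>+ta\<in>{0..t}. mq u b ta xi \<partial>lborel) < ic"
 shows "set_integrable lborel {0..t} (%ta. exp (- (t - ta) * (norm xi)\<^sup>2) *R C (u ta) (b ta) xi)"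
 unfolding set_integrable_def integrable_iff_bounded
proof
 note [measurable (raw)] = jm_compose[OF C_jm[OF u b]]
 show "(%ta. ind {0..t} ta *R exp (- (t - ta) * (norm xi)\<^sup>2) *R C (u ta) (b ta) xi) \<in> borel_measurable lborel" by measurable
 have "(NN ta. er (norm (ind {0..t} ta *R exp (- (t - ta) * (norm xi)\<^sup>2) *R C (u ta) (b ta) xi))) <= (\<integral>\<^sup>+ta\<in>{0..t}. mq u b ta xi \<partial>lborel)"
 proof (rule nn_integral_mono)
 fix ta
 show "er (norm (ind {0..t} ta *R exp (- (t - ta) * (norm xi)\<^sup>2) *R C (u ta) (b ta) xi)) <= mq u b ta xi * ind {0..t} ta"
 proof (cases "ta \<in> {0..t}")
 case True
 have "exp (- (t - ta) * (norm xi)\<^sup>2) <= 1" using True by (auto intro: mult_nonpos_nonneg)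
 then have "norm (exp (- (t - ta) * (norm xi)\<^sup>2) *R C (u ta) (b ta) xi) <= norm (C (u ta) (b ta) xi)"
 by (auto intro!: mult_left_le_one_le)
 then have "er (norm (exp (- (t - ta) * (norm xi)\<^sup>2) *R C (u ta) (b ta) xi)) <= mq u b ta xi"
 by (rule order_trans[OF ennreal_leI C_norm]) (use jm_slice u b in auto)
 then show ?thesis using True by simp
 qed simp
 qed
 then show "(NN ta. er (norm (ind {0..t} ta *R exp (- (t - ta) * (norm xi)\<^sup>2) *R C (u ta) (b ta) xi))) < ic"
 using fin by (rule le_less_trans)
qed

lemma D_norm:
 assumes u: "jm u" and b: "jm b"
 shows "en (D u b t xi) <= (\<integral>\<^sup>+ta\<in>{0..t}. er (exp (- (t - ta) * (norm xi)\<^sup>2)) * mq u b ta xi \<partial>lborel)"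
proof (cases "set_integrable lborel {0..t} (%ta. exp (- (t - ta) * (norm xi)\<^sup>2) *R C (u ta) (b ta) xi)")
 case True
 have "en (D u b t xi) <= (NN ta. er (norm (ind {0..t} ta *R exp (- (t - ta) * (norm xi)\<^sup>2) *R C (u ta) (b ta) xi)))"
 unfolding D_def set_lebesgue_integral_def by (rule integral_norm_bound_ennreal[OF True[unfolded set_integrable_def]])
 also have "... <= (\<integral>\<^sup>+ta\<in>{0..t}. er (exp (- (t - ta) * (norm xi)\<^sup>2)) * mq u b ta xi \<partial>lborel)"
 proof (rule nn_integral_mono)
 fix ta
 show "er (norm (ind {0..t} ta *R exp (- (t - ta) * (norm xi)\<^sup>2) *R C (u ta) (b ta) xi)) <= er (exp (- (t - ta) * (norm xi)\<^sup>2)) * mq u b ta xi * ind {0..t} ta"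
 using C_norm[of "u ta" "b ta" xi] jm_slice[OF u, of ta] jm_slice[OF b, of ta] by (auto simp: indicator_def ennreal_mult intro!: mult_left_mono)
 qed
 finally show ?thesis .
next
 case False then show ?thesis by (simp add: D_def set_lebesgue_integral_def set_integrable_def not_integrable_integral_eq)
qed

lemma D_diff_norm:
 assumes u: "jm u" and b: "jm b" and u': "jm u'" and b': "jm b'"
 and fin: "(\<integral>\<^sup>+ta\<in>{0..t}. mq u b ta xi \<partial>lborel) < ic"
 and fin': "(\<integral>\<^sup>+ta\<in>{0..t}. mq u' b' ta xi \<partial>lborel) < ic"
 shows "en (D u b t xi - D u' b' t xi) <= (\<integral>\<^sup>+ta\<in>{0..t}. er (exp (- (t - ta) * (norm xi)\<^sup>2)) *
 (mm (%x. u ta x - u' ta x) (%x. b ta x - b' ta x) (u ta) (b ta) xi + mm (u' ta) (b' ta) (%x. u ta x - u' ta x) (%x. b ta x - b' ta x) xi) \<partial>lborel)"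
proof -
 let ?e = "%ta. exp (- (t - ta) * (norm xi)\<^sup>2)"
 have i: "integrable lborel (%ta. ind {0..t} ta *R ?e ta *R C (u ta) (b ta) xi)"
 "integrable lborel (%ta. ind {0..t} ta *R ?e ta *R C (u' ta) (b' ta) xi)"
 using D_integrable[OF u b fin] D_integrable[OF u' b' fin'] by (auto simp: set_integrable_def)
 have "D u b t xi - D u' b' t xi = (LINT ta|lborel. ind {0..t} ta *R ?e ta *R C (u ta) (b ta) xi - ind {0..t} ta *R ?e ta *R C (u' ta) (b' ta) xi)"
 unfolding D_def set_lebesgue_integral_def using i by simp
 then have "en (D u b t xi - D u' b' t xi) <= (NN ta. en (ind {0..t} ta *R ?e ta *R C (u ta) (b ta) xi - ind {0..t} ta *R ?e ta *R C (u' ta) (b' ta) xi))"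
 using integral_norm_bound_ennreal[OF Bochner_Integration.integrable_diff[OF i]] by simp
 also have "... <= (\<integral>\<^sup>+ta\<in>{0..t}. er (?e ta) *
 (mm (%x. u ta x - u' ta x) (%x. b ta x - b' ta x) (u ta) (b ta) xi + mm (u' ta) (b' ta) (%x. u ta x - u' ta x) (%x. b ta x - b' ta x) xi) \<partial>lborel)"
 proof (rule nn_integral_mono_AE)
 note [measurable] = mm_measurable[OF u b u b] mm_measurable[OF u' b' u' b']
 have "AL ta. mq u b ta xi * ind {0..t} ta ~= ic"
 "AL ta. mq u' b' ta xi * ind {0..t} ta ~= ic"
 by (rule nn_integral_PInf_AE, measurable, use fin fin' in simp)+
 then show "AL ta. en (ind {0..t} ta *R ?e ta *R C (u ta) (b ta) xi - ind {0..t} ta *R ?e ta *R C (u' ta) (b' ta) xi) <= er (?e ta) *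
 (mm (%x. u ta x - u' ta x) (%x. b ta x - b' ta x) (u ta) (b ta) xi + mm (u' ta) (b' ta) (%x. u ta x - u' ta x) (%x. b ta x - b' ta x) xi) * ind {0..t} ta"
 proof eventually_elim
 case (elim ta)
 show ?case
 proof (cases "ta \<in> {0..t}")
 case True
 have "?e ta *R C (u ta) (b ta) xi - ?e ta *R C (u' ta) (b' ta) xi = ?e ta *R (C (u ta) (b ta) xi - C (u' ta) (b' ta) xi)"
 by (rule scaleR_diff_right[symmetric])
 then have "en (?e ta *R C (u ta) (b ta) xi - ?e ta *R C (u' ta) (b' ta) xi) = er (?e ta) * en (C (u ta) (b ta) xi - C (u' ta) (b' ta) xi)"
 by (simp add: ennreal_mult)
 also have "... <= er (?e ta) * (mm (%x. u ta x - u' ta x) (%x. b ta x - b' ta x) (u ta) (b ta) xi + mm (u' ta) (b' ta) (%x. u ta x - u' ta x) (%x. b ta x - b' ta x) xi)"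
 using elim True by (intro mult_left_mono C_diff_norm jm_slice u b u' b') (auto simp: less_top)
 finally show ?thesis using True by simp
 qed simp
 qed
 qed
 finally show ?thesis .
qed

text \<open>The factor |xi| in \<open>int_m\<close> is exactly that of the supremum clause. In the
  integral clause the heat kernel supplies |xi|^2, of which one factor cancels it.\<close>

lemma D_Maj:
 assumes J: "initial J" and u: "jm u" and b: "jm b"
 and [measurable]: "p \<in> BM" "q \<in> BM"
 and p: "Maj J u p" and q: "Maj J b q"
 shows "Maj J (D u b) (F p q p q)"
 unfolding Maj_def using AE_nonzero
proof eventually_elim
 case (elim xi)
 have Jm: "J \<in> sets borel" using J by (simp add: initial_def)
 have X: "(\<integral>\<^sup>+ta\<in>J. mq u b ta xi \<partial>lborel) <= en xi * F p q p q xi"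
 by (rule int_mm[OF u b u b Jm _ _ _ _ p q p q]) measurable
 let ?h = "%ta. mq u b ta xi"
 have hm: "?h \<in> BM" by (rule mm_measurable[OF u b u b])
 have Y: "en (D u b t xi) <= (\<integral>\<^sup>+ta\<in>{0..t}. er (exp (- (t - ta) * (norm xi)\<^sup>2)) * ?h ta \<partial>lborel)" if "t \<in> J" for t
 by (rule D_norm[OF u b])
 have bd1: "en (D u b t xi) <= (\<integral>\<^sup>+ta\<in>J. ?h ta \<partial>lborel)" if "t \<in> J" for t
 by (rule duh_bounds(1)[where Y="%t. en (D u b t xi)" and h="?h", OF J zero_le_power2[of "norm xi"] hm _ that]) (rule Y)
 have bd2: "er ((norm xi)\<^sup>2) * (\<integral>\<^sup>+t\<in>J. en (D u b t xi) \<partial>lborel) <= (\<integral>\<^sup>+ta\<in>J. ?h ta \<partial>lborel)"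
 by (rule duh_bounds(2)[where Y="%t. en (D u b t xi)" and h="?h", OF J zero_le_power2[of "norm xi"] hm]) (rule Y)
 have "en (D u b t xi) <= en xi * F p q p q xi" if "t \<in> J" for t
 by (rule order_trans[OF bd1[OF that] X])
 moreover have "er ((norm xi)\<^sup>2) * (\<integral>\<^sup>+t\<in>J. en (D u b t xi) \<partial>lborel) <= en xi * F p q p q xi"
 by (rule order_trans[OF bd2 X])
 then have "en xi * (\<integral>\<^sup>+t\<in>J. en (D u b t xi) \<partial>lborel) <= F p q p q xi"
 by (rule divide_norm_le[rotated]) (use elim in auto)
 ultimately show ?case by blast
qed

text \<open>The symbol is bilinear, so the difference is a sum of two terms with one difference
  factor each. Finiteness of \<open>F\<close> at almost every xi makes the Duhamel integrals
  converge, so that they may be subtracted under the integral.\<close>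

lemma D_diff_Maj:
 assumes J: "initial J" and u: "jm u" and b: "jm b" and u': "jm u'" and b': "jm b'"
 and [measurable]: "p \<in> BM" "q \<in> BM" "p' \<in> BM" "q' \<in> BM"
 "r \<in> BM" "s \<in> BM"
 and p: "Maj J u p" and q: "Maj J b q" and p': "Maj J u' p'" and q': "Maj J b' q'"
 and r: "Maj J (%t x. u t x - u' t x) r" and s: "Maj J (%t x. b t x - b' t x) s"
 and fin: "AL xi. F p q p q xi < ic" "AL xi. F p' q' p' q' xi < ic"
 shows "Maj J (%t xi. D u b t xi - D u' b' t xi) (%xi. F r s p q xi + F p' q' r s xi)"
 unfolding Maj_def using AE_nonzero fin
proof eventually_elim
 case (elim xi)
 have Jm[measurable]: "J \<in> sets borel" using J by (simp add: initial_def)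
 let ?du = "%t x. u t x - u' t x" and ?db = "%t x. b t x - b' t x"
 have du: "jm ?du"
 proof -
 note [measurable (raw)] = jm_compose[OF u] jm_compose[OF u']
 show ?thesis by (rule jmI) measurable
 qed
 have db: "jm ?db"
 proof -
 note [measurable (raw)] = jm_compose[OF b] jm_compose[OF b']
 show ?thesis by (rule jmI) measurable
 qed
 note [measurable] = mm_measurable[OF du db u b] mm_measurable[OF u' b' du db]
 have X1: "(\<integral>\<^sup>+ta\<in>J. mq u b ta xi \<partial>lborel) <= en xi * F p q p q xi"
 by (rule int_mm[OF u b u b Jm _ _ _ _ p q p q]) measurable
 have X2: "(\<integral>\<^sup>+ta\<in>J. mq u' b' ta xi \<partial>lborel) <= en xi * F p' q' p' q' xi"
 by (rule int_mm[OF u' b' u' b' Jm _ _ _ _ p' q' p' q']) measurable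
 have X3: "(\<integral>\<^sup>+ta\<in>J. mm (?du ta) (?db ta) (u ta) (b ta) xi \<partial>lborel) <= en xi * F r s p q xi"
 by (rule int_mm[OF du db u b Jm _ _ _ _ r s p q]) measurable
 have X4: "(\<integral>\<^sup>+ta\<in>J. mm (u' ta) (b' ta) (?du ta) (?db ta) xi \<partial>lborel) <= en xi * F p' q' r s xi"
 by (rule int_mm[OF u' b' du db Jm _ _ _ _ p' q' r s]) measurable
 let ?h = "%ta. mm (?du ta) (?db ta) (u ta) (b ta) xi + mm (u' ta) (b' ta) (?du ta) (?db ta) xi"
 have X: "(\<integral>\<^sup>+ta\<in>J. ?h ta \<partial>lborel) <= en xi * (F r s p q xi + F p' q' r s xi)"
 unfolding distrib_right distrib_left using add_mono[OF X3 X4] by (subst nn_integral_add) auto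
 have sub: "(\<integral>\<^sup>+ta\<in>{0..t}. f ta \<partial>lborel) <= (\<integral>\<^sup>+ta\<in>J. f ta \<partial>lborel)" if "t \<in> J" for f :: "real => ennreal" and t
 using initialD[OF J that] by (intro nn_integral_mono mult_left_mono) (auto simp: indicator_def)
 have fin1: "(\<integral>\<^sup>+ta\<in>J. mq u b ta xi \<partial>lborel) < ic"
 by (rule le_less_trans[OF X1]) (use elim in \<open>simp add: ennreal_mult_less_top\<close>)
 have fin2: "(\<integral>\<^sup>+ta\<in>J. mq u' b' ta xi \<partial>lborel) < ic"
 by (rule le_less_trans[OF X2]) (use elim in \<open>simp add: ennreal_mult_less_top\<close>)
 have Y: "en (D u b t xi - D u' b' t xi) <= (\<integral>\<^sup>+ta\<in>{0..t}. er (exp (- (t - ta) * (norm xi)\<^sup>2)) * ?h ta \<partial>lborel)" if "t \<in> J" for t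
 by (intro D_diff_norm u b u' b' le_less_trans[OF sub[OF that] fin1] le_less_trans[OF sub[OF that] fin2])
 have hm: "?h \<in> BM" by measurable
 have bd1: "en (D u b t xi - D u' b' t xi) <= (\<integral>\<^sup>+ta\<in>J. ?h ta \<partial>lborel)" if "t \<in> J" for t
 by (rule duh_bounds(1)[where Y="%t. en (D u b t xi - D u' b' t xi)" and h="?h", OF J zero_le_power2[of "norm xi"] hm _ that]) (rule Y)
 have bd2: "er ((norm xi)\<^sup>2) * (\<integral>\<^sup>+t\<in>J. en (D u b t xi - D u' b' t xi) \<partial>lborel) <= (\<integral>\<^sup>+ta\<in>J. ?h ta \<partial>lborel)"
 by (rule duh_bounds(2)[where Y="%t. en (D u b t xi - D u' b' t xi)" and h="?h", OF J zero_le_power2[of "norm xi"] hm]) (rule Y)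
 have "en (D u b t xi - D u' b' t xi) <= en xi * (F r s p q xi + F p' q' r s xi)" if "t \<in> J" for t
 by (rule order_trans[OF bd1[OF that] X])
 moreover have "er ((norm xi)\<^sup>2) * (\<integral>\<^sup>+t\<in>J. en (D u b t xi - D u' b' t xi) \<partial>lborel) <= en xi * (F r s p q xi + F p' q' r s xi)"
 by (rule order_trans[OF bd2 X])
 then have "en xi * (\<integral>\<^sup>+t\<in>J. en (D u b t xi - D u' b' t xi) \<partial>lborel) <= F r s p q xi + F p' q' r s xi"
 by (rule divide_norm_le[rotated]) (use elim in auto)
 ultimately show ?case by blast
qed

text \<open>Dominated convergence in the earlier time; the cut-off at \<open>ta = t\<close> is the
  only discontinuity, at a single point. Continuity in time later yields strong measurability in the
  Bochner sense.\<close>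

lemma D_continuous:
 assumes u: "jm u" and b: "jm b" and fin: "(\<integral>\<^sup>+ta\<in>{0..}. mq u b ta xi \<partial>lborel) < ic"
 shows "continuous_on {0..} (%t. D u b t xi)"
 unfolding continuous_on_sequentially
proof (intro allI ballI impI)
 fix s :: "nat => real" and t assume st: "t \<in> {0..}" "(\<forall>n. s n \<in> {0..}) & s -+> t"
 note [measurable (raw)] = jm_compose[OF C_jm[OF u b]]
 note [measurable] = mm_measurable[OF u b u b]
 let ?g = "%t ta. if 0 <= ta & ta <= t then exp (- (t - ta) * (norm xi)\<^sup>2) *R C (u ta) (b ta) xi else 0"
 let ?w = "%ta. ind {0..} ta * norm (C (u ta) (b ta) xi)"
 have "(%n. LINT ta|lborel. ?g (s n) ta) -+> (LINT ta|lborel. ?g t ta)"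
 proof (rule integral_dominated_convergence[where w="?w"])
 have "(NN ta. en (?w ta)) <= (\<integral>\<^sup>+ta\<in>{0..}. mq u b ta xi \<partial>lborel)"
 proof (rule nn_integral_mono)
 fix ta
 show "en (?w ta) <= mq u b ta xi * ind {0..} ta"
 using C_norm[OF jm_slice[OF u] jm_slice[OF b], of ta ta xi] by (auto simp: indicator_def)
 qed
 then show "integrable lborel ?w" unfolding integrable_iff_bounded using fin by (auto intro: le_less_trans)
 show "AL ta. (%n. ?g (s n) ta) -+> ?g t ta"
 using AE_lborel_singleton[of t]
 proof eventually_elim
 case (elim ta)
 have s: "s -+> t" using st by simp
 show ?case
 proof (cases "ta < t")
 case True
 have lim: "(%n. (exp (- (s n - ta) * (norm xi)\<^sup>2)) *R C (u ta) (b ta) xi) -+> exp (- (t - ta) * (norm xi)\<^sup>2) *R C (u ta) (b ta) xi"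
 by (intro tendsto_intros s)
 have "\<forall>\<^sub>F n in sequentially. ta < s n" using s True by (rule order_tendstoD)
 then have "\<forall>\<^sub>F n in sequentially. (if 0 <= ta then (exp (- (s n - ta) * (norm xi)\<^sup>2)) *R C (u ta) (b ta) xi else 0) = ?g (s n) ta"
 by eventually_elim auto
 moreover have "(%n. (if 0 <= ta then (exp (- (s n - ta) * (norm xi)\<^sup>2)) *R C (u ta) (b ta) xi else 0)) -+> ?g t ta"
 using lim True by (cases "0 <= ta") auto
 ultimately show ?thesis by (rule Lim_transform_eventually[rotated])
 next
 case False
 then have "t < ta" using elim by simp
 then have "\<forall>\<^sub>F n in sequentially. s n < ta" using s by (auto dest: order_tendstoD)
 then have "\<forall>\<^sub>F n in sequentially. ?g (s n) ta = ?g t ta" by eventually_elim (use \<open>t < ta\<close> in auto)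
 then show ?thesis by (rule tendsto_eventually)
 qed
 qed
 show "AL ta. norm (?g (s n) ta) <= ?w ta" for n
 by (intro AE_I2) (auto simp: indicator_def intro!: mult_left_le_one_le mult_nonpos_nonneg)
 qed measurable
 then show "((%t. D u b t xi) \<circ> s) -+> D u b t xi" unfolding D_eq o_def .
qed

end

definition mU :: "real^3 => complex^3 => complex^3 => complex^3 => complex^3 => real" where
 "mU x a b a' b' = norm x * (norm a * norm a' + norm b * norm b')"

definition mB :: "real^3 => complex^3 => complex^3 => complex^3 => complex^3 => real" where
 "mB x a b a' b' = norm x * (norm a * norm b') + (norm x)\<^sup>2 * (norm b * norm b')"

lemma case_prod5_measurable:
 fixes h :: "real^3 => complex^3 => complex^3 => complex^3 => complex^3 => 'c::topological_space"
 assumes "(%w. h (fst w) (fst (snd w)) (fst (snd (snd w))) (fst (snd (snd (snd w)))) (snd (snd (snd (snd w))))) \<in> BM"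
 shows "(%(x, a, b, a', b'). h x a b a' b') \<in> BM"
 using assms by (simp add: case_prod_beta')

lemma fst_snd_borel [measurable]:
 "(fst :: 'a::second_countable_topology \<times> 'b::second_countable_topology => 'a) \<in> BM"
 "(snd :: 'a::second_countable_topology \<times> 'b::second_countable_topology => 'b) \<in> BM"
 by (auto intro!: borel_measurable_continuous_onI continuous_intros)

interpretation U: bilin Nu mU FU
proof
 show "(%(x, a, b, a', b'). Nu x a b a' b') \<in> BM"
 by (rule case_prod5_measurable) measurable
 show "(%(x, a, b, a', b'). mU x a b a' b') \<in> BM"
 by (rule case_prod5_measurable[of mU]) (simp only: mU_def, measurable)
 show "norm (Nu x a b a' b') <= mU x a b a' b'" for x a b a' b' unfolding mU_def by (rule norm_Nu_le)
 show "Nu x a b c d - Nu x a' b' c' d' = Nu x (a - a') (b - b') c d + Nu x a' b' (c - c') (d - d')" for x a b c d a' b' c' d'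
 by (rule Nu_diff)
 fix u w u' w' :: "real => real^3 => complex^3" and J :: "real set" and p q p' q' :: "real^3 => ennreal" and xi :: "real^3"
 assume j: "jm u" "jm w" "jm u'" "jm w'" and J[measurable]: "J \<in> sets borel"
 and m[measurable]: "p \<in> BM" "q \<in> BM" "p' \<in> BM" "q' \<in> BM"
 and M: "Maj J u p" "Maj J w q" "Maj J u' p'" "Maj J w' q'"
 note [measurable (raw)] = jm_compose[OF j(1)] jm_compose[OF j(2)] jm_compose[OF j(3)] jm_compose[OF j(4)]
 let ?i = "%f g t. \<integral>\<^sup>+et. er (norm (f t (xi - et)) * norm (g t et)) \<partial>lborel"
 have "(NN et. er (mU xi (u t (xi - et)) (w t (xi - et)) (u' t et) (w' t et))) = en xi * (?i u u' t + ?i w w' t)" for t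
 unfolding mU_def by (simp add: ennreal_mult' ennreal_plus nn_integral_cmult nn_integral_add)
 then have "(\<integral>\<^sup>+t\<in>J. (NN et. er (mU xi (u t (xi - et)) (w t (xi - et)) (u' t et) (w' t et))) \<partial>lborel)
 = en xi * ((\<integral>\<^sup>+t\<in>J. ?i u u' t \<partial>lborel) + (\<integral>\<^sup>+t\<in>J. ?i w w' t \<partial>lborel))"
 by (simp add: mult.assoc distrib_right nn_integral_cmult nn_integral_add)
 also have "... <= en xi * FU p q p' q' xi"
 unfolding FU_def by (intro mult_left_mono add_mono time_conv j J m M) auto
 finally show "(\<integral>\<^sup>+t\<in>J. (NN et. er (mU xi (u t (xi - et)) (w t (xi - et)) (u' t et) (w' t et))) \<partial>lborel) <= en xi * FU p q p' q' xi" .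
qed

interpretation B: bilin Nb mB FB
proof
 show "(%(x, a, b, a', b'). Nb x a b a' b') \<in> BM"
 by (rule case_prod5_measurable) measurable
 show "(%(x, a, b, a', b'). mB x a b a' b') \<in> BM"
 by (rule case_prod5_measurable[of mB]) (simp only: mB_def, measurable)
 show "norm (Nb x a b a' b') <= mB x a b a' b'" for x a b a' b' unfolding mB_def by (rule norm_Nb_le)
 show "Nb x a b c d - Nb x a' b' c' d' = Nb x (a - a') (b - b') c d + Nb x a' b' (c - c') (d - d')" for x a b c d a' b' c' d'
 by (rule Nb_diff)
 fix u w u' w' :: "real => real^3 => complex^3" and J :: "real set" and p q p' q' :: "real^3 => ennreal" and xi :: "real^3"
 assume j: "jm u" "jm w" "jm u'" "jm w'" and J[measurable]: "J \<in> sets borel"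
 and m[measurable]: "p \<in> BM" "q \<in> BM" "p' \<in> BM" "q' \<in> BM"
 and M: "Maj J u p" "Maj J w q" "Maj J u' p'" "Maj J w' q'"
 note [measurable (raw)] = jm_compose[OF j(1)] jm_compose[OF j(2)] jm_compose[OF j(3)] jm_compose[OF j(4)]
 let ?i = "%f g t. \<integral>\<^sup>+et. er (norm (f t (xi - et)) * norm (g t et)) \<partial>lborel"
 have "(NN et. er (mB xi (u t (xi - et)) (w t (xi - et)) (u' t et) (w' t et))) = en xi * (?i u w' t + en xi * ?i w w' t)" for t
 unfolding mB_def power2_eq_square by (simp add: ennreal_mult' ennreal_plus nn_integral_cmult nn_integral_add distrib_left mult.assoc)
 then have "(\<integral>\<^sup>+t\<in>J. (NN et. er (mB xi (u t (xi - et)) (w t (xi - et)) (u' t et) (w' t et))) \<partial>lborel)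
 = en xi * ((\<integral>\<^sup>+t\<in>J. ?i u w' t \<partial>lborel) + en xi * (\<integral>\<^sup>+t\<in>J. ?i w w' t \<partial>lborel))"
 by (simp add: mult.assoc distrib_right nn_integral_cmult nn_integral_add)
 also have "... <= en xi * (kconv kap1 p q' xi + en xi * kconv kap1 q q' xi)"
 by (intro mult_left_mono add_mono time_conv j J m M) auto
 also have "... <= en xi * FB p q p' q' xi"
 unfolding FB_def by (intro mult_left_mono add_mono norm_kconv1_le m order_refl) auto
 finally show "(\<integral>\<^sup>+t\<in>J. (NN et. er (mB xi (u t (xi - et)) (w t (xi - et)) (u' t et) (w' t et))) \<partial>lborel) <= en xi * FB p q p' q' xi" .
qed

lemma jm_add: "jm u ==> jm w ==> jm (%t x. u t x + w t x :: complex^3)"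
proof -
 assume u: "jm u" and w: "jm w"
 note [measurable (raw)] = jm_compose[OF u] jm_compose[OF w]
 show ?thesis by (rule jmI) measurable
qed

lemma jm_diff: "jm u ==> jm w ==> jm (%t x. u t x - w t x :: complex^3)"
proof -
 assume u: "jm u" and w: "jm w"
 note [measurable (raw)] = jm_compose[OF u] jm_compose[OF w]
 show ?thesis by (rule jmI) measurable
qed

lemma jm_zero: "jm (%t x. 0)"
 by (rule jmI) measurable

lemma norm_borel_measurable [measurable]: "(norm :: real^3 => real) \<in> BM"
 by (intro borel_measurable_continuous_onI continuous_intros)

section \<open>The heat flow and operations on majorants\<close>

definition heatF :: "(real^3 => complex^3) => real => real^3 => complex^3" where
 "heatF a t xi = exp (- t * (norm xi)\<^sup>2) *R a xi"

text \<open>The majorant of the heat flow started at \<open>a\<close>: the supremum |a| divided by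
  |xi|, and equally |xi| times the time integral, which is at most |a|/|xi|^2.\<close>

definition iv :: "(real^3 => complex^3) => real^3 => ennreal" where
 "iv a xi = er (norm (a xi) / norm xi)"

lemma iv_measurable [measurable (raw)]:
 assumes [measurable]: "a \<in> BM" shows "iv a \<in> BM"
 unfolding iv_def[abs_def] by measurable

lemma heatF_jm:
 assumes [measurable]: "a \<in> BM" shows "jm (heatF a)"
 unfolding heatF_def[abs_def] by (rule jmI) measurable

lemma heatF_Maj:
 assumes J: "initial J"
 shows "Maj J (heatF a) (iv a)"
 unfolding Maj_def using AE_nonzero
proof eventually_elim
 case (elim xi)
 have J0: "0 <= t" if "t \<in> J" for t using J that by (auto simp: initial_def)
 have iv: "en xi * iv a xi = en (a xi)"
 using elim unfolding iv_def by (subst ennreal_mult'[symmetric]) auto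
 have "en (heatF a t xi) <= en xi * iv a xi" if "t \<in> J" for t
 unfolding iv heatF_def using J0[OF that] by (intro ennreal_leI) (auto intro!: mult_left_le_one_le)
 moreover have "er ((norm xi)\<^sup>2) * (\<integral>\<^sup>+t\<in>J. en (heatF a t xi) \<partial>lborel) <= en xi * iv a xi"
 proof -
 have "(\<integral>\<^sup>+t\<in>J. en (heatF a t xi) \<partial>lborel) <= (\<integral>\<^sup>+t\<in>{0..}. en (heatF a t xi) \<partial>lborel)"
 using J0 by (intro nn_integral_mono) (auto simp: indicator_def)
 then have "er ((norm xi)\<^sup>2) * (\<integral>\<^sup>+t\<in>J. en (heatF a t xi) \<partial>lborel) <= er ((norm xi)\<^sup>2) * (\<integral>\<^sup>+t\<in>{0..}. en (heatF a t xi) \<partial>lborel)"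
 by (rule mult_left_mono) simp
 also have "... = (NN t. er ((norm xi)\<^sup>2) * (en (heatF a t xi) * ind {0..} t))"
 unfolding heatF_def by (rule nn_integral_cmult[symmetric]) measurable
 also have "... = (NN t. en (a xi) * (er ((norm xi)\<^sup>2 * exp (- (t - 0) * (norm xi)\<^sup>2)) * ind {0..} t))"
 by (intro nn_integral_cong) (auto simp: heatF_def ennreal_mult' indicator_def mult_ac)
 also have "... = en (a xi) * (NN t. er ((norm xi)\<^sup>2 * exp (- (t - 0) * (norm xi)\<^sup>2)) * ind {0..} t)"
 by (rule nn_integral_cmult) measurable
 also have "... <= en (a xi) * 1"
 by (intro mult_left_mono nn_integral_exp_decay) auto
 finally show ?thesis unfolding iv by simp
 qed
 then have "en xi * (\<integral>\<^sup>+t\<in>J. en (heatF a t xi) \<partial>lborel) <= iv a xi"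
 by (rule divide_norm_le[rotated]) (use elim in auto)
 ultimately show ?case by blast
qed

lemma Maj_add:
 assumes z: "jm z" and w: "jm w" and J: "J \<in> sets borel" and p: "Maj J z p" and q: "Maj J w q"
 shows "Maj J (%t x. z t x + w t x) (%x. p x + q x)"
 using p q unfolding Maj_def
proof eventually_elim
 case (elim xi)
 note [measurable] = J
 note [measurable (raw)] = jm_compose[OF z] jm_compose[OF w]
 have tri: "en (z t xi + w t xi) <= en (z t xi) + en (w t xi)" for t
 by (subst ennreal_plus[symmetric]) (auto intro!: ennreal_leI norm_triangle_ineq simp del: ennreal_plus)
 have sup: "en (z t xi + w t xi) <= en xi * (p xi + q xi)" if "t \<in> J" for t
 unfolding distrib_left using elim that by (intro order_trans[OF tri] add_mono) auto
 have "(\<integral>\<^sup>+t\<in>J. en (z t xi + w t xi) \<partial>lborel) <= (NN t. en (z t xi) * ind J t + en (w t xi) * ind J t)"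
 unfolding distrib_right[symmetric] by (intro nn_integral_mono mult_right_mono tri) simp
 then have "(\<integral>\<^sup>+t\<in>J. en (z t xi + w t xi) \<partial>lborel) <= (\<integral>\<^sup>+t\<in>J. en (z t xi) \<partial>lborel) + (\<integral>\<^sup>+t\<in>J. en (w t xi) \<partial>lborel)"
 by (subst (asm) nn_integral_add) auto
 then have "en xi * (\<integral>\<^sup>+t\<in>J. en (z t xi + w t xi) \<partial>lborel) <= en xi * ((\<integral>\<^sup>+t\<in>J. en (z t xi) \<partial>lborel) + (\<integral>\<^sup>+t\<in>J. en (w t xi) \<partial>lborel))"
 by (rule mult_left_mono) simp
 also have "... <= p xi + q xi" unfolding distrib_left using elim by (intro add_mono) auto
 finally show ?case using sup by blast
qed

lemma Maj_uminus: "Maj J z p ==> Maj J (%t x. - z t x) p"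
 by (simp add: Maj_def)

lemma Maj_cong_AE:
 assumes "Maj J z p" "AL xi. \<forall>t\<in>J. z t xi = w t xi"
 shows "Maj J w p"
 using assms unfolding Maj_def
proof eventually_elim
 case (elim xi)
 then have "(\<integral>\<^sup>+t\<in>J. en (w t xi) \<partial>lborel) = (\<integral>\<^sup>+t\<in>J. en (z t xi) \<partial>lborel)"
 by (intro nn_integral_cong) (auto simp: indicator_def)
 then show ?case using elim by auto
qed

lemma Maj_diff:
 assumes "jm z" "jm w" "J \<in> sets borel" "Maj J z p" "Maj J w q"
 shows "Maj J (%t x. z t x - w t x) (%x. p x + q x)"
proof -
 have w': "jm (%t x. - w t x)" using jm_diff[OF jm_zero assms(2)] by simp
 from Maj_add[OF assms(1) w' assms(3,4) Maj_uminus[OF assms(5)]] show ?thesis by simp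
qed

lemma Maj_suminf:
 assumes d: "!!n. jm (d n)" and J[measurable]: "J \<in> sets borel" and m: "!!n. Maj J (d n) (\<delta> n)"
 and z: "AL xi. \<forall>t\<in>J. en (z t xi) <= (\<Sum>n. en (d n t xi))"
 shows "Maj J z (%xi. \<Sum>n. \<delta> n xi)"
proof -
 have "AL xi. \<forall>n. (\<forall>t\<in>J. en (d n t xi) <= en xi * \<delta> n xi) &
 en xi * (\<integral>\<^sup>+t\<in>J. en (d n t xi) \<partial>lborel) <= \<delta> n xi"
 using m unfolding Maj_def AE_all_countable by blast
 then show ?thesis using z unfolding Maj_def
proof eventually_elim
 case (elim xi)
 have "en (z t xi) <= en xi * (\<Sum>n. \<delta> n xi)" if t: "t \<in> J" for t
 proof -
 have "en (z t xi) <= (\<Sum>n. en (d n t xi))" using elim(2) t by (rule bspec)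
 also have "... <= (\<Sum>n. en xi * \<delta> n xi)"
 proof (rule suminf_le)
 show "en (d n t xi) <= en xi * \<delta> n xi" for n using elim(1) t by blast
 qed auto
 finally show ?thesis by simp
 qed
 moreover have "en xi * (\<integral>\<^sup>+t\<in>J. en (z t xi) \<partial>lborel) <= (\<Sum>n. \<delta> n xi)"
 proof -
 have dm: "(%t. en (d n t xi) * ind J t) \<in> borel_measurable lborel" for n
 proof -
 note [measurable (raw)] = jm_compose[OF d[of n]]
 show ?thesis by measurable
 qed
 have "(\<integral>\<^sup>+t\<in>J. en (z t xi) \<partial>lborel) <= (NN t. (\<Sum>n. en (d n t xi) * ind J t))"
 proof (rule nn_integral_mono)
 fix t show "en (z t xi) * ind J t <= (\<Sum>n. en (d n t xi) * ind J t)"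
 proof (cases "t \<in> J")
 case True
 then have "en (z t xi) <= (\<Sum>n. en (d n t xi))" using elim(2) by (rule bspec[rotated])
 then show ?thesis using True by (simp only: indicator_simps mult_1_right)
 qed simp
 qed
 also have "... = (\<Sum>n. \<integral>\<^sup>+t\<in>J. en (d n t xi) \<partial>lborel)"
 by (rule nn_integral_suminf[OF dm])
 finally have "en xi * (\<integral>\<^sup>+t\<in>J. en (z t xi) \<partial>lborel) <= en xi * (\<Sum>n. \<integral>\<^sup>+t\<in>J. en (d n t xi) \<partial>lborel)"
 by (rule mult_left_mono) simp
 also have "... = (\<Sum>n. en xi * (\<integral>\<^sup>+t\<in>J. en (d n t xi) \<partial>lborel))" by (rule ennreal_suminf_cmult[symmetric])
 also have "... <= (\<Sum>n. \<delta> n xi)"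
 proof (rule suminf_le)
 show "en xi * (\<integral>\<^sup>+t\<in>J. en (d n t xi) \<partial>lborel) <= \<delta> n xi" for n using elim(1) by blast
 qed auto
 finally show ?thesis .
 qed
 ultimately show ?case by blast
qed
qed

text \<open>Norms tending to 0 do not force the majorants to tend to 0 pointwise. Their infimum,
  however, has norm 0, hence vanishes almost everywhere, and still dominates |z|/|xi|.\<close>

lemma Maj_zero:
 assumes m: "!!n. Maj J z (X n)" and [measurable]: "!!n. X n \<in> BM" and lim: "(%n. wN 0 (X n)) -+> 0"
 shows "AL xi. \<forall>t\<in>J. z t xi = 0"
proof -
 let ?Y = "%xi. INF n. X n xi"
 have "wN 0 ?Y <= wN 0 (X n)" for n by (intro wN_mono AE_I2 INF_lower) simp
 then have "wN 0 ?Y <= 0" by (intro LIMSEQ_le_const[OF lim]) auto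
 then have "AL xi. er (norm xi powr 0) * ?Y xi = 0"
 unfolding wN_def by (subst (asm) le_zero_eq, subst (asm) nn_integral_0_iff_AE) auto
 moreover have "AL xi. \<forall>n. (\<forall>t\<in>J. en (z t xi) <= en xi * X n xi)"
 using m unfolding Maj_def AE_all_countable by (auto elim!: eventually_mono)
 ultimately show ?thesis using AE_nonzero
 proof eventually_elim
 case (elim xi)
 show ?case
 proof (rule ballI, rule ccontr)
 fix t assume t: "t \<in> J" and nz: "z t xi ~= 0"
 have "er (norm (z t xi) / norm xi) <= X n xi" for n
 proof -
 have "er (1 / norm xi) * en (z t xi) <= er (1 / norm xi) * (en xi * X n xi)"
 using elim t by (intro mult_left_mono) auto
 also have "er (1 / norm xi) * (en xi * X n xi) = X n xi"
 using elim unfolding mult.assoc[symmetric] by (subst ennreal_mult'[symmetric]) auto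
 also have "er (1 / norm xi) * en (z t xi) = er (norm (z t xi) / norm xi)"
 by (subst ennreal_mult'[symmetric]) auto
 finally show ?thesis .
 qed
 then have "er (norm (z t xi) / norm xi) <= ?Y xi" by (intro INF_greatest)
 moreover have "?Y xi = 0" using elim by simp
 ultimately show False using nz elim by (simp add: ennreal_eq_0_iff divide_le_0_iff)
 qed
 qed
qed

lemma telescope_lim:
 fixes x :: "nat => 'a::banach"
 assumes fin: "(\<Sum>j. en (x (Suc j) - x j)) < ic"
 shows "x -+> lim x" and "en (lim x - x n) <= (\<Sum>j. er (norm (x (Suc (j + n)) - x (j + n))))"
proof -
 let ?d = "%j. x (Suc j) - x j"
 have sn: "summable (%j. norm (?d j))"
 using fin by (intro summable_suminf_not_top) auto
 then have sd: "summable ?d" by (rule summable_norm_cancel)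
 have tel: "(\<Sum>j<m. ?d (j + n)) = x (m + n) - x n" for m n by (induction m) auto
 have "(%m. \<Sum>j<m. ?d j) -+> suminf ?d" using sd by (rule summable_LIMSEQ)
 moreover have "(\<Sum>j<m. ?d j) = x m - x 0" for m by (induction m) auto
 ultimately have "(%m. x m - x 0) -+> suminf ?d" by simp
 then have "(%m. x m - x 0 + x 0) -+> suminf ?d + x 0" by (intro tendsto_intros)
 then have "convergent x" by (auto simp: convergent_def)
 then show l: "x -+> lim x" by (simp add: convergent_LIMSEQ_iff)
 have sn': "summable (%j. norm (?d (j + n)))" using sn by (rule summable_ignore_initial_segment)
 have "(%m. x (m + n) - x n) -+> lim x - x n" by (intro tendsto_intros LIMSEQ_ignore_initial_segment l)
 then have "(%j. ?d (j + n)) sums (lim x - x n)" unfolding sums_def tel .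
 then have "lim x - x n = (\<Sum>j. ?d (j + n))" by (rule sums_unique)
 then have "norm (lim x - x n) <= (\<Sum>j. norm (?d (j + n)))" using summable_norm[OF sn'] by simp
 then have "en (lim x - x n) <= er (\<Sum>j. norm (?d (j + n)))" by (rule ennreal_leI)
 also have "... = (\<Sum>j. en (?d (j + n)))" using sn' by (intro suminf_ennreal2[symmetric]) auto
 finally show "en (lim x - x n) <= (\<Sum>j. er (norm (x (Suc (j + n)) - x (j + n))))" by simp
qed

lemma nrm_add:
 assumes [measurable]: "p \<in> BM" "q \<in> BM" "p' \<in> BM" "q' \<in> BM"
 shows "nrm (%x. p x + p' x) (%x. q x + q' x) = nrm p q + nrm p' q'"
 unfolding nrm_def by (subst (1 2 3) wN_add) (auto simp: add_ac)

lemma nrm_mono: "AL x. p x <= p' x ==> AL x. q x <= q' x ==> nrm p q <= nrm p' q'"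
 unfolding nrm_def by (intro add_mono wN_mono)

lemma wN_le_nrm: "wN 0 p <= nrm p q" "wN 0 q <= nrm p q" "wN 1 q <= nrm p q"
 unfolding nrm_def by (auto simp: add_increasing add_increasing2)

lemma wN_suminf:
 assumes [measurable]: "!!n. f n \<in> BM"
 shows "wN s (%x. \<Sum>n. f n x) = (\<Sum>n. wN s (f n))"
proof -
 have "wN s (%x. \<Sum>n. f n x) = (NN x. (\<Sum>n. er (norm x powr s) * f n x))"
 unfolding wN_def by (simp only: ennreal_suminf_cmult)
 also have "... = (\<Sum>n. wN s (f n))" unfolding wN_def by (rule nn_integral_suminf) measurable
 finally show ?thesis .
qed

lemma nrm_suminf:
 assumes [measurable]: "!!n. f n \<in> BM" "!!n. g n \<in> BM"
 shows "nrm (%x. \<Sum>n. f n x) (%x. \<Sum>n. g n x) = (\<Sum>n. nrm (f n) (g n))"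
 unfolding nrm_def by (subst (1 2 3) wN_suminf) (auto simp: suminf_add)

lemma finite_AE_of_wN:
 assumes [measurable]: "f \<in> BM" and fin: "wN 0 f < ic"
 shows "AL x. f x < ic"
proof -
 have "AL x. er (norm x powr 0) * f x ~= ic"
 using fin unfolding wN_def by (intro nn_integral_PInf_AE) auto
 then show ?thesis using AE_nonzero by eventually_elim (auto simp: less_top)
qed

lemma nrm_finite_AE:
 assumes "f \<in> BM" "g \<in> BM" and fin: "nrm f g < ic"
 shows "AL x. f x < ic" "AL x. g x < ic"
proof -
 have "wN 0 f < ic" "wN 0 g < ic" using fin by (simp_all add: nrm_def)
 then show "AL x. f x < ic" "AL x. g x < ic" using assms finite_AE_of_wN by blast+
qed

lemma F_finite_AE:
 assumes [measurable]: "p \<in> BM" "q \<in> BM" "p' \<in> BM" "q' \<in> BM"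
 and "nrm p q < ic" "nrm p' q' < ic"
 shows "AL xi. FU p q p' q' xi < ic" "AL xi. FB p q p' q' xi < ic"
proof -
 have "nrm (FU p q p' q') (FB p q p' q') <= 8 * (nrm p q * nrm p' q')" by (rule nrm_F) auto
 also have "... < ic" using assms by (simp add: ennreal_mult_less_top)
 finally have f: "nrm (FU p q p' q') (FB p q p' q') < ic" .
 show "AL xi. FU p q p' q' xi < ic" by (rule nrm_finite_AE(1)[OF _ _ f]) measurable
 show "AL xi. FB p q p' q' xi < ic" by (rule nrm_finite_AE(2)[OF _ _ f]) measurable
qed

lemma F_mono:
 assumes "!!x. p x <= r x" "!!x. q x <= s x" "!!x. p' x <= r' x" "!!x. q' x <= s' x"
 shows "FU p q p' q' xi <= FU r s r' s' xi" "FB p q p' q' xi <= FB r s r' s' xi"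
 unfolding FU_def FB_def using assms by (auto intro!: add_mono kconv_mono AE_I2)

section \<open>Uniqueness for small majorants\<close>

definition solF :: "real set => (real^3 => complex^3) => (real^3 => complex^3) => (real => real^3 => complex^3) => (real => real^3 => complex^3) => bool" where
 "solF J a0 b0 u b \<longleftrightarrow> (AL xi. \<forall>t\<in>J. u t xi = heatF a0 t xi + U.D u b t xi & b t xi = heatF b0 t xi + B.D u b t xi)"

text \<open>The initial data cancel in the difference of two solutions, so any majorant of the
  difference is improved by the difference estimate. Each round multiplies its norm by at most 8/32
  + 8/32 = 1/2.\<close>

lemma solF_unique:
 assumes J: "initial J" and s: "solF J a0 b0 u b" "solF J a0 b0 u' b'"
 and j: "jm u" "jm b" "jm u'" "jm b'"
 and pm[measurable]: "p \<in> BM" "q \<in> BM" "p' \<in> BM" "q' \<in> BM"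
 and M: "Maj J u p" "Maj J b q" "Maj J u' p'" "Maj J b' q'"
 and small: "nrm p q <= er (1/32)" "nrm p' q' <= er (1/32)"
 shows "AL xi. \<forall>t\<in>J. u t xi = u' t xi" "AL xi. \<forall>t\<in>J. b t xi = b' t xi"
proof -
 have Jm: "J \<in> sets borel" using J by (simp add: initial_def)
 let ?du = "%t x. u t x - u' t x" and ?db = "%t x. b t x - b' t x"
 \<comment> \<open>\<open>G\<close> is the improvement given by \<open>D_diff_Maj\<close> for both
   equations; it starts from the sum of the majorants of the two solutions.\<close>
 define G where "G rs = (%xi. FU (fst rs) (snd rs) p q xi + FU p' q' (fst rs) (snd rs) xi, %xi. FB (fst rs) (snd rs) p q xi + FB p' q' (fst rs) (snd rs) xi)" for rs
 define rs where "rs n = (G ^^ n) (%xi. p xi + p' xi, %xi. q xi + q' xi)" for n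
 have rs0: "rs 0 = (%xi. p xi + p' xi, %xi. q xi + q' xi)" and rsS: "rs (Suc n) = G (rs n)" for n
 by (simp_all add: rs_def)
 have fin: "nrm p q < ic" "nrm p' q' < ic" using small by (auto intro: le_less_trans)
 have e1: "AL xi. \<forall>t\<in>J. U.D u b t xi - U.D u' b' t xi = ?du t xi" and e2: "AL xi. \<forall>t\<in>J. B.D u b t xi - B.D u' b' t xi = ?db t xi"
 using s unfolding solF_def by (auto elim!: eventually_elim2)
 have *: "fst (rs n) \<in> BM & snd (rs n) \<in> BM & Maj J ?du (fst (rs n)) & Maj J ?db (snd (rs n))
 & nrm (fst (rs n)) (snd (rs n)) <= er ((1/2) ^ n)" for n
 proof (induction n)
 case 0
 have "nrm p q + nrm p' q' <= er (1/32) + er (1/32)" using small by (intro add_mono)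
 also have "... <= ennreal 1" by (subst ennreal_plus[symmetric]) (auto intro!: ennreal_leI simp del: ennreal_plus)
 finally have "nrm p q + nrm p' q' <= 1" by simp
 then show ?case unfolding rs0 using j M Jm by (auto intro!: Maj_diff simp: nrm_add)
 next
 case (Suc n)
 obtain r s where rs: "rs n = (r, s)" by fastforce
 have rm[measurable]: "r \<in> BM" "s \<in> BM" using Suc rs by auto
 have rM: "Maj J ?du r" "Maj J ?db s" and rn: "nrm r s <= er ((1/2) ^ n)" using Suc rs by auto
 have m1: "Maj J ?du (%xi. FU r s p q xi + FU p' q' r s xi)"
 by (rule Maj_cong_AE[OF U.D_diff_Maj[OF J j pm rm M rM F_finite_AE(1)[OF pm(1,2) pm(1,2) fin(1) fin(1)] F_finite_AE(1)[OF pm(3,4) pm(3,4) fin(2) fin(2)]] e1])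
 have m2: "Maj J ?db (%xi. FB r s p q xi + FB p' q' r s xi)"
 by (rule Maj_cong_AE[OF B.D_diff_Maj[OF J j pm rm M rM F_finite_AE(2)[OF pm(1,2) pm(1,2) fin(1) fin(1)] F_finite_AE(2)[OF pm(3,4) pm(3,4) fin(2) fin(2)]] e2])
 have "nrm (%xi. FU r s p q xi + FU p' q' r s xi) (%xi. FB r s p q xi + FB p' q' r s xi) = nrm (FU r s p q) (FB r s p q) + nrm (FU p' q' r s) (FB p' q' r s)"
 by (rule nrm_add) measurable
 also have "... <= 8 * (nrm r s * nrm p q) + 8 * (nrm p' q' * nrm r s)" by (intro add_mono nrm_F) measurable
 also have "... <= 8 * (er ((1/2) ^ n) * er (1/32)) + 8 * (er (1/32) * er ((1/2) ^ n))"
 by (intro add_mono mult_mono small rn) auto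
 also have "... = er (8 * ((1/2) ^ n * (1/32)) + 8 * ((1/32) * (1/2) ^ n))"
 proof -
 have 8: "8 * (ennreal a * ennreal b) = er (8 * (a * b))" if "a >= 0" "b >= 0" for a b
 using that by (simp add: ennreal_mult)
 show ?thesis by (subst (1 2) 8) (simp_all add: ennreal_plus[symmetric] del: ennreal_plus)
 qed
 also have "... = er ((1/2) ^ Suc n)" by simp
 finally show ?case unfolding rsS rs G_def using m1 m2 by simp
 qed
 have t0: "(%n. er ((1/2) ^ n)) -+> 0"
 using tendsto_ennrealI[OF LIMSEQ_realpow_zero[of "1/2"]] by simp
 have l: "(%n. wN 0 (fst (rs n))) -+> 0" "(%n. wN 0 (snd (rs n))) -+> 0"
 proof -
 have "wN 0 (fst (rs n)) <= er ((1/2) ^ n)" "wN 0 (snd (rs n)) <= er ((1/2) ^ n)" for n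
 using * wN_le_nrm by (blast intro: order_trans)+
 then show "(%n. wN 0 (fst (rs n))) -+> 0" "(%n. wN 0 (snd (rs n))) -+> 0"
 by (auto intro!: tendsto_sandwich[OF _ _ tendsto_const t0])
 qed
 have "AL xi. \<forall>t\<in>J. ?du t xi = 0" by (rule Maj_zero[where X="%n. fst (rs n)"]) (use * l in auto)
 then show "AL xi. \<forall>t\<in>J. u t xi = u' t xi" by simp
 have "AL xi. \<forall>t\<in>J. ?db t xi = 0" by (rule Maj_zero[where X="%n. snd (rs n)"]) (use * l in auto)
 then show "AL xi. \<forall>t\<in>J. b t xi = b' t xi" by simp
qed

section \<open>Picard iteration\<close>

text \<open>The supremum clause passes to the pointwise limit directly, the time integral by
  Fatou.\<close>

lemma Maj_limit:
 assumes z: "!!n. jm (z n)" and J[measurable]: "J \<in> sets borel" and w: "jm w" and m: "!!n. Maj J (z n) p"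
 and lim: "AL xi. \<forall>t\<in>J. (%n. z n t xi) -+> w t xi"
 shows "Maj J w p"
proof -
 have "AL xi. \<forall>n. (\<forall>t\<in>J. en (z n t xi) <= en xi * p xi) &
 en xi * (\<integral>\<^sup>+t\<in>J. en (z n t xi) \<partial>lborel) <= p xi"
 using m unfolding Maj_def AE_all_countable by blast
 then show ?thesis using lim unfolding Maj_def
 proof eventually_elim
 case (elim xi)
 have conv: "(%n. en (z n t xi)) -+> en (w t xi)" if "t \<in> J" for t
 using elim(2) that by (intro tendsto_ennrealI tendsto_norm) blast
 have sup: "en (w t xi) <= en xi * p xi" if t: "t \<in> J" for t
 by (rule LIMSEQ_le_const2[OF conv[OF t]]) (use elim(1) t in blast)
 have zm: "(%t. en (z n t xi) * ind J t) \<in> borel_measurable lborel" for n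
 proof -
 note [measurable (raw)] = jm_compose[OF z[of n]]
 show ?thesis by measurable
 qed
 have wm: "(%t. en (w t xi) * ind J t) \<in> borel_measurable lborel"
 proof -
 note [measurable (raw)] = jm_compose[OF w]
 show ?thesis by measurable
 qed
 have zm': "(%t. en xi * (en (z n t xi) * ind J t)) \<in> borel_measurable lborel" for n
 by (intro borel_measurable_times_ennreal zm borel_measurable_const)
 have "en xi * (\<integral>\<^sup>+t\<in>J. en (w t xi) \<partial>lborel) = (NN t. en xi * (en (w t xi) * ind J t))"
 by (rule nn_integral_cmult[OF wm, symmetric])
 also have "... = (NN t. liminf (%n. en xi * (en (z n t xi) * ind J t)))"
 proof (rule nn_integral_cong)
 fix t
 have "(%n. en xi * (en (z n t xi) * ind J t)) -+> en xi * (en (w t xi) * ind J t)"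
 proof (cases "t \<in> J")
 case True
 have "(%n. en xi * en (z n t xi)) -+> en xi * en (w t xi)"
 by (rule ennreal_tendsto_cmult[OF _ conv[OF True]]) simp
 then show ?thesis using True by simp
 qed simp
 then show "en xi * (en (w t xi) * ind J t) = liminf (%n. en xi * (en (z n t xi) * ind J t))"
 by (rule lim_imp_Liminf[OF sequentially_bot, symmetric])
 qed
 also have "... <= liminf (%n. \<integral>\<^sup>+t. en xi * (en (z n t xi) * ind J t) \<partial>lborel)"
 by (rule nn_integral_liminf[OF zm'])
 also have "... <= p xi"
 proof (rule Liminf_le[OF sequentially_bot always_eventually], rule allI)
 show "(NN t. en xi * (en (z n t xi) * ind J t)) <= p xi" for n
 unfolding nn_integral_cmult[OF zm] using elim(1) by blast
 qed
 finally show ?case using sup by blast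
 qed
qed

lemma wN_SUP_le:
 assumes "incseq f" "!!n. f n \<in> BM" "!!n. wN s (f n) <= c"
 shows "wN s (%x. SUP n. f n x) <= c"
proof -
 have "wN s (%x. SUP n. f n x) = (NN x. (SUP n. er (norm x powr s) * f n x))"
 unfolding wN_def by (simp add: SUP_mult_left_ennreal)
 also have "... = (SUP n. wN s (f n))"
 unfolding wN_def
 proof (rule nn_integral_monotone_convergence_SUP)
 show "incseq (%n x. er (norm x powr s) * f n x)"
 using assms(1) by (auto simp: incseq_def le_fun_def intro!: mult_left_mono)
 qed (use assms(2) in measurable)
 also have "... <= c" by (intro SUP_least assms)
 finally show ?thesis .
qed

lemma conv_cnj:
 assumes "!!xi. a (- xi) = vcnj (a xi)" "!!xi. b (- xi) = vcnj (b xi)"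
 shows "U.C a b (- xi) = vcnj (U.C a b xi)" "B.C a b (- xi) = vcnj (B.C a b xi)"
proof -
 have s: "a (- xi - et) = vcnj (a (xi - (- et)))" "b (- xi - et) = vcnj (b (xi - (- et)))"
 "a et = vcnj (a (- et))" "b et = vcnj (b (- et))" for et
 using assms(1)[of "xi + et"] assms(2)[of "xi + et"] assms(1)[of "- et"] assms(2)[of "- et"] by simp_all
 have "U.C a b (- xi) = (LINT et|lborel. vcnj (Nu xi (a (xi - (- et))) (b (xi - (- et))) (a (- et)) (b (- et))))"
 unfolding U.C_def Nu_cnj[symmetric] s[symmetric] ..
 also have "... = vcnj (U.C a b xi)"
 unfolding integral_vcnj U.C_def using integral_reflect[where t=0 and f="%et. Nu xi (a (xi - et)) (b (xi - et)) (a et) (b et)"] by simp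
 finally show "U.C a b (- xi) = vcnj (U.C a b xi)" .
 have "B.C a b (- xi) = (LINT et|lborel. vcnj (Nb xi (a (xi - (- et))) (b (xi - (- et))) (a (- et)) (b (- et))))"
 unfolding B.C_def Nb_cnj[symmetric] s[symmetric] ..
 also have "... = vcnj (B.C a b xi)"
 unfolding integral_vcnj B.C_def using integral_reflect[where t=0 and f="%et. Nb xi (a (xi - et)) (b (xi - et)) (a et) (b et)"] by simp
 finally show "B.C a b (- xi) = vcnj (B.C a b xi)" .
qed

lemma vcnj_scaleR: "vcnj (c *R v) = c *R vcnj v" and vcnj_add: "vcnj (v + w) = vcnj v + vcnj w"
 by (simp_all add: vec_eq_iff)

lemma D_cnj:
 assumes "!!t xi. u t (- xi) = vcnj (u t xi)" "!!t xi. b t (- xi) = vcnj (b t xi)"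
 shows "U.D u b t (- xi) = vcnj (U.D u b t xi)" "B.D u b t (- xi) = vcnj (B.D u b t xi)"
proof -
 have c: "U.C (u ta) (b ta) (- xi) = vcnj (U.C (u ta) (b ta) xi)" "B.C (u ta) (b ta) (- xi) = vcnj (B.C (u ta) (b ta) xi)" for ta
 by (rule conv_cnj; rule assms)+
 show "U.D u b t (- xi) = vcnj (U.D u b t xi)" "B.D u b t (- xi) = vcnj (B.D u b t xi)"
 unfolding U.D_def B.D_def set_lebesgue_integral_def c norm_minus_cancel vcnj_scaleR[symmetric] integral_vcnj by (rule refl)+
qed

lemma numeral_mult_ennreal: "numeral w * ennreal b = er (numeral w * b)"
 by (simp add: ennreal_mult')

text \<open>The bound 1/192 is dictated by uniqueness: the limit has a majorant of norm at most 6
  \<epsilon>, and \<open>solF_unique\<close> asks for 1/32. Boundedness of the iterates requires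
  only 32 \<epsilon> <= 1, halving of their differences 64 \<epsilon> <= 1.\<close>

locale picard =
 fixes a0 b0 :: "real^3 => complex^3" and \<epsilon> :: real
 assumes a0[measurable]: "a0 \<in> BM" and b0[measurable]: "b0 \<in> BM"
 and \<epsilon>0: "0 <= \<epsilon>" and \<epsilon>: "\<epsilon> <= 1/192" and small: "nrm (iv a0) (iv b0) <= ennreal \<epsilon>"
begin

primrec zs :: "nat => (real => real^3 => complex^3) \<times> (real => real^3 => complex^3)" where
 "zs 0 = ((%t x. 0), (%t x. 0))"
| "zs (Suc n) = ((%t x. heatF a0 t x + U.D (fst (zs n)) (snd (zs n)) t x), (%t x. heatF b0 t x + B.D (fst (zs n)) (snd (zs n)) t x))"

text \<open>The same recursion for scalar majorants. It dominates the vector iteration and is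
  monotone, as all its operations are.\<close>

primrec ps :: "nat => (real^3 => ennreal) \<times> (real^3 => ennreal)" where
 "ps 0 = ((%x. 0), (%x. 0))"
| "ps (Suc n) = ((%x. iv a0 x + FU (fst (ps n)) (snd (ps n)) (fst (ps n)) (snd (ps n)) x), (%x. iv b0 x + FB (fst (ps n)) (snd (ps n)) (fst (ps n)) (snd (ps n)) x))"

definition zu where "zu n = fst (zs n)"

definition zb where "zb n = snd (zs n)"

definition p where "p n = fst (ps n)"

definition q where "q n = snd (ps n)"

lemma zu_Suc: "zu (Suc n) = (%t x. heatF a0 t x + U.D (zu n) (zb n) t x)" and zb_Suc: "zb (Suc n) = (%t x. heatF b0 t x + B.D (zu n) (zb n) t x)"
 and p_Suc: "p (Suc n) = (%x. iv a0 x + FU (p n) (q n) (p n) (q n) x)" and q_Suc: "q (Suc n) = (%x. iv b0 x + FB (p n) (q n) (p n) (q n) x)"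
 and zu_0: "zu 0 = (%t x. 0)" and zb_0: "zb 0 = (%t x. 0)" and p_0: "p 0 = (%x. 0)" and q_0: "q 0 = (%x. 0)"
 by (simp_all add: zu_def zb_def p_def q_def)

lemma pq_measurable: "p n \<in> BM & q n \<in> BM"
proof (induction n)
 case 0 show ?case by (simp add: p_0 q_0)
next
 case (Suc n)
 then have [measurable]: "p n \<in> BM" "q n \<in> BM" by auto
 show ?case unfolding p_Suc q_Suc by (intro conjI; measurable)
qed

lemma p_measurable [measurable]: "p n \<in> BM" and q_measurable [measurable]: "q n \<in> BM"
 using pq_measurable by auto

lemma z_jm: "jm (zu n) & jm (zb n)"
proof (induction n)
 case 0 show ?case by (simp add: zu_0 zb_0 jm_zero)
next
 case (Suc n) then show ?case unfolding zu_Suc zb_Suc by (intro conjI jm_add heatF_jm U.D_jm B.D_jm) auto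
qed

lemma zu_jm: "jm (zu n)" and zb_jm: "jm (zb n)"
 using z_jm by auto

lemma z_Maj: "Maj {0..} (zu n) (p n) & Maj {0..} (zb n) (q n)"
proof (induction n)
 case 0 show ?case by (simp add: zu_0 zb_0 Maj_def)
next
 case (Suc n)
 show ?case unfolding zu_Suc zb_Suc p_Suc q_Suc
 by (intro conjI Maj_add heatF_jm heatF_Maj initial_atLeast U.D_jm B.D_jm U.D_Maj B.D_Maj zu_jm zb_jm) (use Suc in auto)
qed

lemma zu_Maj: "Maj {0..} (zu n) (p n)" and zb_Maj: "Maj {0..} (zb n) (q n)"
 using z_Maj by auto

lemma ennreal_8: "a >= 0 ==> b >= 0 ==> 8 * (ennreal a * ennreal b) = er (8 * (a * b))"
 by (simp add: ennreal_mult)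

lemma nrm_pq: "nrm (p n) (q n) <= er (2 * \<epsilon>)"
proof (induction n)
 case 0 show ?case by (simp add: p_0 q_0 nrm_def wN_def)
next
 case (Suc n)
 have "nrm (p (Suc n)) (q (Suc n)) = nrm (iv a0) (iv b0) + nrm (FU (p n) (q n) (p n) (q n)) (FB (p n) (q n) (p n) (q n))"
 unfolding p_Suc q_Suc by (rule nrm_add) measurable
 also have "... <= ennreal \<epsilon> + 8 * (nrm (p n) (q n) * nrm (p n) (q n))" by (intro add_mono small nrm_F) measurable
 also have "... <= ennreal \<epsilon> + 8 * (er (2 * \<epsilon>) * er (2 * \<epsilon>))" by (intro add_mono mult_mono Suc order_refl) auto
 also have "... = er (\<epsilon> + 32 * \<epsilon> * \<epsilon>)" using \<epsilon>0 by (subst ennreal_8) (simp_all add: ennreal_plus[symmetric] del: ennreal_plus)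
 also have "... <= er (2 * \<epsilon>)"
 proof (rule ennreal_leI)
 have "\<epsilon> * (32 * \<epsilon>) <= \<epsilon> * 1" using \<epsilon>0 \<epsilon> by (intro mult_left_mono) auto
 then show "\<epsilon> + 32 * \<epsilon> * \<epsilon> <= 2 * \<epsilon>" by (simp add: mult_ac)
 qed
 finally show ?case .
qed

lemma pq_mono: "p n x <= p (Suc n) x & q n x <= q (Suc n) x"
proof (induction n arbitrary: x)
 case 0 show ?case by (simp add: p_0 q_0)
next
 case (Suc n)
 then show ?case unfolding p_Suc[of "Suc n"] q_Suc[of "Suc n"] unfolding p_Suc[of n] q_Suc[of n]
 by (intro conjI add_left_mono F_mono) (auto simp: p_Suc[symmetric] q_Suc[symmetric])
qed

lemma incseq_p: "incseq p" and incseq_q: "incseq q"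
 using pq_mono by (auto intro!: incseq_SucI simp: le_fun_def)

text \<open>The increasing iterates have a supremum, a single majorant for all Picard iterates and
  for their limit. Norm bounds pass to it by monotone convergence.\<close>

definition P where "P = (%x. SUP n. p n x)"

definition Q where "Q = (%x. SUP n. q n x)"

lemma P_measurable [measurable]: "P \<in> BM" and Q_measurable [measurable]: "Q \<in> BM"
 unfolding P_def Q_def by measurable

lemma p_le_P: "p n x <= P x" and q_le_Q: "q n x <= Q x"
 unfolding P_def Q_def by (auto intro: SUP_upper)

text \<open>The bound 2 \<epsilon> is carried over to each of the three summands of
  \<open>nrm\<close> separately, hence 6 \<epsilon>.\<close>

lemma nrm_PQ: "nrm P Q <= er (6 * \<epsilon>)"
proof -
 have "wN 0 P <= er (2 * \<epsilon>)" "wN 0 Q <= er (2 * \<epsilon>)" "wN 1 Q <= er (2 * \<epsilon>)"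
 unfolding P_def Q_def by (intro wN_SUP_le incseq_p incseq_q p_measurable q_measurable order_trans[OF wN_le_nrm(1) nrm_pq]
 order_trans[OF wN_le_nrm(2) nrm_pq] order_trans[OF wN_le_nrm(3) nrm_pq])+
 then have "nrm P Q <= er (2 * \<epsilon>) + er (2 * \<epsilon>) + er (2 * \<epsilon>)" unfolding nrm_def by (intro add_mono)
 then show ?thesis using \<epsilon>0 by (simp add: ennreal_plus[symmetric] del: ennreal_plus)
qed

text \<open>If an iterate has high norm at most 2H, the tame estimate bounds the next one by H + 2 *
  2^k * (2H * 2 \<epsilon> + 2 \<epsilon> * 2H) = H + 16 * 2^k * \<epsilon> * H, which is at most
  2H. This is the origin of the 16.\<close>

lemma high_norm:
 assumes k: "k >= 0" "16 * 2 powr k * \<epsilon> <= 1"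
 shows "wN k P <= 2 * hN k (iv a0) (iv b0)" "wN k Q <= 2 * hN k (iv a0) (iv b0)"
proof -
 let ?H = "hN k (iv a0) (iv b0)"
 have "hN k (p n) (q n) <= 2 * ?H" for n
 proof (induction n)
 case 0 show ?case by (simp add: p_0 q_0 hN_def wN_def)
 next
 case (Suc n)
 have "hN k (p (Suc n)) (q (Suc n)) = ?H + hN k (FU (p n) (q n) (p n) (q n)) (FB (p n) (q n) (p n) (q n))"
 unfolding p_Suc q_Suc hN_def by (subst (1 2) wN_add) (auto simp: add_ac)
 also have "... <= ?H + er (2 * 2 powr k) * (hN k (p n) (q n) * nrm (p n) (q n) + nrm (p n) (q n) * hN k (p n) (q n))"
 by (intro add_left_mono hN_F k) measurable
 also have "... <= ?H + er (2 * 2 powr k) * (2 * ?H * er (2 * \<epsilon>) + er (2 * \<epsilon>) * (2 * ?H))"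
 by (intro add_left_mono mult_left_mono add_mono mult_mono Suc nrm_pq) auto
 also have "... = ?H + er (2 * 2 powr k) * (4 * er (2 * \<epsilon>)) * ?H"
 by (simp only: ennreal_ring)
 also have "er (2 * 2 powr k) * (4 * er (2 * \<epsilon>)) = er (2 * 2 powr k * (4 * (2 * \<epsilon>)))"
 by (subst numeral_mult_ennreal, subst ennreal_mult'[symmetric]) simp_all
 also have "?H + er (2 * 2 powr k * (4 * (2 * \<epsilon>))) * ?H <= ?H + 1 * ?H"
 using k by (intro add_left_mono mult_right_mono) (auto simp: mult_ac)
 finally show ?case by (simp add: mult_2)
 qed
 then have h: "wN k (p n) + wN k (q n) <= 2 * ?H" for n by (simp add: hN_def)
 have "wN k (p n) <= 2 * ?H" "wN k (q n) <= 2 * ?H" for n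
 by (rule order_trans[OF _ h[of n]], simp)+
 then show "wN k P <= 2 * ?H" "wN k Q <= 2 * ?H"
 unfolding P_def Q_def by (auto intro!: wN_SUP_le incseq_p incseq_q)
qed

text \<open>The induction of \<open>high_norm\<close> with a pointwise bound: the nonlinear part is
  at most 4 * 2^s * 2A * 2 \<epsilon> = 16 * 2^s * \<epsilon> * A <= A.\<close>

lemma sup_norm:
 assumes s: "s >= 0" "16 * 2 powr s * \<epsilon> <= 1"
 and a: "AL x. er (norm x powr s) * iv a0 x <= A" and b: "AL x. er (norm x powr s) * iv b0 x <= A"
 shows "AL x. er (norm x powr s) * P x <= 2 * A" "AL x. er (norm x powr s) * Q x <= 2 * A"
proof -
 have *: "(AL x. er (norm x powr s) * p n x <= 2 * A) & (AL x. er (norm x powr s) * q n x <= 2 * A)" for n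
 proof (induction n)
 case 0 show ?case by (simp add: p_0 q_0)
 next
 case (Suc n)
 have X: "er (4 * 2 powr s) * (2 * A * nrm (p n) (q n)) <= A"
 proof -
 have "er (4 * 2 powr s) * (2 * A * nrm (p n) (q n)) <= er (4 * 2 powr s) * (2 * A * er (2 * \<epsilon>))"
 by (intro mult_left_mono nrm_pq) auto
 also have "... = er (4 * 2 powr s) * (2 * er (2 * \<epsilon>)) * A" by (simp only: ennreal_ring)
 also have "er (4 * 2 powr s) * (2 * er (2 * \<epsilon>)) = er (4 * 2 powr s * (2 * (2 * \<epsilon>)))"
 by (subst numeral_mult_ennreal, subst ennreal_mult'[symmetric]) simp_all
 also have "... * A <= 1 * A" using s by (intro mult_right_mono) (auto simp: mult_ac)
 finally show ?thesis by simp
 qed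
 have "er (norm x powr s) * FU (p n) (q n) (p n) (q n) x <= A" "er (norm x powr s) * FB (p n) (q n) (p n) (q n) x <= A" for x
 using sup_F[OF s(1) p_measurable q_measurable conjunct1[OF Suc] conjunct2[OF Suc]] X by (blast intro: order_trans)+
 then show ?case unfolding p_Suc q_Suc distrib_left mult_2
 by (intro conjI eventually_mono[OF a] eventually_mono[OF b] add_mono)
 qed
 have "AL x. \<forall>n. er (norm x powr s) * p n x <= 2 * A" "AL x. \<forall>n. er (norm x powr s) * q n x <= 2 * A"
 unfolding AE_all_countable using * by blast+
 then show "AL x. er (norm x powr s) * P x <= 2 * A" "AL x. er (norm x powr s) * Q x <= 2 * A"
 unfolding P_def Q_def SUP_mult_left_ennreal
 by (simp_all only: SUP_le_iff ball_UNIV)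
qed

text \<open>Majorants of the differences of successive iterates, following
  \<open>D_diff_Maj\<close>. As the iteration starts at 0, the first difference is the first
  iterate.\<close>

primrec ds :: "nat => (real^3 => ennreal) \<times> (real^3 => ennreal)" where
 "ds 0 = (p 1, q 1)"
| "ds (Suc n) = ((%x. FU (fst (ds n)) (snd (ds n)) (p (Suc n)) (q (Suc n)) x + FU (p n) (q n) (fst (ds n)) (snd (ds n)) x),
 (%x. FB (fst (ds n)) (snd (ds n)) (p (Suc n)) (q (Suc n)) x + FB (p n) (q n) (fst (ds n)) (snd (ds n)) x))"

definition r where "r n = fst (ds n)"

definition s where "s n = snd (ds n)"

lemma r_Suc: "r (Suc n) = (%x. FU (r n) (s n) (p (Suc n)) (q (Suc n)) x + FU (p n) (q n) (r n) (s n) x)"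
 and s_Suc: "s (Suc n) = (%x. FB (r n) (s n) (p (Suc n)) (q (Suc n)) x + FB (p n) (q n) (r n) (s n) x)"
 and r_0: "r 0 = p 1" and s_0: "s 0 = q 1"
 by (simp_all add: r_def s_def)

lemma rs_measurable: "r n \<in> BM & s n \<in> BM"
proof (induction n)
 case 0 show ?case by (simp add: r_0 s_0)
next
 case (Suc n)
 then have [measurable]: "r n \<in> BM" "s n \<in> BM" by auto
 show ?case unfolding r_Suc s_Suc by (intro conjI; measurable)
qed

lemma r_measurable [measurable]: "r n \<in> BM" and s_measurable [measurable]: "s n \<in> BM"
 using rs_measurable by auto

lemma fin_pq: "nrm (p n) (q n) < ic" "nrm P Q < ic"
 using le_less_trans[OF nrm_pq, of ic n] le_less_trans[OF nrm_PQ, of ic] by simp_all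

lemma rs_Maj: "Maj {0..} (%t x. zu (Suc n) t x - zu n t x) (r n) & Maj {0..} (%t x. zb (Suc n) t x - zb n t x) (s n)"
proof (induction n)
 case 0 show ?case unfolding zu_0 zb_0 r_0 s_0 using zu_Maj[of 1] zb_Maj[of 1] by simp
next
 case (Suc n)
 have "Maj {0..} (%t x. U.D (zu (Suc n)) (zb (Suc n)) t x - U.D (zu n) (zb n) t x) (r (Suc n))"
 unfolding r_Suc
 by (rule U.D_diff_Maj[OF initial_atLeast zu_jm zb_jm zu_jm zb_jm p_measurable q_measurable p_measurable q_measurable
 r_measurable s_measurable zu_Maj zb_Maj zu_Maj zb_Maj conjunct1[OF Suc] conjunct2[OF Suc]])
 (intro F_finite_AE p_measurable q_measurable fin_pq)+
 moreover have "Maj {0..} (%t x. B.D (zu (Suc n)) (zb (Suc n)) t x - B.D (zu n) (zb n) t x) (s (Suc n))"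
 unfolding s_Suc
 by (rule B.D_diff_Maj[OF initial_atLeast zu_jm zb_jm zu_jm zb_jm p_measurable q_measurable p_measurable q_measurable
 r_measurable s_measurable zu_Maj zb_Maj zu_Maj zb_Maj conjunct1[OF Suc] conjunct2[OF Suc]])
 (intro F_finite_AE p_measurable q_measurable fin_pq)+
 ultimately show ?case by (simp add: zu_Suc[of "Suc n"] zb_Suc[of "Suc n"] zu_Suc[of n, symmetric] zb_Suc[of n, symmetric])
 (simp add: zu_Suc[of n] zb_Suc[of n])
qed

lemma nrm_rs: "nrm (r n) (s n) <= er (2 * \<epsilon> * (1/2) ^ n)"
proof (induction n)
 case 0 show ?case using nrm_pq[of 1] by (simp add: r_0 s_0)
next
 case (Suc n)
 have "nrm (r (Suc n)) (s (Suc n)) = nrm (FU (r n) (s n) (p (Suc n)) (q (Suc n))) (FB (r n) (s n) (p (Suc n)) (q (Suc n)))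
 + nrm (FU (p n) (q n) (r n) (s n)) (FB (p n) (q n) (r n) (s n))"
 unfolding r_Suc s_Suc by (rule nrm_add) measurable
 also have "... <= 8 * (nrm (r n) (s n) * nrm (p (Suc n)) (q (Suc n))) + 8 * (nrm (p n) (q n) * nrm (r n) (s n))"
 by (intro add_mono nrm_F) measurable
 also have "... <= 8 * (er (2 * \<epsilon> * (1/2) ^ n) * er (2 * \<epsilon>)) + 8 * (er (2 * \<epsilon>) * er (2 * \<epsilon> * (1/2) ^ n))"
 by (intro add_mono mult_left_mono mult_mono Suc nrm_pq) auto
 also have "... = er (\<epsilon> * (1/2)^n * (64 * \<epsilon>))"
 using \<epsilon>0 by (subst (1 2) ennreal_8) (auto simp: ennreal_plus[symmetric] field_simps simp del: ennreal_plus)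
 also have "... <= er (\<epsilon> * (1/2)^n * 1)"
 using \<epsilon> \<epsilon>0 by (intro ennreal_leI mult_left_mono) auto
 finally show ?case by simp
qed

definition R where "R n = (%x. \<Sum>j. r (j + n) x)"

definition S where "S n = (%x. \<Sum>j. s (j + n) x)"

lemma R_measurable [measurable]: "R n \<in> BM" and S_measurable [measurable]: "S n \<in> BM"
 unfolding R_def S_def by measurable

lemma nrm_RS: "nrm (R n) (S n) <= er (4 * \<epsilon> * (1/2) ^ n)"
proof -
 have "nrm (R n) (S n) = (\<Sum>j. nrm (r (j + n)) (s (j + n)))" unfolding R_def S_def by (rule nrm_suminf) measurable
 also have "... <= (\<Sum>j. er (2 * \<epsilon> * (1/2) ^ (j + n)))" by (intro suminf_le nrm_rs) auto
 also have "... = (\<Sum>j. er (2 * \<epsilon> * (1/2) ^ n * (1/2) ^ j))" by (simp add: power_add mult_ac)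
 also have "... = er (\<Sum>j. 2 * \<epsilon> * (1/2) ^ n * (1/2) ^ j)" using \<epsilon>0 by (intro suminf_ennreal2 summable_mult summable_geometric) auto
 also have "(\<Sum>j. 2 * \<epsilon> * (1/2) ^ n * (1/2) ^ j) = 4 * \<epsilon> * (1/2)^n"
 by (subst suminf_mult) (auto simp: suminf_geometric)
 finally show ?thesis .
qed

lemma RS_tendsto: "(%n. nrm (R n) (S n)) -+> 0"
proof (rule tendsto_sandwich[OF _ _ tendsto_const])
 have "(%n. 4 * \<epsilon> * (1/2) ^ n) -+> 4 * \<epsilon> * 0" by (intro tendsto_intros LIMSEQ_realpow_zero) auto
 then show "(%n. er (4 * \<epsilon> * (1/2) ^ n)) -+> 0" using tendsto_ennrealI by fastforce
qed (auto intro!: always_eventually nrm_RS)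

text \<open>\<open>lim\<close> also has a value where the iterates diverge, which keeps the limit
  jointly measurable. The frequencies at which they diverge for some time form a null set.\<close>

definition u where "u = (%t x. lim (%n. zu n t x))"

definition b where "b = (%t x. lim (%n. zb n t x))"

lemma u_jm: "jm u" and b_jm: "jm b"
 unfolding u_def b_def using zu_jm zb_jm unfolding jm_def case_prod_beta' by (intro borel_measurable_lim_metric; simp)+

lemma limit_aux:
 assumes "!!n. Maj {0..} (%t x. z (Suc n) t x - z n t x) (\<rho> n)"
 and "!!n. jm (z n)" "AL x. (\<Sum>j. \<rho> j x) < ic"
 shows "AL x. \<forall>t\<in>{0..}. (%n. z n t x) -+> lim (%n. z n t x)"
 and "Maj {0..} (%t x. lim (%n. z n t x) - z m t x) (%x. \<Sum>j. \<rho> (j + m) x)"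
proof -
 have "AL x. \<forall>n. \<forall>t\<in>{0..}. en (z (Suc n) t x - z n t x) <= en x * \<rho> n x"
 unfolding AE_all_countable using assms(1) unfolding Maj_def by (auto elim!: eventually_mono)
 then have f: "AL x. \<forall>t\<in>{0..}. (\<Sum>n. en (z (Suc n) t x - z n t x)) < ic"
 using assms(3)
 proof eventually_elim
 case (elim x)
 show ?case
 proof
 fix t :: real assume t: "t \<in> {0..}"
 have "(\<Sum>n. en (z (Suc n) t x - z n t x)) <= (\<Sum>n. en x * \<rho> n x)"
 proof (rule suminf_le)
 show "en (z (Suc n) t x - z n t x) <= en x * \<rho> n x" for n using elim(1) t by blast
 qed auto
 also have "... = en x * (\<Sum>n. \<rho> n x)" by (rule ennreal_suminf_cmult)
 also have "... < ic" using elim(2) by (simp add: ennreal_mult_less_top)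
 finally show "(\<Sum>n. en (z (Suc n) t x - z n t x)) < ic" .
 qed
 qed
 then show "AL x. \<forall>t\<in>{0..}. (%n. z n t x) -+> lim (%n. z n t x)"
 by (rule eventually_mono) (blast intro: telescope_lim(1))
 show "Maj {0..} (%t x. lim (%n. z n t x) - z m t x) (%x. \<Sum>j. \<rho> (j + m) x)"
 proof (rule Maj_suminf[where d="%j t x. z (Suc (j + m)) t x - z (j + m) t x"])
 show "AL x. \<forall>t\<in>{0..}. en (lim (%n. z n t x) - z m t x) <= (\<Sum>j. er (norm (z (Suc (j + m)) t x - z (j + m) t x)))"
 using f by (rule eventually_mono) (blast intro: telescope_lim(2))
 qed (auto intro: jm_diff assms)
qed

lemma fin_RS: "AL x. (\<Sum>j. r j x) < ic" "AL x. (\<Sum>j. s j x) < ic"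
proof -
 have "nrm (R 0) (S 0) < ic" by (rule le_less_trans[OF nrm_RS]) simp
 from nrm_finite_AE[OF R_measurable S_measurable this] show "AL x. (\<Sum>j. r j x) < ic" "AL x. (\<Sum>j. s j x) < ic"
 by (simp_all add: R_def S_def)
qed

lemma u_lim: "AL x. \<forall>t\<in>{0..}. (%n. zu n t x) -+> u t x" and b_lim: "AL x. \<forall>t\<in>{0..}. (%n. zb n t x) -+> b t x"
 and u_err: "Maj {0..} (%t x. u t x - zu n t x) (R n)" and b_err: "Maj {0..} (%t x. b t x - zb n t x) (S n)"
 unfolding u_def b_def R_def S_def
 by (rule limit_aux[where z=zu and \<rho>=r, OF conjunct1[OF rs_Maj] zu_jm fin_RS(1)]
 limit_aux[where z=zb and \<rho>=s, OF conjunct2[OF rs_Maj] zb_jm fin_RS(2)])+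

lemma u_Maj: "Maj {0..} u P"
 by (rule Maj_limit[OF zu_jm _ u_jm Maj_mono[OF zu_Maj] u_lim]) (auto intro: p_le_P)

lemma b_Maj: "Maj {0..} b Q"
 by (rule Maj_limit[OF zb_jm _ b_jm Maj_mono[OF zb_Maj] b_lim]) (auto intro: q_le_Q)

lemma Maj_minus_commute: "Maj J (%t x. z t x - w t x) f ==> Maj J (%t x. w t x - z t x) f"
 by (simp add: Maj_def norm_minus_commute)

text \<open>The residual of the equation is independent of n, but comparison with the n-th iterate
  provides a majorant \<open>?XU n\<close>, \<open>?XB n\<close> for every n. Their norms tend to 0,
  so \<open>Maj_zero\<close> applies.\<close>

lemma u_b_solution: "solF {0..} a0 b0 u b"
proof -
 let ?XU = "%n x. R (Suc n) x + (FU (R n) (S n) (p n) (q n) x + FU P Q (R n) (S n) x)"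
 let ?XB = "%n x. S (Suc n) x + (FB (R n) (S n) (p n) (q n) x + FB P Q (R n) (S n) x)"
 have mU: "Maj {0..} (%t x. u t x - heatF a0 t x - U.D u b t x) (?XU n)" for n
 proof -
 have 1: "Maj {0..} (%t x. U.D (zu n) (zb n) t x - U.D u b t x) (%x. FU (R n) (S n) (p n) (q n) x + FU P Q (R n) (S n) x)"
 by (rule U.D_diff_Maj[OF initial_atLeast zu_jm zb_jm u_jm b_jm p_measurable q_measurable P_measurable Q_measurable
 R_measurable S_measurable zu_Maj zb_Maj u_Maj b_Maj Maj_minus_commute[OF u_err] Maj_minus_commute[OF b_err]])
 (intro F_finite_AE p_measurable q_measurable P_measurable Q_measurable fin_pq)+
 have "Maj {0..} (%t x. (u t x - zu (Suc n) t x) + (U.D (zu n) (zb n) t x - U.D u b t x)) (?XU n)"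
 by (rule Maj_add[OF _ _ _ u_err 1]) (auto intro!: jm_diff u_jm zu_jm U.D_jm zb_jm b_jm)
 then show ?thesis by (simp add: zu_Suc algebra_simps)
 qed
 have mB: "Maj {0..} (%t x. b t x - heatF b0 t x - B.D u b t x) (?XB n)" for n
 proof -
 have 1: "Maj {0..} (%t x. B.D (zu n) (zb n) t x - B.D u b t x) (%x. FB (R n) (S n) (p n) (q n) x + FB P Q (R n) (S n) x)"
 by (rule B.D_diff_Maj[OF initial_atLeast zu_jm zb_jm u_jm b_jm p_measurable q_measurable P_measurable Q_measurable
 R_measurable S_measurable zu_Maj zb_Maj u_Maj b_Maj Maj_minus_commute[OF u_err] Maj_minus_commute[OF b_err]])
 (intro F_finite_AE p_measurable q_measurable P_measurable Q_measurable fin_pq)+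
 have "Maj {0..} (%t x. (b t x - zb (Suc n) t x) + (B.D (zu n) (zb n) t x - B.D u b t x)) (?XB n)"
 by (rule Maj_add[OF _ _ _ b_err 1]) (auto intro!: jm_diff u_jm zu_jm B.D_jm zb_jm b_jm)
 then show ?thesis by (simp add: zb_Suc algebra_simps)
 qed
 have X: "wN 0 (?XU n) <= nrm (R (Suc n)) (S (Suc n)) + (8 * (nrm (R n) (S n) * er (2 * \<epsilon>)) + 8 * (er (6 * \<epsilon>) * nrm (R n) (S n)))"
 "wN 0 (?XB n) <= nrm (R (Suc n)) (S (Suc n)) + (8 * (nrm (R n) (S n) * er (2 * \<epsilon>)) + 8 * (er (6 * \<epsilon>) * nrm (R n) (S n)))" for n
 proof -
 have 1: "nrm (FU (R n) (S n) (p n) (q n)) (FB (R n) (S n) (p n) (q n)) <= 8 * (nrm (R n) (S n) * er (2 * \<epsilon>))"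
 by (rule order_trans[OF nrm_F]) (auto intro!: mult_left_mono nrm_pq)
 have 2: "nrm (FU P Q (R n) (S n)) (FB P Q (R n) (S n)) <= 8 * (er (6 * \<epsilon>) * nrm (R n) (S n))"
 by (rule order_trans[OF nrm_F]) (auto intro!: mult_left_mono mult_right_mono nrm_PQ)
 show "wN 0 (?XU n) <= nrm (R (Suc n)) (S (Suc n)) + (8 * (nrm (R n) (S n) * er (2 * \<epsilon>)) + 8 * (er (6 * \<epsilon>) * nrm (R n) (S n)))"
 by (subst wN_add, measurable, subst wN_add, measurable)
 (intro add_mono order_trans[OF wN_le_nrm(1) 1] order_trans[OF wN_le_nrm(1) 2] wN_le_nrm(1))
 show "wN 0 (?XB n) <= nrm (R (Suc n)) (S (Suc n)) + (8 * (nrm (R n) (S n) * er (2 * \<epsilon>)) + 8 * (er (6 * \<epsilon>) * nrm (R n) (S n)))"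
 by (subst wN_add, measurable, subst wN_add, measurable)
 (intro add_mono order_trans[OF wN_le_nrm(2) 1] order_trans[OF wN_le_nrm(2) 2] wN_le_nrm(2))
 qed
 have l: "(%n. nrm (R (Suc n)) (S (Suc n)) + (8 * (nrm (R n) (S n) * er (2 * \<epsilon>)) + 8 * (er (6 * \<epsilon>) * nrm (R n) (S n)))) -+> 0"
 proof -
 have c: "(%n. c * nrm (R n) (S n)) -+> 0" if "c < top" for c
 using ennreal_tendsto_cmult[OF that RS_tendsto] by simp
 have "(%n. nrm (R (Suc n)) (S (Suc n)) + (8 * er (2 * \<epsilon>) * nrm (R n) (S n) + 8 * er (6 * \<epsilon>) * nrm (R n) (S n))) -+> 0 + (0 + 0)"
 by (intro tendsto_add LIMSEQ_Suc[OF RS_tendsto] c) (auto simp: ennreal_mult_less_top)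
 then show ?thesis by (simp add: mult_ac)
 qed
 have "(%n. wN 0 (?XU n)) -+> 0" "(%n. wN 0 (?XB n)) -+> 0"
 using X by (auto intro!: tendsto_sandwich[OF _ _ tendsto_const l] always_eventually)
 then have "AL x. \<forall>t\<in>{0..}. u t x - heatF a0 t x - U.D u b t x = 0" "AL x. \<forall>t\<in>{0..}. b t x - heatF b0 t x - B.D u b t x = 0"
 using Maj_zero[OF mU] Maj_zero[OF mB] by measurable
 then show ?thesis unfolding solF_def by eventually_elim (auto simp: algebra_simps)
qed

lemma z_cnj:
 assumes "!!xi. a0 (- xi) = vcnj (a0 xi)" "!!xi. b0 (- xi) = vcnj (b0 xi)"
 shows "zu n t (- xi) = vcnj (zu n t xi) & zb n t (- xi) = vcnj (zb n t xi)"
proof (induction n arbitrary: t xi)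
 case 0 show ?case by (simp add: zu_0 zb_0 vec_eq_iff)
next
 case (Suc n) show ?case unfolding zu_Suc zb_Suc using D_cnj[of "zu n" "zb n"] Suc
 by (simp add: heatF_def assms vcnj_add vcnj_scaleR)
qed

lemma u_b_cnj:
 assumes "!!xi. a0 (- xi) = vcnj (a0 xi)" "!!xi. b0 (- xi) = vcnj (b0 xi)"
 shows "AL xi. \<forall>t\<in>{0..}. u t (- xi) = vcnj (u t xi)" "AL xi. \<forall>t\<in>{0..}. b t (- xi) = vcnj (b t xi)"
proof -
 have lim: "v t (- xi) = vcnj (v t xi)" if "(%n. z n t xi) -+> v t xi" "(%n. z n t (0 - xi)) -+> v t (0 - xi)" "!!n. z n t (- xi) = vcnj (z n t xi)"
 for z :: "nat => real => real^3 => complex^3" and v t xi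
 proof (rule LIMSEQ_unique)
 show "(%n. z n t (- xi)) -+> v t (- xi)" using that by simp
 show "(%n. z n t (- xi)) -+> vcnj (v t xi)" unfolding that(3)
 by (rule bounded_linear.tendsto[OF bounded_linear_vcnj that(1)])
 qed
 show "AL xi. \<forall>t\<in>{0..}. u t (- xi) = vcnj (u t xi)"
 using u_lim AE_reflect[OF u_lim, of 0] by eventually_elim (use z_cnj[OF assms] in \<open>blast intro: lim\<close>)
 show "AL xi. \<forall>t\<in>{0..}. b t (- xi) = vcnj (b t xi)"
 using b_lim AE_reflect[OF b_lim, of 0] by eventually_elim (use z_cnj[OF assms] in \<open>blast intro: lim\<close>)
qed

end

section \<open>Duhamel's formula for tempered distributions\<close>

text \<open>Pairings of a curve of distributions are known only up to a null set of times;
  completeness of the measure in \<open>has_time_integral\<close> turns this into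
  measurability.\<close>

lemma lebesgue_measurable_AE:
 fixes f g :: "real => 'b::topological_space"
 assumes g: "g \<in> BM" and ae: "AL x. f x = g x"
 shows "f \<in> borel_measurable lebesgue"
proof (rule measurableI)
 fix A :: "'b set" assume "A \<in> sets borel"
 then have m1: "g -` A \<inter> space lebesgue \<in> sets lebesgue" using measurable_sets[OF g, of A] by (simp add: sets_completionI_sets)
 have m2: "AE x in lebesgue. x \<in> g -` A \<inter> space lebesgue \<longleftrightarrow> x \<in> f -` A \<inter> space lebesgue"
 using AE_completion[OF ae] by eventually_elim (simp only: vimage_eq Int_iff)
 show "f -` A \<inter> space lebesgue \<in> sets lebesgue" by (rule completion.in_sets_AE[OF m2 m1]) simp
qed auto

lemma has_time_integral_unique: "has_time_integral f I t ==> has_time_integral f I' t ==> I = I'"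
 by (auto simp: has_time_integral_def vec_eq_iff intro!: tempered_eqI)

text \<open>The singular weight of order -1 is harmless against a test function because |xi|
  |\<psi>(xi)| is bounded.\<close>

lemma pair_weighted_integrable:
 fixes h :: "real => real^3 => complex" and \<psi> :: "real^3 => complex"
 assumes h: "jm h" and s: "schwartz \<psi>"
 and fin: "(NN xi. er (norm xi powr - 1) * (NN ta. en (h ta xi))) < ic"
 shows "integrable (lborel \<Otimes>\<^sub>M lborel) (%(ta, xi). h ta xi * \<psi> xi)"
proof -
 note [measurable (raw)] = jm_compose[OF h]
 note [measurable] = schwartz_measurable[OF s]
 obtain C where C: "!!x. norm x * cmod (\<psi> x) <= C" using schwartz_bound[OF s, of 1] by auto
 have C0: "C >= 0" using C[of 0] by simp
 have "(\<integral>\<^sup>+w. en (case w of (ta, xi) => h ta xi * \<psi> xi) \<partial>(lborel \<Otimes>\<^sub>M lborel))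
 = (NN xi. (NN ta. en (h ta xi * \<psi> xi)))"
 by (subst lborel_pair.nn_integral_snd[symmetric]) (auto simp: case_prod_beta')
 also have "... = (NN xi. er (cmod (\<psi> xi)) * (NN ta. en (h ta xi)))"
 by (intro nn_integral_cong) (simp add: norm_mult ennreal_mult nn_integral_cmult mult.commute)
 also have "... <= (NN xi. ennreal C * (er (norm xi powr - 1) * (NN ta. en (h ta xi))))"
 proof (rule nn_integral_mono_AE)
 show "AL xi. er (cmod (\<psi> xi)) * (NN ta. en (h ta xi))
 <= ennreal C * (er (norm xi powr - 1) * (NN ta. en (h ta xi)))"
 using AE_nonzero
 proof eventually_elim
 case (elim xi)
 have "cmod (\<psi> xi) <= C * norm xi powr - 1" using C[of xi] elim by (simp add: powr_minus_divide field_simps)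
 then have "er (cmod (\<psi> xi)) <= ennreal C * er (norm xi powr - 1)"
 using C0 by (subst ennreal_mult[symmetric]) (auto intro: ennreal_leI)
 then show ?case unfolding mult.assoc[symmetric] by (rule mult_right_mono) simp
 qed
 qed
 also have "... = ennreal C * (NN xi. er (norm xi powr - 1) * (NN ta. en (h ta xi)))"
 by (rule nn_integral_cmult) measurable
 also have "... < ic" using fin by (simp add: ennreal_mult_less_top)
 finally show ?thesis unfolding integrable_iff_bounded by (simp add: case_prod_beta')
qed

text \<open>After pairing with a test function the time integral and the frequency integral are
  exchanged, so integration of distributions is pointwise integration of representatives. A
  distribution is determined by its pairings, whence the equivalence.\<close>

lemma time_integral:
 fixes n :: "real => real^3 => complex^3"
 assumes n: "jm n" and f: "AL ta. ta \<in> {0..t} --> ftv (n ta) (f ta)"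
 and fin: "(NN xi. er (norm xi powr - 1) * (\<integral>\<^sup>+ta\<in>{0..t}. en (n ta xi) \<partial>lborel)) < ic"
 shows "\<exists>I. ftv (%xi. LINT ta:{0..t}|lborel. n ta xi) I & (\<forall>I'. has_time_integral f I' t \<longleftrightarrow> I' = I)"
proof -
 note [measurable (raw)] = jm_compose[OF n]
 define h where "h ta xi = ind {0..t} ta *R n ta xi" for ta xi
 define N where "N xi = (LINT ta|lborel. h ta xi)" for xi
 have h: "jm h" unfolding h_def[abs_def] by (rule jmI) measurable
 have hm [measurable]: "(%ta. h ta xi) \<in> BM" for xi unfolding h_def by measurable
 have eq: "(\<integral>\<^sup>+ta\<in>{0..t}. en (n ta xi) \<partial>lborel) = (NN ta. en (h ta xi))" for xi
 by (intro nn_integral_cong) (auto simp: h_def indicator_def)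
 have fin': "(NN xi. er (norm xi powr - 1) * (NN ta. en (h ta xi))) < ic"
 using fin unfolding eq .
 have nm: "(%xi. \<integral>\<^sup>+ta. en (h ta xi) \<partial>lborel) \<in> BM"
 proof -
 note [measurable (raw)] = jm_compose[OF h]
 show ?thesis by measurable
 qed
 note [measurable] = nm
 have "AL xi. er (norm xi powr - 1) * (NN ta. en (h ta xi)) ~= ic"
 using fin' by (intro nn_integral_PInf_AE) auto
 then have int: "AL xi. integrable lborel (%ta. h ta xi)"
 using AE_nonzero
 proof eventually_elim
 case (elim xi)
 then have "(NN ta. en (h ta xi)) < ic" by (auto simp: ennreal_mult_eq_top_iff less_top)
 then show ?case unfolding integrable_iff_bounded by auto
 qed
 have Nm [measurable]: "N \<in> BM"
 proof -
 note [measurable (raw)] = jm_compose[OF h]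
 show ?thesis unfolding N_def[abs_def] by measurable
 qed
 have "(NN xi. er (norm xi powr - 1 * norm (N xi))) <= (NN xi. er (norm xi powr - 1) * (NN ta. en (h ta xi)))"
 proof (rule nn_integral_mono_AE)
 show "AL xi. er (norm xi powr - 1 * norm (N xi)) <= er (norm xi powr - 1) * (NN ta. en (h ta xi))"
 using int by eventually_elim (simp only: ennreal_mult'[OF powr_ge_zero] N_def, intro mult_left_mono integral_norm_bound_ennreal, simp_all)
 qed
 then have ftN: "ftv N (field_of N)" using fin' by (intro ftv_field_of Nm) (auto intro: le_less_trans)
 have main: "has_time_integral f (field_of N) t"
 unfolding has_time_integral_def
 proof (intro allI impI)
 fix i :: 3 and fy assume fy: "schwartz fy"
 define \<psi> where "\<psi> = inv_fourier_fun fy"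
 have \<psi>: "schwartz \<psi>" unfolding \<psi>_def by (rule schwartz_inv_fourier[OF fy])
 note [measurable] = schwartz_measurable[OF \<psi>]
 have hi: "jm (%ta xi. h ta xi $ i)"
 proof -
 note [measurable (raw)] = jm_compose[OF h]
 show ?thesis by (rule jmI) measurable
 qed
 have pint: "integrable (lborel \<Otimes>\<^sub>M lborel) (%(ta, xi). h ta xi $ i * \<psi> xi)"
 proof (rule pair_weighted_integrable[OF hi \<psi>], rule le_less_trans[OF nn_integral_mono fin'])
 show "er (norm xi powr - 1) * (NN ta. en (h ta xi $ i)) <= er (norm xi powr - 1) * (NN ta. en (h ta xi))" for xi
 by (intro mult_left_mono nn_integral_mono ennreal_leI norm_vec_nth_le) auto
 qed
 define G where "G ta = (LINT xi|lborel. h ta xi $ i * \<psi> xi)" for ta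
 have Gi: "integrable lborel G" unfolding G_def using lborel_pair.integrable_fst'[OF pint] by simp
 then have Gm: "G \<in> BM" by auto
 have ae: "AL ta. ind {0..t} ta *R pairing (f ta $ i) fy = G ta"
 using f
 proof eventually_elim
 case (elim ta)
 show ?case
 proof (cases "ta \<in> {0..t}")
 case True
 then have "ft (%xi. n ta xi $ i) (f ta $ i)" using elim by (simp add: ftv_def)
 from ft_pairing[OF this fy] True show ?thesis by (simp add: G_def h_def \<psi>_def)
 qed (simp add: G_def h_def)
 qed
 have m: "(%ta. ind {0..t} ta *R pairing (f ta $ i) fy) \<in> borel_measurable lebesgue"
 by (rule lebesgue_measurable_AE[OF Gm ae])
 have Gl: "integrable lebesgue G" using Gi Gm by (subst integrable_completion) auto
 have "integrable lebesgue (%ta. ind {0..t} ta *R pairing (f ta $ i) fy)"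
 by (rule integrable_cong_AE_imp[OF Gl m]) (use AE_completion[OF ae] in \<open>auto elim: eventually_mono\<close>)
 moreover have "pairing (field_of N $ i) fy = (LINT ta|lebesgue. ind {0..t} ta *R pairing (f ta $ i) fy)"
 proof -
 have "ft (%xi. N xi $ i) (field_of N $ i)" using ftN by (simp add: ftv_def)
 from ft_pairing[OF this fy] have "pairing (field_of N $ i) fy = (LINT xi|lborel. N xi $ i * \<psi> xi)" by (simp add: \<psi>_def)
 also have "... = (LINT xi|lborel. LINT ta|lborel. h ta xi $ i * \<psi> xi)"
 proof (rule Bochner_Integration.integral_cong_AE)
 note [measurable (raw)] = jm_compose[OF h]
 show "(%xi. N xi $ i * \<psi> xi) \<in> borel_measurable lborel" "(%xi. LINT ta|lborel. h ta xi $ i * \<psi> xi) \<in> borel_measurable lborel" by measurable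
 show "AL xi. N xi $ i * \<psi> xi = (LINT ta|lborel. h ta xi $ i * \<psi> xi)"
 using int by eventually_elim (simp only: N_def integral_vec_nth Bochner_Integration.integral_mult_left[OF integrable_vec_nth])
 qed
 also have "... = (LINT ta|lborel. LINT xi|lborel. h ta xi $ i * \<psi> xi)" by (rule lborel_pair.Fubini_integral[OF pint])
 also have "... = (LINT ta|lborel. G ta)" unfolding G_def ..
 also have "... = (LINT ta|lebesgue. G ta)" by (rule integral_completion[symmetric]) (use Gm in simp)
 also have "... = (LINT ta|lebesgue. ind {0..t} ta *R pairing (f ta $ i) fy)"
 by (rule Bochner_Integration.integral_cong_AE) (use Gl m AE_completion[OF ae] in \<open>auto elim: eventually_mono\<close>)
 finally show ?thesis .
 qed
 ultimately show "set_integrable lebesgue {0..t} (%ta. pairing (f ta $ i) fy) &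
 pairing (field_of N $ i) fy = (LINT ta:{0..t}|lebesgue. pairing (f ta $ i) fy)"
 by (simp add: set_integrable_def set_lebesgue_integral_def)
 qed
 have "N = (%xi. LINT ta:{0..t}|lborel. n ta xi)" by (simp add: N_def[abs_def] h_def set_lebesgue_integral_def)
 with ftN main show ?thesis by (auto intro!: exI[of _ "field_of N"] dest: has_time_integral_unique)
qed

lemma duhamel_tempered:
 assumes u: "jm u" and b: "jm b" and t: "t >= 0"
 and ae: "AL ta. ta \<in> {0..t} --> ftv (u ta) (v ta) & integrable lborel (u ta) & ftv (b ta) (w ta) & integrable lborel (b ta)"
 and finU: "(NN xi. er (norm xi powr - 1) * (\<integral>\<^sup>+ta\<in>{0..t}. U.mq u b ta xi \<partial>lborel)) < ic"
 and finB: "(NN xi. er (norm xi powr - 1) * (\<integral>\<^sup>+ta\<in>{0..t}. B.mq u b ta xi \<partial>lborel)) < ic"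
 shows "\<exists>I. ftv (%xi. - U.D u b t xi) I & (\<forall>I'. has_time_integral (u_integrand v w t) I' t \<longleftrightarrow> I' = I)"
 and "\<exists>I. ftv (B.D u b t) I & (\<forall>I'. has_time_integral (B_integrand v w t) I' t \<longleftrightarrow> I' = I)"
proof -
 let ?n = "%ta xi. - (exp (- (t - ta) * (norm xi)\<^sup>2) *R conv_Nu (u ta) (b ta) xi)" and ?k = "%ta xi. exp (- (t - ta) * (norm xi)\<^sup>2) *R conv_Nb (u ta) (b ta) xi"
 have cU: "conv_Nu = U.C" and cB: "conv_Nb = B.C" by (simp_all add: fun_eq_iff conv_Nu_def U.C_def conv_Nb_def B.C_def)
 have n: "jm ?n" and k: "jm ?k"
 proof -
 note [measurable (raw)] = jm_compose[OF U.C_jm[OF u b]] jm_compose[OF B.C_jm[OF u b]]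
 show "jm ?n" "jm ?k" unfolding cU cB by (rule jmI, measurable)+
 qed
 have nf: "AL ta. ta \<in> {0..t} --> ftv (?n ta) (u_integrand v w t ta)" and kf: "AL ta. ta \<in> {0..t} --> ftv (?k ta) (B_integrand v w t ta)"
 by (rule eventually_mono[OF ae], rule impI, rule ftv_integrands; simp)+
 have le1: "(\<integral>\<^sup>+ta\<in>{0..t}. en (?n ta xi) \<partial>lborel) <= (\<integral>\<^sup>+ta\<in>{0..t}. U.mq u b ta xi \<partial>lborel)"
 and le2: "(\<integral>\<^sup>+ta\<in>{0..t}. en (?k ta xi) \<partial>lborel) <= (\<integral>\<^sup>+ta\<in>{0..t}. B.mq u b ta xi \<partial>lborel)" for xi
 proof -
 have e: "exp (- (t - ta) * (norm xi)\<^sup>2) * x <= x" if "ta <= t" "x >= 0" for ta x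
 using that by (intro mult_left_le_one_le) (auto intro: mult_nonpos_nonneg)
 have "en (?n ta xi) <= U.mq u b ta xi" "en (?k ta xi) <= B.mq u b ta xi" if "ta <= t" for ta
 unfolding cU cB using e[OF that]
 by (auto intro!: order_trans[OF ennreal_leI U.C_norm[OF jm_slice[OF u] jm_slice[OF b]]] order_trans[OF ennreal_leI B.C_norm[OF jm_slice[OF u] jm_slice[OF b]]])
 then show "(\<integral>\<^sup>+ta\<in>{0..t}. en (?n ta xi) \<partial>lborel) <= (\<integral>\<^sup>+ta\<in>{0..t}. U.mq u b ta xi \<partial>lborel)"
 "(\<integral>\<^sup>+ta\<in>{0..t}. en (?k ta xi) \<partial>lborel) <= (\<integral>\<^sup>+ta\<in>{0..t}. B.mq u b ta xi \<partial>lborel)"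
 by (auto intro!: nn_integral_mono simp: indicator_def)
 qed
 have "\<exists>I. ftv (%xi. LINT ta:{0..t}|lborel. ?n ta xi) I & (\<forall>I'. has_time_integral (u_integrand v w t) I' t \<longleftrightarrow> I' = I)"
 by (rule time_integral[OF n nf], rule le_less_trans[OF nn_integral_mono finU], rule mult_left_mono[OF le1]) simp
 moreover have "(%xi. LINT ta:{0..t}|lborel. ?n ta xi) = (%xi. - U.D u b t xi)"
 unfolding U.D_def cU set_lebesgue_integral_def by simp
 ultimately show "\<exists>I. ftv (%xi. - U.D u b t xi) I & (\<forall>I'. has_time_integral (u_integrand v w t) I' t \<longleftrightarrow> I' = I)" by simp
 have "\<exists>I. ftv (%xi. LINT ta:{0..t}|lborel. ?k ta xi) I & (\<forall>I'. has_time_integral (B_integrand v w t) I' t \<longleftrightarrow> I' = I)"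
 by (rule time_integral[OF k kf], rule le_less_trans[OF nn_integral_mono finB], rule mult_left_mono[OF le2]) simp
 moreover have "(%xi. LINT ta:{0..t}|lborel. ?k ta xi) = B.D u b t"
 unfolding B.D_def cB by (rule ext) (rule refl)
 ultimately show "\<exists>I. ftv (B.D u b t) I & (\<forall>I'. has_time_integral (B_integrand v w t) I' t \<longleftrightarrow> I' = I)" by simp
qed

section \<open>Bochner integrability in time\<close>

text \<open>Strong measurability is obtained by cutting the frequency at \<open>m\<close> and
  freezing the time on a grid of step \<open>d m\<close>. The cut field is uniformly continuous in
  time on [0,m] in the weighted norm, and the tail beyond \<open>m\<close> tends to 0 at each time
  where that norm is finite.\<close>

lemma in_L1I:
 fixes h :: "real => real^3 => complex^3" and W :: "real^3 => ennreal"
 assumes N: "!!f g. ftv g f ==> N f = (NN xi. W xi * en (g xi))"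
 and Wm [measurable]: "W \<in> BM" and Wb: "!!(m::nat) xi. norm xi <= real m ==> W xi <= er (c m)"
 and h: "jm h" and ft: "!!t. t >= 0 ==> ftv (h t) (v t)"
 and Pm [measurable]: "P \<in> BM" and P: "wN 0 P < ic"
 and dom: "AL xi. \<forall>t\<in>{0..}. en (h t xi) <= en xi * P xi"
 and cont: "AL xi. continuous_on {0..} (%t. h t xi)"
 and fin: "(\<integral>\<^sup>+t\<in>{0..}. (NN xi. W xi * en (h t xi)) \<partial>lborel) < ic"
 shows "in_L1 N v"
proof -
 note [measurable (raw)] = jm_compose[OF h]
 define E :: "nat => (real^3) set" where "E m = {xi. norm xi <= real m}" for m
 have Em [measurable]: "E m \<in> sets borel" for m unfolding E_def by measurable
 define V where "V m xi = W xi * ind (E m) xi" for m xi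
 have Vm [measurable]: "V m \<in> BM" for m unfolding V_def by measurable
 define fy where "fy m s t = (NN xi. V m xi * en (h s xi - h t xi))" for m s t
 have AE_P: "AL xi. P xi < ic" by (rule finite_AE_of_wN[OF Pm P])
 have VP: "(NN xi. V m xi * (en xi * P xi)) < ic" for m
 proof -
 have "(NN xi. V m xi * (en xi * P xi)) <= (NN xi. er (c m) * er (real m) * (er (norm xi powr 0) * P xi))"
 proof (rule nn_integral_mono_AE)
 show "AL xi. V m xi * (en xi * P xi) <= er (c m) * er (real m) * (er (norm xi powr 0) * P xi)"
 using AE_nonzero
 proof eventually_elim
 case (elim xi)
 show ?case
 proof (cases "xi \<in> E m")
 case True
 then have "W xi * en xi * P xi <= er (c m) * er (real m) * P xi"
 by (intro mult_right_mono mult_mono Wb ennreal_leI) (auto simp: E_def)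
 then show ?thesis using True elim by (simp add: V_def mult.assoc)
 qed (simp add: V_def)
 qed
 qed
 also have "... = er (c m) * er (real m) * wN 0 P" unfolding wN_def by (rule nn_integral_cmult) measurable
 also have "... < ic" using P by (simp add: ennreal_mult_less_top)
 finally show ?thesis .
 qed
 have tri: "en (x - y) <= en x + en y" for x y :: "complex^3"
 by (subst ennreal_plus[symmetric]) (auto intro!: ennreal_leI norm_triangle_ineq4 simp del: ennreal_plus)
 \<comment> \<open>Otherwise two time sequences of vanishing distance stay apart in norm. Along a
   subsequence both converge to one time, and dominated convergence over the frequencies gives a
   contradiction.\<close>
 have unif: "\<exists>d>0. \<forall>s\<in>{0..real m}. \<forall>t\<in>{0..real m}. \<bar>s - t\<bar> < d --> fy m s t < e" if e: "e > 0" for m e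
 proof (rule ccontr)
 assume "\<not> ?thesis"
 then have "\<forall>n. \<exists>s t. s \<in> {0..real m} & t \<in> {0..real m} & \<bar>s - t\<bar> < 1 / real (Suc n) & e <= fy m s t"
 by (metis not_less of_nat_0_less_iff zero_less_Suc zero_less_divide_1_iff)
 then obtain \<sigma> ta where \<sigma>: "!!n. \<sigma> n \<in> {0..real m}" and ta: "!!n. ta n \<in> {0..real m}"
 and close: "!!n. \<bar>\<sigma> n - ta n\<bar> < 1 / real (Suc n)" and bad: "!!n. e <= fy m (\<sigma> n) (ta n)"
 by metis
 obtain l r where l: "l \<in> {0..real m}" and r: "strict_mono (r :: nat => nat)" and lim: "(\<sigma> \<circ> r) -+> l"
 using compact_Icc[of 0 "real m"] \<sigma> unfolding compact_def by metis
 have d0: "(%n. \<sigma> (r n) - ta (r n)) -+> 0"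
 proof (rule tendsto_rabs_zero_cancel, rule tendsto_sandwich[OF _ _ tendsto_const])
 show "(%n. 1 / real (Suc (r n))) -+> 0"
 using LIMSEQ_subseq_LIMSEQ[OF LIMSEQ_Suc[OF lim_1_over_n] r] by (simp add: o_def)
 qed (auto intro!: always_eventually less_imp_le close simp del: of_nat_Suc)
 have lim': "(%n. \<sigma> (r n)) -+> l" using lim by (simp add: o_def)
 have limt: "(%n. ta (r n)) -+> l" using tendsto_diff[OF lim' d0] by simp
 have "(%n. fy m (\<sigma> (r n)) (ta (r n))) -+> (NN xi. V m xi * en (h l xi - h l xi))"
 unfolding fy_def
 proof (rule nn_integral_dominated_convergence[where w="%xi. 2 * (V m xi * (en xi * P xi))"])
 show "(NN xi. 2 * (V m xi * (en xi * P xi))) < ic"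
 using VP[of m] by (subst nn_integral_cmult) (auto simp: ennreal_mult_less_top)
 show "AL xi. V m xi * er (norm (h (\<sigma> (r n)) xi - h (ta (r n)) xi)) <= 2 * (V m xi * (en xi * P xi))" for n
 using dom
 proof eventually_elim
 case (elim xi)
 have "er (norm (h (\<sigma> (r n)) xi - h (ta (r n)) xi)) <= en xi * P xi + en xi * P xi"
 using elim \<sigma>[of "r n"] ta[of "r n"] by (intro order_trans[OF tri] add_mono) auto
 then have "V m xi * er (norm (h (\<sigma> (r n)) xi - h (ta (r n)) xi)) <= V m xi * (en xi * P xi + en xi * P xi)"
 by (rule mult_left_mono) simp
 then show ?case by (simp only: mult_2 distrib_left)
 qed
 show "AL xi. (%n. V m xi * er (norm (h (\<sigma> (r n)) xi - h (ta (r n)) xi))) -+> V m xi * en (h l xi - h l xi)"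
 using cont
 proof eventually_elim
 case (elim xi)
 have V: "V m xi < top"
 proof (cases "xi \<in> E m")
 case True
 then show ?thesis using Wb[of xi m] by (auto simp: V_def E_def intro: le_less_trans)
 qed (simp add: V_def)
 have c1: "(%n. h (\<sigma> (r n)) xi) -+> h l xi" "(%n. h (ta (r n)) xi) -+> h l xi"
 using \<sigma> ta l by (auto intro!: continuous_on_tendsto_compose[OF elim lim'] continuous_on_tendsto_compose[OF elim limt])
 show ?case by (intro ennreal_tendsto_cmult[OF V] tendsto_ennrealI tendsto_norm tendsto_diff c1)
 qed
 qed measurable
 then have "e <= (NN xi. V m xi * en (h l xi - h l xi))"
 by (rule LIMSEQ_le_const) (use bad in blast)
 then show False using e by simp
 qed
 have "\<exists>d>0. \<forall>s\<in>{0..real m}. \<forall>t\<in>{0..real m}. \<bar>s - t\<bar> < d --> fy m s t < er (1 / real (Suc m))" for m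
 by (rule unif) simp
 then obtain d where d: "!!m. d m > 0"
 and dfy: "!!m s t. s \<in> {0..real m} ==> t \<in> {0..real m} ==> \<bar>s - t\<bar> < d m ==> fy m s t < er (1 / real (Suc m))"
 by metis
 define F where "F m j = field_of (%xi. ind (E m) xi *R h (real j * d m) xi)" for m j
 \<comment> \<open>The index of the last grid point before \<open>t\<close>; the value 0 beyond time
   \<open>m\<close> keeps the range finite.\<close>
 define g where "g m t = (if t <= real m then nat \<lfloor>t / d m\<rfloor> else 0)" for m t
 have hX: "(NN xi. er (norm xi powr - 1 * norm (ind (E m) xi *R h t xi))) < ic" if "t >= 0" for m t
 proof (rule le_less_trans[OF nn_integral_mono_AE P[unfolded wN_def]])
 show "AL xi. er (norm xi powr - 1 * norm (ind (E m) xi *R h t xi)) <= er (norm xi powr 0) * P xi"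
 using dom AE_nonzero
 proof eventually_elim
 case (elim xi)
 have "er (norm xi powr - 1 * norm (ind (E m) xi *R h t xi)) <= er (norm xi powr - 1) * en (h t xi)"
 by (subst ennreal_mult[symmetric]) (auto intro!: ennreal_leI simp: indicator_def)
 also have "... <= er (norm xi powr - 1) * (en xi * P xi)" using elim that by (intro mult_left_mono) auto
 also have "... = er (norm xi powr 0) * P xi"
 unfolding mult.assoc[symmetric] using elim by (subst ennreal_mult[symmetric]) (auto simp: powr_minus_divide)
 finally show ?case .
 qed
 qed
 have ftF: "ftv (%xi. ind (E m) xi *R h (real j * d m) xi) (F m j)" for m j
 unfolding F_def using d[of m] by (intro ftv_field_of hX) (auto simp: less_imp_le)
 have NF: "N (F m j) < ic" for m j
 proof -
 have "N (F m j) = (NN xi. W xi * en (ind (E m) xi *R h (real j * d m) xi))" by (rule N[OF ftF])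
 also have "... <= (NN xi. V m xi * (en xi * P xi))"
 proof (rule nn_integral_mono_AE)
 show "AL xi. W xi * en (ind (E m) xi *R h (real j * d m) xi) <= V m xi * (en xi * P xi)"
 using dom by eventually_elim (use d[of m] in \<open>auto simp: V_def indicator_def less_imp_le intro!: mult_left_mono\<close>)
 qed
 finally show ?thesis using VP[of m] by (rule le_less_trans)
 qed
 have gm: "g m \<in> measurable lborel (count_space UNIV)" for m
 unfolding g_def by measurable
 have simp_g: "simple_function (lebesgue_on {0<..}) (g m)" for m
 unfolding simple_function_def
 proof (intro conjI ballI)
 have "g m ` space (lebesgue_on {0<..}) \<subseteq> {..nat \<lfloor>real m / d m\<rfloor>}"
 using d[of m] by (auto simp: g_def intro!: nat_mono floor_mono divide_right_mono)
 then show "finite (g m ` space (lebesgue_on {0<..}))" by (rule finite_subset) simp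
 have "g m \<in> measurable (lebesgue_on {0<..}) (count_space UNIV)"
 by (intro measurable_restrict_space1 measurable_completion gm)
 then show "g m -` {x} \<inter> space (lebesgue_on {0<..}) \<in> sets (lebesgue_on {0<..})" for x
 by (rule measurable_sets) simp
 qed
 have conv: "(%m. N (F m (g m t) - v t)) -+> 0" if t: "t > 0" and ft_fin: "(NN xi. W xi * en (h t xi)) < ic" for t
 proof -
 \<comment> \<open>The error splits into the oscillation over one grid step for frequencies up to
   \<open>m\<close> and the tail of the field itself beyond \<open>m\<close>.\<close>
 have le: "N (F m (g m t) - v t) <= er (1 / real (Suc m)) + (NN xi. W xi * ind (- E m) xi * en (h t xi))" if m: "t <= real m" for m
 proof -
 let ?s = "real (g m t) * d m"
 have fl: "0 <= \<lfloor>t / d m\<rfloor>" using t d[of m] by simp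
 have gs: "?s = of_int \<lfloor>t / d m\<rfloor> * d m" using m fl by (simp add: g_def)
 have fl': "of_int \<lfloor>t / d m\<rfloor> <= t / d m" "t / d m < of_int \<lfloor>t / d m\<rfloor> + 1" by linarith+
 have s: "?s <= t" "t < ?s + d m"
 using fl'(1)[unfolded pos_le_divide_eq[OF d[of m]]] fl'(2)[unfolded pos_divide_less_eq[OF d[of m]]]
 unfolding gs by (simp_all add: distrib_right)
 have s0: "?s >= 0" using d[of m] by (simp add: less_imp_le)
 have "N (F m (g m t) - v t) = (NN xi. W xi * en (ind (E m) xi *R h ?s xi - h t xi))"
 by (rule N[OF ftv_diff[OF ftF ft]]) (use t in simp)
 also have "... = (NN xi. V m xi * en (h ?s xi - h t xi) + W xi * ind (- E m) xi * en (h t xi))"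
 by (intro nn_integral_cong) (auto simp: V_def indicator_def)
 also have "... = fy m ?s t + (NN xi. W xi * ind (- E m) xi * en (h t xi))"
 unfolding fy_def by (rule nn_integral_add) measurable
 also have "fy m ?s t <= er (1 / real (Suc m))"
 using s s0 m t by (intro less_imp_le dfy) auto
 finally show ?thesis by (simp add: add_right_mono)
 qed
 have l1: "(%m. er (1 / real (Suc m))) -+> 0"
 using tendsto_ennrealI[OF LIMSEQ_Suc[OF lim_1_over_n]] by simp
 have "(%m. \<integral>\<^sup>+xi. W xi * ind (- E m) xi * en (h t xi) \<partial>lborel) -+> (\<integral>\<^sup>+xi. 0 \<partial>(lborel :: (real^3) measure))"
 proof (rule nn_integral_dominated_convergence[where w="%xi. W xi * en (h t xi)"])
 show "AL xi. (%m. W xi * ind (- E m) xi * en (h t xi)) -+> 0"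
 proof (rule AE_I2)
 fix xi :: "real^3"
 obtain M :: nat where M: "norm xi <= real M" using real_arch_simple by blast
 then have "\<forall>\<^sub>F m in sequentially. W xi * ind (- E m) xi * en (h t xi) = 0"
 unfolding eventually_sequentially by (intro exI[of _ M]) (auto simp: E_def)
 then show "(%m. W xi * ind (- E m) xi * en (h t xi)) -+> 0" by (rule tendsto_eventually)
 qed
 qed (use ft_fin in \<open>auto simp: indicator_def\<close>)
 then have l2: "(%m. \<integral>\<^sup>+xi. W xi * ind (- E m) xi * en (h t xi) \<partial>lborel) -+> 0" by simp
 have "\<forall>\<^sub>F m in sequentially. t <= real m"
 using filterlim_real_sequentially by (simp add: filterlim_at_top)
 then have "\<forall>\<^sub>F m in sequentially. N (F m (g m t) - v t) <= er (1 / real (Suc m)) + (NN xi. W xi * ind (- E m) xi * en (h t xi))"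
 by eventually_elim (rule le)
 then show ?thesis
 using tendsto_sandwich[OF _ _ tendsto_const tendsto_add[OF l1 l2]] by simp
 qed
 have "(NN t. (NN xi. W xi * en (h t xi)) * ind {0..} t) ~= ic" using fin by simp
 then have "AL t. (NN xi. W xi * en (h t xi)) * ind {0..} t ~= ic"
 by (intro nn_integral_PInf_AE) auto
 then have "AL t. t \<in> {0<..} --> (%m. N (F m (g m t) - v t)) -+> 0"
 by eventually_elim (auto intro!: conv simp: less_top)
 then have "AE t in lebesgue_on {0<..}. (%m. N (F m (g m t) - v t)) -+> 0"
 by (subst AE_restrict_space_iff) (auto intro: AE_completion)
 moreover have "(\<integral>\<^sup>+t. N (v t) \<partial>lebesgue_on {0<..}) < ic"
 proof -
 have "(\<integral>\<^sup>+t. N (v t) \<partial>lebesgue_on {0<..}) = (NN t. N (v t) * ind {0<..} t)"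
 by (subst nn_integral_restrict_space) (auto simp: nn_integral_completion)
 also have "... <= (\<integral>\<^sup>+t\<in>{0..}. (NN xi. W xi * en (h t xi)) \<partial>lborel)"
 by (intro nn_integral_mono) (auto simp: indicator_def N[OF ft])
 finally show ?thesis using fin by (rule le_less_trans)
 qed
 ultimately show ?thesis
 unfolding in_L1_def using simp_g NF
 by (intro conjI exI[of _ "%m t. F m (g m t)"]) (auto intro: simple_function_compose1)
qed

section \<open>Existence\<close>

lemma Maj_subset: "Maj J z p ==> I \<subseteq> J ==> Maj I z p"
 unfolding Maj_def
proof (elim eventually_mono conjE, intro conjI ballI)
 fix xi assume "I \<subseteq> J" and le: "en xi * (\<integral>\<^sup>+t\<in>J. en (z t xi) \<partial>lborel) <= p xi"
 then have "(\<integral>\<^sup>+t\<in>I. en (z t xi) \<partial>lborel) <= (\<integral>\<^sup>+t\<in>J. en (z t xi) \<partial>lborel)"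
 by (intro nn_integral_mono) (auto simp: indicator_def)
 then show "en xi * (\<integral>\<^sup>+t\<in>I. en (z t xi) \<partial>lborel) <= p xi"
 by (intro order_trans[OF mult_left_mono le]) auto
qed auto

lemma powr_split: "x > 0 ==> er (x powr (s - 1)) * ennreal x = er (x powr s)"
 "x > 0 ==> er (x powr (s + 1)) = er (x powr s) * ennreal x"
 by (subst ennreal_mult[symmetric], auto simp: powr_diff powr_add)+

section \<open>From majorants to Lei-Lin norms and tempered solutions\<close>

lemma Maj_sup_wN:
 assumes "Maj J z p" "t \<in> J"
 shows "(NN xi. er (norm xi powr (s - 1) * norm (z t xi))) <= wN s p"
 unfolding wN_def
proof (rule nn_integral_mono_AE)
 show "AL xi. er (norm xi powr (s - 1) * norm (z t xi)) <= er (norm xi powr s) * p xi"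
 using assms(1) AE_nonzero unfolding Maj_def
 proof eventually_elim
 case (elim xi)
 then have "er (norm xi powr (s - 1)) * en (z t xi) <= er (norm xi powr (s - 1)) * (en xi * p xi)"
 using assms(2) by (intro mult_left_mono) auto
 then show ?case using elim by (simp add: ennreal_mult' powr_split(1) mult.assoc[symmetric])
 qed
qed

lemma Maj_int_wN:
 assumes z: "jm z" and [measurable]: "J \<in> sets borel" and M: "Maj J z p"
 shows "(\<integral>\<^sup>+t\<in>J. (NN xi. er (norm xi powr (s + 1) * norm (z t xi))) \<partial>lborel) <= wN s p"
proof -
 note [measurable (raw)] = jm_compose[OF z]
 have "(\<integral>\<^sup>+t\<in>J. (NN xi. er (norm xi powr (s + 1) * norm (z t xi))) \<partial>lborel)
 = (NN t. (NN xi. er (norm xi powr (s + 1)) * (en (z t xi) * ind J t)))"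
 by (intro nn_integral_cong) (auto simp: indicator_def ennreal_mult')
 also have "... = (NN xi. (NN t. er (norm xi powr (s + 1)) * (en (z t xi) * ind J t)))"
 by (rule lborel_pair.Fubini') measurable
 also have "... = (NN xi. er (norm xi powr (s + 1)) * (\<integral>\<^sup>+t\<in>J. en (z t xi) \<partial>lborel))"
 by (intro nn_integral_cong nn_integral_cmult) measurable
 also have "... <= wN s p"
 unfolding wN_def
 proof (rule nn_integral_mono_AE)
 show "AL xi. er (norm xi powr (s + 1)) * (\<integral>\<^sup>+t\<in>J. en (z t xi) \<partial>lborel) <= er (norm xi powr s) * p xi"
 using M AE_nonzero unfolding Maj_def
 proof eventually_elim
 case (elim xi)
 then have "er (norm xi powr s) * (en xi * (\<integral>\<^sup>+t\<in>J. en (z t xi) \<partial>lborel)) <= er (norm xi powr s) * p xi"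
 by (intro mult_left_mono) auto
 then show ?case using elim by (simp add: powr_split(2) mult.assoc)
 qed
 qed
 finally show ?thesis .
qed

text \<open>Interpolation: 1 <= 1/|xi| + |xi|.\<close>

lemma integrable_of_two:
 assumes [measurable]: "f \<in> BM"
 and "(NN xi. er (norm xi powr - 1 * norm (f xi))) < ic" "(NN xi. er (norm xi powr 1 * norm (f xi))) < ic"
 shows "integrable lborel (f :: real^3 => complex^3)"
 unfolding integrable_iff_bounded
proof
 have "(NN xi. en (f xi)) <= (NN xi. er (norm xi powr - 1 * norm (f xi)) + er (norm xi powr 1 * norm (f xi)))"
 proof (rule nn_integral_mono_AE)
 show "AL xi. en (f xi) <= er (norm xi powr - 1 * norm (f xi)) + er (norm xi powr 1 * norm (f xi))"
 using AE_nonzero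
 proof eventually_elim
 case (elim xi)
 have "1 <= norm xi powr - 1 + norm xi powr 1"
 proof (cases "norm xi <= 1")
 case True then show ?thesis using elim by (simp add: powr_minus_divide add_increasing2)
 qed (simp add: add_increasing)
 then have "1 * norm (f xi) <= (norm xi powr - 1 + norm xi powr 1) * norm (f xi)" by (rule mult_right_mono) simp
 then show ?case by (subst ennreal_plus[symmetric]) (auto simp: distrib_right intro!: ennreal_leI simp del: ennreal_plus)
 qed
 qed
 also have "... < ic" using assms by (subst nn_integral_add) auto
 finally show "(NN xi. en (f xi)) < ic" .
qed simp

text \<open>Products require integrable transforms. The norm of order 1 is only integrable in time,
  so this is available at almost every time, which is enough inside a time integral.\<close>

lemma Maj_integrable:
 assumes z: "jm z" and J[measurable]: "J \<in> sets borel" and M: "Maj J z p" and p: "wN 0 p < ic"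
 shows "AL t. t \<in> J --> integrable lborel (z t)"
proof -
 note [measurable (raw)] = jm_compose[OF z]
 have "(NN t. (NN xi. er (norm xi powr (0 + 1) * norm (z t xi))) * ind J t) ~= ic"
 using le_less_trans[OF Maj_int_wN[OF z J M, of 0] p] by simp
 then have "AL t. (NN xi. er (norm xi powr (0 + 1) * norm (z t xi))) * ind J t ~= ic"
 by (intro nn_integral_PInf_AE) auto
 then show ?thesis
 proof eventually_elim
 case (elim t)
 show ?case
 proof
 assume t: "t \<in> J"
 show "integrable lborel (z t)"
 by (rule integrable_of_two[OF jm_slice[OF z]])
 (use le_less_trans[OF Maj_sup_wN[OF M t, of 0] p] elim t in \<open>auto simp: less_top\<close>)
 qed
 qed
qed

lemma weighted_div: "(NN xi. er (norm xi powr - 1) * (en xi * f xi)) = wN 0 f"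
 unfolding wN_def
proof (rule nn_integral_cong_AE)
 show "AL xi. er (norm xi powr - 1) * (en xi * f xi) = er (norm xi powr 0) * f xi"
 using AE_nonzero by eventually_elim (use powr_split(1)[of _ 0] in \<open>simp add: mult.assoc[symmetric]\<close>)
qed

lemma Maj_finite_mm:
 assumes u: "jm u" and b: "jm b" and J: "J \<in> sets borel"
 and [measurable]: "p \<in> BM" "q \<in> BM" and M: "Maj J u p" "Maj J b q" and fin: "nrm p q < ic"
 shows "(NN xi. er (norm xi powr - 1) * (\<integral>\<^sup>+ta\<in>J. U.mq u b ta xi \<partial>lborel)) < ic"
 and "(NN xi. er (norm xi powr - 1) * (\<integral>\<^sup>+ta\<in>J. B.mq u b ta xi \<partial>lborel)) < ic"
proof -
 have "nrm (FU p q p q) (FB p q p q) <= 8 * (nrm p q * nrm p q)" by (rule nrm_F) auto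
 also have "... < ic" using fin by (simp add: ennreal_mult_less_top)
 finally have f: "wN 0 (FU p q p q) < ic" "wN 0 (FB p q p q) < ic" by (auto intro: le_less_trans[OF wN_le_nrm(1)] le_less_trans[OF wN_le_nrm(2)])
 have "(NN xi. er (norm xi powr - 1) * (\<integral>\<^sup>+ta\<in>J. U.mq u b ta xi \<partial>lborel)) <= wN 0 (FU p q p q)"
 unfolding weighted_div[symmetric] by (intro nn_integral_mono mult_left_mono U.int_mm[OF u b u b J _ _ _ _ M M]) auto
 then show "(NN xi. er (norm xi powr - 1) * (\<integral>\<^sup>+ta\<in>J. U.mq u b ta xi \<partial>lborel)) < ic"
 using f(1) by (rule le_less_trans)
 have "(NN xi. er (norm xi powr - 1) * (\<integral>\<^sup>+ta\<in>J. B.mq u b ta xi \<partial>lborel)) <= wN 0 (FB p q p q)"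
 unfolding weighted_div[symmetric] by (intro nn_integral_mono mult_left_mono B.int_mm[OF u b u b J _ _ _ _ M M]) auto
 then show "(NN xi. er (norm xi powr - 1) * (\<integral>\<^sup>+ta\<in>J. B.mq u b ta xi \<partial>lborel)) < ic"
 using f(2) by (rule le_less_trans)
qed

lemma ftv_heatF: "ftv a f ==> t >= 0 ==> ftv (heatF a t) (heat t f)"
 unfolding heatF_def[abs_def] by (rule ftv_heat)

text \<open>The bridge between the tempered equation and its pointwise Fourier form: existence uses
  it from right to left, uniqueness from left to right.\<close>

lemma duhamel_iff:
 assumes u: "jm u" and b: "jm b" and t: "t >= 0" and a0: "ftv a0 u0" and b0: "ftv b0 B0"
 and ae: "AL ta. ta \<in> {0..t} --> ftv (u ta) (v ta) & integrable lborel (u ta) & ftv (b ta) (w ta) & integrable lborel (b ta)"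
 and finU: "(NN xi. er (norm xi powr - 1) * (\<integral>\<^sup>+ta\<in>{0..t}. U.mq u b ta xi \<partial>lborel)) < ic"
 and finB: "(NN xi. er (norm xi powr - 1) * (\<integral>\<^sup>+ta\<in>{0..t}. B.mq u b ta xi \<partial>lborel)) < ic"
 shows "(\<exists>Iu IB. has_time_integral (u_integrand v w t) Iu t & has_time_integral (B_integrand v w t) IB t &
 v t = heat t u0 - Iu & w t = heat t B0 + IB) \<longleftrightarrow>
 ftv (%xi. heatF a0 t xi + U.D u b t xi) (v t) & ftv (%xi. heatF b0 t xi + B.D u b t xi) (w t)"
proof -
 obtain I where I: "ftv (%xi. - U.D u b t xi) I" "!!I'. has_time_integral (u_integrand v w t) I' t \<longleftrightarrow> I' = I"
 using duhamel_tempered(1)[OF u b t ae finU finB] by blast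
 obtain K where K: "ftv (B.D u b t) K" "!!I'. has_time_integral (B_integrand v w t) I' t \<longleftrightarrow> I' = K"
 using duhamel_tempered(2)[OF u b t ae finU finB] by blast
 have 1: "ftv (%xi. heatF a0 t xi + U.D u b t xi) (heat t u0 - I)" using ftv_diff[OF ftv_heatF[OF a0 t] I(1)] by simp
 have 2: "ftv (%xi. heatF b0 t xi + B.D u b t xi) (heat t B0 + K)" using ftv_add[OF ftv_heatF[OF b0 t] K(1)] by simp
 have "v t = heat t u0 - I \<longleftrightarrow> ftv (%xi. heatF a0 t xi + U.D u b t xi) (v t)" by (rule iffI, erule ssubst, rule 1, rule ftv_inj[OF _ 1])
 moreover have "w t = heat t B0 + K \<longleftrightarrow> ftv (%xi. heatF b0 t xi + B.D u b t xi) (w t)" by (rule iffI, erule ssubst, rule 2, rule ftv_inj[OF _ 2])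
 ultimately show ?thesis using I(2) K(2) by auto
qed

section \<open>Divergence-free and real-valued fields\<close>

definition dotc :: "real^3 => complex^3 => complex" where
 "dotc xi v = (\<Sum>i\<in>UNIV. cor (xi $ i) * v $ i)"

lemma bounded_linear_dotc: "bounded_linear (dotc xi)"
 unfolding dotc_def[abs_def]
 by (intro bounded_linear_sum bounded_linear_const_mult bounded_linear_vec_nth)

text \<open>Carries the divergence condition through the convolution and time integrals; a divergent
  integral has the value 0, which also lies in the kernel.\<close>

lemma integral_kernel:
 fixes f :: "'a => complex^3"
 assumes T: "bounded_linear T" and z: "!!x. T (f x) = (0 :: complex)"
 shows "T (integral\<^sup>L M f) = 0"
proof (cases "integrable M f")
 case True
 from integral_bounded_linear[OF T True] show ?thesis by (simp add: z)
next
 case False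
 interpret bounded_linear T by (rule T)
 show ?thesis using False by (simp add: not_integrable_integral_eq zero)
qed

lemma D_div_free:
 assumes "xi ~= 0"
 shows "dotc xi (U.D u b t xi) = 0" "dotc xi (B.D u b t xi) = 0"
proof -
 interpret d: bounded_linear "dotc xi" by (rule bounded_linear_dotc)
 have N: "dotc xi (Nu xi a c a' c') = 0" "dotc xi (Nb xi a c a' c') = 0" for a c a' c'
 unfolding dotc_def by (rule Nu_div_free[OF assms] Nb_div_free)+
 have C: "dotc xi (U.C a c xi) = 0" "dotc xi (B.C a c xi) = 0" for a c
 unfolding U.C_def B.C_def by (rule integral_kernel[OF bounded_linear_dotc], rule N)+
 show "dotc xi (U.D u b t xi) = 0" "dotc xi (B.D u b t xi) = 0"
 unfolding U.D_def B.D_def set_lebesgue_integral_def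
 by (rule integral_kernel[OF bounded_linear_dotc], simp only: d.scaleR C scaleR_zero_right)+
qed

text \<open>Averaging \<open>h\<close> with its conjugate reflection makes the symmetry exact. Exact
  symmetry of the data is inherited by every Picard iterate, without collecting null sets.\<close>

lemma symmetric_representative:
 assumes [measurable]: "h \<in> BM" and ae: "AL xi. h (- xi) = vcnj (h xi)"
 shows "\<exists>k \<in> BM. (\<forall>xi. k (- xi) = vcnj (k xi)) & (AL xi. h xi = k xi)"
proof (intro bexI conjI)
 let ?k = "%xi. (1/2::real) *R (h xi + vcnj (h (- xi)))"
 have v: "vcnj (vcnj x) = x" for x by (simp add: vec_eq_iff)
 show "\<forall>xi. ?k (- xi) = vcnj (?k xi)" by (simp add: vcnj_add vcnj_scaleR v add.commute)
 show "AL xi. h xi = ?k xi"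
 using ae by eventually_elim (simp add: v scaleR_2[symmetric])
 have [measurable]: "vcnj \<in> BM"
 by (intro borel_measurable_continuous_onI linear_continuous_on bounded_linear_vcnj)
 show "?k \<in> BM" by measurable
qed

lemma real_field_ftvI_AE:
 assumes h: "ftv h f" and ae: "AL xi. h (- xi) = vcnj (h xi)"
 shows "real_field f"
proof -
 obtain k where k: "k \<in> BM" "\<forall>xi. k (- xi) = vcnj (k xi)" "AL xi. h xi = k xi"
 using symmetric_representative[OF ftv_measurable[OF h] ae] by blast
 show ?thesis by (rule real_field_ftvI[OF ftv_cong_AE[OF h k(1,3)]]) (use k in auto)
qed

lemma real_field_representative:
 assumes h: "ftv h f" and r: "real_field f"
 obtains k where "ftv k f" "!!xi. k (- xi) = vcnj (k xi)"
proof -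
 obtain k where k: "k \<in> BM" "\<forall>xi. k (- xi) = vcnj (k xi)" "AL xi. h xi = k xi"
 using symmetric_representative[OF ftv_measurable[OF h] real_field_ftvD[OF h r]] by blast
 from that[OF ftv_cong_AE[OF h k(1,3)]] k(2) show ?thesis by blast
qed

lemma wN_iv:
 assumes a: "ftv a f"
 shows "wN s (iv a) = Xnorm (s - 1) f"
 unfolding Xnorm_ftv[OF a] wN_def iv_def
proof (rule nn_integral_cong_AE)
 show "AL xi. er (norm xi powr s) * er (norm (a xi) / norm xi) = er (norm xi powr (s - 1) * norm (a xi))"
 using AE_nonzero by eventually_elim (subst ennreal_mult[symmetric], auto simp: powr_diff)
qed

lemma Ynorm_bound:
 assumes h: "!!t. t >= 0 ==> ftv (z t) (f t)" and M: "Maj {0..} z p" and p: "AL x. er (norm x powr (\<sigma> + 1)) * p x <= A" and t: "t >= 0"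
 shows "Ynorm \<sigma> (f t) <= A"
 unfolding Ynorm_ftv[OF h[OF t]]
proof (rule esssup_I)
 note [measurable] = ftv_measurable[OF h[OF t]]
 show "(%xi. er (norm xi powr \<sigma> * norm (z t xi))) \<in> borel_measurable lborel" by measurable
 show "AL xi. er (norm xi powr \<sigma> * norm (z t xi)) <= A"
 using M p AE_nonzero unfolding Maj_def
 proof eventually_elim
 case (elim xi)
 have "er (norm xi powr \<sigma> * norm (z t xi)) = er (norm xi powr \<sigma>) * en (z t xi)" by (simp add: ennreal_mult')
 also have "... <= er (norm xi powr \<sigma>) * (en xi * p xi)" using elim t by (intro mult_left_mono) auto
 also have "... <= A" using elim by (simp add: powr_split(2) mult.assoc)
 finally show ?case .
 qed
qed

section \<open>The Picard limit as a solution in the class of the theorem\<close>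

context picard
begin

definition fu where "fu t = field_of (u t)"

definition fb where "fb t = field_of (b t)"

lemma fin_P: "wN 0 P < ic" "wN 0 Q < ic" "wN 1 Q < ic"
 using le_less_trans[OF wN_le_nrm(1) fin_pq(2)] le_less_trans[OF wN_le_nrm(2) fin_pq(2)] le_less_trans[OF wN_le_nrm(3) fin_pq(2)] .

lemma ftv_fu: "t >= 0 ==> ftv (u t) (fu t)" and ftv_fb: "t >= 0 ==> ftv (b t) (fb t)"
 unfolding fu_def fb_def
 using le_less_trans[OF Maj_sup_wN[OF u_Maj, of t 0] fin_P(1)] le_less_trans[OF Maj_sup_wN[OF b_Maj, of t 0] fin_P(2)]
 by (auto intro!: ftv_field_of jm_slice u_jm b_jm)

lemma tempered_solution:
 assumes a: "ftv a0 u0" and bb: "ftv b0 B0" and s: "!!xi. a0 (- xi) = vcnj (a0 xi)" "!!xi. b0 (- xi) = vcnj (b0 xi)"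
 and div: "tdiv u0 = 0" "tdiv B0 = 0"
 shows "hall_mhd_solution u0 B0 fu fb"
 unfolding hall_mhd_solution_def
proof (intro allI impI conjI)
 fix t :: real assume t: "t >= 0"
 have eq: "AL xi. u t xi = heatF a0 t xi + U.D u b t xi" "AL xi. b t xi = heatF b0 t xi + B.D u b t xi"
 using u_b_solution t unfolding solF_def by (auto elim!: eventually_mono)
 show "real_field (fu t)"
 by (rule real_field_ftvI_AE[OF ftv_fu[OF t]]) (use u_b_cnj(1)[OF s] t in \<open>auto elim: eventually_mono\<close>)
 show "real_field (fb t)"
 by (rule real_field_ftvI_AE[OF ftv_fb[OF t]]) (use u_b_cnj(2)[OF s] t in \<open>auto elim: eventually_mono\<close>)
 have dl: "dotc xi (heatF a t xi + w) = exp (- t * (norm xi)\<^sup>2) *R dotc xi (a xi) + dotc xi w" for xi a w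
 proof -
 interpret d: bounded_linear "dotc xi" by (rule bounded_linear_dotc)
 show ?thesis by (simp add: heatF_def d.add d.scaleR)
 qed
 show "tdiv (fu t) = 0"
 using tdiv_zero_ftvD[OF a div(1)] eq(1) AE_nonzero unfolding dotc_def[symmetric]
 by (intro tdiv_zero_ftvI[OF ftv_fu[OF t], folded dotc_def], eventually_elim) (simp add: dl D_div_free)
 show "tdiv (fb t) = 0"
 using tdiv_zero_ftvD[OF bb div(2)] eq(2) AE_nonzero unfolding dotc_def[symmetric]
 by (intro tdiv_zero_ftvI[OF ftv_fb[OF t], folded dotc_def], eventually_elim) (simp add: dl D_div_free)
 have sub: "{0..t} \<subseteq> {0..}" by auto
 have i1: "AL t. t \<in> {0..} --> integrable lborel (u t)" by (rule Maj_integrable[OF u_jm _ u_Maj fin_P(1)]) simp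
 have i2: "AL t. t \<in> {0..} --> integrable lborel (b t)" by (rule Maj_integrable[OF b_jm _ b_Maj fin_P(2)]) simp
 have "AL ta. ta \<in> {0..t} --> ftv (u ta) (fu ta) & integrable lborel (u ta) & ftv (b ta) (fb ta) & integrable lborel (b ta)"
 using i1 i2 by eventually_elim (auto intro: ftv_fu ftv_fb)
 note iff = duhamel_iff[OF u_jm b_jm t a bb this
 Maj_finite_mm(1)[OF u_jm b_jm _ P_measurable Q_measurable Maj_subset[OF u_Maj sub] Maj_subset[OF b_Maj sub] fin_pq(2)]
 Maj_finite_mm(2)[OF u_jm b_jm _ P_measurable Q_measurable Maj_subset[OF u_Maj sub] Maj_subset[OF b_Maj sub] fin_pq(2)]]
 note [measurable] = jm_slice[OF heatF_jm] jm_slice[OF U.D_jm[OF u_jm b_jm]] jm_slice[OF B.D_jm[OF u_jm b_jm]]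
 show "\<exists>Iu IB. has_time_integral (u_integrand fu fb t) Iu t & has_time_integral (B_integrand fu fb t) IB t &
 fu t = heat t u0 - Iu & fb t = heat t B0 + IB"
 proof (rule iff[THEN iffD2], simp, simp, intro conjI)
 show "ftv (%xi. heatF a0 t xi + U.D u b t xi) (fu t)"
 by (rule ftv_cong_AE[OF ftv_fu[OF t] _ eq(1)]) measurable
 show "ftv (%xi. heatF b0 t xi + B.D u b t xi) (fb t)"
 by (rule ftv_cong_AE[OF ftv_fb[OF t] _ eq(2)]) measurable
 qed
qed

lemma u_b_continuous:
 shows "AL xi. continuous_on {0..} (%t. heatF a0 t xi + U.D u b t xi)" "AL xi. continuous_on {0..} (%t. heatF b0 t xi + B.D u b t xi)"
proof -
 have h: "continuous_on {0..} (%t. heatF a t xi)" for a xi unfolding heatF_def by (intro continuous_intros)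
 have f: "en xi * x < ic" if "x < ic" for x and xi :: "real^3" using that by (simp add: ennreal_mult_less_top)
 have "(\<integral>\<^sup>+ta\<in>{0..}. U.mq u b ta xi \<partial>lborel) <= en xi * FU P Q P Q xi"
 "(\<integral>\<^sup>+ta\<in>{0..}. B.mq u b ta xi \<partial>lborel) <= en xi * FB P Q P Q xi" for xi
 by (rule U.int_mm[OF u_jm b_jm u_jm b_jm _ _ _ _ _ u_Maj b_Maj u_Maj b_Maj] B.int_mm[OF u_jm b_jm u_jm b_jm _ _ _ _ _ u_Maj b_Maj u_Maj b_Maj]; measurable)+
 note le = le_less_trans[OF this(1) f] le_less_trans[OF this(2) f]
 show "AL xi. continuous_on {0..} (%t. heatF a0 t xi + U.D u b t xi)"
 using F_finite_AE(1)[OF P_measurable Q_measurable P_measurable Q_measurable fin_pq(2) fin_pq(2)]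
 by (rule eventually_mono) (intro continuous_on_add h U.D_continuous[OF u_jm b_jm] le(1))
 show "AL xi. continuous_on {0..} (%t. heatF b0 t xi + B.D u b t xi)"
 using F_finite_AE(2)[OF P_measurable Q_measurable P_measurable Q_measurable fin_pq(2) fin_pq(2)]
 by (rule eventually_mono) (intro continuous_on_add h B.D_continuous[OF u_jm b_jm] le(2))
qed

lemma u_b_continuous': "AL xi. continuous_on {0..} (%t. u t xi)" "AL xi. continuous_on {0..} (%t. b t xi)"
proof -
 show "AL xi. continuous_on {0..} (%t. u t xi)"
 using u_b_continuous(1) u_b_solution unfolding solF_def
 proof eventually_elim
 case (elim xi)
 show ?case by (rule continuous_on_eq[OF elim(1)]) (use elim(2) in simp)
 qed
 show "AL xi. continuous_on {0..} (%t. b t xi)"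
 using u_b_continuous(2) u_b_solution unfolding solF_def
 proof eventually_elim
 case (elim xi)
 show ?case by (rule continuous_on_eq[OF elim(1)]) (use elim(2) in simp)
 qed
qed

lemma solution_class:
 assumes k: "k >= 0" and hk: "wN k P < ic" "wN k Q < ic" and A: "A < ic"
 and s: "AL x. er (norm x powr (\<sigma> + 1)) * P x <= A" "AL x. er (norm x powr (\<sigma> + 1)) * Q x <= A"
 shows "in_solution_class k \<sigma> fu fb"
 unfolding in_solution_class_def
proof (intro conjI)
 have X: "Xnorm (s - 1) (fu t) <= wN s P" "Xnorm (s - 1) (fb t) <= wN s Q" if "t >= 0" for s t
 unfolding Xnorm_ftv[OF ftv_fu[OF that]] Xnorm_ftv[OF ftv_fb[OF that]] using that by (intro Maj_sup_wN[OF u_Maj] Maj_sup_wN[OF b_Maj]; simp)+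
 note X0 = X[where s=0, simplified] and X1 = X(2)[where s=1, simplified]
 have "(SUP t\<in>{0..}. u_norm k \<sigma> (fu t)) <= wN k P + wN 0 P + A"
 unfolding u_norm_def by (intro SUP_least add_mono X X0 Ynorm_bound[OF ftv_fu u_Maj s(1)]) auto
 then show "in_Linfty (u_norm k \<sigma>) fu" unfolding in_Linfty_def using hk fin_P A by (auto intro: le_less_trans)
 have "(SUP t\<in>{0..}. B_norm k \<sigma> (fb t)) <= wN k Q + wN 0 Q + wN 1 Q + A"
 unfolding B_norm_def by (intro SUP_least add_mono X X0 X1 Ynorm_bound[OF ftv_fb b_Maj s(2)]) auto
 then show "in_Linfty (B_norm k \<sigma>) fb" unfolding in_Linfty_def using hk fin_P A by (auto intro: le_less_trans)
 have pw: "er (norm xi powr e) <= er (real m powr e)" if "norm xi <= real m" "e >= 0" for xi :: "real^3" and m e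
 using that by (intro ennreal_leI powr_mono2) auto
 note [measurable (raw)] = jm_compose[OF u_jm] jm_compose[OF b_jm]
 let ?W = "%xi::real^3. er (norm xi powr (k + 1)) + er (norm xi powr 1)"
 show "in_L1 (%f. Xnorm (k + 1) f + Xnorm 1 f) fu"
 proof (rule in_L1I[where W="?W" and h=u and P=P and c="%m. real m powr (k + 1) + real m powr 1"])
 show "Xnorm (k + 1) f + Xnorm 1 f = (NN xi. ?W xi * en (g xi))" if g: "ftv g f" for f g
 proof -
 note [measurable] = ftv_measurable[OF g]
 show ?thesis unfolding Xnorm_ftv[OF g] by (subst nn_integral_add[symmetric]) (auto simp: distrib_right ennreal_mult)
 qed
 show "?W xi <= er (real m powr (k + 1) + real m powr 1)" if "norm xi <= real m" for m xi
 using pw[OF that, of "k + 1"] pw[OF that, of 1] k by (subst ennreal_plus) (auto intro!: add_mono)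
 have "(\<integral>\<^sup>+t\<in>{0..}. (NN xi. ?W xi * en (u t xi)) \<partial>lborel)
 = (\<integral>\<^sup>+t\<in>{0..}. (NN xi. er (norm xi powr (k + 1) * norm (u t xi))) \<partial>lborel) + (\<integral>\<^sup>+t\<in>{0..}. (NN xi. er (norm xi powr (0 + 1) * norm (u t xi))) \<partial>lborel)"
 by (simp add: distrib_right ennreal_mult nn_integral_add)
 also have "... <= wN k P + wN 0 P" by (intro add_mono Maj_int_wN[OF u_jm _ u_Maj]) auto
 finally show "(\<integral>\<^sup>+t\<in>{0..}. (NN xi. ?W xi * en (u t xi)) \<partial>lborel) < ic" using hk fin_P by (auto intro: le_less_trans)
 show "AL xi. \<forall>t\<in>{0..}. en (u t xi) <= en xi * P xi" using u_Maj unfolding Maj_def by (auto elim: eventually_mono)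
 qed (use fin_P in \<open>auto intro: ftv_fu u_jm u_b_continuous'\<close>)
 let ?W = "%xi::real^3. er (norm xi powr (k + 1)) + er (norm xi powr 1) + er (norm xi powr 2)"
 show "in_L1 (%f. Xnorm (k + 1) f + Xnorm 1 f + Xnorm 2 f) fb"
 proof (rule in_L1I[where W="?W" and h=b and P=Q and c="%m. real m powr (k + 1) + real m powr 1 + real m powr 2"])
 show "Xnorm (k + 1) f + Xnorm 1 f + Xnorm 2 f = (NN xi. ?W xi * en (g xi))" if g: "ftv g f" for f g
 proof -
 note [measurable] = ftv_measurable[OF g]
 show ?thesis unfolding Xnorm_ftv[OF g] by (simp add: nn_integral_add[symmetric] distrib_right ennreal_mult)
 qed
 show "?W xi <= er (real m powr (k + 1) + real m powr 1 + real m powr 2)" if "norm xi <= real m" for m xi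
 using pw[OF that, of "k + 1"] pw[OF that, of 1] pw[OF that, of 2] k by (subst ennreal_plus, simp, simp, subst ennreal_plus) (auto intro!: add_mono)
 have "(\<integral>\<^sup>+t\<in>{0..}. (NN xi. ?W xi * en (b t xi)) \<partial>lborel)
 = (\<integral>\<^sup>+t\<in>{0..}. (NN xi. er (norm xi powr (k + 1) * norm (b t xi))) \<partial>lborel) + (\<integral>\<^sup>+t\<in>{0..}. (NN xi. er (norm xi powr (0 + 1) * norm (b t xi))) \<partial>lborel)
 + (\<integral>\<^sup>+t\<in>{0..}. (NN xi. er (norm xi powr (1 + 1) * norm (b t xi))) \<partial>lborel)"
 by (simp add: distrib_right ennreal_mult nn_integral_add)
 also have "... <= wN k Q + wN 0 Q + wN 1 Q" by (intro add_mono Maj_int_wN[OF b_jm _ b_Maj]) auto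
 finally show "(\<integral>\<^sup>+t\<in>{0..}. (NN xi. ?W xi * en (b t xi)) \<partial>lborel) < ic" using hk fin_P by (auto intro: le_less_trans)
 show "AL xi. \<forall>t\<in>{0..}. en (b t xi) <= en xi * Q xi" using b_Maj unfolding Maj_def by (auto elim: eventually_mono)
 qed (use fin_P in \<open>auto intro: ftv_fb b_jm u_b_continuous'\<close>)
qed

end

section \<open>Uniqueness\<close>

definition nf :: "(real^3 => complex^3) => real^3 => ennreal" where
 "nf f xi = en (f xi)"

lemma nf_measurable [measurable (raw)]: assumes [measurable]: "f \<in> BM" shows "nf f \<in> BM"
 unfolding nf_def[abs_def] by measurable

lemma Xnorm_nf: "ftv h f ==> Xnorm s f = wN s (nf h)"
 by (simp add: Xnorm_ftv wN_def nf_def ennreal_mult)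

text \<open>Plain convolution of moduli. At a single time there is no time integration, hence no
  gain from \<open>kap1\<close>.\<close>

abbreviation cc where "cc \<equiv> kconv (%_ _. 1)"

lemma jm_one: "jm (%(_::real^3) (_::real^3). 1 :: ennreal)"
 by (rule jmI) measurable

lemmas cc_measurable [measurable (raw)] = kconv_measurable[OF jm_one]

text \<open>From max^s <= max^(s+1) / min. The orders s + 1 and -1 fit the class: for s = 0 one
  factor is integrable in time and the other bounded in time.\<close>

lemma wN_cc_low:
 assumes s: "s >= 0" and [measurable]: "f \<in> BM" "g \<in> BM"
 shows "wN s (cc f g) <= er (2 powr s) * (wN (s + 1) f * wN (- 1) g + wN (- 1) f * wN (s + 1) g)"
proof -
 have "wN s (cc f g) <=
 (NN ze. er (2 powr s * norm ze powr (s + 1)) * f ze) * (NN et. er (norm et powr - 1) * g et) +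
 (NN ze. er (2 powr s * norm ze powr - 1) * f ze) * (NN et. er (norm et powr (s + 1)) * g et)"
 unfolding wN_def
 proof (rule kconv_weighted[OF jm_one])
 fix ze et :: "real^3" assume nz: "ze ~= 0" "et ~= 0"
 have "norm (ze + et) powr s <= 2 powr s * max (norm ze) (norm et) powr s"
 using nz by (intro powr_sum_le s norm_triangle_ineq) auto
 also have "... <= 2 powr s * (norm ze powr (s + 1) * norm et powr - 1 + norm ze powr - 1 * norm et powr (s + 1))"
 proof (intro mult_left_mono)
 have *: "x powr s <= x powr (s + 1) * y powr - 1" if "0 < y" "y <= x" for x y :: real
 using that by (simp add: powr_add powr_minus_divide field_simps)
 show "max (norm ze) (norm et) powr s <= norm ze powr (s + 1) * norm et powr - 1 + norm ze powr - 1 * norm et powr (s + 1)"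
 using nz *[of "norm et" "norm ze"] *[of "norm ze" "norm et"]
 by (auto simp: max_def add_increasing add_increasing2 mult.commute)
 qed simp
 finally show "er (norm (ze + et) powr s) * 1 <= er (2 powr s * norm ze powr (s + 1)) * er (norm et powr - 1) + er (2 powr s * norm ze powr - 1) * er (norm et powr (s + 1))"
 by (simp add: ennreal_mult[symmetric] ennreal_plus[symmetric] distrib_left mult.assoc ennreal_leI del: ennreal_plus)
 qed measurable
 also have "... = er (2 powr s) * wN (s + 1) f * wN (- 1) g + er (2 powr s) * wN (- 1) f * wN (s + 1) g"
 proof -
 have sc: "(NN ze. er (2 powr s * norm ze powr e) * f ze) = er (2 powr s) * (NN ze. er (norm ze powr e) * f ze)" for e
 by (simp only: ennreal_mult[OF powr_ge_zero powr_ge_zero] mult.assoc, rule nn_integral_cmult, measurable)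
 show ?thesis unfolding wN_def sc ..
 qed
 finally show ?thesis by (simp only: distrib_left mult.assoc)
qed

lemma wN_cc:
 assumes s: "s >= 0" and [measurable]: "f \<in> BM" "g \<in> BM"
 shows "wN s (cc f g) <= er (2 powr s) * (wN s f * wN 0 g + wN 0 f * wN s g)"
proof -
 have "wN s (cc f g) <=
 (NN ze. er (2 powr s * norm ze powr s) * f ze) * (NN et. er (norm et powr 0) * g et) +
 (NN ze. er (2 powr s * norm ze powr 0) * f ze) * (NN et. er (norm et powr s) * g et)"
 unfolding wN_def
 proof (rule kconv_weighted[OF jm_one])
 fix ze et :: "real^3" assume nz: "ze ~= 0" "et ~= 0"
 have "norm (ze + et) powr s <= 2 powr s * max (norm ze) (norm et) powr s"
 using nz by (intro powr_sum_le s norm_triangle_ineq) auto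
 also have "... <= 2 powr s * (norm ze powr s + norm et powr s)" by (intro mult_left_mono) (auto simp: max_def)
 finally show "er (norm (ze + et) powr s) * 1 <= er (2 powr s * norm ze powr s) * er (norm et powr 0) + er (2 powr s * norm ze powr 0) * er (norm et powr s)"
 using nz by (simp add: ennreal_mult[symmetric] ennreal_plus[symmetric] distrib_left mult.assoc ennreal_leI del: ennreal_plus)
 qed measurable
 also have "... = er (2 powr s) * wN s f * wN 0 g + er (2 powr s) * wN 0 f * wN s g"
 unfolding wN_def by (simp add: ennreal_mult mult.assoc nn_integral_cmult)
 finally show ?thesis by (simp only: distrib_left mult.assoc)
qed

text \<open>The asymmetric bound |ze + et| <= 2|ze| + |et|^2/|ze| asks only for the orders 1 and -1
  of the first factor and 0 and 2 of the second, which are the orders the class grants to velocity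
  and magnetic field.\<close>

lemma wN_1_cc:
 assumes [measurable]: "f \<in> BM" "g \<in> BM"
 shows "wN 1 (cc f g) <= 2 * (wN 1 f * wN 0 g) + wN (- 1) f * wN 2 g"
proof -
 have "wN 1 (cc f g) <=
 (NN ze. er (2 * norm ze powr 1) * f ze) * (NN et. er (norm et powr 0) * g et) +
 (NN ze. er (norm ze powr - 1) * f ze) * (NN et. er (norm et powr 2) * g et)"
 unfolding wN_def
 proof (rule kconv_weighted[OF jm_one])
 fix ze et :: "real^3" assume nz: "ze ~= 0" "et ~= 0"
 have "y <= x + y\<^sup>2 / x" if "x > 0" "y > 0" for x y :: real
 proof (cases "y <= x")
 case False
 then have "y * x <= y * y" using that by (intro mult_left_mono) auto
 then show ?thesis using that by (simp add: power2_eq_square field_simps) (simp add: add_increasing)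
 qed (use that in \<open>simp add: add_increasing2\<close>)
 from this[of "norm ze" "norm et"] have "norm (ze + et) <= 2 * norm ze + (norm et)\<^sup>2 / norm ze"
 using nz norm_triangle_ineq[of ze et] by simp
 then show "er (norm (ze + et) powr 1) * 1 <= er (2 * norm ze powr 1) * er (norm et powr 0) + er (norm ze powr - 1) * er (norm et powr 2)"
 using nz by (simp add: ennreal_mult'[symmetric] ennreal_plus[symmetric] powr_minus_divide powr_numeral ennreal_leI del: ennreal_plus)
 qed measurable
 also have "... = 2 * wN 1 f * wN 0 g + wN (- 1) f * wN 2 g"
 unfolding wN_def by (simp add: ennreal_mult mult.assoc nn_integral_cmult)
 finally show ?thesis by (simp only: mult.assoc)
qed

lemma mm_cc:
 assumes [measurable]: "a \<in> BM" "b \<in> BM"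
 shows "U.mm a b a b xi = en xi * (cc (nf a) (nf a) xi + cc (nf b) (nf b) xi)"
 and "B.mm a b a b xi = en xi * (cc (nf a) (nf b) xi + en xi * cc (nf b) (nf b) xi)"
 unfolding U.mm_def B.mm_def mU_def mB_def kconv_def nf_def power2_eq_square
 by (simp_all add: ennreal_mult ennreal_plus nn_integral_cmult nn_integral_add distrib_left mult.assoc)

lemma wN_shift: "wN s (%xi. en xi * f xi) = wN (s + 1) f"
 unfolding wN_def
proof (rule nn_integral_cong_AE)
 show "AL xi. er (norm xi powr s) * (en xi * f xi) = er (norm xi powr (s + 1)) * f xi"
 using AE_nonzero by eventually_elim (simp add: powr_split(2) mult.assoc)
qed

lemma wN_mm:
 assumes [measurable]: "a \<in> BM" "b \<in> BM"
 shows "wN s (U.mm a b a b) = wN (s + 1) (cc (nf a) (nf a)) + wN (s + 1) (cc (nf b) (nf b))"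
 and "wN s (B.mm a b a b) = wN (s + 1) (cc (nf a) (nf b)) + wN (s + 1 + 1) (cc (nf b) (nf b))"
proof -
 have U: "U.mm a b a b = (%xi. en xi * (cc (nf a) (nf a) xi + cc (nf b) (nf b) xi))"
 and B: "B.mm a b a b = (%xi. en xi * (cc (nf a) (nf b) xi + en xi * cc (nf b) (nf b) xi))"
 by (simp_all add: fun_eq_iff mm_cc)
 show "wN s (U.mm a b a b) = wN (s + 1) (cc (nf a) (nf a)) + wN (s + 1) (cc (nf b) (nf b))"
 unfolding U wN_shift by (rule wN_add) measurable
 show "wN s (B.mm a b a b) = wN (s + 1) (cc (nf a) (nf b)) + wN (s + 1 + 1) (cc (nf b) (nf b))"
 unfolding B wN_shift by (subst wN_add) (measurable, simp add: wN_shift)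
qed

context bilin
begin

lemma C_cong:
 assumes [measurable]: "a \<in> BM" "b \<in> BM" "a' \<in> BM" "b' \<in> BM"
 and ae: "AL x. a x = a' x" "AL x. b x = b' x"
 shows "C a b xi = C a' b' xi"
 unfolding C_def
proof (rule Bochner_Integration.integral_cong_AE)
 show "AL et. N xi (a (xi - et)) (b (xi - et)) (a et) (b et) = N xi (a' (xi - et)) (b' (xi - et)) (a' et) (b' et)"
 using ae AE_reflect[OF ae(1), of xi] AE_reflect[OF ae(2), of xi] by eventually_elim simp
qed measurable

lemma D_cong:
 assumes j: "jm u" "jm b" "jm u'" "jm b'"
 and ae: "AL ta. 0 <= ta --> (AL x. u ta x = u' ta x) & (AL x. b ta x = b' ta x)"
 shows "D u b t xi = D u' b' t xi"
 unfolding D_eq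
proof (rule Bochner_Integration.integral_cong_AE)
 note [measurable (raw)] = jm_compose[OF C_jm[OF j(1,2)]] jm_compose[OF C_jm[OF j(3,4)]]
 show "(%ta. if 0 <= ta & ta <= t then exp (- (t - ta) * (norm xi)\<^sup>2) *R C (u ta) (b ta) xi else 0) \<in> borel_measurable lborel" by measurable
 show "(%ta. if 0 <= ta & ta <= t then exp (- (t - ta) * (norm xi)\<^sup>2) *R C (u' ta) (b' ta) xi else 0) \<in> borel_measurable lborel" by measurable
 show "AL ta. (if 0 <= ta & ta <= t then exp (- (t - ta) * (norm xi)\<^sup>2) *R C (u ta) (b ta) xi else 0)
 = (if 0 <= ta & ta <= t then exp (- (t - ta) * (norm xi)\<^sup>2) *R C (u' ta) (b' ta) xi else 0)"
 using ae
 proof eventually_elim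
 case (elim ta)
 then have "C (u ta) (b ta) xi = C (u' ta) (b' ta) xi" if "0 <= ta"
 using that by (intro C_cong jm_slice[OF j(1)] jm_slice[OF j(2)] jm_slice[OF j(3)] jm_slice[OF j(4)]) auto
 then show ?case by simp
 qed
qed

text \<open>The time integral of the nonlinear bound, divided by |xi|, is itself a majorant. This
  needs no majorants of \<open>u\<close> and \<open>b\<close>, and is how a solution of the class
  acquires its first ones.\<close>

lemma Maj_D:
 assumes J: "initial J" and u: "jm u" and b: "jm b"
 shows "Maj J (D u b) (%xi. er (1 / norm xi) * (\<integral>\<^sup>+ta\<in>J. mq u b ta xi \<partial>lborel))"
 unfolding Maj_def using AE_nonzero
proof eventually_elim
 case (elim xi)
 let ?X = "\<integral>\<^sup>+ta\<in>J. mq u b ta xi \<partial>lborel"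
 have X: "en xi * (er (1 / norm xi) * ?X) = ?X"
 using elim unfolding mult.assoc[symmetric] by (subst ennreal_mult[symmetric]) auto
 note m = mm_measurable[OF u b u b, of xi]
 have 1: "en (D u b t xi) <= en xi * (er (1 / norm xi) * ?X)" if "t \<in> J" for t
 unfolding X by (rule duh_bounds(1)[where Y="%t. en (D u b t xi)", OF J zero_le_power2[of "norm xi"] m _ that]) (rule D_norm[OF u b])
 have "er ((norm xi)\<^sup>2) * (\<integral>\<^sup>+t\<in>J. en (D u b t xi) \<partial>lborel) <= en xi * (er (1 / norm xi) * ?X)"
 unfolding X by (rule duh_bounds(2)[where Y="%t. en (D u b t xi)", OF J zero_le_power2[of "norm xi"] m]) (rule D_norm[OF u b])
 then have 2: "en xi * (\<integral>\<^sup>+t\<in>J. en (D u b t xi) \<partial>lborel) <= er (1 / norm xi) * ?X"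
 by (rule divide_norm_le[rotated]) (use elim in auto)
 show ?case using 1 2 by blast
qed

lemma mm_jm: assumes "jm u" "jm b" shows "jm (%ta xi. mq u b ta xi)"
proof -
 note [measurable (raw)] = jm_compose[OF assms(1)] jm_compose[OF assms(2)]
 show ?thesis unfolding mm_def by (rule jmI) measurable
qed

end

text \<open>The part of the solution class relevant for smallness, stated for Fourier
  representatives. The uniform bounds hold at almost every time, because representatives are
  attached to a solution only there.\<close>

definition cls :: "(real => real^3 => complex^3) => (real => real^3 => complex^3) => bool" where
 "cls h d \<longleftrightarrow> jm h & jm d & (\<exists>M<ic. AL ta. 0 <= ta --> wN (- 1) (nf (h ta)) <= M & wN (- 1) (nf (d ta)) <= M & wN 0 (nf (d ta)) <= M) &
 (\<integral>\<^sup>+ta\<in>{0..}. (wN 1 (nf (h ta)) + wN 1 (nf (d ta)) + wN 2 (nf (d ta))) \<partial>lborel) < ic"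

text \<open>The rate at which the nonlinear part of the majorants adds to \<open>nrm\<close>. Its
  integrability makes that norm continuous in the end of the time interval.\<close>

definition gF :: "(real => real^3 => complex^3) => (real => real^3 => complex^3) => real => ennreal" where
 "gF h d ta = wN (- 1) (U.mq h d ta) + wN (- 1) (B.mq h d ta) + wN 0 (B.mq h d ta)"

lemma wN_time_measurable: "jm f ==> (%ta. wN s (f ta)) \<in> BM"
proof -
 assume f: "jm f"
 note [measurable (raw)] = jm_compose[OF f]
 show ?thesis unfolding wN_def by measurable
qed

lemma jm_nf: "jm h ==> jm (%ta. nf (h ta))"
proof -
 assume h: "jm h"
 note [measurable (raw)] = jm_compose[OF h]
 show ?thesis unfolding nf_def[abs_def] by (rule jmI) measurable
qed

lemma gF_measurable: "jm h ==> jm d ==> gF h d \<in> BM"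
 unfolding gF_def[abs_def] by (intro borel_measurable_add wN_time_measurable U.mm_jm B.mm_jm)

lemma gF_algebra:
 fixes x y z M x1 y1 z0 :: ennreal
 assumes "x1 <= M" "y1 <= M" "z0 <= M"
 shows "x * x1 + x1 * x + (y * y1 + y1 * y) + (x * y1 + x1 * y + 2 * (y * z0 + z0 * y)) + (2 * (x * z0) + x1 * z + 4 * (z * z0 + z0 * z)) <= 20 * M * (x + y + z)"
proof -
 have "x * x1 + x1 * x + (y * y1 + y1 * y) + (x * y1 + x1 * y + 2 * (y * z0 + z0 * y)) + (2 * (x * z0) + x1 * z + 4 * (z * z0 + z0 * z))
 <= x * M + M * x + (y * M + M * y) + (x * M + M * y + 2 * (y * M + M * y)) + (2 * (x * M) + M * z + 4 * (z * M + M * z))"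
 using assms by (intro add_mono mult_left_mono mult_right_mono) auto
 also have "... <= ... + (15 * (M * x) + 13 * (M * y) + 11 * (M * z))" by simp
 also have "... = (5 + 15) * (M * x) + (7 + 13) * (M * y) + (9 + 11) * (M * z)"
 proof -
 have "(15::ennreal) = 8 + 4 + 3" "(13::ennreal) = 8 + 4 + 1" "(11::ennreal) = 8 + 3" "(5::ennreal) = 4 + 1" "(7::ennreal) = 4 + 3" "(9::ennreal) = 8 + 1" by simp_all
 then show ?thesis by (simp only: ennreal_ring)
 qed
 also have "... = 20 * M * (x + y + z)" by (simp only: distrib_left mult.assoc) simp
 finally show ?thesis .
qed

lemma gF_finite:
 assumes "cls h d"
 shows "(\<integral>\<^sup>+ta\<in>{0..}. gF h d ta \<partial>lborel) < ic"
proof -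
 have h: "jm h" and d: "jm d" using assms by (auto simp: cls_def)
 obtain M where M: "M < ic" "AL ta. 0 <= ta --> wN (- 1) (nf (h ta)) <= M & wN (- 1) (nf (d ta)) <= M & wN 0 (nf (d ta)) <= M"
 using assms unfolding cls_def by blast
 let ?S = "%ta. wN 1 (nf (h ta)) + wN 1 (nf (d ta)) + wN 2 (nf (d ta))"
 have Sm: "?S \<in> BM" by (intro borel_measurable_add wN_time_measurable jm_nf h d)
 have "AL ta. gF h d ta * ind {0..} ta <= 20 * M * (?S ta * ind {0..} ta)"
 using M(2)
 proof eventually_elim
 case (elim ta)
 note [measurable] = jm_slice[OF h, of ta] jm_slice[OF d, of ta]
 have "gF h d ta <= 20 * M * ?S ta" if "0 <= ta"
 proof -
 have "gF h d ta <= wN 1 (nf (h ta)) * wN (- 1) (nf (h ta)) + wN (- 1) (nf (h ta)) * wN 1 (nf (h ta))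
 + (wN 1 (nf (d ta)) * wN (- 1) (nf (d ta)) + wN (- 1) (nf (d ta)) * wN 1 (nf (d ta)))
 + (wN 1 (nf (h ta)) * wN (- 1) (nf (d ta)) + wN (- 1) (nf (h ta)) * wN 1 (nf (d ta))
 + 2 * (wN 1 (nf (d ta)) * wN 0 (nf (d ta)) + wN 0 (nf (d ta)) * wN 1 (nf (d ta))))
 + (2 * (wN 1 (nf (h ta)) * wN 0 (nf (d ta))) + wN (- 1) (nf (h ta)) * wN 2 (nf (d ta))
 + 4 * (wN 2 (nf (d ta)) * wN 0 (nf (d ta)) + wN 0 (nf (d ta)) * wN 2 (nf (d ta))))"
 unfolding gF_def
 using wN_cc_low[of 0 "nf (h ta)" "nf (h ta)"] wN_cc_low[of 0 "nf (d ta)" "nf (d ta)"] wN_cc_low[of 0 "nf (h ta)" "nf (d ta)"]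
 wN_cc[of 1 "nf (d ta)" "nf (d ta)"] wN_1_cc[of "nf (h ta)" "nf (d ta)"] wN_cc[of 2 "nf (d ta)" "nf (d ta)"]
 by (simp add: wN_mm) (intro add_mono; simp)
 also have "... <= 20 * M * ?S ta" by (rule gF_algebra) (use elim that in auto)
 finally show ?thesis .
 qed
 then show ?case by (auto simp: indicator_def)
 qed
 then have "(\<integral>\<^sup>+ta\<in>{0..}. gF h d ta \<partial>lborel) <= (NN ta. 20 * M * (?S ta * ind {0..} ta))"
 by (rule nn_integral_mono_AE)
 also have "... = 20 * M * (\<integral>\<^sup>+ta\<in>{0..}. ?S ta \<partial>lborel)"
 using Sm by (intro nn_integral_cmult) auto
 also have "... < ic" using assms M(1) unfolding cls_def by (simp add: ennreal_mult_less_top)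
 finally show ?thesis .
qed

lemma wN_time_swap:
 assumes f: "jm f" and [measurable]: "J \<in> sets borel"
 shows "wN s (%xi. \<integral>\<^sup>+ta\<in>J. f ta xi \<partial>lborel) = (\<integral>\<^sup>+ta\<in>J. wN s (f ta) \<partial>lborel)"
proof -
 note [measurable (raw)] = jm_compose[OF f]
 have "wN s (%xi. \<integral>\<^sup>+ta\<in>J. f ta xi \<partial>lborel) = (NN xi. (NN ta. er (norm xi powr s) * (f ta xi * ind J ta)))"
 unfolding wN_def by (intro nn_integral_cong nn_integral_cmult[symmetric]) measurable
 also have "... = (NN ta. (NN xi. er (norm xi powr s) * (f ta xi * ind J ta)))"
 by (rule lborel_pair.Fubini') measurable
 also have "... = (\<integral>\<^sup>+ta\<in>J. wN s (f ta) \<partial>lborel)"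
 unfolding wN_def by (intro nn_integral_cong) (auto simp: indicator_def)
 finally show ?thesis .
qed

lemma wN_inv: "wN s (%xi. er (1 / norm xi) * f xi) = wN (s - 1) f"
 unfolding wN_def
proof (rule nn_integral_cong_AE)
 show "AL xi. er (norm xi powr s) * (er (1 / norm xi) * f xi) = er (norm xi powr (s - 1)) * f xi"
 using AE_nonzero by eventually_elim (unfold mult.assoc[symmetric], subst ennreal_mult[symmetric], auto simp: powr_diff)
qed

text \<open>Continuity argument. The norm of the majorants on {0..S} is \<open>m0 + G S\<close>,
  which starts at \<open>m0\<close>, at most \<epsilon>. If it ever equalled 2 \<epsilon>, the
  quadratic estimate would give 2 \<epsilon> <= \<epsilon> + 8 (2 \<epsilon>)^2, impossible for this
  \<epsilon>.\<close>

lemma class_majorant: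
 assumes c: "cls h d" and e: "0 < \<epsilon>" "\<epsilon> <= 1/192" and a[measurable]: "a0 \<in> BM" "b0 \<in> BM"
 and small: "nrm (iv a0) (iv b0) <= ennreal \<epsilon>"
 and eq: "!!t xi. h t xi = heatF a0 t xi + U.D h d t xi" "!!t xi. d t xi = heatF b0 t xi + B.D h d t xi" and T: "T >= 0"
 shows "\<exists>p \<in> BM. \<exists>q \<in> BM. Maj {0..T} h p & Maj {0..T} d q & nrm p q <= er (2 * \<epsilon>)"
proof -
 have h: "jm h" and d: "jm d" using c by (auto simp: cls_def)
 have gm[measurable]: "gF h d \<in> BM" by (rule gF_measurable[OF h d])
 define x where "x S xi = (\<integral>\<^sup>+ta\<in>{0..S}. U.mq h d ta xi \<partial>lborel)" for S xi
 define y where "y S xi = (\<integral>\<^sup>+ta\<in>{0..S}. B.mq h d ta xi \<partial>lborel)" for S xi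
 define p where "p S = (%xi. iv a0 xi + er (1 / norm xi) * x S xi)" for S
 define q where "q S = (%xi. iv b0 xi + er (1 / norm xi) * y S xi)" for S
 have xy[measurable]: "x S \<in> BM" "y S \<in> BM" for S
 proof -
 note [measurable (raw)] = jm_compose[OF U.mm_jm[OF h d]] jm_compose[OF B.mm_jm[OF h d]]
 show "x S \<in> BM" "y S \<in> BM" unfolding x_def[abs_def] y_def[abs_def] by measurable
 qed
 have pq[measurable]: "p S \<in> BM" "q S \<in> BM" for S
 unfolding p_def q_def by measurable
 have hM: "Maj {0..S} h (p S)" and dM: "Maj {0..S} d (q S)" for S
 proof -
 have "Maj {0..S} (%t xi. heatF a0 t xi + U.D h d t xi) (p S)" unfolding p_def x_def
 by (intro Maj_add heatF_jm a U.D_jm h d heatF_Maj initial_Icc U.Maj_D) auto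
 then show "Maj {0..S} h (p S)" unfolding eq(1)[symmetric] .
 have "Maj {0..S} (%t xi. heatF b0 t xi + B.D h d t xi) (q S)" unfolding q_def y_def
 by (intro Maj_add heatF_jm a B.D_jm h d heatF_Maj initial_Icc B.Maj_D) auto
 then show "Maj {0..S} d (q S)" unfolding eq(2)[symmetric] .
 qed
 have split: "nrm (p S) (q S) = nrm (iv a0) (iv b0) + (\<integral>\<^sup>+ta\<in>{0..S}. gF h d ta \<partial>lborel)" for S
 proof -
 have I: "{0..S} \<in> sets borel" by simp
 have "nrm (p S) (q S) = nrm (iv a0) (iv b0) + nrm (%xi. er (1 / norm xi) * x S xi) (%xi. er (1 / norm xi) * y S xi)"
 unfolding p_def q_def by (rule nrm_add) measurable
 also have "nrm (%xi. er (1 / norm xi) * x S xi) (%xi. er (1 / norm xi) * y S xi)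
 = wN (- 1) (x S) + wN (- 1) (y S) + wN 0 (y S)" by (simp add: nrm_def wN_inv)
 also have "... = (\<integral>\<^sup>+ta\<in>{0..S}. gF h d ta \<partial>lborel)"
 unfolding x_def[abs_def] y_def[abs_def] wN_time_swap[OF U.mm_jm[OF h d] I] wN_time_swap[OF B.mm_jm[OF h d] I] gF_def distrib_right
 using wN_time_measurable[OF U.mm_jm[OF h d], of "- 1"] wN_time_measurable[OF B.mm_jm[OF h d], of "- 1"] wN_time_measurable[OF B.mm_jm[OF h d], of 0]
 by (subst nn_integral_add; simp add: nn_integral_add)
 finally show ?thesis .
 qed
 have gfin: "(\<integral>\<^sup>+ta\<in>{0..T}. gF h d ta \<partial>lborel) < ic"
 by (rule le_less_trans[OF nn_integral_mono gF_finite[OF c]]) (auto simp: indicator_def)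
 \<comment> \<open>A real version of the rate, so that continuity of the integral and the
   intermediate value theorem apply.\<close>
 define g where "g ta = enn2real (gF h d ta)" for ta
 have [measurable]: "g \<in> BM" unfolding g_def[abs_def] by measurable
 have "AL ta. gF h d ta * ind {0..T} ta ~= ic"
 using gfin by (intro nn_integral_PInf_AE) auto
 then have gg: "AL ta. er (ind {0..T} ta *R g ta) = gF h d ta * ind {0..T} ta"
 by eventually_elim (auto simp: g_def indicator_def less_top)
 have gi: "set_integrable lborel {0..T} g"
 unfolding set_integrable_def
 proof (rule integrableI_nonneg)
 show "(NN ta. er (ind {0..T} ta *R g ta)) < ic" using gfin nn_integral_cong_AE[OF gg] by simp
 qed (auto simp: g_def)
 define G where "G S = integral {0..S} g" for S
 have cont: "continuous_on {0..T} G"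
 unfolding G_def by (intro indefinite_integral_continuous_1 set_borel_integral_eq_integral(1)[OF gi])
 have G: "(\<integral>\<^sup>+ta\<in>{0..S}. gF h d ta \<partial>lborel) = er (G S)" and G0: "0 <= G S" if S: "S \<in> {0..T}" for S
 proof -
 have gS: "set_integrable lborel {0..S} g" by (rule set_integrable_subset[OF gi]) (use S in auto)
 have GS: "G S = (LINT ta|lborel. ind {0..S} ta *R g ta)"
 unfolding G_def set_borel_integral_eq_integral(2)[OF gS, symmetric] set_lebesgue_integral_def ..
 have "(\<integral>\<^sup>+ta\<in>{0..S}. gF h d ta \<partial>lborel) = (NN ta. er (ind {0..S} ta *R g ta))"
 proof (rule nn_integral_cong_AE)
 show "AL ta. gF h d ta * ind {0..S} ta = er (ind {0..S} ta *R g ta)"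
 using gg by eventually_elim (use S in \<open>auto simp: indicator_def split: if_splits\<close>)
 qed
 also have "... = er (G S)"
 unfolding GS using gS unfolding set_integrable_def by (intro nn_integral_eq_integral) (auto simp: g_def)
 finally show "(\<integral>\<^sup>+ta\<in>{0..S}. gF h d ta \<partial>lborel) = er (G S)" .
 show "0 <= G S" unfolding GS by (intro Bochner_Integration.integral_nonneg) (auto simp: g_def)
 qed
 define m0 where "m0 = enn2real (nrm (iv a0) (iv b0))"
 have m0: "nrm (iv a0) (iv b0) = ennreal m0" "0 <= m0" "m0 <= \<epsilon>"
 proof -
 have "nrm (iv a0) (iv b0) < top" using small by (rule le_less_trans) simp
 then show 1: "nrm (iv a0) (iv b0) = ennreal m0" by (simp add: m0_def)
 show "0 <= m0" by (simp add: m0_def)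
 show "m0 <= \<epsilon>" using small e unfolding 1 by (simp add: ennreal_le_iff)
 qed
 have n: "nrm (p S) (q S) = er (m0 + G S)" if "S \<in> {0..T}" for S
 unfolding split G[OF that] m0(1) using m0(2) G0[OF that] by simp
 have "m0 + G T <= 2 * \<epsilon>"
 proof (rule ccontr)
 assume "\<not> ?thesis"
 then have GT: "2 * \<epsilon> <= m0 + G T" by simp
 have G0': "m0 + G 0 <= 2 * \<epsilon>" using m0 e by (simp add: G_def)
 have "continuous_on {0..T} (%S. m0 + G S)" by (intro continuous_on_add continuous_on_const cont)
 from IVT'[OF G0' GT T this] obtain S where S: "0 <= S" "S <= T" "m0 + G S = 2 * \<epsilon>" by blast
 have ST: "S \<in> {0..T}" using S by simp
 have f: "p S xi <= iv a0 xi + FU (p S) (q S) (p S) (q S) xi" "q S xi <= iv b0 xi + FB (p S) (q S) (p S) (q S) xi" if nz: "xi ~= 0" for xi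
 proof -
 have inv: "er (1 / norm xi) * (en xi * X) = X" for X
 using nz unfolding mult.assoc[symmetric] by (subst ennreal_mult[symmetric]) auto
 have "x S xi <= en xi * FU (p S) (q S) (p S) (q S) xi" unfolding x_def
 by (rule U.int_mm[OF h d h d _ _ _ _ _ hM dM hM dM]) measurable
 then have "er (1 / norm xi) * x S xi <= FU (p S) (q S) (p S) (q S) xi"
 using mult_left_mono[of "x S xi" "en xi * FU (p S) (q S) (p S) (q S) xi" "er (1 / norm xi)"] by (simp add: inv)
 then show "p S xi <= iv a0 xi + FU (p S) (q S) (p S) (q S) xi" unfolding p_def[of S] by (intro add_left_mono) (simp add: p_def)
 have "y S xi <= en xi * FB (p S) (q S) (p S) (q S) xi" unfolding y_def
 by (rule B.int_mm[OF h d h d _ _ _ _ _ hM dM hM dM]) measurable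
 then have "er (1 / norm xi) * y S xi <= FB (p S) (q S) (p S) (q S) xi"
 using mult_left_mono[of "y S xi" "en xi * FB (p S) (q S) (p S) (q S) xi" "er (1 / norm xi)"] by (simp add: inv)
 then show "q S xi <= iv b0 xi + FB (p S) (q S) (p S) (q S) xi" unfolding q_def[of S] by (intro add_left_mono) (simp add: q_def)
 qed
 have "er (2 * \<epsilon>) = nrm (p S) (q S)" using n[OF ST] S by simp
 also have "... <= nrm (%xi. iv a0 xi + FU (p S) (q S) (p S) (q S) xi) (%xi. iv b0 xi + FB (p S) (q S) (p S) (q S) xi)"
 by (intro nrm_mono; rule eventually_mono[OF AE_nonzero]; simp add: f)
 also have "... = nrm (iv a0) (iv b0) + nrm (FU (p S) (q S) (p S) (q S)) (FB (p S) (q S) (p S) (q S))" by (rule nrm_add) measurable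
 also have "... <= ennreal \<epsilon> + 8 * (nrm (p S) (q S) * nrm (p S) (q S))" by (intro add_mono small nrm_F) measurable
 also have "... = ennreal \<epsilon> + 8 * (er (2 * \<epsilon>) * er (2 * \<epsilon>))" using n[OF ST] S by simp
 also have "... = er (\<epsilon> + 32 * \<epsilon> * \<epsilon>)"
 using e by (simp add: ennreal_plus[symmetric] ennreal_mult[symmetric] numeral_mult_ennreal del: ennreal_plus)
 finally have "2 * \<epsilon> <= \<epsilon> + 32 * \<epsilon> * \<epsilon>" using e by (subst (asm) ennreal_le_iff) auto
 moreover have "\<epsilon> * (32 * \<epsilon>) <= \<epsilon> * (1/2)" using e by (intro mult_left_mono) auto
 ultimately show False using e by simp
 qed
 then have "nrm (p T) (q T) <= er (2 * \<epsilon>)" using n[of T] T by (auto intro: ennreal_leI)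
 then show ?thesis using hM dM pq by blast
qed

section \<open>Jointly measurable representatives of curves in the solution class\<close>

lemma fhat_diff:
 assumes "fhat_is_function f" "fhat_is_function g"
 shows "fhat_is_function (f - g)" "AL xi. fhat (f - g) xi = fhat f xi - fhat g xi"
proof -
 have r: "represents (%xi. fun_of (fourier (f $ i)) xi - fun_of (fourier (g $ i)) xi) (fourier ((f - g) $ i))" for i
 proof -
 have "represents (fun_of (fourier (f $ i))) (fourier (f $ i))" "represents (fun_of (fourier (g $ i))) (fourier (g $ i))"
 using assms unfolding fhat_is_function_def by (auto intro: represents_fun_of)
 from represents_diff[OF this] show ?thesis by (simp add: fourier_minus)
 qed
 then show "fhat_is_function (f - g)" unfolding fhat_is_function_def by blast
 have "AL xi. \<forall>i. fun_of (fourier ((f - g) $ i)) xi = fun_of (fourier (f $ i)) xi - fun_of (fourier (g $ i)) xi"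
 using fun_of_AE[OF r] by (simp add: AE_finite_all[of UNIV, simplified])
 then show "AL xi. fhat (f - g) xi = fhat f xi - fhat g xi"
 by eventually_elim (simp add: fhat_def vec_eq_iff)
qed

text \<open>The level sets are only Lebesgue measurable. Their indicators are replaced by Borel
  functions agreeing almost everywhere, and each of the finitely many values contributes its own
  transform.\<close>

lemma simple_function_representative:
 fixes s :: "real => tempered^3"
 assumes s: "simple_function (lebesgue_on {0<..}) s" and f: "!!t. t > 0 ==> fhat_is_function (s t)"
 shows "\<exists>S. jm S & (AL t. 0 < t --> S t = fhat (s t))"
proof -
 define Y where "Y = s ` {0<..}"
 have Y: "finite Y" using s unfolding simple_function_def Y_def by simp
 have A: "s -` {y} \<inter> {0<..} \<in> sets lebesgue" if "y \<in> Y" for y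
 proof -
 have "s -` {y} \<inter> space (lebesgue_on {0<..}) \<in> sets (lebesgue_on {0<..})" using s that unfolding simple_function_def Y_def by (auto simp: space_restrict_space)
 then show ?thesis by (subst (asm) sets_restrict_space_iff) (auto simp: space_restrict_space Int_commute)
 qed
 have "\<exists>g\<in>borel_measurable lborel. AL t. (ind (s -` {y} \<inter> {0<..}) t :: real) = g t" if "y \<in> Y" for y
 using A[OF that] by (intro completion_ex_borel_measurable_real borel_measurable_indicator) simp
 then obtain g where g: "!!y. y \<in> Y ==> g y \<in> BM"
 "!!y. y \<in> Y ==> AL t. (ind (s -` {y} \<inter> {0<..}) t :: real) = g y t"
 by (simp add: Bex_def) metis
 define S where "S t xi = (\<Sum>y\<in>Y. g y t *R fhat y xi)" for t xi
 have "jm S"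
 unfolding S_def[abs_def]
 proof (rule jmI, rule borel_measurable_sum, rule borel_measurable_scaleR)
 fix y assume y: "y \<in> Y"
 show "(%w. g y (fst w)) \<in> borel_measurable (borel \<Otimes>\<^sub>M borel)" by (rule measurable_compose[OF measurable_fst g(1)[OF y]])
 have "fhat y \<in> BM" using y f unfolding Y_def by (auto intro!: fhat_measurable)
 then show "(%w. fhat y (snd w)) \<in> borel_measurable (borel \<Otimes>\<^sub>M borel)" by (rule measurable_compose[OF measurable_snd])
 qed
 moreover have "AL t. \<forall>y\<in>Y. (ind (s -` {y} \<inter> {0<..}) t :: real) = g y t"
 using g(2) by (simp add: AE_finite_all[OF Y])
 then have "AL t. 0 < t --> S t = fhat (s t)"
 proof eventually_elim
 case (elim t)
 show ?case
 proof (intro impI ext)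
 fix xi assume t: "0 < t"
 have "S t xi = (\<Sum>y\<in>Y. (if s t = y then fhat y xi else 0))"
 unfolding S_def by (rule sum.cong[OF refl]) (use elim t in \<open>auto simp: indicator_def dest!: bspec split: if_splits\<close>)
 also have "... = fhat (s t) xi" using Y t by (simp add: Y_def)
 finally show "S t xi = fhat (s t) xi" .
 qed
 qed
 ultimately show ?thesis by blast
qed

lemma wN_triangle:
 assumes [measurable]: "f \<in> BM" "g \<in> BM" "h \<in> BM"
 shows "wN s (nf (%xi. f xi - h xi)) <= wN s (nf (%xi. f xi - g xi)) + wN s (nf (%xi. h xi - g xi))"
proof -
 have "en (f xi - h xi) <= en (f xi - g xi) + en (h xi - g xi)" for xi
 using norm_triangle_ineq4[of "f xi - g xi" "h xi - g xi"]
 by (subst ennreal_plus[symmetric]) (auto intro!: ennreal_leI simp del: ennreal_plus)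
 then have "wN s (nf (%xi. f xi - h xi)) <= wN s (%xi. nf (%xi. f xi - g xi) xi + nf (%xi. h xi - g xi) xi)"
 by (intro wN_mono AE_I2) (simp add: nf_def)
 also have "... = wN s (nf (%xi. f xi - g xi)) + wN s (nf (%xi. h xi - g xi))" by (rule wN_add) measurable
 finally show ?thesis .
qed

text \<open>
 Along the indices \<open>n j t\<close>, chosen measurably in \<open>t\<close>, the convergence is fast enough to hold almost everywhere.
\<close>

lemma strongly_measurable_representative:
 fixes v :: "real => tempered^3"
 assumes L1: "in_L1 N v" and N: "!!f. Xnorm 1 f <= N f" and v: "!!t. t > 0 ==> fhat_is_function (v t)"
 shows "\<exists>V. jm V & (AL t. 0 < t --> (AL xi. V t xi = fhat (v t) xi))"
proof -
 obtain s where s: "!!n. simple_function (lebesgue_on {0<..}) (s n)" "!!n t. t > 0 ==> N (s n t) < ic"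
 and lim: "AE t in lebesgue_on {0<..}. (%n. N (s n t - v t)) -+> 0"
 using L1 unfolding in_L1_def by blast
 have fs: "fhat_is_function (s n t)" if "t > 0" for n t
 using le_less_trans[OF N s(2)[OF that, of n]] by (auto simp: Xnorm_def split: if_splits)
 have "\<exists>S. jm S & (AL t. 0 < t --> S t = fhat (s n t))" for n
 by (rule simple_function_representative[OF s(1) fs])
 then obtain S where S: "!!n. jm (S n)" "!!n. AL t. 0 < t --> S n t = fhat (s n t)" by metis
 have AS: "AL t. \<forall>n. 0 < t --> S n t = fhat (s n t)" unfolding AE_all_countable using S(2) by blast
 have lim': "AL t. 0 < t --> (%n. N (s n t - v t)) -+> 0"
 using lim by (subst (asm) AE_restrict_space_iff) (auto simp: AE_completion_iff)
 define J where "J m l t = wN 1 (nf (%xi. S m t xi - S l t xi))" for m l t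
 have Jm[measurable]: "J m l \<in> BM" for m l
 unfolding J_def[abs_def] by (intro wN_time_measurable jm_nf jm_diff S(1))
 \<comment> \<open>The index is selected by a Cauchy condition among the approximants. The distance
   to \<open>v\<close> would be more direct, but its measurability in time is not yet known.\<close>
 define nn where "nn j t = (LEAST n. \<forall>m\<ge>n. \<forall>l\<ge>n. J m l t <= er ((1/2) ^ j))" for j :: nat and t
 have nnm: "nn j \<in> measurable borel (count_space UNIV)" for j
 unfolding nn_def by measurable
 define W where "W j t = S (nn j t) t" for j t
 have Wj: "jm (W j)" for j
 proof (rule jmI)
 have "(%w. S (nn j (fst w)) (fst w) (snd w)) \<in> borel_measurable (borel \<Otimes>\<^sub>M borel)"
 proof (rule measurable_compose_countable)
 show "(%w. S n (fst w) (snd w)) \<in> borel_measurable (borel \<Otimes>\<^sub>M borel)" for n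
 by (rule jm_compose[OF S(1)]) simp_all
 show "(%w. nn j (fst w)) \<in> measurable (borel \<Otimes>\<^sub>M borel) (count_space UNIV)"
 by (rule measurable_compose[OF measurable_fst nnm])
 qed
 then show "(%w. W j (fst w) (snd w)) \<in> borel_measurable (borel \<Otimes>\<^sub>M borel)" unfolding W_def .
 qed
 define V where "V t xi = lim (%j. W j t xi)" for t xi
 have "jm V"
 unfolding V_def[abs_def] using Wj unfolding jm_def case_prod_beta' by (intro borel_measurable_lim_metric) simp
 moreover have "AL t. 0 < t --> (AL xi. V t xi = fhat (v t) xi)"
 using AS lim'
 proof eventually_elim
 case (elim t)
 show ?case
 proof
 assume t: "0 < t"
 note [measurable] = fhat_measurable[OF v[OF t]] jm_slice[OF S(1)] jm_slice[OF Wj]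
 define D where "D n = wN 1 (nf (%xi. S n t xi - fhat (v t) xi))" for n
 have DN: "D n <= N (s n t - v t)" for n
 proof -
 have ae: "AL xi. fhat (s n t - v t) xi = S n t xi - fhat (v t) xi"
 using fhat_diff(2)[OF fs[OF t] v[OF t]] elim(1) t by simp
 have "Xnorm 1 (s n t - v t) = (NN xi. er (norm xi powr 1 * norm (fhat (s n t - v t) xi)))"
 using fhat_diff(1)[OF fs[OF t] v[OF t]] by (simp add: Xnorm_def)
 also have "... = D n" unfolding D_def wN_def nf_def
 by (rule nn_integral_cong_AE, rule eventually_mono[OF ae]) (simp add: ennreal_mult')
 finally have "D n = Xnorm 1 (s n t - v t)" ..
 then show ?thesis using N by simp
 qed
 have D0: "D -+> 0"
 proof (rule tendsto_sandwich[OF _ _ tendsto_const])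
 show "(%n. N (s n t - v t)) -+> 0" using elim(2) t by blast
 show "\<forall>\<^sub>F n in sequentially. D n <= N (s n t - v t)" by (rule always_eventually) (use DN in blast)
 qed simp
 have JD: "J m l t <= D m + D l" for m l unfolding J_def D_def by (rule wN_triangle) measurable
 have DJ: "D m <= J m l t + D l" for m l
 proof -
 have "D m <= wN 1 (nf (%xi. S m t xi - S l t xi)) + wN 1 (nf (%xi. fhat (v t) xi - S l t xi))"
 unfolding D_def by (rule wN_triangle) measurable
 moreover have "nf (%xi. fhat (v t) xi - S l t xi) = nf (%xi. S l t xi - fhat (v t) xi)"
 by (rule ext) (simp add: nf_def norm_minus_commute)
 ultimately show ?thesis by (simp only: J_def D_def)
 qed
 have Dn: "D (nn j t) <= er ((1/2) ^ j)" for j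
 proof -
 have "\<exists>n. \<forall>m\<ge>n. \<forall>l\<ge>n. J m l t <= er ((1/2) ^ j)"
 proof -
 have "\<forall>\<^sub>F n in sequentially. D n < er ((1/2) ^ j / 2)" using D0 by (rule order_tendstoD) simp
 then obtain n where n: "!!m. m >= n ==> D m < er ((1/2) ^ j / 2)" unfolding eventually_sequentially by blast
 have "J m l t <= er ((1/2) ^ j)" if "m >= n" "l >= n" for m l
 proof -
 have "J m l t <= er ((1/2) ^ j / 2) + er ((1/2) ^ j / 2)"
 using n[OF that(1)] n[OF that(2)] by (intro order_trans[OF JD] add_mono less_imp_le)
 then show ?thesis by (simp add: ennreal_plus[symmetric] del: ennreal_plus)
 qed
 then show ?thesis by blast
 qed
 from LeastI_ex[OF this] have "\<forall>m\<ge>nn j t. \<forall>l\<ge>nn j t. J m l t <= er ((1/2) ^ j)" unfolding nn_def .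
 then have le: "J (nn j t) l t <= er ((1/2) ^ j)" if "l >= nn j t" for l using that by blast
 have Dl: "D (nn j t) <= er ((1/2) ^ j) + D l" if "l >= nn j t" for l
 by (rule order_trans[OF DJ[of _ l] add_right_mono[OF le[OF that]]])
 have "D (nn j t) <= er ((1/2) ^ j) + 0"
 proof (rule LIMSEQ_le_const[OF tendsto_add[OF tendsto_const D0]])
 show "\<exists>N. \<forall>l\<ge>N. D (nn j t) <= er ((1/2) ^ j) + D l"
 by (rule exI[of _ "nn j t"]) (use Dl in blast)
 qed
 then show ?thesis by simp
 qed
 have "wN 1 (%xi. \<Sum>j. nf (%xi. W j t xi - fhat (v t) xi) xi) = (\<Sum>j. D (nn j t))"
 unfolding D_def W_def[symmetric] by (rule wN_suminf) measurable
 also have "... <= (\<Sum>j. er ((1/2) ^ j))" by (intro suminf_le Dn) auto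
 also have "... < ic" by (subst suminf_ennreal2) (auto intro: summable_geometric)
 finally have fin: "wN 1 (%xi. \<Sum>j. nf (%xi. W j t xi - fhat (v t) xi) xi) < ic" .
 have "AL xi. er (norm xi powr 1) * (\<Sum>j. nf (%xi. W j t xi - fhat (v t) xi) xi) ~= ic"
 using fin unfolding wN_def by (intro nn_integral_PInf_AE) auto
 then show "AL xi. V t xi = fhat (v t) xi"
 using AE_nonzero
 proof eventually_elim
 case (elim xi)
 then have "(\<Sum>j. en (W j t xi - fhat (v t) xi)) ~= \<top>" by (auto simp: ennreal_mult_eq_top_iff nf_def)
 then have "summable (%j. norm (W j t xi - fhat (v t) xi))" by (intro summable_suminf_not_top) auto
 then have "(%j. norm (W j t xi - fhat (v t) xi)) -+> 0" by (rule summable_LIMSEQ_zero)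
 then have "(%j. W j t xi - fhat (v t) xi) -+> 0" by (rule tendsto_norm_zero_cancel)
 then have "(%j. W j t xi) -+> fhat (v t) xi" by (rule LIM_zero_cancel)
 then show ?case unfolding V_def by (rule limI)
 qed
 qed
 qed
 ultimately show ?thesis by blast
qed

lemma class_bounds:
 assumes "in_solution_class k \<sigma> v w" "t >= 0"
 defines "M \<equiv> (SUP t\<in>{0..}. u_norm k \<sigma> (v t)) + (SUP t\<in>{0..}. B_norm k \<sigma> (w t))"
 shows "M < ic" "Xnorm (- 1) (v t) <= M" "Xnorm (- 1) (w t) <= M" "Xnorm 0 (w t) <= M"
proof -
 show "M < ic" using assms(1) unfolding M_def in_solution_class_def in_Linfty_def by simp
 have t: "t \<in> {0..}" using assms by simp
 have "Xnorm (- 1) (v t) <= u_norm k \<sigma> (v t)" by (simp add: u_norm_def add_increasing add_increasing2)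
 also have "... <= (SUP t\<in>{0..}. u_norm k \<sigma> (v t))" using t by (rule SUP_upper)
 also have "... <= M" unfolding M_def by simp
 finally show "Xnorm (- 1) (v t) <= M" .
 have "B_norm k \<sigma> (w t) <= (SUP t\<in>{0..}. B_norm k \<sigma> (w t))" using t by (rule SUP_upper)
 also have "... <= M" unfolding M_def by simp
 finally have B: "B_norm k \<sigma> (w t) <= M" .
 have "Xnorm (- 1) (w t) <= B_norm k \<sigma> (w t)" "Xnorm 0 (w t) <= B_norm k \<sigma> (w t)"
 by (simp_all add: B_norm_def add_increasing add_increasing2)
 then show "Xnorm (- 1) (w t) <= M" "Xnorm 0 (w t) <= M" using B by (blast intro: order_trans)+
qed

lemma in_L1_integral:
 assumes L1: "in_L1 N v" and G: "G \<in> BM" and le: "AL t. 0 <= t --> G t <= N (v t)"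
 shows "(\<integral>\<^sup>+t\<in>{0..}. G t \<partial>lborel) < ic"
proof -
 have "(\<integral>\<^sup>+t\<in>{0..}. G t \<partial>lborel) <= (NN t. N (v t) * ind {0<..} t)"
 proof (rule nn_integral_mono_AE)
 show "AL t. G t * ind {0..} t <= N (v t) * ind {0<..} t"
 using le AE_lborel_singleton[of 0] by eventually_elim (auto simp: indicator_def)
 qed
 also have "... = (\<integral>\<^sup>+t. N (v t) \<partial>lebesgue_on {0<..})"
 by (subst nn_integral_restrict_space) (auto simp: nn_integral_completion)
 also have "... < ic" using L1 unfolding in_L1_def by blast
 finally show ?thesis .
qed

lemma cls_of_class:
 assumes c: "in_solution_class k \<sigma> v w" and h: "jm h" and d: "jm d"
 and ae: "AL ta. 0 <= ta --> ftv (h ta) (v ta) & ftv (d ta) (w ta)"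
 shows "cls h d"
 unfolding cls_def
proof (intro conjI h d exI)
 let ?M = "(SUP t\<in>{0..}. u_norm k \<sigma> (v t)) + (SUP t\<in>{0..}. B_norm k \<sigma> (w t))"
 show "?M < ic" using class_bounds(1)[OF c order_refl] .
 show "AL ta. 0 <= ta --> wN (- 1) (nf (h ta)) <= ?M & wN (- 1) (nf (d ta)) <= ?M & wN 0 (nf (d ta)) <= ?M"
 using ae by eventually_elim (use class_bounds(2-4)[OF c] in \<open>auto simp: Xnorm_nf[symmetric]\<close>)
 have m[measurable]: "(%ta. wN s (nf (h ta))) \<in> BM" "(%ta. wN s (nf (d ta))) \<in> BM" for s
 by (intro wN_time_measurable jm_nf h d)+
 have L: "in_L1 (%f. Xnorm (k + 1) f + Xnorm 1 f) v" "in_L1 (%f. Xnorm (k + 1) f + Xnorm 1 f + Xnorm 2 f) w"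
 using c by (auto simp: in_solution_class_def)
 have aeX: "AL ta. 0 <= ta --> wN 1 (nf (h ta)) = Xnorm 1 (v ta) & (\<forall>s. wN s (nf (d ta)) = Xnorm s (w ta))"
 using ae by eventually_elim (auto intro!: Xnorm_nf[symmetric])
 have 1: "(\<integral>\<^sup>+ta\<in>{0..}. wN 1 (nf (h ta)) \<partial>lborel) < ic"
 by (rule in_L1_integral[OF L(1) m(1)], rule eventually_mono[OF aeX]) (simp add: add_increasing)
 have 2: "(\<integral>\<^sup>+ta\<in>{0..}. wN 1 (nf (d ta)) \<partial>lborel) < ic"
 by (rule in_L1_integral[OF L(2) m(2)], rule eventually_mono[OF aeX]) (simp add: add_increasing add_increasing2)
 have 3: "(\<integral>\<^sup>+ta\<in>{0..}. wN 2 (nf (d ta)) \<partial>lborel) < ic"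
 by (rule in_L1_integral[OF L(2) m(2)], rule eventually_mono[OF aeX]) (simp add: add_increasing)
 show "(\<integral>\<^sup>+ta\<in>{0..}. (wN 1 (nf (h ta)) + wN 1 (nf (d ta)) + wN 2 (nf (d ta))) \<partial>lborel) < ic"
 using 1 2 3 by (simp add: distrib_right nn_integral_add)
qed

lemma cls_integrable:
 assumes c: "cls h d"
 shows "AL ta. 0 <= ta --> integrable lborel (h ta) & integrable lborel (d ta)"
proof -
 have h: "jm h" and d: "jm d" using c by (auto simp: cls_def)
 obtain M where M: "M < ic" "AL ta. 0 <= ta --> wN (- 1) (nf (h ta)) <= M & wN (- 1) (nf (d ta)) <= M & wN 0 (nf (d ta)) <= M"
 using c unfolding cls_def by blast
 have "AL ta. (wN 1 (nf (h ta)) + wN 1 (nf (d ta)) + wN 2 (nf (d ta))) * ind {0..} ta ~= ic"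
 proof (rule nn_integral_PInf_AE)
 have [measurable]: "(%ta. wN s (nf (h ta))) \<in> BM" "(%ta. wN s (nf (d ta))) \<in> BM" for s
 by (intro wN_time_measurable jm_nf h d)+
 show "(%ta. (wN 1 (nf (h ta)) + wN 1 (nf (d ta)) + wN 2 (nf (d ta))) * ind {0..} ta) \<in> borel_measurable lborel" by measurable
 qed (use conjunct2[OF conjunct2[OF conjunct2[OF c[unfolded cls_def]]]] in auto)
 then show ?thesis using M(2)
 proof eventually_elim
 case (elim ta)
 have i: "integrable lborel f" if "f \<in> BM" "wN (- 1) (nf f) < ic" "wN 1 (nf f) < ic" for f
 using that unfolding wN_def nf_def ennreal_mult'[OF powr_ge_zero, symmetric] by (rule integrable_of_two)
 show ?case
 using elim M(1) by (auto simp: less_top intro!: i jm_slice[OF h] jm_slice[OF d] intro: le_less_trans)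
 qed
qed

lemma cls_finite_mm:
 assumes c: "cls h d"
 shows "(NN xi. er (norm xi powr - 1) * (\<integral>\<^sup>+ta\<in>{0..t}. U.mq h d ta xi \<partial>lborel)) < ic"
 and "(NN xi. er (norm xi powr - 1) * (\<integral>\<^sup>+ta\<in>{0..t}. B.mq h d ta xi \<partial>lborel)) < ic"
proof -
 have h: "jm h" and d: "jm d" using c by (auto simp: cls_def)
 have le: "(\<integral>\<^sup>+ta\<in>{0..t}. f ta \<partial>lborel) < ic" if "!!ta. f ta <= gF h d ta" for f
 by (rule le_less_trans[OF nn_integral_mono gF_finite[OF c]]) (use that in \<open>auto simp: indicator_def\<close>)
 have gU: "wN (- 1) (U.mq h d ta) <= gF h d ta" and gB: "wN (- 1) (B.mq h d ta) <= gF h d ta" for ta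
 by (simp_all add: gF_def add_increasing add_increasing2)
 show "(NN xi. er (norm xi powr - 1) * (\<integral>\<^sup>+ta\<in>{0..t}. U.mq h d ta xi \<partial>lborel)) < ic"
 unfolding wN_def[symmetric] wN_time_swap[OF U.mm_jm[OF h d] atLeastAtMost_borel] by (rule le[OF gU])
 show "(NN xi. er (norm xi powr - 1) * (\<integral>\<^sup>+ta\<in>{0..t}. B.mq h d ta xi \<partial>lborel)) < ic"
 unfolding wN_def[symmetric] wN_time_swap[OF B.mm_jm[OF h d] atLeastAtMost_borel] by (rule le[OF gB])
qed

text \<open>The class gives majorants on {0..t} for the competing solution, small by continuity; the
  Picard limit has small majorants by construction. \<open>solF_unique\<close> identifies the
  transforms, hence the distributions, at time \<open>t\<close>.\<close>

lemma (in picard) unique_solution: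
 assumes e: "0 < \<epsilon>" and a: "ftv a0 u0" and bb: "ftv b0 B0"
 and sol: "hall_mhd_solution u0 B0 v w" and c: "in_solution_class k \<sigma> v w" and t: "t >= 0"
 shows "v t = fu t & w t = fb t"
proof -
 have fv: "ftv (fhat (v ta)) (v ta)" "ftv (fhat (w ta)) (w ta)" if "ta >= 0" for ta
 using class_bounds[OF c that] by (auto intro!: ftv_of_Xnorm intro: le_less_trans)
 have L: "in_L1 (%f. Xnorm (k + 1) f + Xnorm 1 f) v" "in_L1 (%f. Xnorm (k + 1) f + Xnorm 1 f + Xnorm 2 f) w"
 using c by (auto simp: in_solution_class_def)
 have ff: "fhat_is_function (v ta)" "fhat_is_function (w ta)" if "ta > 0" for ta
 using fv[of ta] that by (auto intro: ftv_fhat_is_function)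
 have le: "Xnorm 1 f <= Xnorm (k + 1) f + Xnorm 1 f" "Xnorm 1 f <= Xnorm (k + 1) f + Xnorm 1 f + Xnorm 2 f" for f
 by (simp_all add: add_increasing add_increasing2)
 obtain V where V: "jm V" "AL t. 0 < t --> (AL xi. V t xi = fhat (v t) xi)"
 using strongly_measurable_representative[OF L(1) le(1) ff(1)] by blast
 obtain W where W: "jm W" "AL t. 0 < t --> (AL xi. W t xi = fhat (w t) xi)"
 using strongly_measurable_representative[OF L(2) le(2) ff(2)] by blast
 have aeVW: "AL ta. 0 <= ta --> ftv (V ta) (v ta) & ftv (W ta) (w ta)"
 using V(2) W(2) AE_lborel_singleton[of 0]
 proof eventually_elim
 case (elim ta)
 show ?case
 proof
 assume ta: "0 <= ta"
 then have "AL xi. fhat (v ta) xi = V ta xi" "AL xi. fhat (w ta) xi = W ta xi"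
 using elim by (auto elim: eventually_mono)
 then show "ftv (V ta) (v ta) & ftv (W ta) (w ta)"
 using fv[OF ta] jm_slice[OF V(1)] jm_slice[OF W(1)] by (auto intro: ftv_cong_AE)
 qed
 qed
 have cVW: "cls V W" by (rule cls_of_class[OF c V(1) W(1) aeVW])
 \<comment> \<open>\<open>V\<close>, \<open>W\<close> represent the solution at almost every time
   only. The right-hand side formed from them represents it at every time, and it does not change
   when \<open>V\<close>, \<open>W\<close> are replaced by \<open>h\<close>, \<open>d\<close>, so
   these solve the equation exactly.\<close>
 define h where "h = (%t xi. heatF a0 t xi + U.D V W t xi)"
 define d where "d = (%t xi. heatF b0 t xi + B.D V W t xi)"
 have h: "jm h" and d: "jm d" unfolding h_def d_def by (intro jm_add heatF_jm a0 b0 U.D_jm B.D_jm V W)+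
 have fhd: "ftv (h s) (v s)" "ftv (d s) (w s)" if s: "s >= 0" for s
 proof -
 have "AL ta. ta \<in> {0..s} --> ftv (V ta) (v ta) & integrable lborel (V ta) & ftv (W ta) (w ta) & integrable lborel (W ta)"
 using aeVW cls_integrable[OF cVW] by eventually_elim auto
 from duhamel_iff[OF V(1) W(1) s a bb this cls_finite_mm[OF cVW]] sol s
 show "ftv (h s) (v s)" "ftv (d s) (w s)" unfolding hall_mhd_solution_def h_def d_def by blast+
 qed
 have chd: "cls h d" by (rule cls_of_class[OF c h d]) (simp add: fhd)
 have same: "AL ta. 0 <= ta --> (AL x. V ta x = h ta x) & (AL x. W ta x = d ta x)"
 using aeVW by eventually_elim (use fhd ftv_unique in blast)
 have eq: "h s xi = heatF a0 s xi + U.D h d s xi" "d s xi = heatF b0 s xi + B.D h d s xi" for s xi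
 proof -
 have "h s xi = heatF a0 s xi + U.D V W s xi" unfolding h_def ..
 also have "U.D V W s xi = U.D h d s xi" by (rule U.D_cong[OF V(1) W(1) h d same])
 finally show "h s xi = heatF a0 s xi + U.D h d s xi" .
 have "d s xi = heatF b0 s xi + B.D V W s xi" unfolding d_def ..
 also have "B.D V W s xi = B.D h d s xi" by (rule B.D_cong[OF V(1) W(1) h d same])
 finally show "d s xi = heatF b0 s xi + B.D h d s xi" .
 qed
 obtain p q where pq: "p \<in> BM" "q \<in> BM" "Maj {0..t} h p" "Maj {0..t} d q" "nrm p q <= er (2 * \<epsilon>)"
 using class_majorant[OF chd e \<epsilon> a0 b0 small eq t] by blast
 have sub: "{0..t} \<subseteq> {0..}" by auto
 have sA: "solF {0..t} a0 b0 h d" unfolding solF_def using eq by simp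
 have sB: "solF {0..t} a0 b0 u b" using u_b_solution unfolding solF_def by (auto elim: eventually_mono)
 have n1: "nrm p q <= er (1/32)" by (rule order_trans[OF pq(5) ennreal_leI]) (use \<epsilon> in simp)
 have n2: "nrm P Q <= er (1/32)" by (rule order_trans[OF nrm_PQ ennreal_leI]) (use \<epsilon> in simp)
 have "AL xi. \<forall>s\<in>{0..t}. h s xi = u s xi" "AL xi. \<forall>s\<in>{0..t}. d s xi = b s xi"
 using solF_unique[OF initial_Icc sA sB h d u_jm b_jm pq(1,2) P_measurable Q_measurable pq(3,4) Maj_subset[OF u_Maj sub] Maj_subset[OF b_Maj sub] n1 n2] by blast+
 then have "AL xi. h t xi = u t xi" "AL xi. d t xi = b t xi" using t by (auto elim: eventually_mono)
 note ae = this
 have "v t = fu t" by (rule ftv_inj[OF ftv_cong_AE[OF fhd(1)[OF t] jm_slice[OF u_jm] ae(1)] ftv_fu[OF t]])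
 moreover have "w t = fb t" by (rule ftv_inj[OF ftv_cong_AE[OF fhd(2)[OF t] jm_slice[OF b_jm] ae(2)] ftv_fb[OF t]])
 ultimately show ?thesis ..
qed

section \<open>Decay\<close>

context bilin
begin

text \<open>Restarting at time \<open>s\<close>: by the semigroup property the contribution of [0,s]
  cancels, leaving a Duhamel integral over the elapsed time.\<close>

lemma D_shift_norm:
 assumes u: "jm u" and b: "jm b" and s: "s >= 0" and t: "t >= 0"
 and fin: "(\<integral>\<^sup>+ta\<in>{0..s + t}. mq u b ta xi \<partial>lborel) < ic"
 shows "er (norm (D u b (s + t) xi - exp (- t * (norm xi)\<^sup>2) *R D u b s xi))
 <= (\<integral>\<^sup>+ta\<in>{0..t}. er (exp (- (t - ta) * (norm xi)\<^sup>2)) * mq u b (s + ta) xi \<partial>lborel)"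
proof -
 let ?e = "exp (- t * (norm xi)\<^sup>2)"
 let ?f = "%ta. ind {0..s + t} ta *R (exp (- (s + t - ta) * (norm xi)\<^sup>2) *R C (u ta) (b ta) xi)"
 let ?g = "%ta. ind {0..s} ta *R (exp (- (s - ta) * (norm xi)\<^sup>2) *R C (u ta) (b ta) xi)"
 let ?H = "%ta. er (exp (- (s + t - ta) * (norm xi)\<^sup>2)) * mq u b ta xi * ind {s<..s + t} ta"
 note [measurable] = mm_measurable[OF u b u b, of xi]
 have fin': "(\<integral>\<^sup>+ta\<in>{0..s}. mq u b ta xi \<partial>lborel) < ic"
 by (rule le_less_trans[OF nn_integral_mono fin]) (use t in \<open>auto simp: indicator_def\<close>)
 have f: "integrable lborel ?f" and g: "integrable lborel ?g"
 using D_integrable[OF u b fin] D_integrable[OF u b fin'] unfolding set_integrable_def .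
 have e: "?e * exp (- (s - ta) * (norm xi)\<^sup>2) = exp (- (s + t - ta) * (norm xi)\<^sup>2)" for ta
 unfolding exp_add[symmetric] by (rule arg_cong[of _ _ exp]) (simp add: algebra_simps)
 have pt: "?f ta - ?e *R ?g ta = ind {s<..s + t} ta *R (exp (- (s + t - ta) * (norm xi)\<^sup>2) *R C (u ta) (b ta) xi)" for ta
 proof (cases "ta \<in> {0..s}")
 case True
 then have "?f ta - ?e *R ?g ta = exp (- (s + t - ta) * (norm xi)\<^sup>2) *R C (u ta) (b ta) xi - (?e * exp (- (s - ta) * (norm xi)\<^sup>2)) *R C (u ta) (b ta) xi"
 using t by simp
 also have "... = 0" unfolding e by simp
 finally show ?thesis using True by (simp add: indicator_def)
 qed (use s in \<open>auto simp: indicator_def\<close>)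
 have eqn: "D u b (s + t) xi - ?e *R D u b s xi = (LINT ta|lborel. ?f ta - ?e *R ?g ta)"
 unfolding D_def set_lebesgue_integral_def using f g by (simp only: Bochner_Integration.integral_diff integrable_scaleR_right integral_scaleR_right)
 have "en (D u b (s + t) xi - ?e *R D u b s xi) <= (NN ta. en (?f ta - ?e *R ?g ta))"
 unfolding eqn using f g by (intro integral_norm_bound_ennreal Bochner_Integration.integrable_diff integrable_scaleR_right) auto
 also have "... <= (NN ta. ?H ta)"
 proof (rule nn_integral_mono)
 fix ta
 have "en (C (u ta) (b ta) xi) <= mq u b ta xi" by (rule C_norm[OF jm_slice[OF u] jm_slice[OF b]])
 then show "en (?f ta - ?e *R ?g ta) <= ?H ta"
 unfolding pt by (auto simp: indicator_def ennreal_mult' intro: mult_left_mono)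
 qed
 also have "... = (NN ta. ?H (s + 1 * ta))"
 by (subst nn_integral_real_affine[of ?H 1 s]) auto
 also have "... <= (\<integral>\<^sup>+ta\<in>{0..t}. er (exp (- (t - ta) * (norm xi)\<^sup>2)) * mq u b (s + ta) xi \<partial>lborel)"
 by (intro nn_integral_mono) (auto simp: indicator_def)
 finally show ?thesis .
qed

end

text \<open>\<open>Maj_D\<close> for a function known only through an inequality of Duhamel type, as
  produced by restarting.\<close>

lemma Maj_duhamel:
 assumes J: "initial J" and H: "!!xi. (%ta. H ta xi) \<in> BM"
 and le: "AL xi. \<forall>t\<in>J. en (z t xi) <= (\<integral>\<^sup>+ta\<in>{0..t}. er (exp (- (t - ta) * (norm xi)\<^sup>2)) * H ta xi \<partial>lborel)"
 shows "Maj J z (%xi. er (1 / norm xi) * (\<integral>\<^sup>+ta\<in>J. H ta xi \<partial>lborel))"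
 unfolding Maj_def using AE_nonzero le
proof eventually_elim
 case (elim xi)
 let ?X = "\<integral>\<^sup>+ta\<in>J. H ta xi \<partial>lborel"
 have X: "en xi * (er (1 / norm xi) * ?X) = ?X"
 using elim unfolding mult.assoc[symmetric] by (subst ennreal_mult[symmetric]) auto
 have 1: "en (z t xi) <= en xi * (er (1 / norm xi) * ?X)" if "t \<in> J" for t
 unfolding X by (rule duh_bounds(1)[where Y="%t. en (z t xi)", OF J zero_le_power2[of "norm xi"] H _ that]) (use elim in blast)
 have "er ((norm xi)\<^sup>2) * (\<integral>\<^sup>+t\<in>J. en (z t xi) \<partial>lborel) <= en xi * (er (1 / norm xi) * ?X)"
 unfolding X by (rule duh_bounds(2)[where Y="%t. en (z t xi)", OF J zero_le_power2[of "norm xi"] H]) (use elim in blast)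
 then have 2: "en xi * (\<integral>\<^sup>+t\<in>J. en (z t xi) \<partial>lborel) <= er (1 / norm xi) * ?X"
 by (rule divide_norm_le[rotated]) (use elim in auto)
 show ?case using 1 2 by blast
qed

lemma ennreal_absorb:
 fixes x a :: ennreal
 assumes "x <= a + er (1/2) * x" "x < ic"
 shows "x <= 2 * a"
proof (cases "a = top")
 case False
 then obtain r where r: "a = ennreal r" "r >= 0" by (cases a) auto
 obtain y where y: "x = ennreal y" "y >= 0" using assms(2) by (cases x) auto
 have E: "er (r + 1/2 * y) = ennreal r + er (1/2) * ennreal y"
 by (subst ennreal_plus[OF r(2)], simp add: y(2), subst ennreal_mult', simp, rule refl)
 have "ennreal y <= er (r + 1/2 * y)" using assms(1) unfolding E r(1) y(1) .
 then have "y <= 2 * r" using r y by (subst (asm) ennreal_le_iff) auto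
 then show ?thesis using r y by (simp add: numeral_mult_ennreal ennreal_leI)
qed (simp add: ennreal_mult_eq_top_iff)

text \<open>With X proportional to 1/t, the quantity t^\<gamma> f(t) is at most half its value at
  t/2 plus a constant. Iteration leaves twice the constant, since the scaled value at t/2^n stays at
  most t^\<gamma> F0. Times up to 1 use the bound \<open>F0\<close>, later ones 1 + t <= 2t.\<close>

lemma decay_real:
 fixes f :: "real => real"
 assumes step: "!!t X. t > 0 ==> X > 0 ==> f t <= 8 / (t * X) * f (t / 2) + K * X powr \<gamma>"
 and f: "!!t. t > 0 ==> f t <= F0" "!!t. t > 0 ==> 0 <= f t" and \<gamma>: "\<gamma> > 0" and K: "K >= 0" and t: "t > 0"
 shows "f t <= 2 powr \<gamma> * (F0 + 2 * (K * (2 powr (\<gamma> + 4)) powr \<gamma>)) * (1 + t) powr (- \<gamma>)"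
proof -
 define c where "c = K * (2 powr (\<gamma> + 4)) powr \<gamma>"
 have c: "c >= 0" unfolding c_def using K by simp
 have F0: "F0 >= 0" using f[of 1] by simp
 have h: "t powr \<gamma> * f t <= 1/2 * ((t/2) powr \<gamma> * f (t/2)) + c" if t: "t > 0" for t
 proof -
 \<comment> \<open>The choice X = 2^(\<gamma>+4)/t makes the coefficient 8/(tX) equal to
   2^(-\<gamma>)/2; the 2^(-\<gamma>) turns t^\<gamma> into (t/2)^\<gamma>.\<close>
 have "f t <= 8 / (t * (2 powr (\<gamma> + 4) / t)) * f (t / 2) + K * (2 powr (\<gamma> + 4) / t) powr \<gamma>"
 using t by (intro step) auto
 also have "8 / (t * (2 powr (\<gamma> + 4) / t)) = 1/2 * 2 powr (- \<gamma>)" using t by (simp add: powr_add powr_minus_divide)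
 also have "K * (2 powr (\<gamma> + 4) / t) powr \<gamma> = c / t powr \<gamma>" using t by (simp add: c_def powr_divide)
 finally have "t powr \<gamma> * f t <= t powr \<gamma> * (1/2 * 2 powr (- \<gamma>) * f (t / 2) + c / t powr \<gamma>)" by (rule mult_left_mono) simp
 also have "... = 1/2 * ((t/2) powr \<gamma> * f (t/2)) + c"
 using t by (simp add: powr_divide powr_minus_divide distrib_left)
 finally show ?thesis .
 qed
 let ?\<Phi> = "%t. t powr \<gamma> * f t"
 have it: "?\<Phi> t <= (1/2) ^ n * ?\<Phi> (t / 2 ^ n) + 2 * c * (1 - (1/2) ^ n)" for n
 proof (induction n)
 case (Suc n)
 have "(1/2) ^ n * ?\<Phi> (t / 2 ^ n) <= (1/2) ^ n * (1/2 * ?\<Phi> (t / 2 ^ n / 2) + c)"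
 using t by (intro mult_left_mono h) auto
 also have "... = (1/2) ^ Suc n * ?\<Phi> (t / 2 ^ Suc n) + (1/2) ^ n * c" by (simp add: distrib_left mult.commute)
 finally show ?case using Suc by (simp add: algebra_simps)
 qed simp
 have it': "?\<Phi> t <= (1/2) ^ n * (t powr \<gamma> * F0) + 2 * c" for n
 proof -
 have "?\<Phi> (t / 2 ^ n) <= t powr \<gamma> * F0"
 using t \<gamma> by (intro mult_mono powr_mono2 f) (auto simp: divide_le_eq_1 field_simps intro: order_trans[of _ "t * 1"] mult_left_mono)
 then have "(1/2) ^ n * ?\<Phi> (t / 2 ^ n) <= (1/2) ^ n * (t powr \<gamma> * F0)" by (intro mult_left_mono) auto
 moreover have "2 * c * (1 - (1/2) ^ n) <= 2 * c * 1" using c by (intro mult_left_mono) auto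
 ultimately show ?thesis using it[of n] by linarith
 qed
 have "(%n. (1/2) ^ n * (t powr \<gamma> * F0) + 2 * c) -+> 0 * (t powr \<gamma> * F0) + 2 * c"
 by (intro tendsto_intros LIMSEQ_realpow_zero) auto
 then have P: "?\<Phi> t <= 2 * c" using LIMSEQ_le_const[OF _ exI[of _ 0]] it' by fastforce
 have two: "(2 * x) powr (- \<gamma>) * 2 powr \<gamma> = x powr (- \<gamma>)" if "x > 0" for x
 using that by (simp add: powr_mult powr_minus)
 show ?thesis
 proof (cases "t <= 1")
 case True
 then have "2 powr (- \<gamma>) <= (1 + t) powr (- \<gamma>)" using t \<gamma> by (intro powr_mono2') auto
 then have "F0 * (2 powr (- \<gamma>) * 2 powr \<gamma>) <= (F0 + 2 * c) * ((1 + t) powr (- \<gamma>) * 2 powr \<gamma>)"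
 using F0 c by (intro mult_mono mult_right_mono) auto
 then show ?thesis using f(1)[OF t] unfolding c_def[symmetric] by (simp add: powr_minus mult_ac)
 next
 case False
 then have "(2 * t) powr (- \<gamma>) <= (1 + t) powr (- \<gamma>)" using t \<gamma> by (intro powr_mono2') auto
 then have "2 * c * ((2 * t) powr (- \<gamma>) * 2 powr \<gamma>) <= (F0 + 2 * c) * ((1 + t) powr (- \<gamma>) * 2 powr \<gamma>)"
 using F0 c by (intro mult_mono mult_right_mono) auto
 moreover have "f t <= 2 * c * t powr (- \<gamma>)" using P t by (simp add: powr_minus field_simps)
 ultimately show ?thesis unfolding two[OF t] c_def[symmetric] by (simp add: mult_ac)
 qed
qed

definition lowint :: "real => real => ennreal" where
 "lowint R e = (\<integral>\<^sup>+xi. er (norm xi powr e) * ind {xi. norm xi <= R} xi \<partial>(lborel :: (real^3) measure))"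

lemma lowint_scale:
 assumes R: "R > 0"
 shows "(\<integral>\<^sup>+xi. er (norm xi powr e) * ind {xi. a * R < norm xi & norm xi <= R} xi \<partial>(lborel :: (real^3) measure))
 = er (R powr (e + 3)) * (\<integral>\<^sup>+xi. er (norm xi powr e) * ind {xi. a < norm xi & norm xi <= 1} xi \<partial>(lborel :: (real^3) measure))"
proof -
 have "(\<integral>\<^sup>+xi. er (norm xi powr e) * ind {xi. a * R < norm xi & norm xi <= R} xi \<partial>(lborel :: (real^3) measure))
 = er (\<bar>R\<bar> ^ DIM(real^3)) * (\<integral>\<^sup>+xi. er (norm (0 + R *R xi) powr e) * ind {xi. a * R < norm xi & norm xi <= R} (0 + R *R xi) \<partial>(lborel :: (real^3) measure))"
 using R by (intro nn_integral_affine) auto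
 also have "(\<integral>\<^sup>+xi. er (norm (0 + R *R xi) powr e) * ind {xi. a * R < norm xi & norm xi <= R} (0 + R *R xi) \<partial>(lborel :: (real^3) measure))
 = (\<integral>\<^sup>+xi. er (R powr e) * (er (norm xi powr e) * ind {xi. a < norm xi & norm xi <= 1} xi) \<partial>(lborel :: (real^3) measure))"
 using R by (intro nn_integral_cong) (auto simp: indicator_def powr_mult ennreal_mult mult.commute[of a])
 also have "... = er (R powr e) * (\<integral>\<^sup>+xi. er (norm xi powr e) * ind {xi. a < norm xi & norm xi <= 1} xi \<partial>(lborel :: (real^3) measure))"
 by (rule nn_integral_cmult) measurable
 also have "er (\<bar>R\<bar> ^ DIM(real^3)) * (er (R powr e) * X) = er (R powr (e + 3)) * X" for X
 using R unfolding mult.assoc[symmetric] by (subst ennreal_mult[symmetric]) (auto simp: powr_add mult.commute)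
 finally show ?thesis .
qed

text \<open>Scaling by 1/2 maps the region outside radius 2^(-n) to the one between 2^(-n-1) and 1/2
  and contributes 2^(-e-3) <= 1/2. The integrals over |xi| > 2^(-n) thus stay below twice the first
  shell, and increase to the full integral.\<close>

lemma lowint_finite:
 assumes e: "e >= - 2"
 shows "lowint 1 e < ic"
proof -
 define I where "I a = (\<integral>\<^sup>+xi. er (norm xi powr e) * ind {xi. a < norm xi & norm xi <= 1} xi \<partial>(lborel :: (real^3) measure))" for a
 have S: "I (1/2) < ic"
 proof -
 have "norm xi powr e <= 2 powr \<bar>e\<bar>" if "1/2 < norm xi" "norm xi <= 1" for xi :: "real^3"
 proof (cases "e >= 0")
 case True
 then have "norm xi powr e <= 1 powr e" using that by (intro powr_mono2) auto
 also have "... <= 2 powr \<bar>e\<bar>" by (simp add: ge_one_powr_ge_zero)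
 finally show ?thesis .
 next
 case False
 then have "norm xi powr e <= (1/2) powr e" using that by (intro powr_mono2') auto
 then show ?thesis using False by (simp add: powr_divide powr_minus_divide)
 qed
 then have "I (1/2) <= (\<integral>\<^sup>+xi. er (2 powr \<bar>e\<bar>) * ind (cball 0 1) xi \<partial>(lborel :: (real^3) measure))"
 unfolding I_def by (intro nn_integral_mono) (auto simp: indicator_def intro!: ennreal_leI)
 also have "... = er (2 powr \<bar>e\<bar>) * emeasure lborel (cball 0 1 :: (real^3) set)" by (rule nn_integral_cmult_indicator) simp
 also have "... < ic" using emeasure_bounded_finite[of "cball 0 1 :: (real^3) set"] by (simp add: ennreal_mult_less_top)
 finally show ?thesis .
 qed
 have In: "I ((1/2) ^ n) <= 2 * I (1/2)" for n
 proof (induction n)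
 case 0
 have "I 1 = 0" unfolding I_def by (intro nn_integral_zero') (auto simp: indicator_def)
 then show ?case by simp
 next
 case (Suc n)
 have "I ((1/2) ^ Suc n) <= (\<integral>\<^sup>+xi. er (norm xi powr e) * ind {xi. 1/2 < norm xi & norm xi <= 1} xi
 + er (norm xi powr e) * ind {xi. (1/2) ^ n * (1/2) < norm xi & norm xi <= 1/2} xi \<partial>(lborel :: (real^3) measure))"
 unfolding I_def by (intro nn_integral_mono) (auto simp: indicator_def)
 also have "... = I (1/2) + (\<integral>\<^sup>+xi. er (norm xi powr e) * ind {xi. (1/2) ^ n * (1/2) < norm xi & norm xi <= 1/2} xi \<partial>(lborel :: (real^3) measure))"
 unfolding I_def by (rule nn_integral_add) measurable
 also have "... = I (1/2) + er ((1/2) powr (e + 3)) * I ((1/2) ^ n)"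
 unfolding I_def by (subst lowint_scale) auto
 also have "... <= I (1/2) + er (1/2) * (2 * I (1/2))"
 proof (intro add_left_mono mult_mono Suc ennreal_leI)
 have "(1/2::real) powr (e + 3) <= (1/2) powr 1" using e by (intro powr_mono') auto
 then show "(1/2::real) powr (e + 3) <= 1/2" by simp
 qed auto
 also have "... = 2 * I (1/2)"
 proof -
 have "er (1/2) * 2 = 1" unfolding mult.commute[of _ 2] numeral_mult_ennreal by simp
 note h = this
 show ?thesis by (simp only: mult.assoc[symmetric] h mult_1_left) (simp only: mult_2)
 qed
 finally show ?case .
 qed
 have "lowint 1 e = (\<integral>\<^sup>+xi. (SUP n. er (norm xi powr e) * ind {xi. (1/2) ^ n < norm xi & norm xi <= 1} xi) \<partial>(lborel :: (real^3) measure))"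
 unfolding lowint_def
 proof (rule nn_integral_cong_AE)
 show "AE xi in (lborel :: (real^3) measure). er (norm xi powr e) * ind {xi. norm xi <= 1} xi = (SUP n. er (norm xi powr e) * ind {xi. (1/2) ^ n < norm xi & norm xi <= 1} xi)"
 using AE_nonzero
 proof eventually_elim
 case (elim xi)
 obtain n where n: "(1/2) ^ n < norm xi" using real_arch_pow_inv[of "norm xi" "1/2"] elim by auto
 show ?case
 proof (rule antisym)
 show "er (norm xi powr e) * ind {xi. norm xi <= 1} xi <= (SUP n. er (norm xi powr e) * ind {xi. (1/2) ^ n < norm xi & norm xi <= 1} xi)"
 by (rule SUP_upper2[of n]) (use n in \<open>auto simp: indicator_def\<close>)
 qed (auto intro!: SUP_least simp: indicator_def)
 qed
 qed
 also have "... = (SUP n. I ((1/2) ^ n))"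
 unfolding I_def
 proof (rule nn_integral_monotone_convergence_SUP)
 show "incseq (%n xi. er (norm xi powr e) * ind {xi. (1/2) ^ n < norm xi & norm xi <= 1} (xi :: real^3))"
 proof (intro incseq_SucI le_funI mult_left_mono)
 fix n and xi :: "real^3"
 have "(1/2::real) ^ Suc n <= (1/2) ^ n" by (rule power_decreasing) auto
 then have "(1/2) ^ Suc n < norm xi" if "(1/2) ^ n < norm xi" using that by (rule le_less_trans)
 then show "ind {xi. (1/2) ^ n < norm xi & norm xi <= 1} xi <= (ind {xi. (1/2) ^ Suc n < norm xi & norm xi <= 1} xi :: ennreal)"
 by (auto simp: indicator_def simp del: power_Suc)
 qed simp
 qed measurable
 also have "... <= 2 * I (1/2)" by (intro SUP_least In)
 also have "... < ic" using S by (simp add: ennreal_mult_less_top)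
 finally show ?thesis .
qed

lemma lowint_R: "R > 0 ==> lowint R e = er (R powr (e + 3)) * lowint 1 e"
proof -
 assume R: "R > 0"
 \<comment> \<open>The inner radius -1 turns the shell of \<open>lowint_scale\<close> into a full
   ball.\<close>
 have "- 1 * R < norm xi" "- 1 < norm xi" for xi :: "real^3"
 by (rule less_le_trans[OF _ norm_ge_zero], use R in simp)+
 then have "{xi::real^3. - 1 * R < norm xi & norm xi <= R} = {xi. norm xi <= R}" "{xi::real^3. - 1 < norm xi & norm xi <= 1} = {xi. norm xi <= 1}"
 by blast+
 then show ?thesis using lowint_scale[OF R, of e "- 1"] unfolding lowint_def by (simp only:)
qed

text \<open>The exponent k + 2 - \<sigma> is k - 1 - \<sigma> plus the dimension 3, from integrating
  the pseudo-measure bound over the ball of radius \<open>R\<close>. Above \<open>R\<close> two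
  derivatives are exchanged for R^(-2).\<close>

lemma low_high:
 assumes [measurable]: "f \<in> BM" and R: "R > 0" and A: "AL xi. er (norm xi powr \<sigma>) * f xi <= A"
 shows "wN (k - 1) f <= er (1 / R\<^sup>2) * wN (k + 1) f + A * lowint 1 (k - 1 - \<sigma>) * er (R powr (k + 2 - \<sigma>))"
proof -
 have "wN (k - 1) f <= (NN xi. er (1 / R\<^sup>2) * (er (norm xi powr (k + 1)) * f xi) + A * (er (norm xi powr (k - 1 - \<sigma>)) * ind {xi. norm xi <= R} xi))"
 unfolding wN_def
 proof (rule nn_integral_mono_AE)
 show "AL xi. er (norm xi powr (k - 1)) * f xi <= er (1 / R\<^sup>2) * (er (norm xi powr (k + 1)) * f xi) + A * (er (norm xi powr (k - 1 - \<sigma>)) * ind {xi. norm xi <= R} xi)"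
 using A AE_nonzero
 proof eventually_elim
 case (elim xi)
 show ?case
 proof (cases "norm xi <= R")
 case True
 have "er (norm xi powr (k - 1)) * f xi = er (norm xi powr (k - 1 - \<sigma>)) * (er (norm xi powr \<sigma>) * f xi)"
 unfolding mult.assoc[symmetric] by (subst ennreal_mult[symmetric]) (auto simp: powr_add[symmetric])
 also have "... <= er (norm xi powr (k - 1 - \<sigma>)) * A" using elim by (intro mult_left_mono) auto
 finally show ?thesis using True by (simp add: mult.commute add_increasing)
 next
 case False
 have "norm xi powr (k + 1) = norm xi powr (k - 1) * (norm xi)\<^sup>2"
 using elim powr_add[of "norm xi" "k - 1" 2] by (simp add: powr_numeral add.commute)
 moreover have "1 <= 1 / R\<^sup>2 * (norm xi)\<^sup>2" using False R by (simp add: power_mono)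
 ultimately have "norm xi powr (k - 1) <= 1 / R\<^sup>2 * norm xi powr (k + 1)"
 using mult_left_mono[of 1 "1 / R\<^sup>2 * (norm xi)\<^sup>2" "norm xi powr (k - 1)"] by (simp add: mult_ac)
 then have "er (norm xi powr (k - 1)) <= er (1 / R\<^sup>2) * er (norm xi powr (k + 1))"
 by (subst ennreal_mult[symmetric]) (auto intro: ennreal_leI)
 then show ?thesis using False unfolding mult.assoc[symmetric] by (simp add: mult_right_mono)
 qed
 qed
 qed
 also have "... = er (1 / R\<^sup>2) * wN (k + 1) f + A * lowint R (k - 1 - \<sigma>)"
 unfolding wN_def lowint_def by (simp add: nn_integral_add nn_integral_cmult)
 also have "lowint R (k - 1 - \<sigma>) = er (R powr (k + 2 - \<sigma>)) * lowint 1 (k - 1 - \<sigma>)"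
 using lowint_R[OF R, of "k - 1 - \<sigma>"] by (simp add: algebra_simps)
 finally show ?thesis by (simp add: mult_ac)
qed

lemma wN_nf: "(NN xi. er (norm xi powr e * norm (f xi))) = wN e (nf f)"
 by (simp add: wN_def nf_def ennreal_mult')

lemma wN_iv_nf: "wN s (iv f) = wN (s - 1) (nf f)"
proof -
 have "iv f = (%xi. er (1 / norm xi) * nf f xi)"
 by (rule ext) (simp add: iv_def nf_def ennreal_mult'[symmetric])
 then show ?thesis by (simp only: wN_inv)
qed

lemma jm_shift: "jm u ==> jm (%ta. u (s + ta))" for s :: real
proof -
 assume u: "jm u"
 note [measurable (raw)] = jm_compose[OF u]
 show ?thesis by (rule jmI) measurable
qed

lemma hall_algebra:
 fixes c E x y :: ennreal
 shows "c * (x * E + E * x) + c * (y * E + E * y) + (c * (x * E + E * y) + 2 * c * (y * E + E * y)) <= 8 * (c * E) * (x + y)"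
proof -
 have "8 * (c * E) * (x + y) = c * (x * E + E * x) + c * (y * E + E * y) + (c * (x * E + E * y) + 2 * c * (y * E + E * y)) + (4 * (c * E * x) + c * E * x + c * E * y)"
 by (simp only: ennreal_ring)
 then show ?thesis by simp
qed

section \<open>Energy inequality and decay of the Picard limit\<close>

context picard
begin

definition FF where "FF k t = wN (k - 1) (nf (u t)) + wN (k - 1) (nf (b t))"

definition GG where "GG k t = wN (k + 1) (nf (u t)) + wN (k + 1) (nf (b t))"

lemma low_norms:
 assumes "t >= 0"
 shows "wN (- 1) (nf (u t)) <= er (6 * \<epsilon>)" "wN (- 1) (nf (b t)) <= er (6 * \<epsilon>)" "wN 0 (nf (b t)) <= er (6 * \<epsilon>)"
proof -
 have t: "t \<in> {0..}" using assms by simp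
 show "wN (- 1) (nf (u t)) <= er (6 * \<epsilon>)"
 using order_trans[OF Maj_sup_wN[OF u_Maj t, of 0] order_trans[OF wN_le_nrm(1) nrm_PQ]] by (simp only: wN_nf) simp
 show "wN (- 1) (nf (b t)) <= er (6 * \<epsilon>)"
 using order_trans[OF Maj_sup_wN[OF b_Maj t, of 0] order_trans[OF wN_le_nrm(2) nrm_PQ]] by (simp only: wN_nf) simp
 show "wN 0 (nf (b t)) <= er (6 * \<epsilon>)"
 using order_trans[OF Maj_sup_wN[OF b_Maj t, of 1] order_trans[OF wN_le_nrm(3) nrm_PQ]] by (simp only: wN_nf) simp
qed

text \<open>At each time one factor is of low order and at most 6 \<epsilon>, so the nonlinearity is
  at most 8 * 2^k * 6 \<epsilon> = 48 * 2^k * \<epsilon> times \<open>GG\<close>. The condition with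
  96 makes this factor at most 1/2.\<close>

lemma nonlinear_bound:
 assumes k: "k >= 0" "96 * 2 powr k * \<epsilon> <= 1" and t: "t >= 0"
 shows "wN (k - 1) (U.mq u b t) + wN (k - 1) (B.mq u b t) <= er (1/2) * GG k t"
proof -
 note [measurable] = jm_slice[OF u_jm, of t] jm_slice[OF b_jm, of t]
 let ?c = "er (2 powr k)" and ?E = "er (6 * \<epsilon>)" and ?x = "wN (k + 1) (nf (u t))" and ?y = "wN (k + 1) (nf (b t))"
 note low = low_norms[OF t]
 have uu: "wN k (cc (nf (u t)) (nf (u t))) <= ?c * (?x * ?E + ?E * ?x)"
 by (rule order_trans[OF wN_cc_low[OF k(1)]]; (measurable; fail | intro mult_left_mono add_mono mult_right_mono low; simp))
 have bb: "wN k (cc (nf (b t)) (nf (b t))) <= ?c * (?y * ?E + ?E * ?y)"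
 by (rule order_trans[OF wN_cc_low[OF k(1)]]; (measurable; fail | intro mult_left_mono add_mono mult_right_mono low; simp))
 have ub: "wN k (cc (nf (u t)) (nf (b t))) <= ?c * (?x * ?E + ?E * ?y)"
 by (rule order_trans[OF wN_cc_low[OF k(1)]]; (measurable; fail | intro mult_left_mono add_mono mult_right_mono low; simp))
 have k1: "k + 1 >= 0" using k by simp
 have c2: "er (2 powr (k + 1)) = 2 * ?c" by (simp add: powr_add numeral_mult_ennreal mult.commute)
 have bb': "wN (k + 1) (cc (nf (b t)) (nf (b t))) <= 2 * ?c * (?y * ?E + ?E * ?y)"
 unfolding c2[symmetric]
 by (rule order_trans[OF wN_cc[OF k1]]; (measurable; fail | intro mult_left_mono add_mono mult_right_mono low; simp))
 have "wN (k - 1) (U.mq u b t) + wN (k - 1) (B.mq u b t)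
 = wN k (cc (nf (u t)) (nf (u t))) + wN k (cc (nf (b t)) (nf (b t))) + (wN k (cc (nf (u t)) (nf (b t))) + wN (k + 1) (cc (nf (b t)) (nf (b t))))"
 using wN_mm(1)[of "u t" "b t" "k - 1"] wN_mm(2)[of "u t" "b t" "k - 1"] by simp
 also have "... <= ?c * (?x * ?E + ?E * ?x) + ?c * (?y * ?E + ?E * ?y) + (?c * (?x * ?E + ?E * ?y) + 2 * ?c * (?y * ?E + ?E * ?y))"
 by (intro add_mono uu bb ub bb')
 also have "... <= 8 * (?c * ?E) * (?x + ?y)" by (rule hall_algebra)
 also have "8 * (?c * ?E) = er (8 * (2 powr k * (6 * \<epsilon>)))"
 using \<epsilon>0 by (subst numeral_mult_ennreal[symmetric], subst ennreal_mult) auto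
 also have "... * (?x + ?y) <= er (1/2) * (?x + ?y)" using k by (intro mult_right_mono ennreal_leI) (auto simp: mult_ac)
 finally show ?thesis unfolding GG_def .
qed

lemma mm_finite_AE:
 "AL xi. (\<integral>\<^sup>+ta\<in>{0..}. U.mq u b ta xi \<partial>lborel) < ic"
 "AL xi. (\<integral>\<^sup>+ta\<in>{0..}. B.mq u b ta xi \<partial>lborel) < ic"
proof -
 have J: "{0::real..} \<in> sets borel" by simp
 have "(\<integral>\<^sup>+ta\<in>{0..}. U.mq u b ta xi \<partial>lborel) < ic" if "FU P Q P Q xi < ic" for xi
 by (rule le_less_trans[OF U.int_mm[OF u_jm b_jm u_jm b_jm J P_measurable Q_measurable P_measurable Q_measurable u_Maj b_Maj u_Maj b_Maj]])
 (use that in \<open>simp add: ennreal_mult_less_top\<close>)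
 then show "AL xi. (\<integral>\<^sup>+ta\<in>{0..}. U.mq u b ta xi \<partial>lborel) < ic"
 by (rule eventually_mono[OF F_finite_AE(1)[OF P_measurable Q_measurable P_measurable Q_measurable fin_pq(2) fin_pq(2)]])
 have "(\<integral>\<^sup>+ta\<in>{0..}. B.mq u b ta xi \<partial>lborel) < ic" if "FB P Q P Q xi < ic" for xi
 by (rule le_less_trans[OF B.int_mm[OF u_jm b_jm u_jm b_jm J P_measurable Q_measurable P_measurable Q_measurable u_Maj b_Maj u_Maj b_Maj]])
 (use that in \<open>simp add: ennreal_mult_less_top\<close>)
 then show "AL xi. (\<integral>\<^sup>+ta\<in>{0..}. B.mq u b ta xi \<partial>lborel) < ic"
 by (rule eventually_mono[OF F_finite_AE(2)[OF P_measurable Q_measurable P_measurable Q_measurable fin_pq(2) fin_pq(2)]])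
qed

text \<open>Majorants whose linear part is built from the value at time \<open>s\<close> instead of
  the initial data, so that norms after \<open>s\<close> are compared with norms at
  \<open>s\<close>.\<close>

lemma shift_Maj:
 fixes s :: real
 assumes s: "s >= 0"
 shows "Maj {0..T} (%t. u (s + t)) (%xi. iv (u s) xi + er (1 / norm xi) * (\<integral>\<^sup>+ta\<in>{0..T}. U.mq u b (s + ta) xi \<partial>lborel))"
 and "Maj {0..T} (%t. b (s + t)) (%xi. iv (b s) xi + er (1 / norm xi) * (\<integral>\<^sup>+ta\<in>{0..T}. B.mq u b (s + ta) xi \<partial>lborel))"
proof -
 have hh: "heatF a (s + t) xi = exp (- t * (norm xi)\<^sup>2) *R heatF a s xi" for a t xi
 unfolding heatF_def by (simp add: exp_add[symmetric] algebra_simps)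
 have sub: "(\<integral>\<^sup>+ta\<in>{0..s + t}. f ta \<partial>lborel) < ic" if "(\<integral>\<^sup>+ta\<in>{0..}. f ta \<partial>lborel) < ic" for f :: "real => ennreal" and t
 by (rule le_less_trans[OF nn_integral_mono that]) (auto simp: indicator_def)
 have 1: "Maj {0..T} (%t xi. u (s + t) xi - heatF (u s) t xi) (%xi. er (1 / norm xi) * (\<integral>\<^sup>+ta\<in>{0..T}. U.mq u b (s + ta) xi \<partial>lborel))"
 proof (rule Maj_duhamel[OF initial_Icc U.mm_measurable[OF jm_shift[OF u_jm] jm_shift[OF b_jm] jm_shift[OF u_jm] jm_shift[OF b_jm]]])
 show "AL xi. \<forall>t\<in>{0..T}. en (u (s + t) xi - heatF (u s) t xi)
 <= (\<integral>\<^sup>+ta\<in>{0..t}. er (exp (- (t - ta) * (norm xi)\<^sup>2)) * U.mq u b (s + ta) xi \<partial>lborel)"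
 using u_b_solution mm_finite_AE(1) unfolding solF_def
 proof eventually_elim
 case (elim xi)
 show ?case
 proof
 fix t assume t: "t \<in> {0..T}"
 have us: "u s xi = heatF a0 s xi + U.D u b s xi" and ut: "u (s + t) xi = heatF a0 (s + t) xi + U.D u b (s + t) xi"
 using elim(1) s t by auto
 have "u (s + t) xi - heatF (u s) t xi = U.D u b (s + t) xi - exp (- t * (norm xi)\<^sup>2) *R U.D u b s xi"
 unfolding heatF_def[of "u s"] us ut hh by (simp add: scaleR_add_right)
 then show "en (u (s + t) xi - heatF (u s) t xi)
 <= (\<integral>\<^sup>+ta\<in>{0..t}. er (exp (- (t - ta) * (norm xi)\<^sup>2)) * U.mq u b (s + ta) xi \<partial>lborel)"
 using U.D_shift_norm[OF u_jm b_jm s _ sub[OF elim(2)], of t] t by simp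
 qed
 qed
 qed
 have "Maj {0..T} (%t xi. heatF (u s) t xi + (u (s + t) xi - heatF (u s) t xi)) (%xi. iv (u s) xi + er (1 / norm xi) * (\<integral>\<^sup>+ta\<in>{0..T}. U.mq u b (s + ta) xi \<partial>lborel))"
 by (intro Maj_add 1 heatF_Maj initial_Icc heatF_jm jm_slice[OF u_jm] jm_diff jm_shift[OF u_jm]) simp
 then show "Maj {0..T} (%t. u (s + t)) (%xi. iv (u s) xi + er (1 / norm xi) * (\<integral>\<^sup>+ta\<in>{0..T}. U.mq u b (s + ta) xi \<partial>lborel))" by simp
 have 2: "Maj {0..T} (%t xi. b (s + t) xi - heatF (b s) t xi) (%xi. er (1 / norm xi) * (\<integral>\<^sup>+ta\<in>{0..T}. B.mq u b (s + ta) xi \<partial>lborel))"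
 proof (rule Maj_duhamel[OF initial_Icc B.mm_measurable[OF jm_shift[OF u_jm] jm_shift[OF b_jm] jm_shift[OF u_jm] jm_shift[OF b_jm]]])
 show "AL xi. \<forall>t\<in>{0..T}. en (b (s + t) xi - heatF (b s) t xi)
 <= (\<integral>\<^sup>+ta\<in>{0..t}. er (exp (- (t - ta) * (norm xi)\<^sup>2)) * B.mq u b (s + ta) xi \<partial>lborel)"
 using u_b_solution mm_finite_AE(2) unfolding solF_def
 proof eventually_elim
 case (elim xi)
 show ?case
 proof
 fix t assume t: "t \<in> {0..T}"
 have us: "b s xi = heatF b0 s xi + B.D u b s xi" and ut: "b (s + t) xi = heatF b0 (s + t) xi + B.D u b (s + t) xi"
 using elim(1) s t by auto
 have "b (s + t) xi - heatF (b s) t xi = B.D u b (s + t) xi - exp (- t * (norm xi)\<^sup>2) *R B.D u b s xi"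
 unfolding heatF_def[of "b s"] us ut hh by (simp add: scaleR_add_right)
 then show "en (b (s + t) xi - heatF (b s) t xi)
 <= (\<integral>\<^sup>+ta\<in>{0..t}. er (exp (- (t - ta) * (norm xi)\<^sup>2)) * B.mq u b (s + ta) xi \<partial>lborel)"
 using B.D_shift_norm[OF u_jm b_jm s _ sub[OF elim(2)], of t] t by simp
 qed
 qed
 qed
 have "Maj {0..T} (%t xi. heatF (b s) t xi + (b (s + t) xi - heatF (b s) t xi)) (%xi. iv (b s) xi + er (1 / norm xi) * (\<integral>\<^sup>+ta\<in>{0..T}. B.mq u b (s + ta) xi \<partial>lborel))"
 by (intro Maj_add 2 heatF_Maj initial_Icc heatF_jm jm_slice[OF b_jm] jm_diff jm_shift[OF b_jm]) simp
 then show "Maj {0..T} (%t. b (s + t)) (%xi. iv (b s) xi + er (1 / norm xi) * (\<integral>\<^sup>+ta\<in>{0..T}. B.mq u b (s + ta) xi \<partial>lborel))" by simp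
qed

lemma GG_measurable: "GG k \<in> BM"
 unfolding GG_def[abs_def] by (intro borel_measurable_add wN_time_measurable jm_nf u_jm b_jm)

text \<open>The finiteness that allows half of this integral to be absorbed in
  \<open>energy\<close>.\<close>

lemma GG_integral:
 fixes s :: real
 assumes "s >= 0"
 shows "(\<integral>\<^sup>+ta\<in>{0..T}. GG k (s + ta) \<partial>lborel) <= wN k P + wN k Q"
proof -
 have [measurable]: "GG k \<in> BM" by (rule GG_measurable)
 have m: "(%ta. wN (k + 1) (nf (u ta)) * ind {0..} ta) \<in> borel_measurable lborel" "(%ta. wN (k + 1) (nf (b ta)) * ind {0..} ta) \<in> borel_measurable lborel"
 using wN_time_measurable[OF jm_nf[OF u_jm]] wN_time_measurable[OF jm_nf[OF b_jm]] by auto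
 have "(\<integral>\<^sup>+ta\<in>{0..T}. GG k (s + ta) \<partial>lborel) <= (NN ta. GG k (s + 1 * ta) * ind {0..} (s + 1 * ta))"
 using assms by (intro nn_integral_mono) (auto simp: indicator_def)
 also have "... = (\<integral>\<^sup>+ta\<in>{0..}. GG k ta \<partial>lborel)"
 by (subst nn_integral_real_affine[of "%ta. GG k ta * ind {0..} ta" 1 s]) auto
 also have "... = (\<integral>\<^sup>+ta\<in>{0..}. wN (k + 1) (nf (u ta)) \<partial>lborel) + (\<integral>\<^sup>+ta\<in>{0..}. wN (k + 1) (nf (b ta)) \<partial>lborel)"
 unfolding GG_def distrib_right by (rule nn_integral_add[OF m])
 also have "... <= wN k P + wN k Q"
 using Maj_int_wN[OF u_jm _ u_Maj, of k] Maj_int_wN[OF b_jm _ b_Maj, of k] unfolding wN_nf by (intro add_mono) auto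
 finally show ?thesis .
qed

text \<open>The order-k norm of the restarted majorants bounds both \<open>FF k (s + T)\<close> and
  the integral of \<open>GG\<close>, and is itself at most \<open>FF k s\<close> plus half that
  integral. Absorbing the half gives the second bound, and inserting this the first.\<close>

lemma energy:
 fixes s :: real
 assumes k: "k >= 0" "96 * 2 powr k * \<epsilon> <= 1" and hk: "wN k P < ic" "wN k Q < ic" and s: "s >= 0" and T: "T >= 0"
 shows "FF k (s + T) <= 2 * FF k s" "(\<integral>\<^sup>+ta\<in>{0..T}. GG k (s + ta) \<partial>lborel) <= 2 * FF k s"
proof -
 let ?U = "%ta. U.mq u b (s + ta)" and ?B = "%ta. B.mq u b (s + ta)"
 define p' where "p' = (%xi. iv (u s) xi + er (1 / norm xi) * (\<integral>\<^sup>+ta\<in>{0..T}. ?U ta xi \<partial>lborel))"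
 define q' where "q' = (%xi. iv (b s) xi + er (1 / norm xi) * (\<integral>\<^sup>+ta\<in>{0..T}. ?B ta xi \<partial>lborel))"
 have J: "{0..T} \<in> sets borel" by simp
 have jU: "jm ?U" and jB: "jm ?B" using U.mm_jm[OF jm_shift[OF u_jm] jm_shift[OF b_jm]] B.mm_jm[OF jm_shift[OF u_jm] jm_shift[OF b_jm]] .
 note [measurable] = jm_slice[OF u_jm] jm_slice[OF b_jm]
 have xm[measurable]: "(%xi. \<integral>\<^sup>+ta\<in>{0..T}. ?U ta xi \<partial>lborel) \<in> BM" "(%xi. \<integral>\<^sup>+ta\<in>{0..T}. ?B ta xi \<partial>lborel) \<in> BM"
 proof -
 note [measurable (raw)] = jm_compose[OF jU] jm_compose[OF jB]
 show "(%xi. \<integral>\<^sup>+ta\<in>{0..T}. ?U ta xi \<partial>lborel) \<in> BM" "(%xi. \<integral>\<^sup>+ta\<in>{0..T}. ?B ta xi \<partial>lborel) \<in> BM"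
 by measurable
 qed
 let ?G = "\<integral>\<^sup>+ta\<in>{0..T}. GG k (s + ta) \<partial>lborel"
 have pk: "wN k p' = wN (k - 1) (nf (u s)) + (\<integral>\<^sup>+ta\<in>{0..T}. wN (k - 1) (?U ta) \<partial>lborel)"
 unfolding p'_def by (subst wN_add, measurable) (simp add: wN_inv wN_iv_nf wN_time_swap[OF jU J])
 have qk: "wN k q' = wN (k - 1) (nf (b s)) + (\<integral>\<^sup>+ta\<in>{0..T}. wN (k - 1) (?B ta) \<partial>lborel)"
 unfolding q'_def by (subst wN_add, measurable) (simp add: wN_inv wN_iv_nf wN_time_swap[OF jB J])
 have Gm: "(%ta. GG k (s + ta)) \<in> BM" by (rule measurable_compose[OF _ GG_measurable]) simp
 have "wN k p' + wN k q' = FF k s + (NN ta. (wN (k - 1) (?U ta) + wN (k - 1) (?B ta)) * ind {0..T} ta)"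
 unfolding pk qk FF_def distrib_right using wN_time_measurable[OF jU] wN_time_measurable[OF jB]
 by (subst nn_integral_add) (auto simp: add_ac)
 also have "... <= FF k s + (NN ta. er (1/2) * (GG k (s + ta) * ind {0..T} ta))"
 proof (intro add_left_mono nn_integral_mono)
 fix ta show "(wN (k - 1) (?U ta) + wN (k - 1) (?B ta)) * ind {0..T} ta <= er (1/2) * (GG k (s + ta) * ind {0..T} ta)"
 proof (cases "ta \<in> {0..T}")
 case True
 then show ?thesis using nonlinear_bound[OF k, of "s + ta"] s by (simp only: indicator_simps mult_1_right) simp
 qed simp
 qed
 also have "... = FF k s + er (1/2) * ?G"
 using Gm by (subst nn_integral_cmult) auto
 finally have S: "wN k p' + wN k q' <= FF k s + er (1/2) * ?G" .
 note M = shift_Maj[OF s, of T, folded p'_def q'_def]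
 have "?G = (\<integral>\<^sup>+ta\<in>{0..T}. wN (k + 1) (nf (u (s + ta))) \<partial>lborel) + (\<integral>\<^sup>+ta\<in>{0..T}. wN (k + 1) (nf (b (s + ta))) \<partial>lborel)"
 unfolding GG_def distrib_right using wN_time_measurable[OF jm_nf[OF jm_shift[OF u_jm]]] wN_time_measurable[OF jm_nf[OF jm_shift[OF b_jm]]]
 by (intro nn_integral_add) auto
 also have "... <= wN k p' + wN k q'"
 using Maj_int_wN[OF jm_shift[OF u_jm] J M(1), of k] Maj_int_wN[OF jm_shift[OF b_jm] J M(2), of k] unfolding wN_nf by (intro add_mono)
 finally have G: "?G <= wN k p' + wN k q'" .
 have fin: "?G < ic" by (rule le_less_trans[OF GG_integral[OF s]]) (use hk in simp)
 show G2: "?G <= 2 * FF k s" by (rule ennreal_absorb[OF order_trans[OF G S] fin])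
 have TT: "T \<in> {0..T}" using T by simp
 have "FF k (s + T) <= wN k p' + wN k q'"
 using Maj_sup_wN[OF M(1) TT, of k] Maj_sup_wN[OF M(2) TT, of k] unfolding wN_nf FF_def by (intro add_mono)
 also have "... <= FF k s + er (1/2) * (2 * FF k s)" by (intro order_trans[OF S] add_left_mono mult_left_mono G2) auto
 also have "... = 2 * FF k s"
 proof -
 have h: "er (1/2) * 2 = 1" unfolding mult.commute[of _ 2] numeral_mult_ennreal by simp
 show ?thesis by (simp only: mult.assoc[symmetric] h mult_1_left) (simp only: mult_2)
 qed
 finally show "FF k (s + T) <= 2 * FF k s" .
qed

text \<open>Average over [t/2, t]: \<open>FF k t\<close> is at most twice \<open>FF k\<close> at any
  time of this interval, which is split at frequency \<open>R\<close>; the integral of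
  \<open>GG\<close> is then bounded by the energy at t/2. The factor t/2 is the length of the
  interval.\<close>

lemma dyadic:
 fixes R :: real
 assumes k: "k >= 0" "96 * 2 powr k * \<epsilon> <= 1" and hk: "wN k P < ic" "wN k Q < ic" and t: "t > 0" and R: "R > 0"
 and A: "!!t. t >= 0 ==> AL xi. er (norm xi powr \<sigma>) * nf (u t) xi <= A" "!!t. t >= 0 ==> AL xi. er (norm xi powr \<sigma>) * nf (b t) xi <= A"
 shows "er (t / 2) * FF k t <= er (4 / R\<^sup>2) * FF k (t / 2) + er (t / 2) * (4 * (A * lowint 1 (k - 1 - \<sigma>) * er (R powr (k + 2 - \<sigma>))))"
proof -
 let ?h = "t / 2" and ?Z = "A * lowint 1 (k - 1 - \<sigma>) * er (R powr (k + 2 - \<sigma>))"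
 have h: "?h >= 0" using t by simp
 have lh: "FF k ta <= er (1 / R\<^sup>2) * GG k ta + 2 * ?Z" if "ta >= 0" for ta
 proof -
 note [measurable] = jm_slice[OF u_jm, of ta] jm_slice[OF b_jm, of ta]
 have "FF k ta <= (er (1 / R\<^sup>2) * wN (k + 1) (nf (u ta)) + ?Z) + (er (1 / R\<^sup>2) * wN (k + 1) (nf (b ta)) + ?Z)"
 unfolding FF_def by (intro add_mono low_high R A that) measurable
 also have "... = er (1 / R\<^sup>2) * GG k ta + 2 * ?Z" unfolding GG_def by (simp only: distrib_left mult_2 add_ac)
 finally show ?thesis .
 qed
 have le: "FF k t <= er (2 / R\<^sup>2) * GG k (?h + ta) + 4 * ?Z" if "ta \<in> {0..?h}" for ta
 proof -
 have "FF k t = FF k (?h + ta + (?h - ta))" by simp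
 also have "... <= 2 * FF k (?h + ta)" by (rule energy(1)[OF k hk]) (use that t in auto)
 also have "... <= 2 * (er (1 / R\<^sup>2) * GG k (?h + ta) + 2 * ?Z)" by (intro mult_left_mono lh) (use that t in auto)
 also have "... = 2 * er (1 / R\<^sup>2) * GG k (?h + ta) + 4 * ?Z" by (simp only: ennreal_ring)
 also have "2 * er (1 / R\<^sup>2) = er (2 / R\<^sup>2)" by (simp only: numeral_mult_ennreal) simp
 finally show ?thesis .
 qed
 have Gm: "(%ta. GG k (?h + ta)) \<in> BM" by (rule measurable_compose[OF _ GG_measurable]) simp
 have em: "emeasure lborel {0..?h} = ennreal ?h" using h by simp
 have "ennreal ?h * FF k t = (NN ta. FF k t * ind {0..?h} ta)"
 by (subst nn_integral_cmult_indicator) (simp_all only: em mult.commute, simp)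
 also have "... <= (NN ta. er (2 / R\<^sup>2) * (GG k (?h + ta) * ind {0..?h} ta) + 4 * ?Z * ind {0..?h} ta)"
 proof (rule nn_integral_mono)
 fix ta show "FF k t * ind {0..?h} ta <= er (2 / R\<^sup>2) * (GG k (?h + ta) * ind {0..?h} ta) + 4 * ?Z * ind {0..?h} ta"
 using le[of ta] by (cases "ta \<in> {0..?h}") (simp_all only: indicator_simps mult_1_right mult_zero_right, simp)
 qed
 also have "... = er (2 / R\<^sup>2) * (\<integral>\<^sup>+ta\<in>{0..?h}. GG k (?h + ta) \<partial>lborel) + 4 * ?Z * ennreal ?h"
 proof -
 have [measurable]: "GG k \<in> BM" by (rule GG_measurable)
 show ?thesis
 by (subst nn_integral_add, measurable, subst nn_integral_cmult, measurable, subst nn_integral_cmult_indicator, simp, simp only: em)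
 qed
 also have "... <= er (2 / R\<^sup>2) * (2 * FF k ?h) + 4 * ?Z * ennreal ?h"
 by (intro add_right_mono mult_left_mono energy(2)[OF k hk h h]) simp
 also have "... = 2 * er (2 / R\<^sup>2) * FF k ?h + ennreal ?h * (4 * ?Z)" by (simp only: mult_ac)
 also have "2 * er (2 / R\<^sup>2) = er (4 / R\<^sup>2)" by (simp only: numeral_mult_ennreal) simp
 finally show ?thesis .
qed

lemma decay:
 assumes k: "k >= 0" "96 * 2 powr k * \<epsilon> <= 1" and \<sigma>: "\<sigma> <= 1"
 and F0: "wN k P + wN k Q <= ennreal F0" "F0 >= 0" and A0: "A >= 0" and t: "t > 0"
 and A: "AL x. er (norm x powr (\<sigma> + 1)) * P x <= ennreal A" "AL x. er (norm x powr (\<sigma> + 1)) * Q x <= ennreal A"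
 defines "\<gamma> \<equiv> (k + 2 - \<sigma>) / 2" and "L \<equiv> enn2real (lowint 1 (k - 1 - \<sigma>))"
 shows "FF k t <= er (2 powr \<gamma> * (F0 + 2 * (4 * (A * L) * (2 powr (\<gamma> + 4)) powr \<gamma>)) * (1 + t) powr (- \<gamma>))"
proof -
 have "wN k P + wN k Q < ic" by (rule le_less_trans[OF F0(1)]) simp
 then have hk: "wN k P < ic" "wN k Q < ic" by simp_all
 have FF0: "FF k t <= ennreal F0" if "t >= 0" for t
 proof -
 have "t \<in> {0..}" using that by simp
 then have "FF k t <= wN k P + wN k Q"
 using Maj_sup_wN[OF u_Maj, of t k] Maj_sup_wN[OF b_Maj, of t k] unfolding wN_nf FF_def by (intro add_mono)
 then show ?thesis using F0(1) by (rule order_trans)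
 qed
 define f where "f t = enn2real (FF k t)" for t
 have f: "FF k t = er (f t)" if "t >= 0" for t
 using le_less_trans[OF FF0[OF that]] by (simp add: f_def)
 have f0: "0 <= f t" for t by (simp add: f_def)
 have fF: "f t <= F0" if "t >= 0" for t using FF0[OF that] F0(2) unfolding f[OF that] by simp
 have L: "lowint 1 (k - 1 - \<sigma>) = ennreal L" "L >= 0"
 using lowint_finite[of "k - 1 - \<sigma>"] k \<sigma> by (simp_all add: L_def)
 have Am: "AL xi. er (norm xi powr \<sigma>) * nf (z t) xi <= ennreal A"
 if M: "Maj {0..} z r" and r: "AL x. er (norm x powr (\<sigma> + 1)) * r x <= ennreal A" and t: "t >= 0" for z r t
 using M r AE_nonzero unfolding Maj_def
 proof eventually_elim
 case (elim xi)
 have "er (norm xi powr \<sigma>) * nf (z t) xi <= er (norm xi powr \<sigma>) * (en xi * r xi)"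
 unfolding nf_def using elim t by (intro mult_left_mono) auto
 also have "... = er (norm xi powr (\<sigma> + 1)) * r xi" using elim by (simp add: powr_split(2) mult.assoc)
 finally show ?case using elim by auto
 qed
 have step: "f t <= 8 / (t * X) * f (t / 2) + 4 * (A * L) * X powr \<gamma>" if t: "t > 0" and X: "X > 0" for t X
 proof -
 have t2: "0 <= t / 2" and X4: "0 <= 4 / X" using t X by simp_all
 \<comment> \<open>\<open>decay_real\<close> uses X = R^2, so R^(k+2-\<sigma>) becomes
   X^\<gamma>.\<close>
 have R: "sqrt X > 0" using X by simp
 have Rp: "sqrt X powr (k + 2 - \<sigma>) = X powr \<gamma>"
 using X by (simp add: powr_half_sqrt[symmetric] powr_powr \<gamma>_def)
 have "er (t / 2) * FF k t <= er (4 / (sqrt X)\<^sup>2) * FF k (t / 2) + er (t / 2) * (4 * (ennreal A * lowint 1 (k - 1 - \<sigma>) * er (sqrt X powr (k + 2 - \<sigma>))))"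
 by (rule dyadic[OF k hk t R Am[OF u_Maj A(1)] Am[OF b_Maj A(2)]])
 also have "... = er (4 / X * f (t / 2) + t / 2 * (4 * (A * L * X powr \<gamma>)))"
 proof -
 have F: "FF k (t / 2) = er (f (t / 2))" by (rule f) (use t in simp)
 have sq: "(sqrt X)\<^sup>2 = X" using X by simp
 have AL: "ennreal A * ennreal L * er (X powr \<gamma>) = er (A * L * X powr \<gamma>)" using A0 L(2) by (simp add: ennreal_mult)
 show ?thesis
 unfolding Rp L(1) sq F AL numeral_mult_ennreal ennreal_mult'[OF t2, symmetric] ennreal_mult'[OF X4, symmetric]
 by (rule ennreal_plus[symmetric]) (use X t A0 L(2) f0 in auto)
 qed
 also have "er (t / 2) * FF k t = er (t / 2 * f t)"
 unfolding f[OF less_imp_le[OF t]] by (rule ennreal_mult'[OF t2, symmetric])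
 finally have "t / 2 * f t <= 4 / X * f (t / 2) + t / 2 * (4 * (A * L * X powr \<gamma>))"
 using t X A0 L(2) f0[of "t/2"] by (subst (asm) ennreal_le_iff) auto
 then have "2 / t * (t / 2 * f t) <= 2 / t * (4 / X * f (t / 2) + t / 2 * (4 * (A * L * X powr \<gamma>)))"
 using t by (intro mult_left_mono) auto
 then show ?thesis using t X by (simp add: distrib_left mult.assoc)
 qed
 have "f t <= 2 powr \<gamma> * (F0 + 2 * (4 * (A * L) * (2 powr (\<gamma> + 4)) powr \<gamma>)) * (1 + t) powr (- \<gamma>)"
 by (rule decay_real[of f "4 * (A * L)" \<gamma>, OF step fF f0 _ _ t]) (use k \<sigma> A0 L(2) in \<open>auto simp: \<gamma>_def\<close>)
 then show ?thesis using f[of t] t by (simp add: ennreal_leI)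
qed

end

theorem theorem1p5:
  fixes k \<sigma> :: real
  assumes "k \<ge> 0" and "\<sigma> \<in> {-1..1}"
  shows "\<exists>\<epsilon>>0. \<exists>C :: ennreal \<Rightarrow> ennreal \<Rightarrow> real.
    \<forall>u0 B0 :: tempered^3.
      real_field u0 \<longrightarrow> real_field B0 \<longrightarrow>
      u_norm k \<sigma> u0 < \<infinity> \<longrightarrow> B_norm k \<sigma> B0 < \<infinity> \<longrightarrow>
      tdiv u0 = 0 \<longrightarrow> tdiv B0 = 0 \<longrightarrow>
      Xnorm (- 1) u0 + Xnorm (- 1) B0 + Xnorm 0 B0 \<le> ennreal \<epsilon> \<longrightarrow>
      (\<exists>u B.
         hall_mhd_solution u0 B0 u B \<and> in_solution_class k \<sigma> u B \<and>
         (\<forall>v D. hall_mhd_solution u0 B0 v D \<and> in_solution_class k \<sigma> v D \<longrightarrow>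
                (\<forall>t\<ge>0. v t = u t \<and> D t = B t)) \<and>
         (\<forall>t>0. Xnorm (k - 1) (u t) + Xnorm (k - 1) (B t)
                \<le> ennreal (C (u_norm k \<sigma> u0) (B_norm k \<sigma> B0) * (1 + t) powr (- 1 + \<sigma> / 2 - k / 2))))"
proof -
 \<comment> \<open>One choice meets all requirements: \<epsilon> <= 1/192 as 2^k >= 1, while 2^k *
   \<epsilon> = 1/192 handles the conditions with 16 and 96.\<close>
 define \<epsilon> where "\<epsilon> = 1 / (192 * 2 powr k)"
 define \<gamma> where "\<gamma> = (k + 2 - \<sigma>) / 2"
 define L where "L = enn2real (lowint 1 (k - 1 - \<sigma>))"
 \<comment> \<open>The bound of \<open>decay\<close> with F0 = 4N and A = 2N, where N is the sum of
   the two data norms: \<open>high_norm\<close> doubles N for each of two fields,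
   \<open>sup_norm\<close> doubles it once.\<close>
 define C where "C x y = 2 powr \<gamma> * (4 * (enn2real x + enn2real y) + 2 * (4 * (2 * (enn2real x + enn2real y) * L) * (2 powr (\<gamma> + 4)) powr \<gamma>))" for x y
 have k1: "1 <= 2 powr k" using assms(1) by (simp add: ge_one_powr_ge_zero)
 have e0: "\<epsilon> > 0" by (simp add: \<epsilon>_def)
 have e2: "2 powr k * \<epsilon> = 1/192" by (simp add: \<epsilon>_def)
 have e1: "\<epsilon> <= 1/192" using mult_right_mono[OF k1, of \<epsilon>] e0 e2 by simp
 have main: "\<exists>u B. hall_mhd_solution u0 B0 u B & in_solution_class k \<sigma> u B &
 (\<forall>v D. hall_mhd_solution u0 B0 v D & in_solution_class k \<sigma> v D --> (\<forall>t\<ge>0. v t = u t & D t = B t)) &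
 (\<forall>t>0. Xnorm (k - 1) (u t) + Xnorm (k - 1) (B t) <= er (C (u_norm k \<sigma> u0) (B_norm k \<sigma> B0) * (1 + t) powr (- 1 + \<sigma> / 2 - k / 2)))"
 if r: "real_field u0" "real_field B0" and n: "u_norm k \<sigma> u0 < ic" "B_norm k \<sigma> B0 < ic" and div: "tdiv u0 = 0" "tdiv B0 = 0"
 and small: "Xnorm (- 1) u0 + Xnorm (- 1) B0 + Xnorm 0 B0 <= ennreal \<epsilon>" for u0 B0
 proof -
 have f: "ftv (fhat u0) u0" "ftv (fhat B0) B0" using n by (auto intro!: ftv_of_Xnorm simp: u_norm_def B_norm_def)
 \<comment> \<open>The symmetry must hold at every frequency, not almost everywhere, to be inherited
   by the iterates.\<close>
 obtain a0 where ha: "ftv a0 u0" "!!xi. a0 (- xi) = vcnj (a0 xi)" by (rule real_field_representative[OF f(1) r(1)]) blast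
 obtain b0 where hb: "ftv b0 B0" "!!xi. b0 (- xi) = vcnj (b0 xi)" by (rule real_field_representative[OF f(2) r(2)]) blast
 interpret picard a0 b0 \<epsilon>
 proof
 show "nrm (iv a0) (iv b0) <= ennreal \<epsilon>" using small by (simp add: nrm_def wN_iv[OF ha(1)] wN_iv[OF hb(1)])
 qed (use e0 e1 ftv_measurable[OF ha(1)] ftv_measurable[OF hb(1)] in auto)
 define N where "N = enn2real (u_norm k \<sigma> u0) + enn2real (B_norm k \<sigma> B0)"
 have N: "u_norm k \<sigma> u0 + B_norm k \<sigma> B0 = ennreal N" "N >= 0"
 using n by (simp_all add: N_def ennreal_plus)
 have "hN k (iv a0) (iv b0) = Xnorm (k - 1) u0 + Xnorm (k - 1) B0" by (simp add: hN_def wN_iv[OF ha(1)] wN_iv[OF hb(1)])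
 also have "... <= u_norm k \<sigma> u0 + B_norm k \<sigma> B0" unfolding u_norm_def B_norm_def by (intro add_mono) (simp_all add: add_increasing2)
 finally have H: "hN k (iv a0) (iv b0) <= ennreal N" unfolding N(1) .
 have kk: "16 * 2 powr k * \<epsilon> <= 1" "96 * 2 powr k * \<epsilon> <= 1" using e2 by (simp_all add: mult.assoc)
 note hn = high_norm[OF assms(1) kk(1)]
 have PQ: "wN k P + wN k Q <= er (4 * N)"
 proof -
 have "wN k P + wN k Q <= 2 * ennreal N + 2 * ennreal N"
 using hn H by (intro add_mono) (blast intro: order_trans mult_left_mono zero_le)+
 also have "... = er (4 * N)" using N(2) by (simp only: numeral_mult_ennreal) (simp add: ennreal_plus[symmetric] del: ennreal_plus)
 finally show ?thesis .
 qed
 have "wN k P + wN k Q < ic" by (rule le_less_trans[OF PQ]) simp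
 then have hk: "wN k P < ic" "wN k Q < ic" by simp_all
 have Y: "AL x. er (norm x powr (\<sigma> + 1)) * iv a x <= ennreal N" if a: "ftv a f" and le: "Ynorm \<sigma> f <= ennreal N" for a f
 proof -
 have "AL x. er (norm x powr \<sigma> * norm (a x)) <= Ynorm \<sigma> f" unfolding Ynorm_ftv[OF a] by (rule esssup_AE)
 then show ?thesis using AE_nonzero
 proof eventually_elim
 case (elim x)
 have "er (norm x powr (\<sigma> + 1)) * iv a x = er (norm x powr \<sigma> * norm (a x))"
 using elim unfolding iv_def by (subst ennreal_mult[symmetric]) (auto simp: powr_add)
 then show ?case using elim le by auto
 qed
 qed
 have "Ynorm \<sigma> u0 <= u_norm k \<sigma> u0 + B_norm k \<sigma> B0" "Ynorm \<sigma> B0 <= u_norm k \<sigma> u0 + B_norm k \<sigma> B0"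
 unfolding u_norm_def B_norm_def by (simp_all add: add_increasing add_increasing2)
 then have Y0: "Ynorm \<sigma> u0 <= ennreal N" "Ynorm \<sigma> B0 <= ennreal N" unfolding N(1) .
 have s0: "\<sigma> + 1 >= 0" using assms(2) by simp
 \<comment> \<open>Since \<sigma> + 1 <= 2, the left side is at most 16 * 4/192 = 1/3.\<close>
 have ss: "16 * 2 powr (\<sigma> + 1) * \<epsilon> <= 1"
 proof -
 have "2 powr (\<sigma> + 1) <= 2 powr (2::real)" using assms(2) by (intro powr_mono) auto
 then have "2 powr (\<sigma> + 1) * \<epsilon> <= 4 * (1/192)" using e0 e1 by (intro mult_mono) auto
 then show ?thesis by simp
 qed
 have A2: "2 * ennreal N = er (2 * N)" by (rule numeral_mult_ennreal)
 note sn = sup_norm[OF s0 ss Y[OF ha(1) Y0(1)] Y[OF hb(1) Y0(2)], unfolded A2]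
 have sol: "hall_mhd_solution u0 B0 fu fb" by (rule tempered_solution[OF ha(1) hb(1) ha(2) hb(2) div])
 have cls: "in_solution_class k \<sigma> fu fb" by (rule solution_class[OF assms(1) hk _ sn]) simp
 have uniq: "\<forall>v D. hall_mhd_solution u0 B0 v D & in_solution_class k \<sigma> v D --> (\<forall>t\<ge>0. v t = fu t & D t = fb t)"
 using unique_solution[OF e0 ha(1) hb(1)] by blast
 have dec: "Xnorm (k - 1) (fu t) + Xnorm (k - 1) (fb t) <= er (C (u_norm k \<sigma> u0) (B_norm k \<sigma> B0) * (1 + t) powr (- 1 + \<sigma> / 2 - k / 2))" if t: "t > 0" for t
 proof -
 have t0: "t >= 0" using t by simp
 have "Xnorm (k - 1) (fu t) + Xnorm (k - 1) (fb t) = FF k t"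
 unfolding FF_def by (simp add: Xnorm_nf[OF ftv_fu[OF t0]] Xnorm_nf[OF ftv_fb[OF t0]])
 also have "... <= er (2 powr \<gamma> * (4 * N + 2 * (4 * (2 * N * L) * (2 powr (\<gamma> + 4)) powr \<gamma>)) * (1 + t) powr (- \<gamma>))"
 unfolding \<gamma>_def L_def by (rule decay[OF assms(1) kk(2) _ PQ _ _ t sn]) (use assms(2) N(2) in auto)
 also have "- \<gamma> = - 1 + \<sigma> / 2 - k / 2" by (simp add: \<gamma>_def field_simps)
 finally show ?thesis unfolding C_def N_def .
 qed
 show ?thesis using sol cls uniq dec by blast
 qed
 show ?thesis
 by (rule exI[of _ \<epsilon>], rule conjI[OF e0], rule exI[of _ C]) (use main in blast)
qed

end
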